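(* Let $(S,\Omega)$ be a relative Sierpiński carpet. Suppose that $u_n:S\to\mathbb R$, $n\in\mathbb N$, is a sequence of (normalized) carpet-harmonic functions converging locally uniformly to a function $u:S\to\mathbb R$. Then $u$ is carpet-harmonic.
   Context: Relative Sierpiński carpets. Let $\Omega\subset\mathbb C$ be a connected open set and $\{Q_i\}_{i\in\mathbb N}$ open Jordan regions compactly contained in $\Omega$, with pairwise disjoint closures, such that $S:=\Omega\setminus\bigcup_iQ_i$ has empty interior and is locally connected. Then $(S,\Omega)$ is a relative Sierpiński carpet with peripheral disks $Q_i$. Standing assumptions on every relative Sierpiński carpet: (i) $\mathcal H^2(S)=0$; (ii) there is $K_0\ge1$ such that for each $i$ there are concentric balls $B(x,r)\subset Q_i\subset B(x,R)$ with $R/r\le K_0$; (iii) there is $K_1>0$ such that $\mathcal H^2(B(x,r)\cap Q_i)\ge K_1r^2$ for all $i$, $x\in Q_i$, $0<r<\operatorname{diam}(Q_i)$. $\mathcal H^m$ is Hausdorff measure normalized to agree with Lebesgue measure. Notation. Locally uniformly: uniformly on $S\cap K$ for each compact $K\subset\Omega$. $\widehat{\mathbb R}=\mathbb R\cup\{\pm\infty\}$. $V\subset\subset\Omega$: $\overline V$ is compact and contained in $\Omega$. $I_V=\{i:Q_i\cap V\ne\emptyset\}$. $S^\circ$: points of $S$ on no $\partial Q_i$. A path is a continuous map from a bounded interval to $\mathbb C$ with a continuous extension to the closed interval (also its image); it is open if the interval is open; subpaths are restrictions to subintervals. For $g:S\to\widehat{\mathbb R}$: $M_{Q_i}(g)=\sup_{\partial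 Q_i}g$, $m_{Q_i}(g)=\inf_{\partial Q_i}g$, $\operatorname{osc}_{Q_i}(g)=M_{Q_i}(g)-m_{Q_i}(g)$. Moduli of a path family $\Gamma$ in $\Omega$. $\mathrm{mod}_2(\Gamma)=\inf\int\lambda^2d\mathcal H^2$ over Borel $\lambda\ge0$ with $\int_\gamma\lambda\,ds\ge1$ for all $\gamma\in\Gamma$ (with $\int_\gamma\lambda\,ds:=\infty$ if $\gamma$ is not locally rectifiable). Weak modulus $\mathrm{mod}_w(\Gamma)=\inf\sum_i\rho(Q_i)^2$ over non-negative sequences for which there is $\Gamma_0\subset\Gamma$ with $\mathrm{mod}_2(\Gamma_0)=0$ and $\sum_{i:Q_i\cap\gamma\ne\emptyset}\rho(Q_i)\ge1$ for $\gamma\in\Gamma\setminus\Gamma_0$. Strong modulus $\mathrm{mod}_s(\Gamma)$: the same infimum over sequences satisfying this inequality for all $\gamma\in\Gamma$ with $\mathcal H^1(\gamma\cap S)=0$. Sobolev spaces. $\{\rho(Q_i)\}$ is a weak (strong) upper gradient of $g:S\to\widehat{\mathbb R}$ if there is $\Gamma_0$ with $\mathrm{mod}_w(\Gamma_0)=0$ ($\mathrm{mod}_s(\Gamma_0)=0$) such that for all paths $\gamma\subset\Omega$, $\gamma\notin\Gamma_0$, and $x,y\in\gamma\cap S$: $g(x),g(y)\neq\pm\infty$ and $|g(x)-g(y)|\le\sum_{i:Q_i\cap\gamma\ne\emptyset}\rho(Q_i)$. $g\in\mathcal W^{1,2}_{\mathrm{loc}}(S)$ if $M_{Q_i}(g),m_{Q_i}(g)$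 are finite for all $i$, $\sum_{i\in I_B}M_{Q_i}(g)^2\operatorname{diam}(Q_i)^2<\infty$ and $\sum_{i\in I_B}\operatorname{osc}_{Q_i}(g)^2<\infty$ for every ball $B\subset\subset\Omega$, and $\{\operatorname{osc}_{Q_i}(g)\}$ is an upper gradient of $g$; $g\in\mathcal W^{1,2}(S)$ if moreover the sums over all $i\in\mathbb N$ are finite. There is a weak and a strong version; the statement holds for each, with one version fixed throughout. Dirichlet energy: $D_V(g)=\sum_{i\in I_V}\operatorname{osc}_{Q_i}(g)^2$. $u\in\mathcal W^{1,2}_{\mathrm{loc}}(S)$ is carpet-harmonic if $D_V(u)\le D_V(u+\zeta)$ for every open $V\subset\subset\Omega$ and $\zeta\in\mathcal W^{1,2}(S)$ with $\zeta|_{S\setminus V}\equiv0$. Normalized functions. For $g\in\mathcal W^{1,2}_{\mathrm{loc}}(S)$ let $\hat g(Q_i)=M_{Q_i}(g)$. Let $\mathcal G_{\hat g}$ be the family of non-constant paths $\gamma\subset\Omega$ with: $\mathcal H^1(\gamma\cap S)=0$; for every subpath $\gamma'$ of $\gamma$ and $Q_{i_1},Q_{i_2}$ meeting $\gamma'$, $|\hat g(Q_{i_1})-\hat g(Q_{i_2})|\le\sum_{i:Q_i\cap\gamma'\neq\emptyset}\operatorname{osc}_{Q_i}(g)$; $\sum_{i:Q_i\cap\gamma'\ne\emptyset}\operatorname{osc}_{Q_i}(g)<\infty$ for subpaths $\gamma'\subset\subset\Omega$; and, if $\sum_{i\in\mathbb N}\operatorname{osc}_{Q_i}(g)^2<\infty$,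 also $\sum_{i:Q_i\cap\gamma\ne\emptyset}\operatorname{osc}_{Q_i}(g)<\infty$. A point $x\in S$ is accessible by $\gamma_0$ if $x\in\gamma_0\cap S^\circ$ (put $\gamma=\gamma_0$), or there is an open subpath $\gamma$ of $\gamma_0$ with $x\in\overline\gamma\setminus\gamma$ and $\gamma\cap Q_{i_0}=\emptyset$ whenever $x\in\partial Q_{i_0}$. The normalized version $\tilde g$ of $g$ is: $\tilde g(x)=\liminf_{Q_i\to x,\,Q_i\cap\gamma\ne\emptyset}\hat g(Q_i)$ if $x$ is accessible by a path $\gamma_0\in\mathcal G_{\hat g}$, where $\gamma=\gamma_0$ if $x\in\gamma_0\cap S^\circ$, and otherwise $\gamma$ is an open subpath of $\gamma_0$ with $x\in\overline\gamma\setminus\gamma$ and $\gamma\cap Q_{i_0}=\emptyset$ whenever $x\in\partial Q_{i_0}$ (the value is independent of $\gamma$); for non-accessible $x\in\partial Q_{i_0}$, $\tilde g(x)=\liminf\tilde g(y)$ as $y\to x$ through accessible $y\in\partial Q_{i_0}$; for all other $x$, $\tilde g(x)=\liminf\tilde g(y)$ as $y\to x$ through accessible $y$. A function is normalized if it equals the normalized version of some function in the Sobolev space. Standing convention: carpet-harmonic functions are normalized. *)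

theory Defs
  imports "HOL-Analysis.Analysis"
begin

section \<open>Relative Sierpinski carpets\<close>

definition compactly_contained :: "complex set \<Rightarrow> complex set \<Rightarrow> bool" where
  "compactly_contained V \<Omega> \<longleftrightarrow> compact (closure V) \<and> closure V \<subseteq> \<Omega>"

definition open_jordan_region :: "complex set \<Rightarrow> bool" where
  "open_jordan_region U \<longleftrightarrow>
    (\<exists>c. simple_path c \<and> pathfinish c = pathstart c \<and> U = inside (path_image c))"

definition carpet :: "complex set \<Rightarrow> (nat \<Rightarrow> complex set) \<Rightarrow> complex set" where
  "carpet \<Omega> Q = \<Omega> - (\<Union>i. Q i)"

definition carpet_inner :: "complex set \<Rightarrow> (nat \<Rightarrow> complex set) \<Rightarrow> complex set" where
  "carpet_inner \<Omega> Q = carpet \<Omega> Q - (\<Union>i. frontier (Q i))"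

text \<open>The last three conjuncts are the standing assumptions (zero area, uniform
  quasi-balls, uniform fatness).  Two-dimensional Hausdorff measure of the plane,
  normalized to agree with Lebesgue measure, is \<^const>\<open>lborel\<close>; it is only ever applied to
  Borel sets and Borel functions.\<close>

definition relative_sierpinski_carpet :: "complex set \<Rightarrow> (nat \<Rightarrow> complex set) \<Rightarrow> bool" where
  "relative_sierpinski_carpet \<Omega> Q \<longleftrightarrow>
     open \<Omega> \<and> connected \<Omega> \<and>
     (\<forall>i. open_jordan_region (Q i) \<and> compactly_contained (Q i) \<Omega>) \<and>
     disjoint_family (\<lambda>i. closure (Q i)) \<and>
     interior (carpet \<Omega> Q) = {} \<and>
     locally connected (carpet \<Omega> Q) \<and>
     emeasure lborel (carpet \<Omega> Q) = 0 \<and>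
     (\<exists>K0\<ge>1. \<forall>i. \<exists>x r R. 0 < r \<and> 0 < R \<and>
        ball x r \<subseteq> Q i \<and> Q i \<subseteq> ball x R \<and> R / r \<le> K0) \<and>
     (\<exists>K1>0. \<forall>i. \<forall>x\<in>Q i. \<forall>r. 0 < r \<and> r < diameter (Q i) \<longrightarrow>
        emeasure lborel (ball x r \<inter> Q i) \<ge> ennreal (K1 * r\<^sup>2))"

text \<open>The indices of the peripheral disks meeting a set; this is \<open>I_V\<close> for an open set \<open>V\<close>,
  and also the index set of all sums along a path.\<close>

definition hits :: "(nat \<Rightarrow> complex set) \<Rightarrow> complex set \<Rightarrow> nat set" where
  "hits Q A = {i. Q i \<inter> A \<noteq> {}}"


section \<open>Paths\<close>

text \<open>A path is a pair of its parameter interval and a function of which only the values on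
  that interval matter.\<close>

type_synonym cpath = "real set \<times> (real \<Rightarrow> complex)"

definition is_cpath :: "cpath \<Rightarrow> bool" where
  "is_cpath \<gamma> \<longleftrightarrow> is_interval (fst \<gamma>) \<and> fst \<gamma> \<noteq> {} \<and> bounded (fst \<gamma>) \<and>
     (\<exists>h. continuous_on (closure (fst \<gamma>)) h \<and> (\<forall>t\<in>fst \<gamma>. h t = snd \<gamma> t))"

definition img :: "cpath \<Rightarrow> complex set" where
  "img \<gamma> = snd \<gamma> ` fst \<gamma>"

definition cpaths_in :: "complex set \<Rightarrow> cpath set" where
  "cpaths_in \<Omega> = {\<gamma>. is_cpath \<gamma> \<and> img \<gamma> \<subseteq> \<Omega>}"

definition subpath_of :: "cpath \<Rightarrow> cpath \<Rightarrow> bool" where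
  "subpath_of \<gamma>' \<gamma> \<longleftrightarrow> is_interval (fst \<gamma>') \<and> fst \<gamma>' \<noteq> {} \<and> fst \<gamma>' \<subseteq> fst \<gamma> \<and> snd \<gamma>' = snd \<gamma>"

definition open_subpath_of :: "cpath \<Rightarrow> cpath \<Rightarrow> bool" where
  "open_subpath_of \<gamma>' \<gamma> \<longleftrightarrow> subpath_of \<gamma>' \<gamma> \<and> open (fst \<gamma>')"

text \<open>Length of the restriction of \<open>f\<close> to \<open>J\<close>: supremum over all finite increasing
  sequences \<open>t 0 \<le> \<dots> \<le> t n\<close> in \<open>J\<close>.\<close>

definition curve_length :: "(real \<Rightarrow> complex) \<Rightarrow> real set \<Rightarrow> ennreal" where
  "curve_length f J =
     (SUP (n, t) \<in> UNIV \<times> {t :: nat \<Rightarrow> real. mono t \<and> range t \<subseteq> J}.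
        \<Sum>i<n. ennreal (dist (f (t i)) (f (t (Suc i)))))"

definition locally_rectifiable :: "cpath \<Rightarrow> bool" where
  "locally_rectifiable \<gamma> \<longleftrightarrow>
     (\<forall>a b. a \<le> b \<and> {a..b} \<subseteq> fst \<gamma> \<longrightarrow> curve_length (snd \<gamma>) {a..b} < \<infinity>)"

text \<open>Parametrization by arc length of a rectifiable \<open>f\<close> on \<open>{a..b}\<close>; the choice of \<open>t\<close> is
  immaterial since \<open>f\<close> is constant where the length function is.\<close>

definition arc_length_param :: "(real \<Rightarrow> complex) \<Rightarrow> real \<Rightarrow> real \<Rightarrow> real \<Rightarrow> complex" where
  "arc_length_param f a b s =
     f (SOME t. t \<in> {a..b} \<and> curve_length f {a..t} = ennreal s)"

definition path_integral :: "(complex \<Rightarrow> ennreal) \<Rightarrow> cpath \<Rightarrow> ennreal" where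
  "path_integral l \<gamma> =
     (if locally_rectifiable \<gamma> then
        (SUP (a, b) \<in> {(a, b). a \<le> b \<and> {a..b} \<subseteq> fst \<gamma>}.
           \<integral>\<^sup>+ s \<in> {0..enn2real (curve_length (snd \<gamma>) {a..b})}.
             l (arc_length_param (snd \<gamma>) a b s) \<partial>lborel)
      else \<infinity>)"

text \<open>One-dimensional Hausdorff (outer) measure.  In dimension one the normalizing constant
  is 1.  Boundedness is required because \<^const>\<open>diameter\<close> is 0 on unbounded sets.\<close>

definition hausdorff1 :: "complex set \<Rightarrow> ennreal" where
  "hausdorff1 A =
     (SUP \<delta>\<in>{0<..}.
       INF U\<in>{U :: nat \<Rightarrow> complex set.
                A \<subseteq> (\<Union>k. U k) \<and> (\<forall>k. bounded (U k) \<and> diameter (U k) \<le> \<delta>)}.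
         \<Sum>k. ennreal (diameter (U k)))"


section \<open>Moduli of path families\<close>

definition mod2 :: "cpath set \<Rightarrow> ennreal" where
  "mod2 \<Gamma> =
     (INF l\<in>{l. l \<in> borel_measurable borel \<and> (\<forall>\<gamma>\<in>\<Gamma>. 1 \<le> path_integral l \<gamma>)}.
        \<integral>\<^sup>+ z. (l z)\<^sup>2 \<partial>lborel)"

text \<open>Sum of a non-negative extended real sequence over the peripheral disks meeting a path.\<close>

definition path_sum :: "(nat \<Rightarrow> complex set) \<Rightarrow> (nat \<Rightarrow> ereal) \<Rightarrow> cpath \<Rightarrow> ereal" where
  "path_sum Q \<rho> \<gamma> = (\<Sum>\<^sub>\<infinity>i\<in>hits Q (img \<gamma>). \<rho> i)"

definition weak_modulus :: "(nat \<Rightarrow> complex set) \<Rightarrow> cpath set \<Rightarrow> ereal" where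
  "weak_modulus Q \<Gamma> =
     (INF \<rho>\<in>{\<rho> :: nat \<Rightarrow> real. (\<forall>i. 0 \<le> \<rho> i) \<and>
              (\<exists>\<Gamma>0\<subseteq>\<Gamma>. mod2 \<Gamma>0 = 0 \<and>
                 (\<forall>\<gamma>\<in>\<Gamma> - \<Gamma>0. 1 \<le> path_sum Q (\<lambda>i. ereal (\<rho> i)) \<gamma>))}.
        \<Sum>\<^sub>\<infinity>i. ereal ((\<rho> i)\<^sup>2))"

definition strong_modulus ::
    "complex set \<Rightarrow> (nat \<Rightarrow> complex set) \<Rightarrow> cpath set \<Rightarrow> ereal" where
  "strong_modulus \<Omega> Q \<Gamma> =
     (INF \<rho>\<in>{\<rho> :: nat \<Rightarrow> real. (\<forall>i. 0 \<le> \<rho> i) \<and>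
              (\<forall>\<gamma>\<in>\<Gamma>. hausdorff1 (img \<gamma> \<inter> carpet \<Omega> Q) = 0 \<longrightarrow>
                 1 \<le> path_sum Q (\<lambda>i. ereal (\<rho> i)) \<gamma>)}.
        \<Sum>\<^sub>\<infinity>i. ereal ((\<rho> i)\<^sup>2))"

datatype version = Weak | Strong

fun carpet_modulus ::
    "version \<Rightarrow> complex set \<Rightarrow> (nat \<Rightarrow> complex set) \<Rightarrow> cpath set \<Rightarrow> ereal" where
  "carpet_modulus Weak \<Omega> Q \<Gamma> = weak_modulus Q \<Gamma>"
| "carpet_modulus Strong \<Omega> Q \<Gamma> = strong_modulus \<Omega> Q \<Gamma>"


section \<open>Sobolev spaces on the carpet\<close>

text \<open>Functions on the carpet are total functions of which only the values on the carpet are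
  used.\<close>

definition sup_on :: "(nat \<Rightarrow> complex set) \<Rightarrow> (complex \<Rightarrow> ereal) \<Rightarrow> nat \<Rightarrow> ereal" where
  "sup_on Q g i = (SUP x\<in>frontier (Q i). g x)"

definition inf_on :: "(nat \<Rightarrow> complex set) \<Rightarrow> (complex \<Rightarrow> ereal) \<Rightarrow> nat \<Rightarrow> ereal" where
  "inf_on Q g i = (INF x\<in>frontier (Q i). g x)"

definition osc :: "(nat \<Rightarrow> complex set) \<Rightarrow> (complex \<Rightarrow> ereal) \<Rightarrow> nat \<Rightarrow> ereal" where
  "osc Q g i = sup_on Q g i - inf_on Q g i"

definition upper_gradient ::
    "version \<Rightarrow> complex set \<Rightarrow> (nat \<Rightarrow> complex set) \<Rightarrow> (nat \<Rightarrow> ereal) \<Rightarrow> (complex \<Rightarrow> ereal) \<Rightarrow> bool"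
  where
  "upper_gradient v \<Omega> Q \<rho> g \<longleftrightarrow>
     (\<forall>i. 0 \<le> \<rho> i) \<and>
     (\<exists>\<Gamma>0\<subseteq>cpaths_in \<Omega>. carpet_modulus v \<Omega> Q \<Gamma>0 = 0 \<and>
        (\<forall>\<gamma>\<in>cpaths_in \<Omega> - \<Gamma>0. \<forall>x\<in>img \<gamma> \<inter> carpet \<Omega> Q. \<forall>y\<in>img \<gamma> \<inter> carpet \<Omega> Q.
           \<bar>g x\<bar> \<noteq> \<infinity> \<and> \<bar>g y\<bar> \<noteq> \<infinity> \<and> \<bar>g x - g y\<bar> \<le> path_sum Q \<rho> \<gamma>))"

definition sobolev_loc ::
    "version \<Rightarrow> complex set \<Rightarrow> (nat \<Rightarrow> complex set) \<Rightarrow> (complex \<Rightarrow> ereal) \<Rightarrow> bool" where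
  "sobolev_loc v \<Omega> Q g \<longleftrightarrow>
     (\<forall>i. \<bar>sup_on Q g i\<bar> \<noteq> \<infinity> \<and> \<bar>inf_on Q g i\<bar> \<noteq> \<infinity>) \<and>
     (\<forall>x r. 0 < r \<and> compactly_contained (ball x r) \<Omega> \<longrightarrow>
        (\<Sum>\<^sub>\<infinity>i\<in>hits Q (ball x r). (sup_on Q g i)\<^sup>2 * ereal ((diameter (Q i))\<^sup>2)) < \<infinity> \<and>
        (\<Sum>\<^sub>\<infinity>i\<in>hits Q (ball x r). (osc Q g i)\<^sup>2) < \<infinity>) \<and>
     upper_gradient v \<Omega> Q (osc Q g) g"

definition sobolev ::
    "version \<Rightarrow> complex set \<Rightarrow> (nat \<Rightarrow> complex set) \<Rightarrow> (complex \<Rightarrow> ereal) \<Rightarrow> bool" where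
  "sobolev v \<Omega> Q g \<longleftrightarrow>
     sobolev_loc v \<Omega> Q g \<and>
     (\<Sum>\<^sub>\<infinity>i. (sup_on Q g i)\<^sup>2 * ereal ((diameter (Q i))\<^sup>2)) < \<infinity> \<and>
     (\<Sum>\<^sub>\<infinity>i. (osc Q g i)\<^sup>2) < \<infinity>"

definition dirichlet_energy ::
    "(nat \<Rightarrow> complex set) \<Rightarrow> complex set \<Rightarrow> (complex \<Rightarrow> ereal) \<Rightarrow> ereal" where
  "dirichlet_energy Q V g = (\<Sum>\<^sub>\<infinity>i\<in>hits Q V. (osc Q g i)\<^sup>2)"


section \<open>Normalized functions\<close>

text \<open>The family \<open>G\<close> of good paths for \<open>i \<mapsto> sup_on Q g i\<close>, the discrete function
  associated with \<open>g\<close>.\<close>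

definition good_paths ::
    "complex set \<Rightarrow> (nat \<Rightarrow> complex set) \<Rightarrow> (complex \<Rightarrow> ereal) \<Rightarrow> cpath set" where
  "good_paths \<Omega> Q g = {\<gamma> \<in> cpaths_in \<Omega>.
     \<not> snd \<gamma> constant_on fst \<gamma> \<and>
     hausdorff1 (img \<gamma> \<inter> carpet \<Omega> Q) = 0 \<and>
     (\<forall>\<gamma>'. subpath_of \<gamma>' \<gamma> \<longrightarrow>
        (\<forall>i\<in>hits Q (img \<gamma>'). \<forall>j\<in>hits Q (img \<gamma>').
           \<bar>sup_on Q g i - sup_on Q g j\<bar> \<le> path_sum Q (osc Q g) \<gamma>')) \<and>
     (\<forall>\<gamma>'. subpath_of \<gamma>' \<gamma> \<and> compactly_contained (img \<gamma>') \<Omega> \<longrightarrow>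
        path_sum Q (osc Q g) \<gamma>' < \<infinity>) \<and>
     ((\<Sum>\<^sub>\<infinity>i. (osc Q g i)\<^sup>2) < \<infinity> \<longrightarrow> path_sum Q (osc Q g) \<gamma> < \<infinity>)}"

text \<open>The paths \<open>\<gamma>\<close> along which \<open>x\<close> is accessible by some good path \<open>\<gamma>0\<close>.\<close>

definition access_paths ::
    "complex set \<Rightarrow> (nat \<Rightarrow> complex set) \<Rightarrow> (complex \<Rightarrow> ereal) \<Rightarrow> complex \<Rightarrow> cpath set" where
  "access_paths \<Omega> Q g x = {\<gamma>. \<exists>\<gamma>0\<in>good_paths \<Omega> Q g.
     (if x \<in> img \<gamma>0 \<inter> carpet_inner \<Omega> Q then \<gamma> = \<gamma>0
      else open_subpath_of \<gamma> \<gamma>0 \<and> x \<in> closure (img \<gamma>) - img \<gamma> \<and>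
           (\<forall>i. x \<in> frontier (Q i) \<longrightarrow> img \<gamma> \<inter> Q i = {}))}"

definition accessible ::
    "complex set \<Rightarrow> (nat \<Rightarrow> complex set) \<Rightarrow> (complex \<Rightarrow> ereal) \<Rightarrow> complex \<Rightarrow> bool" where
  "accessible \<Omega> Q g x \<longleftrightarrow> x \<in> carpet \<Omega> Q \<and> access_paths \<Omega> Q g x \<noteq> {}"

text \<open>Lower limit of \<open>sup_on Q g\<close> over the disks meeting \<open>\<gamma>\<close> that converge, as sets, to the
  point \<open>x\<close>; so a disk with \<open>x\<close> on its boundary does not count.\<close>

definition disk_liminf ::
    "(nat \<Rightarrow> complex set) \<Rightarrow> (complex \<Rightarrow> ereal) \<Rightarrow> cpath \<Rightarrow> complex \<Rightarrow> ereal" where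
  "disk_liminf Q g \<gamma> x =
     (SUP \<epsilon>\<in>{0<..}. INF i\<in>{i\<in>hits Q (img \<gamma>). Q i \<subseteq> ball x \<epsilon>}. sup_on Q g i)"

text \<open>The value does not depend on the path chosen, by the theory of normalized functions.\<close>

definition access_value ::
    "complex set \<Rightarrow> (nat \<Rightarrow> complex set) \<Rightarrow> (complex \<Rightarrow> ereal) \<Rightarrow> complex \<Rightarrow> ereal" where
  "access_value \<Omega> Q g x = disk_liminf Q g (SOME \<gamma>. \<gamma> \<in> access_paths \<Omega> Q g x) x"

definition normalized_version ::
    "complex set \<Rightarrow> (nat \<Rightarrow> complex set) \<Rightarrow> (complex \<Rightarrow> ereal) \<Rightarrow> complex \<Rightarrow> ereal" where
  "normalized_version \<Omega> Q g x =
     (if accessible \<Omega> Q g x then access_value \<Omega> Q g x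
      else if \<exists>i. x \<in> frontier (Q i) then
        Liminf (at x within {y. accessible \<Omega> Q g y \<and> (\<exists>i. x \<in> frontier (Q i) \<and> y \<in> frontier (Q i))})
          (access_value \<Omega> Q g)
      else Liminf (at x within {y. accessible \<Omega> Q g y}) (access_value \<Omega> Q g))"

definition normalized ::
    "version \<Rightarrow> complex set \<Rightarrow> (nat \<Rightarrow> complex set) \<Rightarrow> (complex \<Rightarrow> ereal) \<Rightarrow> bool" where
  "normalized v \<Omega> Q u \<longleftrightarrow>
     (\<exists>g. sobolev_loc v \<Omega> Q g \<and> (\<forall>x\<in>carpet \<Omega> Q. u x = normalized_version \<Omega> Q g x))"


section \<open>Carpet-harmonic functions\<close>

text \<open>Carpet-harmonic functions are normalized by convention.\<close>

definition carpet_harmonic ::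
    "version \<Rightarrow> complex set \<Rightarrow> (nat \<Rightarrow> complex set) \<Rightarrow> (complex \<Rightarrow> ereal) \<Rightarrow> bool" where
  "carpet_harmonic v \<Omega> Q u \<longleftrightarrow>
     sobolev_loc v \<Omega> Q u \<and> normalized v \<Omega> Q u \<and>
     (\<forall>V \<zeta>. open V \<and> compactly_contained V \<Omega> \<and> sobolev v \<Omega> Q \<zeta> \<and>
        (\<forall>x\<in>carpet \<Omega> Q - V. \<zeta> x = 0) \<longrightarrow>
        dirichlet_energy Q V u \<le> dirichlet_energy Q V (\<lambda>x. u x + \<zeta> x))"

definition locally_uniform_limit ::
    "complex set \<Rightarrow> (nat \<Rightarrow> complex set) \<Rightarrow> (nat \<Rightarrow> complex \<Rightarrow> real) \<Rightarrow> (complex \<Rightarrow> real) \<Rightarrow> bool"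
  where
  "locally_uniform_limit \<Omega> Q u u_lim \<longleftrightarrow>
     (\<forall>K. compact K \<and> K \<subseteq> \<Omega> \<longrightarrow> uniform_limit (carpet \<Omega> Q \<inter> K) u u_lim sequentially)"

end

theory Submission
  imports Defs
begin

text \<open>Write \<open>a\<^sub>n\<close> for the sequence of oscillations of \<open>u\<^sub>n\<close>. Testing the minimality of \<open>u\<^sub>n\<close> and \<open>u\<^sub>m\<close> with
  \<open>\<plusminus> \<eta>\<^sup>2 (u\<^sub>m - u\<^sub>n) / 2\<close>, where \<open>\<eta>\<close> is a cutoff function and \<open>\<bar>u\<^sub>m - u\<^sub>n\<bar> \<le> \<epsilon>\<close> on its support, bounds
  \<open>\<Sum> \<eta>\<^sup>2 (a\<^sub>n - a\<^sub>m)\<^sup>2\<close> by a multiple of \<open>\<epsilon>\<close>; so the oscillations converge locally in square mean. Hence the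
  limit inherits an upper gradient and the minimality of its energy. It remains to see that the limit is
  normalized. Harmonic functions are continuous on the carpet: by the length-area method almost every
  family of small squares contains one along which the function varies little (apart from the disk carrying
  the centre), and the maximum principle carries this bound to the region it cuts off. So the limit is
  continuous, and a continuous Sobolev function is its own normalized version, since along good paths
  there are small disks approaching each accessible point and accessible points are dense.\<close>

section \<open>Nonnegative sums\<close>

text \<open>The weak and the strong version are handled at once: both moduli take the same form once
  \<open>excluded\<close> describes the families that an admissible weight may ignore. The Sobolev
  class asks for the oscillations themselves as upper gradient, whereas a cutoff, a truncation or a
  limit comes only with some larger upper gradient; \<open>osr_upper_gradient\<close> closes this
  gap. The main obstacle is a point x on the boundary of a disk: every small square around x crosses
  that disk, whose oscillation need not be small. Therefore a single arc of the square outside the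
  closed disk is kept; together with the disk it cuts off the exterior points near x, and the
  maximum principle tolerates one disk on the boundary of the region if the arc touches it. Squares
  replace circles because their sides lie on coordinate lines, where Fubini's theorem applies
  directly. A second obstacle is that a normalized function is built from some other Sobolev
  function g; its disk values are compared with those of g through accessible points of the disk
  boundaries.\<close>

lemma infsum_ereal_summable:
 fixes f :: "'a => real"
 assumes "f summable_on A" "!!i. i \<in> A ==> 0 <= f i"
 shows "(infsum (%i. ereal (f i)) A) = ereal (infsum f A)"
proof -
 have "(infsum (%i. ereal (f i)) A) = (SUP F\<in>{F. finite F & F \<subseteq> A}. (\<Sum>i\<in>F. ereal (f i)))"
  using assms by (intro nonneg_infsum_complete) auto
 also have "... = ereal (infsum f A)"
  using assms by (subst infsum_nonneg_is_SUPREMUM_ereal) auto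
 finally show ?thesis .
qed

text \<open>A real \<open>infsum\<close> is 0 by default when the family is not summable, whereas
  the extended sum is then infinite. So finiteness of the \<open>ereal\<close> sums in the
  definitions is the summability that all real arguments below carry along.\<close>

lemma infsum_ereal_less_top_iff:
 fixes f :: "'a => real"
 assumes "!!i. i \<in> A ==> 0 <= f i"
 shows "(infsum (%i. ereal (f i)) A) < \<infinity> \<longleftrightarrow> f summable_on A"
proof
 assume "f summable_on A"
 then show "(infsum (%i. ereal (f i)) A) < \<infinity>"
  using infsum_ereal_summable assms by force
next
 assume *: "(infsum (%i. ereal (f i)) A) < \<infinity>"
 have nn: "0 <= (infsum (%i. ereal (f i)) A)"
  using assms by (intro infsum_nonneg) auto
 have eq: "(infsum (%i. ereal (f i)) A) = (SUP F\<in>{F. finite F & F \<subseteq> A}. (\<Sum>i\<in>F. ereal (f i)))"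
  using assms by (intro nonneg_infsum_complete) auto
 obtain c where c: "(infsum (%i. ereal (f i)) A) = ereal c"
  using * nn by (cases "\<Sum>\<^sub>\<infinity>i\<in>A. ereal (f i)") auto
 show "f summable_on A"
 proof (rule nonneg_bdd_above_summable_on)
  show "bdd_above (sum f ` {F. F \<subseteq> A & finite F})"
  proof (rule bdd_aboveI2)
   fix F assume "F \<in> {F. F \<subseteq> A & finite F}"
   then have "(\<Sum>i\<in>F. ereal (f i)) <= ereal c"
    unfolding c[symmetric] eq by (intro SUP_upper) auto
   then show "sum f F <= c" by simp
  qed
 qed (use assms in auto)
qed

lemma infsum_ereal_top:
 fixes f :: "'a => real"
 assumes "!!i. i \<in> A ==> 0 <= f i" "\<not> f summable_on A"
 shows "(infsum (%i. ereal (f i)) A) = \<infinity>"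
 using infsum_ereal_less_top_iff[of A f] assms by auto

lemma summable_on_sub:
 fixes f :: "'a => real"
 assumes "f summable_on A" "B \<subseteq> A" "!!i. i \<in> A ==> 0 <= f i"
 shows "f summable_on B"
 using assms summable_on_subset_banach by blast

lemma summable_on_le:
 fixes f g :: "'a => real"
 assumes "g summable_on A" "!!i. i \<in> A ==> 0 <= f i" "!!i. i \<in> A ==> f i <= g i"
 shows "f summable_on A"
 using summable_on_comparison_test[OF assms(1), of f] assms by auto

lemma infsum_sub_mono:
 fixes f g :: "'a => real"
 assumes "g summable_on B" "A \<subseteq> B" "!!i. i \<in> A ==> 0 <= f i" "!!i. i \<in> A ==> f i <= g i"
  "!!i. i \<in> B ==> 0 <= g i"
 shows "infsum f A <= infsum g B"
proof -
 have gA: "g summable_on A" using assms summable_on_sub by blast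
 then have "f summable_on A" using assms summable_on_le by blast
 then show ?thesis using assms by (intro infsum_mono_neutral) auto
qed

lemma sum_le_infsum:
 fixes f :: "'a => real"
 assumes "f summable_on A" "finite F" "F \<subseteq> A" "!!i. i \<in> A ==> 0 <= f i"
 shows "sum f F <= infsum f A"
 using infsum_sub_mono[OF assms(1) assms(3), of f] assms by force

lemma elem_le_infsum:
 fixes f :: "'a => real"
 assumes "f summable_on A" "i \<in> A" "!!i. i \<in> A ==> 0 <= f i"
 shows "f i <= infsum f A"
 using sum_le_infsum[of f A "{i}"] assms by auto

text \<open>Quantifying over all \<open>B\<close> off \<open>F\<close> suits the applications, where
  \<open>B\<close> consists of the disks met by a short arc or by a small ball.\<close>

lemma infsum_tail_small:
 fixes f :: "'a => real"
 assumes f: "f summable_on A" and nn: "!!i. i \<in> A ==> 0 <= f i" and "e > 0"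
 obtains F where "finite F" "F \<subseteq> A" "!!B. B \<subseteq> A - F ==> infsum f B < e"
proof -
 have "((sum f) \<longlongrightarrow> infsum f A) (finite_subsets_at_top A)"
  using f infsum_tendsto by blast
 then have "\<forall>\<^sub>F F in finite_subsets_at_top A. dist (sum f F) (infsum f A) < e"
  using \<open>e > 0\<close> tendstoD by blast
 then obtain F where F: "finite F" "F \<subseteq> A" "dist (sum f F) (infsum f A) < e"
  unfolding eventually_finite_subsets_at_top by blast
 have "infsum f B < e" if B: "B \<subseteq> A - F" for B
 proof -
  have s: "f summable_on (A - F)" using f nn summable_on_sub by blast
  have "infsum f A = infsum f F + infsum f (A - F)"
   using infsum_Un_disjoint[of f F "A - F"] F s by (simp add: Un_absorb1)
  then have "infsum f (A - F) < e" using F by (auto simp: dist_real_def)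
  moreover have "infsum f B <= infsum f (A - F)"
   by (rule infsum_sub_mono[OF s B]) (use nn B in auto)
  ultimately show ?thesis by simp
 qed
 then show thesis using that F by blast
qed

lemma infsum_bounded_finite_sums:
 fixes f :: "'a => real"
 assumes "!!i. i \<in> A ==> 0 <= f i" "!!F. finite F ==> F \<subseteq> A ==> sum f F <= c"
 shows "f summable_on A" "infsum f A <= c"
proof -
 show *: "f summable_on A"
  using assms by (intro nonneg_bdd_above_summable_on bdd_aboveI2[where M = c]) auto
 show "infsum f A <= c"
  using assms by (intro infsum_le_finite_sums[OF *]) auto
qed

lemma square_sum_le: "(x + y)^2 <= 2 * x^2 + 2 * (y::real)^2"
 using sum_squares_ge_zero[of "x - y" 0] by (simp add: power2_eq_square algebra_simps)

lemma summable_on_square_add: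
 fixes f g :: "'a => real"
 assumes "(%i. (f i)^2) summable_on A" "(%i. (g i)^2) summable_on A"
 shows "(%i. (f i + g i)^2) summable_on A"
proof (rule summable_on_le)
 show "(%i. 2 * (f i)^2 + 2 * (g i)^2) summable_on A"
  using assms by (intro summable_on_add summable_on_cmult_right)
qed (auto simp: square_sum_le)

section \<open>One-dimensional Hausdorff measure\<close>

text \<open>For null sets the bound on the diameters comes for free: no member of a cover is wider
  than the total of all diameters. A total of at most \<open>min e d\<close> therefore gives a cover
  that is admissible for \<open>d\<close>.\<close>

lemma hausdorff1_eq_0_iff:
 "hausdorff1 A = 0 \<longleftrightarrow> (\<forall>e>0. \<exists>U::nat => complex set.
   A \<subseteq> (\<Union>k. U k) & (\<forall>k. bounded (U k)) & (\<Sum>k. ennreal (diameter (U k))) <= ennreal e)"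
 (is "_ \<longleftrightarrow> ?R")
proof
 assume 0: "hausdorff1 A = 0"
 show ?R
 proof (intro allI impI)
  fix e :: real assume "e > 0"
  let ?C = "{U :: nat => complex set. A \<subseteq> (\<Union>k. U k) & (\<forall>k. bounded (U k) & diameter (U k) <= 1)}"
  have "(INF U\<in>?C. \<Sum>k. ennreal (diameter (U k))) <= hausdorff1 A"
   unfolding hausdorff1_def by (rule SUP_upper) simp
  then have "(INF U\<in>?C. \<Sum>k. ennreal (diameter (U k))) < ennreal e"
   using 0 \<open>e > 0\<close> by simp
  then obtain U where "U \<in> ?C" "(\<Sum>k. ennreal (diameter (U k))) < ennreal e"
   unfolding INF_less_iff by blast
  then show "\<exists>U::nat => complex set. A \<subseteq> (\<Union>k. U k) & (\<forall>k. bounded (U k)) &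
    (\<Sum>k. ennreal (diameter (U k))) <= ennreal e"
   by (intro exI[of _ U]) auto
 qed
next
 assume R: ?R
 have "(INF U\<in>{U :: nat => complex set. A \<subseteq> (\<Union>k. U k) & (\<forall>k. bounded (U k) & diameter (U k) <= d)}.
   \<Sum>k. ennreal (diameter (U k))) <= 0" if "d > 0" for d
 proof (rule ennreal_le_epsilon)
  fix e :: real assume "e > 0"
  define e' where "e' = min e d"
  have "e' > 0" using \<open>e > 0\<close> that by (simp add: e'_def)
  then obtain U :: "nat => complex set" where U: "A \<subseteq> (\<Union>k. U k)" "!!k. bounded (U k)"
   "(\<Sum>k. ennreal (diameter (U k))) <= ennreal e'" using R by blast
  have d: "diameter (U k) <= d" for k
  proof -
   have "ennreal (diameter (U k)) <= (\<Sum>k. ennreal (diameter (U k)))"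
    using sum_le_suminf[of "%k. ennreal (diameter (U k))" "{k}"] by auto
   also have "... <= ennreal e'" by fact
   finally have "diameter (U k) <= e'" using \<open>e' > 0\<close> by (simp add: ennreal_le_iff)
   then show ?thesis by (simp add: e'_def)
  qed
  have "(INF U\<in>{U :: nat => complex set. A \<subseteq> (\<Union>k. U k) & (\<forall>k. bounded (U k) & diameter (U k) <= d)}.
   \<Sum>k. ennreal (diameter (U k))) <= (\<Sum>k. ennreal (diameter (U k)))"
   using U d by (intro INF_lower) auto
  also have "... <= ennreal e'" by fact
  also have "... <= 0 + ennreal e" using \<open>e' > 0\<close> by (simp add: e'_def ennreal_leI)
  finally show "(INF U\<in>{U :: nat => complex set. A \<subseteq> (\<Union>k. U k) & (\<forall>k. bounded (U k) & diameter (U k) <= d)}.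
   \<Sum>k. ennreal (diameter (U k))) <= 0 + ennreal e" .
 qed
 then have "hausdorff1 A <= 0" unfolding hausdorff1_def by (intro SUP_least) auto
 then show "hausdorff1 A = 0" by simp
qed

lemma hausdorff1_null_subset:
 assumes "hausdorff1 A = 0" "B \<subseteq> A" shows "hausdorff1 B = 0"
 unfolding hausdorff1_eq_0_iff
proof (intro allI impI)
 fix e :: real assume "e > 0"
 obtain U :: "nat => complex set" where "A \<subseteq> (\<Union>k. U k)" "\<forall>k. bounded (U k)"
  "(\<Sum>k. ennreal (diameter (U k))) <= ennreal e"
  using assms(1)[unfolded hausdorff1_eq_0_iff, rule_format, OF \<open>e > 0\<close>] by (elim exE conjE)
 then show "\<exists>U::nat => complex set. B \<subseteq> (\<Union>k. U k) & (\<forall>k. bounded (U k)) &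
   (\<Sum>k. ennreal (diameter (U k))) <= ennreal e"
  using assms(2) by (intro exI[of _ U]) auto
qed

lemma hausdorff1_null_UN:
 fixes A :: "nat => complex set"
 assumes "!!n. hausdorff1 (A n) = 0" shows "hausdorff1 (\<Union>n. A n) = 0"
 unfolding hausdorff1_eq_0_iff
proof (intro allI impI)
 fix e :: real assume "e > 0"
 have "\<forall>n. \<exists>U::nat => complex set. A n \<subseteq> (\<Union>k. U k) & (\<forall>k. bounded (U k)) &
   (\<Sum>k. ennreal (diameter (U k))) <= ennreal (e * (1/2) ^ Suc n)"
 proof
  fix n
  have "e * (1/2) ^ Suc n > 0" using \<open>e > 0\<close> by simp
  then show "\<exists>U::nat => complex set. A n \<subseteq> (\<Union>k. U k) & (\<forall>k. bounded (U k)) &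
   (\<Sum>k. ennreal (diameter (U k))) <= ennreal (e * (1/2) ^ Suc n)"
   by (rule assms[unfolded hausdorff1_eq_0_iff, rule_format])
 qed
 then obtain U :: "nat => nat => complex set" where U: "!!n. A n \<subseteq> (\<Union>k. U n k)"
  "!!n k. bounded (U n k)" "!!n. (\<Sum>k. ennreal (diameter (U n k))) <= ennreal (e * (1/2) ^ Suc n)"
  by metis
 define V where "V k = (case prod_decode k of (n, j) => U n j)" for k
 have "(\<Sum>k. ennreal (diameter (V k))) = (\<Sum>k. (%(n, j). ennreal (diameter (U n j))) (prod_decode k))"
  by (intro suminf_cong) (auto simp: V_def split: prod.split)
 also have "... = (\<Sum>n. \<Sum>j. ennreal (diameter (U n j)))"
  by (rule suminf_ennreal_2dimen) auto
 also have "... <= (\<Sum>n. ennreal (e * (1/2) ^ Suc n))"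
  by (intro suminf_le U) auto
 also have "... = ennreal (\<Sum>n. e * (1/2) ^ Suc n)"
  using \<open>e > 0\<close> by (intro suminf_ennreal2 summable_mult) (auto simp: summable_geometric)
 also have "(\<Sum>n. e * (1/2) ^ Suc n) = e"
  using sums_mult[OF power_half_series, of e] sums_unique by force
 finally have sum: "(\<Sum>k. ennreal (diameter (V k))) <= ennreal e" .
 have "(\<Union>n. A n) \<subseteq> (\<Union>k. V k)"
 proof
  fix z assume "z \<in> (\<Union>n. A n)"
  then obtain n j where "z \<in> U n j" using U(1) by blast
  then have "z \<in> V (prod_encode (n, j))" by (simp add: V_def)
  then show "z \<in> (\<Union>k. V k)" by blast
 qed
 moreover have "bounded (V k)" for k using U(2) by (auto simp: V_def split: prod.split)
 ultimately show "\<exists>U::nat => complex set. (\<Union>n. A n) \<subseteq> (\<Union>k. U k) & (\<forall>k. bounded (U k)) &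
   (\<Sum>k. ennreal (diameter (U k))) <= ennreal e" using sum by blast
qed

lemma hausdorff1_countable:
 assumes "countable A" shows "hausdorff1 A = 0"
 unfolding hausdorff1_eq_0_iff
proof (intro allI impI exI conjI)
 fix e :: real
 show "A \<subseteq> (\<Union>k. {from_nat_into A k})"
  using subset_range_from_nat_into[OF assms] by auto
qed (auto simp: diameter_def)

lemma hausdorff1_null_countable_UN:
 assumes "countable I" "!!i. i \<in> I ==> hausdorff1 (A i) = 0"
 shows "hausdorff1 (\<Union>i\<in>I. A i) = 0"
proof (cases "I = {}")
 case True then show ?thesis by (simp add: hausdorff1_countable)
next
 case False
 have "(\<Union>i\<in>I. A i) \<subseteq> (\<Union>n. A (from_nat_into I n))"
  using subset_range_from_nat_into[OF assms(1)] by force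
 moreover have "hausdorff1 (\<Union>n. A (from_nat_into I n)) = 0"
  using assms(2) False by (intro hausdorff1_null_UN) (simp add: from_nat_into)
 ultimately show ?thesis using hausdorff1_null_subset by blast
qed

lemma open_real_disjoint_intervals:
 fixes T :: "real set"
 assumes "open T"
 shows "\<exists>C :: nat => real set. disjoint_family C & T = (\<Union>n. C n) &
  (\<forall>n. open (C n)) & (\<forall>n. connected (C n))"
proof -
 have cnt: "countable (components T)"
 proof (rule countable_disjoint_open_subsets)
  show "pairwise disjnt (components T)"
   using pairwise_disjoint_components[of T] by (simp add: pairwise_def disjnt_def)
 qed (use open_components[OF assms] in auto)
 \<comment> \<open>Only codes of components are used; the other indices get the empty set, so that
   the family is indexed by all of \<open>nat\<close>.\<close>
 define C where "C n = (if n \<in> to_nat_on (components T) ` components T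
   then from_nat_into (components T) n else {})" for n
 have C: "C (to_nat_on (components T) X) = X" if "X \<in> components T" for X
  using that cnt by (auto simp: C_def)
 have Cn: "C n = {} | C n \<in> components T & to_nat_on (components T) (C n) = n" for n
  using C by (auto simp: C_def cnt)
 show ?thesis
 proof (intro exI[of _ C] conjI allI)
  show "disjoint_family C"
   unfolding disjoint_family_on_def
  proof (intro ballI impI)
   fix m n :: nat assume "m ~= n"
   then show "C m Int C n = {}"
    using Cn[of m] Cn[of n] pairwise_disjoint_components[of T] unfolding pairwise_def by fastforce
  qed
  show "T = (\<Union>n. C n)"
  proof
   show "T \<subseteq> (\<Union>n. C n)"
   proof
    fix t assume "t \<in> T"
    then obtain X where X: "X \<in> components T" "t \<in> X" using Union_components[of T] by blast
    then have "t \<in> C (to_nat_on (components T) X)" using C by simp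
    then show "t \<in> (\<Union>n. C n)" by blast
   qed
   show "(\<Union>n. C n) \<subseteq> T" using Cn in_components_subset by blast
  qed
  show "open (C n)" for n using Cn[of n] open_components[OF assms] by auto
  show "connected (C n)" for n using Cn[of n] in_components_connected by auto
 qed
qed

text \<open>An open set of small measure around \<open>N\<close> splits into intervals, and the part
  of \<open>N\<close> in one interval has an image no wider than that interval. The Lipschitz bound
  is asked on \<open>N\<close> only because it will be applied to an inverse of a length function,
  which behaves well only on a part of its domain.\<close>

lemma hausdorff1_image_null_set:
 fixes f :: "real => complex"
 assumes N: "N \<in> null_sets lborel" and lip: "!!x y. x \<in> N ==> y \<in> N ==> dist (f x) (f y) <= \<bar>x - y\<bar>"
 shows "hausdorff1 (f ` N) = 0"
 unfolding hausdorff1_eq_0_iff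
proof (intro allI impI)
 fix e :: real assume "e > 0"
 have NL: "N \<in> null_sets lebesgue" using N by (simp add: null_sets_completionI)
 obtain T where T: "open T" "N \<subseteq> T" "emeasure lebesgue (T - N) < ennreal e"
  by (rule sets_lebesgue_outer_open[OF null_setsD2[OF NL] \<open>e > 0\<close>])
 have "emeasure lebesgue T = emeasure lebesgue (T - N)"
  using NL T(1) by (metis emeasure_Diff_null_set lborelD sets_completionI_sets borel_open sets_lborel)
 then have Te: "emeasure lborel T < ennreal e"
  using T by simp
 obtain C :: "nat => real set" where C': "disjoint_family C & T = (\<Union>n. C n) &
   (\<forall>n. open (C n)) & (\<forall>n. connected (C n))"
  using open_real_disjoint_intervals[OF T(1)] by (rule exE) (rule that)
 have C: "disjoint_family C" "T = (\<Union>n. C n)" "!!n. open (C n)" "!!n. connected (C n)"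
  using C' by blast+
 have sumC: "(\<Sum>n. emeasure lborel (C n)) = emeasure lborel T"
  using C by (subst suminf_emeasure) auto
 have Cfin: "emeasure lborel (C n) < \<infinity>" for n
 proof -
  have "emeasure lborel (C n) <= emeasure lborel T" using C T by (intro emeasure_mono) auto
  then show ?thesis using Te by (metis ennreal_less_top infinity_ennreal_def le_less_trans less_trans)
 qed
 have dist: "\<bar>x - y\<bar> <= measure lborel (C n)" if "x \<in> C n" "y \<in> C n" for x y n
 proof -
  have *: "y' - x' <= measure lborel (C n)" if "x' \<in> C n" "y' \<in> C n" "x' <= y'" for x' y'
  proof -
   have "{x'..y'} \<subseteq> C n" using connected_contains_Icc[OF C(4)] that by blast
   then have "emeasure lborel {x'..y'} <= emeasure lborel (C n)" using C by (intro emeasure_mono) auto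
   also have "... = ennreal (measure lborel (C n))" using Cfin[of n] by (simp add: emeasure_eq_ennreal_measure)
   finally show ?thesis using that by (simp add: ennreal_le_iff)
  qed
  show ?thesis using *[of x y] *[of y x] that by (cases "x <= y") auto
 qed
 define U where "U n = f ` (N Int C n)" for n
 have fd: "dist p q <= measure lborel (C n)" if "p \<in> U n" "q \<in> U n" for p q n
  using that lip dist unfolding U_def by (smt (verit) Int_iff imageE)
 have diam: "diameter (U n) <= measure lborel (C n)" for n
  using fd[of _ n] by (intro diameter_le) (auto simp: dist_norm)
 show "\<exists>U::nat => complex set. f ` N \<subseteq> (\<Union>k. U k) & (\<forall>k. bounded (U k)) &
    (\<Sum>k. ennreal (diameter (U k))) <= ennreal e"
 proof (intro exI[of _ U] conjI allI)
  show "f ` N \<subseteq> (\<Union>k. U k)"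
  proof
   fix z assume "z \<in> f ` N"
   then obtain t where t: "t \<in> N" "z = f t" by blast
   then obtain n where "t \<in> C n" using T(2) C(2) by auto
   then show "z \<in> (\<Union>k. U k)" using t by (intro UN_I[of n]) (auto simp: U_def)
  qed
  show "bounded (U k)" for k
   unfolding bounded_two_points using fd by blast
  have "(\<Sum>k. ennreal (diameter (U k))) <= (\<Sum>n. emeasure lborel (C n))"
  proof (intro suminf_le allI)
   fix n
   have "ennreal (diameter (U n)) <= ennreal (measure lborel (C n))" using diam by (intro ennreal_leI)
   also have "... = emeasure lborel (C n)"
    using Cfin[of n] by (intro emeasure_eq_ennreal_measure[symmetric]) auto
   finally show "ennreal (diameter (U n)) <= emeasure lborel (C n)" .
  qed auto
  also have "... <= ennreal e" using Te sumC by simp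
  finally show "(\<Sum>k. ennreal (diameter (U k))) <= ennreal e" .
 qed
qed

section \<open>Length and path integrals\<close>

lemma curve_length_mono: "J \<subseteq> J' ==> curve_length f J <= curve_length f J'"
 unfolding curve_length_def by (rule SUP_subset_mono) auto

lemma dist_le_curve_length:
 assumes "a <= b" "a \<in> J" "b \<in> J"
 shows "ennreal (dist (f a) (f b)) <= curve_length f J"
proof -
 let ?t = "%i::nat. if i = 0 then a else b"
 have "(\<Sum>i<1. ennreal (dist (f (?t i)) (f (?t (Suc i))))) <= curve_length f J"
  unfolding curve_length_def using assms
  by (intro SUP_upper2[of "(1, ?t)"]) (auto simp: mono_def)
 then show ?thesis by simp
qed

lemma curve_length_superadd:
 assumes "a <= b" "b <= c"
 shows "curve_length f {a..b} + curve_length f {b..c} <= curve_length f {a..c}"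
proof -
 let ?S = "%n t. \<Sum>i<(n::nat). ennreal (dist (f (t i)) (f (t (Suc i))))"
 let ?T = "%J. {t :: nat => real. mono t & range t \<subseteq> J}"
 have step: "?S n t + ?S m t' <= curve_length f {a..c}"
  if t: "t \<in> ?T {a..b}" and t': "t' \<in> ?T {b..c}" for n m t t'
 proof -
  \<comment> \<open>The two sequences are run one after the other. The index \<open>n\<close>
    carries the extra jump from \<open>t n\<close> to \<open>t' 0\<close>, a nonnegative term that
    is dropped.\<close>
  define s where "s i = (if i <= n then t i else t' (i - Suc n))" for i
  have "mono s"
  proof (rule monoI)
   fix i j :: nat assume "i <= j"
   have "t i <= b" "b <= t' (j - Suc n)" using t t' by (auto simp: image_subset_iff)
   then show "s i <= s j" using \<open>i <= j\<close> t t' by (auto simp: s_def mono_def)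
  qed
  moreover have "range s \<subseteq> {a..c}"
  proof -
   have "t i \<in> {a..b}" "t' i \<in> {b..c}" for i using t t' by blast+
   then show ?thesis using assms unfolding s_def by (auto simp: image_subset_iff intro: order_trans)
  qed
  moreover have "?S n t + ?S m t' <= ?S (Suc n + m) s"
  proof -
   let ?h = "%i. ennreal (dist (f (s i)) (f (s (Suc i))))"
   have "sum ?h {..<k + m} = sum ?h {..<k} + (\<Sum>i<m. ?h (k + i))" for k m :: nat
    by (induction m) (auto simp: add.assoc)
   from this[of "Suc n" m]
   have "?S (Suc n + m) s = ?S n s + ?h n + (\<Sum>i<m. ?h (Suc n + i))" by (simp add: add.assoc)
   moreover have "?S n s = ?S n t" by (intro sum.cong) (auto simp: s_def)
   moreover have "(\<Sum>i<m. ?h (Suc n + i)) = ?S m t'" by (intro sum.cong) (auto simp: s_def)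
   ultimately show ?thesis
    by (simp add: add.assoc add_left_mono)
  qed
  moreover have "?S (Suc n + m) s <= curve_length f {a..c}" if "mono s" "range s \<subseteq> {a..c}"
   unfolding curve_length_def using that by (intro SUP_upper2[of "(Suc n + m, s)"])
    (auto simp del: sum_ennreal sum.lessThan_Suc)
  ultimately show ?thesis by (meson order_trans)
 qed
 have ne: "(UNIV :: nat set) \<times> ?T {x..y} ~= {}" if "x <= y" for x y :: real
  using that by (auto intro!: exI[of _ "%_. x"] simp: mono_def)
 have "curve_length f {a..b} + curve_length f {b..c} <= curve_length f {a..c}"
  unfolding curve_length_def[of f "{a..b}"]
  apply (subst ennreal_SUP_add_left[symmetric, OF ne[OF assms(1)]])
  apply (rule SUP_least)
  apply clarify
  unfolding curve_length_def[of f "{b..c}"]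
  apply (subst add.commute)
  apply (subst ennreal_SUP_add_left[symmetric, OF ne[OF assms(2)]])
  apply (rule SUP_least)
  apply clarify
  apply (subst add.commute)
  apply (rule step)
  by auto
 then show ?thesis .
qed


lemma locally_rectifiable_subpath:
 assumes "locally_rectifiable gm" "subpath_of gm' gm"
 shows "locally_rectifiable gm'"
 using assms by (auto simp: locally_rectifiable_def subpath_of_def)

lemma path_integral_subpath:
 assumes "subpath_of gm' gm"
 shows "path_integral l gm' <= path_integral l gm"
proof (cases "locally_rectifiable gm")
 case True
 then have "locally_rectifiable gm'" using assms locally_rectifiable_subpath by blast
 then show ?thesis
  using True assms unfolding path_integral_def subpath_of_def
  by simp (intro SUP_subset_mono, auto)
qed (auto simp: path_integral_def)

text \<open>No measurability of \<open>f\<close> is assumed: \<open>arc_length_param\<close> is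
  defined by choice, so measurability of the integrands in \<open>path_integral\<close> is not at
  hand. For the integral as a supremum over simple functions below \<open>f\<close> this inequality
  survives.\<close>

lemma nn_integral_cmult_ge:
 fixes c :: real
 assumes "c > 0"
 shows "ennreal c * (\<integral>\<^sup>+x. f x \<partial>M) <= (\<integral>\<^sup>+x. ennreal c * f x \<partial>M)"
 unfolding nn_integral_def[of M f] SUP_mult_left_ennreal
proof (rule SUP_least)
 fix g assume g: "g \<in> {g. simple_function M g & g <= f}"
 have "ennreal c * integral\<^sup>S M g = integral\<^sup>S M (%x. ennreal c * g x)"
  using g by (simp add: simple_integral_mult)
 also have "... <= (\<integral>\<^sup>+x. ennreal c * f x \<partial>M)"
  unfolding nn_integral_def using g
  by (intro SUP_upper) (auto simp: le_fun_def intro!: mult_left_mono)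
 finally show "ennreal c * integral\<^sup>S M g <= (\<integral>\<^sup>+x. ennreal c * f x \<partial>M)" .
qed

lemma path_integral_mono:
 assumes "!!z. l z <= l' z" shows "path_integral l gm <= path_integral l' gm"
 unfolding path_integral_def
 by (auto intro!: SUP_mono' nn_integral_mono mult_right_mono assms split: prod.split)

lemma path_integral_cmult_ge:
 fixes c :: real
 assumes "c > 0"
 shows "ennreal c * path_integral l gm <= path_integral (%z. ennreal c * l z) gm"
proof (cases "locally_rectifiable gm")
 case True
 show ?thesis
  using True unfolding path_integral_def
  apply (simp add: SUP_mult_left_ennreal)
  apply (rule SUP_mono')
  apply clarsimp
  apply (rule order_trans[OF nn_integral_cmult_ge[OF assms]])
  apply (simp add: mult.assoc)
  done
qed (auto simp: path_integral_def)

text \<open>If the lengths up to two parameters agree, superadditivity forces the length between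
  them to be 0, so \<open>f\<close> takes the same value at both. Hence the choice in
  \<open>arc_length_param\<close> does not matter.\<close>

lemma arc_length_param_eq:
 assumes fin: "curve_length f {a..b} < \<infinity>" and t: "t \<in> {a..b}"
  and s: "curve_length f {a..t} = ennreal s"
 shows "arc_length_param f a b s = f t"
proof -
 let ?t = "SOME t. t \<in> {a..b} & curve_length f {a..t} = ennreal s"
 have *: "?t \<in> {a..b} & curve_length f {a..?t} = ennreal s"
  by (rule someI_ex) (use t s in blast)
 have const: "f x = f y" if "a <= x" "x <= y" "y <= b" "curve_length f {a..x} = curve_length f {a..y}" for x y
 proof -
  have "curve_length f {a..x} + curve_length f {x..y} <= curve_length f {a..x} + 0"
   using curve_length_superadd[of a x y f] that by simp
  moreover have "curve_length f {a..x} < \<infinity>"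
   using fin curve_length_mono[of "{a..x}" "{a..b}" f] that by (metis atLeastatMost_subset_iff le_less_trans order_refl order_trans)
  ultimately have "curve_length f {x..y} <= 0"
   by (metis ennreal_add_left_cancel_le infinity_ennreal_def less_irrefl)
  moreover have "ennreal (dist (f x) (f y)) <= curve_length f {x..y}"
   using that by (intro dist_le_curve_length) auto
  ultimately show ?thesis by (metis dist_eq_0_iff ennreal_eq_0_iff le_zero_eq order_antisym zero_le_dist)
 qed
 have "f ?t = f t"
 proof (cases "?t <= t")
  case True then show ?thesis using const[of ?t t] * t s by simp
 next
  case False then show ?thesis using const[of t ?t] * t s by simp
 qed
 then show ?thesis by (simp add: arc_length_param_def)
qed

text \<open>With unit speed, parameter and arc length differ by the shift by \<open>a\<close>, so
  every integral along arc length is a translate of an integral over a subinterval of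
  \<open>T\<close>.\<close>

lemma path_integral_unit_speed:
 fixes f :: "real => complex"
 assumes len: "!!a b. a <= b ==> {a..b} \<subseteq> T ==> curve_length f {a..b} = ennreal (b - a)"
  and J: "J \<subseteq> T" and meas: "(%t. l (f t)) \<in> borel_measurable borel" and T: "T \<in> sets borel"
 shows "path_integral l (J, f) <= (\<integral>\<^sup>+t\<in>T. l (f t) \<partial>lborel)"
proof -
 have lr: "locally_rectifiable (J, f)"
  using len J by (auto simp: locally_rectifiable_def)
 have "(\<integral>\<^sup>+ s \<in> {0..enn2real (curve_length f {a..b})}. l (arc_length_param f a b s) \<partial>lborel)
   <= (\<integral>\<^sup>+t\<in>T. l (f t) \<partial>lborel)" if ab: "a <= b" "{a..b} \<subseteq> J" for a b
 proof -
  have L: "enn2real (curve_length f {a..b}) = b - a" using len ab J by auto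
  have arc: "arc_length_param f a b s = f (a + s)" if "s \<in> {0..b - a}" for s
  proof (rule arc_length_param_eq)
   show "curve_length f {a..b} < \<infinity>" using len[of a b] ab J by auto
   have "{a..a+s} \<subseteq> T" using that ab J by (force simp: subset_iff)
   then show "curve_length f {a..a + s} = ennreal s" using len[of a "a+s"] that by auto
  qed (use that in auto)
  have "(\<integral>\<^sup>+ s \<in> {0..b - a}. l (arc_length_param f a b s) \<partial>lborel) =
    (\<integral>\<^sup>+ s. l (f (a + s)) * indicator {a..b} (a + s) \<partial>lborel)"
   by (intro nn_integral_cong) (auto simp: arc indicator_def)
  also have "... = (\<integral>\<^sup>+ s. l (f s) * indicator {a..b} s \<partial>lborel)"
   using nn_integral_real_affine[of "%s. l (f s) * indicator {a..b} s" 1 a] meas by simp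
  also have "... <= (\<integral>\<^sup>+t\<in>T. l (f t) \<partial>lborel)"
   using ab J by (intro nn_integral_mono mult_left_mono) (auto simp: indicator_def)
  finally show ?thesis using L by simp
 qed
 then show ?thesis unfolding path_integral_def using lr by (auto intro!: SUP_least)
qed

text \<open>A path may live on an open or half-open interval; this writes it as a countable union of
  compact arcs, and null sets are stable under countable unions.\<close>

lemma interval_countable_UN_Icc:
 fixes J :: "real set"
 assumes "is_interval J"
 obtains D where "countable D" "J = (\<Union>(p, q)\<in>D. {p..q})"
proof -
 \<comment> \<open>Rational points alone would miss an endpoint that belongs to \<open>J\<close>, so
   the minimum and the maximum of \<open>J\<close> are added when they exist.\<close>
 define E where "E = (\<rat> Int J) Un {e \<in> J. (\<forall>x\<in>J. e <= x) | (\<forall>x\<in>J. x <= e)}"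
 have "e = Inf J" if "e \<in> J" "\<forall>x\<in>J. e <= x" for e
  using cInf_eq_minimum[of e J] that by simp
 moreover have "e = Sup J" if "e \<in> J" "\<forall>x\<in>J. x <= e" for e
  using cSup_eq_maximum[of e J] that by simp
 ultimately have "{e \<in> J. (\<forall>x\<in>J. e <= x) | (\<forall>x\<in>J. x <= e)} \<subseteq> {Inf J, Sup J}"
  by blast
 then have "countable {e \<in> J. (\<forall>x\<in>J. e <= x) | (\<forall>x\<in>J. x <= e)}"
  by (rule countable_subset) simp
 then have cE: "countable E" by (auto simp: E_def countable_rat)
 have low: "\<exists>p\<in>E. p <= t" if "t \<in> J" for t
 proof (cases "\<forall>x\<in>J. t <= x")
  case False
  then obtain x where "x \<in> J" "x < t" by auto
  then obtain q where "q \<in> \<rat>" "x < q" "q < t" using Rats_dense_in_real by blast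
  then have "q \<in> J" using assms \<open>x \<in> J\<close> that by (meson is_interval_1 less_imp_le)
  then show ?thesis using \<open>q \<in> \<rat>\<close> \<open>q < t\<close> by (auto simp: E_def intro!: bexI[of _ q])
 qed (use that in \<open>auto simp: E_def\<close>)
 have high: "\<exists>p\<in>E. t <= p" if "t \<in> J" for t
 proof (cases "\<forall>x\<in>J. x <= t")
  case False
  then obtain x where "x \<in> J" "x > t" by auto
  then obtain q where "q \<in> \<rat>" "t < q" "q < x" using Rats_dense_in_real by blast
  then have "q \<in> J" using assms \<open>x \<in> J\<close> that by (meson is_interval_1 less_imp_le)
  then show ?thesis using \<open>q \<in> \<rat>\<close> \<open>t < q\<close> by (auto simp: E_def intro!: bexI[of _ q])
 qed (use that in \<open>auto simp: E_def\<close>)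
 have "E \<subseteq> J" by (auto simp: E_def)
 have sub: "{p..q} \<subseteq> J" if "p \<in> E" "q \<in> E" for p q
 proof
  fix x assume "x \<in> {p..q}"
  then show "x \<in> J" using that \<open>E \<subseteq> J\<close> assms unfolding is_interval_1
   by (meson atLeastAtMost_iff subsetD)
 qed
 have "J \<subseteq> (\<Union>(p, q)\<in>E \<times> E. {p..q})"
 proof
  fix t assume "t \<in> J"
  then obtain p q where "p \<in> E" "p <= t" "q \<in> E" "t <= q" using low high by blast
  then show "t \<in> (\<Union>(p, q)\<in>E \<times> E. {p..q})" by (intro UN_I[of "(p, q)"]) auto
 qed
 moreover have "(\<Union>(p, q)\<in>E \<times> E. {p..q}) \<subseteq> J" using sub by fast
 ultimately have "J = (\<Union>(p, q)\<in>E \<times> E. {p..q})" by (rule equalityI)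
 then show thesis using that[of "E \<times> E"] cE by auto
qed

text \<open>The inverse of the length function is defined off a countable set; there the arc length
 parametrization is a Borel function, and it is 1-Lipschitz wherever it is not a junk value.\<close>

lemma arc_length_integral_infinite:
 fixes f :: "real => complex"
 assumes ab: "a <= b" and cont: "continuous_on {a..b} f" and fin: "curve_length f {a..b} < \<infinity>"
  and B: "B \<in> sets borel" and H: "hausdorff1 (f ` {a..b} Int B) ~= 0"
 shows "(\<integral>\<^sup>+ s \<in> {0..enn2real (curve_length f {a..b})}. \<infinity> * indicator B (arc_length_param f a b s) \<partial>lborel) = \<infinity>"
proof -
 define L where "L = enn2real (curve_length f {a..b})"
 \<comment> \<open>\<open>cl\<close> clamps the parameter to \<open>{a..b}\<close>, so that all
   auxiliary functions are defined and measurable on the whole line.\<close>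
 define cl where "cl t = max a (min b t)" for t :: real
 define len where "len t = enn2real (curve_length f {a..cl t})" for t
 \<comment> \<open>The right-most inverse of the length function; inserting \<open>a\<close> keeps
   the set nonempty.\<close>
 define tau where "tau y = Sup (insert a {t \<in> {a..b}. len t <= y})" for y
 have cl: "cl t \<in> {a..b}" for t using ab by (auto simp: cl_def)
 have cl_id: "cl t = t" if "t \<in> {a..b}" for t using that by (auto simp: cl_def)
 have cl_mono: "s <= t ==> cl s <= cl t" for s t by (auto simp: cl_def)
 have fin': "curve_length f {a..cl t} < \<infinity>" for t
  using fin curve_length_mono[of "{a..cl t}" "{a..b}" f] cl[of t]
  by (metis atLeastAtMost_iff atLeastatMost_subset_iff le_less_trans order_refl)
 have len_e: "curve_length f {a..cl t} = ennreal (len t)" for t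
  using fin'[of t] by (simp add: len_def less_top)
 have len_mono: "len s <= len t" if "s <= t" for s t
 proof -
  have "curve_length f {a..cl s} <= curve_length f {a..cl t}"
   using cl_mono[OF that] by (intro curve_length_mono) auto
  then show ?thesis unfolding len_def by (rule enn2real_mono) (use fin'[of t] in simp)
 qed
 have len_L: "len t \<in> {0..L}" for t
 proof -
  have "curve_length f {a..cl t} <= curve_length f {a..b}"
   using cl[of t] by (intro curve_length_mono) auto
  then have "len t <= L" unfolding len_def L_def by (rule enn2real_mono) (use fin in simp)
  then show ?thesis by (simp add: len_def)
 qed
 have lip: "dist (f s) (f t) <= len t - len s" if "s \<in> {a..b}" "t \<in> {a..b}" "s <= t" for s t
 proof -
  have "ennreal (len s) + ennreal (dist (f s) (f t)) <= ennreal (len t)"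
   using curve_length_superadd[of a s t f] dist_le_curve_length[of s t "{s..t}" f] that len_e[of s] len_e[of t]
   by (simp add: cl_id) (meson add_left_mono order_trans)
  then show ?thesis using len_L[of s] len_L[of t]
   by (simp add: ennreal_plus[symmetric] ennreal_le_iff del: ennreal_plus)
 qed
 have arc: "arc_length_param f a b (len t) = f t" if "t \<in> {a..b}" for t
  using that fin len_e[of t] by (intro arc_length_param_eq) (auto simp: cl_id)
 have bdd: "bdd_above (insert a {t \<in> {a..b}. len t <= y})" for y
  using ab by (intro bdd_aboveI[of _ b]) auto
 have tau_in: "tau y \<in> {a..b}" for y
  unfolding tau_def using bdd[of y] ab by (auto intro!: cSup_upper cSup_least)
 have tau_mono: "mono tau"
  unfolding tau_def by (intro monoI cSup_subset_mono) (use bdd in auto)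
 have len_meas: "len \<in> borel_measurable borel"
  using len_mono by (intro borel_measurable_mono) (auto simp: mono_def)
 have tau_meas[measurable]: "tau \<in> borel_measurable borel" using tau_mono by (rule borel_measurable_mono)
 have "continuous_on UNIV (%t. f (cl t))"
  using cl by (intro continuous_on_compose2[OF cont]) (auto simp: cl_def intro!: continuous_intros)
 then have fcl[measurable]: "(%t. f (cl t)) \<in> borel_measurable borel" by (rule borel_measurable_continuous_onI)
 \<comment> \<open>The lengths \<open>y\<close> attained at \<open>tau y\<close>, at a point over
   \<open>B\<close>. On this set \<open>tau\<close> is a genuine section of the length function,
   hence its composition with \<open>f\<close> is 1-Lipschitz there.\<close>
 define E where "E = {y \<in> {0..L}. len (tau y) = y & f (cl (tau y)) \<in> B}"
 have E_meas: "E \<in> sets borel"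
 proof -
  have [measurable]: "(%y. len (tau y)) \<in> borel_measurable borel"
   using measurable_compose[OF tau_meas len_meas] .
  have [measurable]: "(%y. f (cl (tau y))) \<in> borel_measurable borel"
   using measurable_compose[OF tau_meas fcl] .
  note B[measurable]
  show ?thesis unfolding E_def by measurable
 qed
 have arcE: "arc_length_param f a b y = f (tau y)" if "y \<in> E" for y
  using arc[OF tau_in[of y]] that by (auto simp: E_def)
 have H0: "hausdorff1 (f ` {a..b} Int B) = 0" if "emeasure lborel E = 0"
 proof -
  have n1: "hausdorff1 ((%y. f (tau y)) ` E) = 0"
  proof (rule hausdorff1_image_null_set)
   show "E \<in> null_sets lborel" using that E_meas by auto
   fix x y assume xy: "x \<in> E" "y \<in> E"
   show "dist (f (tau x)) (f (tau y)) <= \<bar>x - y\<bar>"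
   proof (cases "x <= y")
    case True
    then have "tau x <= tau y" using tau_mono by (auto simp: mono_def)
    then show ?thesis using lip[OF tau_in tau_in, of x y] xy by (auto simp: E_def)
   next
    case False
    then have "tau y <= tau x" using tau_mono by (auto simp: mono_def)
    then show ?thesis using lip[OF tau_in tau_in, of y x] xy by (auto simp: E_def dist_commute)
   qed
  qed
  have n2: "hausdorff1 ((%q. f (cl q)) ` \<rat>) = 0"
   by (intro hausdorff1_countable countable_image countable_rat)
  have "f ` {a..b} Int B \<subseteq> (\<Union>n::nat. if n = 0 then (%y. f (tau y)) ` E else (%q. f (cl q)) ` \<rat>)"
  proof
   fix z assume z: "z \<in> f ` {a..b} Int B"
   then obtain t where t: "t \<in> {a..b}" "z = f t" by auto
   define y where "y = len t"
   have ty: "t <= tau y" unfolding tau_def using bdd t by (intro cSup_upper) (auto simp: y_def)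
   show "z \<in> (\<Union>n::nat. if n = 0 then (%y. f (tau y)) ` E else (%q. f (cl q)) ` \<rat>)"
   proof (cases "len (tau y) = y")
    case True
    have "f (tau y) = f t" using lip[OF t(1) tau_in ty] True by (simp add: y_def)
    then have "y \<in> E" using True z t len_L[of t] cl_id[OF tau_in] by (auto simp: E_def y_def)
    then show ?thesis using \<open>f (tau y) = f t\<close> t by (intro UN_I[of 0]) force+
   next
    case False
    \<comment> \<open>The length is constant between \<open>t\<close> and a rational
      \<open>q\<close> below \<open>tau y\<close>, so \<open>f t = f q\<close>: points whose length
      is not attained at \<open>tau y\<close> contribute only countably many values.\<close>
    then have "t < tau y" using ty unfolding y_def by (metis order_le_less)
    then obtain q where q: "q \<in> \<rat>" "t < q" "q < tau y" using Rats_dense_in_real by blast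
    obtain t'' where t'': "t'' \<in> insert a {t \<in> {a..b}. len t <= y}" "q < t''"
    using less_cSupE[OF q(3)[unfolded tau_def]] by blast
    then have "len t'' <= y" "q \<in> {a..b}" using t q by auto
    then have "len q = len t" using len_mono[of t q] len_mono[of q t''] q t'' by (auto simp: y_def)
    then have "f q = f t" using lip[OF t(1) \<open>q \<in> {a..b}\<close>] q by simp
    then show ?thesis using t q cl_id[OF \<open>q \<in> {a..b}\<close>] by (intro UN_I[of 1]) force+
   qed
  qed
  moreover have "hausdorff1 (\<Union>n::nat. if n = 0 then (%y. f (tau y)) ` E else (%q. f (cl q)) ` \<rat>) = 0"
   using n1 n2 by (intro hausdorff1_null_UN) auto
  ultimately show ?thesis using hausdorff1_null_subset by blast
 qed
 then have "emeasure lborel E ~= 0" using H by blast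
 then have "\<infinity> = \<infinity> * emeasure lborel E" by (simp add: ennreal_top_mult)
 also have "... = (\<integral>\<^sup>+ s. \<infinity> * indicator E s \<partial>lborel)"
  using E_meas by (simp add: nn_integral_cmult_indicator)
 also have "... <= (\<integral>\<^sup>+ s \<in> {0..L}. \<infinity> * indicator B (arc_length_param f a b s) \<partial>lborel)"
 proof (intro nn_integral_mono)
  fix s
  show "(\<infinity>::ennreal) * indicator E s <= \<infinity> * indicator B (arc_length_param f a b s) * indicator {0..L} s"
   using arcE[of s] cl_id[OF tau_in, of s] by (cases "s \<in> E") (auto simp: E_def)
 qed
 finally show ?thesis unfolding L_def by (simp add: top_unique)
qed

text \<open>If the path is locally rectifiable, countability yields a compact arc that already meets
  \<open>B\<close> in positive length, and along it the infinite weight has an infinite integral;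
  otherwise the integral is infinite by convention.\<close>

lemma path_integral_infinite_on:
 assumes gm: "is_cpath gm" and B: "B \<in> sets borel" and H: "hausdorff1 (img gm Int B) ~= 0"
 shows "path_integral (%z. \<infinity> * indicator B z) gm = \<infinity>"
proof (cases "locally_rectifiable gm")
 case True
 obtain J f where gm_eq: "gm = (J, f)" by (cases gm)
 have J: "is_interval J" using gm by (simp add: is_cpath_def gm_eq)
 obtain h where h: "continuous_on (closure J) h" "!!t. t \<in> J ==> h t = f t"
  using gm by (auto simp: is_cpath_def gm_eq)
 obtain D where D: "countable D" "J = (\<Union>(p, q)\<in>D. {p..q})"
  using interval_countable_UN_Icc[OF J] by blast
 have "\<exists>d\<in>D. hausdorff1 (f ` {fst d..snd d} Int B) ~= 0"
 proof (rule ccontr)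
  assume "\<not> ?thesis"
  then have "hausdorff1 (\<Union>d\<in>D. f ` {fst d..snd d} Int B) = 0"
   using D(1) by (intro hausdorff1_null_countable_UN) auto
  moreover have "img gm Int B \<subseteq> (\<Union>d\<in>D. f ` {fst d..snd d} Int B)"
   using D(2) by (force simp: img_def gm_eq)
  ultimately show False using H hausdorff1_null_subset by blast
 qed
 then obtain p q where pq: "(p, q) \<in> D" "hausdorff1 (f ` {p..q} Int B) ~= 0" by force
 have sub: "{p..q} \<subseteq> J" using D(2) pq(1) by auto
 have "p <= q"
  using pq(2) hausdorff1_countable[of "{}"] by (cases "p <= q") auto
 have "continuous_on {p..q} f"
 proof (rule continuous_on_eq)
  show "continuous_on {p..q} h"
   using sub closure_subset[of J] by (intro continuous_on_subset[OF h(1)]) (rule subset_trans)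
  show "h t = f t" if "t \<in> {p..q}" for t using h(2) sub that by (simp add: subset_iff)
 qed
 moreover have "curve_length f {p..q} < \<infinity>"
  using True sub \<open>p <= q\<close> by (auto simp: locally_rectifiable_def gm_eq)
 ultimately have "(\<integral>\<^sup>+ s \<in> {0..enn2real (curve_length f {p..q})}. \<infinity> * indicator B (arc_length_param f p q s) \<partial>lborel) = \<infinity>"
  using arc_length_integral_infinite[OF \<open>p <= q\<close>] B pq(2) by blast
 moreover have "(\<integral>\<^sup>+ s \<in> {0..enn2real (curve_length f {p..q})}. \<infinity> * indicator B (arc_length_param f p q s) \<partial>lborel)
   <= path_integral (%z. \<infinity> * indicator B z) gm"
  using True sub \<open>p <= q\<close> unfolding path_integral_def gm_eq
  by (auto intro!: SUP_upper2[of "(p, q)"])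
 ultimately show ?thesis by (simp add: top_unique)
qed (simp add: path_integral_def)

section \<open>Modulus with exponent two\<close>

text \<open>The square of the supremum is at most the sum of the squares. Taking suprema rather than
  sums of weights avoids Minkowski's inequality.\<close>

lemma l2_sup:
 fixes l :: "nat => complex => ennreal"
 assumes meas: "!!n. l n \<in> borel_measurable borel"
  and bound: "!!n. (\<integral>\<^sup>+z. (l n z)^2 \<partial>lborel) <= ennreal ((1/2) ^ n)"
 shows "(\<integral>\<^sup>+z. (SUP n. l n z)^2 \<partial>lborel) < \<infinity>"
proof -
 have sq: "(SUP n. l n z)^2 <= (\<Sum>n. (l n z)^2)" for z
 proof (cases "\<Sum>n. (l n z)^2")
  case (real x)
  have "l n z <= ennreal (sqrt x)" for n
  proof -
   have "(l n z)^2 <= (\<Sum>n. (l n z)^2)"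
    using sum_le_suminf[of "%n. (l n z)^2" "{n}"] by auto
   then have le: "(l n z)^2 <= ennreal x" using real by simp
   then obtain r where r: "l n z = ennreal r" "r >= 0"
    by (cases "l n z") (auto simp: power2_eq_square ennreal_mult_top top_unique)
   then have "r^2 <= x" using le real by (simp add: ennreal_power ennreal_le_iff)
   then show ?thesis using r real by (simp add: ennreal_le_iff real_le_rsqrt)
  qed
  then have "(SUP n. l n z) <= ennreal (sqrt x)" by (intro SUP_least)
  then have "(SUP n. l n z)^2 <= (ennreal (sqrt x))^2" by (simp add: power_mono)
  then show ?thesis using real by (simp add: ennreal_power)
 qed auto
 have "(\<integral>\<^sup>+z. (SUP n. l n z)^2 \<partial>lborel) <= (\<integral>\<^sup>+z. (\<Sum>n. (l n z)^2) \<partial>lborel)"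
  by (intro nn_integral_mono sq)
 also have "... = (\<Sum>n. \<integral>\<^sup>+z. (l n z)^2 \<partial>lborel)"
  using meas by (intro nn_integral_suminf) measurable
 also have "... <= (\<Sum>n. ennreal ((1/2) ^ n))"
  using bound by (intro suminf_le) auto
 also have "... < \<infinity>"
  by (subst suminf_ennreal2) (auto simp: summable_geometric)
 finally show ?thesis .
qed

text \<open>Fuglede's criterion. It replaces a sequence of admissible weights by a single one and
  makes countable unions and superpaths easy.\<close>

lemma mod2_eq_0_iff:
 "mod2 Gm = 0 \<longleftrightarrow> (\<exists>l\<in>borel_measurable borel. (\<integral>\<^sup>+z. (l z)^2 \<partial>lborel) < \<infinity> &
  (\<forall>gm\<in>Gm. path_integral l gm = \<infinity>))" (is "_ \<longleftrightarrow> ?R")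
proof
 assume 0: "mod2 Gm = 0"
 let ?c = "%n. real (Suc n)"
 \<comment> \<open>The budget leaves room to multiply the weight by \<open>n + 1\<close>: the scaled
   weights still have square integrals at most \<open>(1/2)^n\<close>, but their integral along
   every path is at least \<open>n + 1\<close>.\<close>
 have "\<exists>l. l \<in> borel_measurable borel & (\<forall>gm\<in>Gm. 1 <= path_integral l gm) &
   (\<integral>\<^sup>+ z. (l z)^2 \<partial>lborel) < ennreal ((1/2)^n / (?c n)^2)" for n
 proof -
  have "mod2 Gm < ennreal ((1/2)^n / (?c n)^2)" using 0 by simp
  then show ?thesis unfolding mod2_def INF_less_iff by blast
 qed
 then obtain l where l: "!!n. l n \<in> borel_measurable borel" "!!n gm. gm \<in> Gm ==> 1 <= path_integral (l n) gm"
  "!!n. (\<integral>\<^sup>+ z. (l n z)^2 \<partial>lborel) < ennreal ((1/2)^n / (?c n)^2)" by metis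
 define k where "k n z = ennreal (?c n) * l n z" for n z
 have km: "k n \<in> borel_measurable borel" for n using l(1) unfolding k_def by measurable
 have kb: "(\<integral>\<^sup>+z. (k n z)^2 \<partial>lborel) <= ennreal ((1/2) ^ n)" for n
 proof -
  have "(\<integral>\<^sup>+z. (k n z)^2 \<partial>lborel) = ennreal ((?c n)^2) * (\<integral>\<^sup>+z. (l n z)^2 \<partial>lborel)"
   using l(1) unfolding k_def power_mult_distrib ennreal_power[OF of_nat_0_le_iff]
   by (intro nn_integral_cmult) measurable
  also have "... <= ennreal ((?c n)^2) * ennreal ((1/2)^n / (?c n)^2)"
   by (intro mult_left_mono less_imp_le[OF l(3)]) auto
  also have "... = ennreal ((1/2)^n)"
   by (subst ennreal_mult[symmetric]) auto
  finally show ?thesis .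
 qed
 show ?R
 proof (intro bexI[of _ "%z. SUP n. k n z"] conjI ballI)
  show "(\<integral>\<^sup>+z. (SUP n. k n z)^2 \<partial>lborel) < \<infinity>" using l2_sup[OF km kb] .
  fix gm assume "gm \<in> Gm"
  have "of_nat n <= path_integral (%z. SUP n. k n z) gm" for n
  proof -
   have "(of_nat n :: ennreal) <= ennreal (?c n) * 1" by (simp add: ennreal_of_nat_eq_real_of_nat)
   also have "... <= ennreal (?c n) * path_integral (l n) gm"
    using l(2)[OF \<open>gm \<in> Gm\<close>] by (intro mult_left_mono) auto
   also have "... <= path_integral (k n) gm"
    unfolding k_def by (rule path_integral_cmult_ge) auto
   also have "... <= path_integral (%z. SUP n. k n z) gm"
    by (intro path_integral_mono SUP_upper) auto
   finally show ?thesis .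
  qed
  then show "path_integral (%z. SUP n. k n z) gm = \<infinity>"
  proof (cases "path_integral (%z. SUP n. k n z) gm")
   case (real r)
   obtain n where "r < of_nat n" using reals_Archimedean2 by blast
   then show ?thesis using \<open>!!n. of_nat n <= path_integral (%z. SUP n. k n z) gm\<close>[of n] real
    by (simp add: ennreal_of_nat_eq_real_of_nat ennreal_le_iff)
  qed simp
 qed (use km in measurable)
next
 assume ?R
 then obtain l where l: "l \<in> borel_measurable borel" "(\<integral>\<^sup>+z. (l z)^2 \<partial>lborel) < \<infinity>"
  "!!gm. gm \<in> Gm ==> path_integral l gm = \<infinity>" by blast
 obtain C where C: "(\<integral>\<^sup>+z. (l z)^2 \<partial>lborel) = ennreal C" "C >= 0"
  using l(2) by (cases "\<integral>\<^sup>+z. (l z)^2 \<partial>lborel") auto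
 have "mod2 Gm <= 0"
 proof (rule ennreal_le_epsilon)
  fix e :: real assume "e > 0"
  \<comment> \<open>An infinite path integral stays infinite under scaling, so the weight can be
    scaled down until \<open>d^2 * C <= e\<close>; the \<open>+ 1\<close> avoids a division by
    0.\<close>
  define d where "d = sqrt (e / (C + 1))"
  have d: "d > 0" using \<open>e > 0\<close> C by (simp add: d_def)
  have "mod2 Gm <= (\<integral>\<^sup>+z. (ennreal d * l z)^2 \<partial>lborel)"
   unfolding mod2_def
  proof (intro INF_lower CollectI conjI ballI)
   show "(%z. ennreal d * l z) \<in> borel_measurable borel" using l by measurable
   fix gm assume "gm \<in> Gm"
   then show "1 <= path_integral (%z. ennreal d * l z) gm"
    using path_integral_cmult_ge[OF d, of l gm] l(3)[of gm] d
    by (simp add: ennreal_mult_top top_unique)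
  qed
  also have "... = ennreal (d^2) * ennreal C"
   using l d unfolding power_mult_distrib ennreal_power[OF less_imp_le[OF d]] C(1)[symmetric]
   by (intro nn_integral_cmult) measurable
  also have "... = ennreal (e / (C + 1) * C)"
   using \<open>e > 0\<close> C by (simp add: d_def ennreal_mult[symmetric])
  also have "... <= 0 + ennreal e"
   using \<open>e > 0\<close> C by (simp add: ennreal_le_iff field_simps)
  finally show "mod2 Gm <= 0 + ennreal e" .
 qed
 then show "mod2 Gm = 0" by simp
qed

lemma mod2_null_UN:
 fixes Gm :: "nat => cpath set"
 assumes "!!n. mod2 (Gm n) = 0" shows "mod2 (\<Union>n. Gm n) = 0"
proof -
 have "\<exists>l\<in>borel_measurable borel. (\<integral>\<^sup>+z. (l z)^2 \<partial>lborel) <= ennreal ((1/2)^n) &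
  (\<forall>gm\<in>Gm n. path_integral l gm = \<infinity>)" for n
 proof -
  obtain l where l: "l \<in> borel_measurable borel" "(\<integral>\<^sup>+z. (l z)^2 \<partial>lborel) < \<infinity>"
  "!!gm. gm \<in> Gm n ==> path_integral l gm = \<infinity>" using assms[of n] unfolding mod2_eq_0_iff by blast
  obtain C where C: "(\<integral>\<^sup>+z. (l z)^2 \<partial>lborel) = ennreal C" "C >= 0"
   using l(2) by (cases "\<integral>\<^sup>+z. (l z)^2 \<partial>lborel") auto
  define d where "d = sqrt ((1/2)^n / (C + 1))"
  have d: "d > 0" using C by (simp add: d_def)
  have "(\<integral>\<^sup>+z. (ennreal d * l z)^2 \<partial>lborel) = ennreal (d^2) * ennreal C"
   using l d unfolding power_mult_distrib ennreal_power[OF less_imp_le[OF d]] C(1)[symmetric]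
   by (intro nn_integral_cmult) measurable
  also have "... = ennreal ((1/2)^n / (C + 1) * C)"
   using C by (simp add: d_def ennreal_mult[symmetric])
  also have "... <= ennreal ((1/2)^n)"
  proof (rule ennreal_leI)
   have "C / (C + 1) <= 1" using C by (simp add: divide_le_eq_1)
   then have "(1/2)^n * (C / (C + 1)) <= (1/2)^n * 1" by (intro mult_left_mono) auto
   then show "(1/2)^n / (C + 1) * C <= (1/2)^n" by simp
  qed
  finally have "(\<integral>\<^sup>+z. (ennreal d * l z)^2 \<partial>lborel) <= ennreal ((1/2)^n)" .
  moreover have "path_integral (%z. ennreal d * l z) gm = \<infinity>" if "gm \<in> Gm n" for gm
   using path_integral_cmult_ge[OF d, of l gm] l(3)[OF that] d
   by (simp add: ennreal_mult_top top_unique)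
  moreover have "(%z. ennreal d * l z) \<in> borel_measurable borel" using l by measurable
  ultimately show ?thesis by (intro bexI conjI ballI)
 qed
 then obtain l where l: "!!n. l n \<in> borel_measurable borel"
  "!!n. (\<integral>\<^sup>+z. (l n z)^2 \<partial>lborel) <= ennreal ((1/2)^n)"
  "!!n gm. gm \<in> Gm n ==> path_integral (l n) gm = \<infinity>" by metis
 have "path_integral (%z. SUP n. l n z) gm = \<infinity>" if "gm \<in> Gm n" for n gm
 proof -
  have "path_integral (l n) gm <= path_integral (%z. SUP n. l n z) gm"
   by (intro path_integral_mono SUP_upper) auto
  then show ?thesis using l(3)[OF that] by (simp add: top_unique)
 qed
 moreover have "(%z. SUP n. l n z) \<in> borel_measurable borel" using l by measurable
 ultimately show ?thesis
  unfolding mod2_eq_0_iff by (intro bexI[of _ "%z. SUP n. l n z"] conjI ballI l2_sup[OF l(1,2)]) auto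
qed

lemma mod2_null_subset: "mod2 Gm = 0 ==> Gm' \<subseteq> Gm ==> mod2 Gm' = 0"
 unfolding mod2_eq_0_iff by blast

lemma mod2_null_superpaths:
 assumes "mod2 Gm = 0"
 shows "mod2 {gm. \<exists>gm'\<in>Gm. subpath_of gm' gm} = 0"
proof -
 obtain l where l: "l \<in> borel_measurable borel" "(\<integral>\<^sup>+z. (l z)^2 \<partial>lborel) < \<infinity>"
  "!!gm. gm \<in> Gm ==> path_integral l gm = \<infinity>" using assms unfolding mod2_eq_0_iff by blast
 have "path_integral l gm = \<infinity>" if "gm' \<in> Gm" "subpath_of gm' gm" for gm gm'
  using path_integral_subpath[OF that(2), of l] l(3)[OF that(1)] by (simp add: top_unique)
 then show ?thesis unfolding mod2_eq_0_iff using l by blast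
qed

text \<open>The weight that is infinite on \<open>B\<close> and 0 elsewhere has square integral 0,
  yet its integral along each of these paths is infinite. With \<open>B\<close> the carpet, of area
  0, almost every path meets it in length 0.\<close>

lemma mod2_null_hausdorff1:
 assumes B: "B \<in> sets borel" "emeasure lborel B = 0"
 shows "mod2 {gm. is_cpath gm & hausdorff1 (img gm Int B) ~= 0} = 0"
 unfolding mod2_eq_0_iff
proof (intro bexI[of _ "%z. \<infinity> * indicator B z"] conjI ballI)
 have "(\<integral>\<^sup>+z. (\<infinity> * indicator B z)^2 \<partial>lborel) = (\<integral>\<^sup>+z. \<infinity> * indicator B z \<partial>lborel)"
  by (intro nn_integral_cong) (auto simp: indicator_def power2_eq_square ennreal_top_mult)
 also have "... = 0" using B by (simp add: nn_integral_cmult_indicator)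
 finally show "(\<integral>\<^sup>+z. (\<infinity> * indicator B z)^2 \<partial>lborel) < \<infinity>" by simp
qed (use B path_integral_infinite_on in auto)

section \<open>Boundaries of squares as paths\<close>

text \<open>The level sets are squares with sides parallel to the axes; Fubini's theorem then does
  the work for which circles would need polar coordinates.\<close>

definition sup_norm :: "complex => real" where
 "sup_norm z = max \<bar>Re z\<bar> \<bar>Im z\<bar>"

lemma sup_norm_le_norm: "sup_norm z <= norm z"
 by (simp add: sup_norm_def abs_Re_le_cmod abs_Im_le_cmod)

lemma norm_le_sup_norm: "norm z <= 2 * sup_norm z"
 using cmod_le[of z] by (simp add: sup_norm_def max_def split: if_splits)

lemma sup_norm_triangle: "sup_norm (z + w) <= sup_norm z + sup_norm w"
 using abs_triangle_ineq[of "Re z" "Re w"] abs_triangle_ineq[of "Im z" "Im w"]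
 unfolding sup_norm_def by (simp add: max_def)

lemma sup_norm_minus: "sup_norm (- z) = sup_norm z"
 by (simp add: sup_norm_def)

lemma sup_norm_commute: "sup_norm (z - w) = sup_norm (w - z)"
 using sup_norm_minus[of "z - w"] by simp

lemma sup_norm_nonneg: "0 <= sup_norm z"
 by (simp add: sup_norm_def max_def)

lemma sup_norm_diff_le: "\<bar>sup_norm (z - c) - sup_norm (w - c)\<bar> <= dist z w"
 using sup_norm_triangle[of "z - w" "w - c"] sup_norm_triangle[of "w - z" "z - c"]
  sup_norm_le_norm[of "z - w"] sup_norm_commute[of z w]
 by (simp add: dist_norm abs_le_iff)

lemma sup_norm_0: "sup_norm 0 = 0" by (simp add: sup_norm_def)

lemma sup_norm_eq_0: "sup_norm z = 0 \<longleftrightarrow> z = 0"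
 using norm_le_sup_norm[of z] by (auto simp: sup_norm_0)

lemma continuous_sup_norm [continuous_intros]:
 "continuous_on A f ==> continuous_on A (%z. sup_norm (f z))"
 unfolding sup_norm_def by (intro continuous_intros)

text \<open>The boundary of the square with centre \<open>c\<close> and half-side \<open>s\<close>, run through twice with
 unit speed for \<open>-s <= t <= 15 * s\<close>; two turns make every proper arc of it a subpath.\<close>

definition ramp :: "real => real => real => real" where
 "ramp s a t = max 0 (min (t - a) (2 * s))"

text \<open>A \<open>ramp\<close> starting at time \<open>a\<close> is one side of length
  \<open>2 * s\<close> run at unit speed. Horizontal sides start at the times \<open>s\<close>,
  \<open>5 * s\<close>, \<open>9 * s\<close>, \<open>13 * s\<close>, vertical ones at
  \<open>-s\<close>, \<open>3 * s\<close>, \<open>7 * s\<close>, \<open>11 * s\<close>; the signs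
  alternate because opposite sides are run in opposite directions.\<close>

definition square_x :: "real => real => real" where
 "square_x s t = s - ramp s s t + ramp s (5 * s) t - ramp s (9 * s) t + ramp s (13 * s) t"

definition square_y :: "real => real => real" where
 "square_y s t = ramp s (- s) t - s - ramp s (3 * s) t + ramp s (7 * s) t - ramp s (11 * s) t"

definition square_loop :: "complex => real => real => complex" where
 "square_loop c s t = c + Complex (square_x s t) (square_y s t)"

lemma square_side:
 assumes "s > 0"
 shows "t \<in> {-s..s} ==> square_x s t = s & square_y s t = t"
  "t \<in> {s..3 * s} ==> square_x s t = 2 * s - t & square_y s t = s"
  "t \<in> {3 * s..5 * s} ==> square_x s t = -s & square_y s t = 4 * s - t"
  "t \<in> {5 * s..7 * s} ==> square_x s t = t - 6 * s & square_y s t = -s"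
  "t \<in> {7 * s..9 * s} ==> square_x s t = s & square_y s t = t - 8 * s"
  "t \<in> {9 * s..11 * s} ==> square_x s t = 10 * s - t & square_y s t = s"
  "t \<in> {11 * s..13 * s} ==> square_x s t = -s & square_y s t = 12 * s - t"
  "t \<in> {13 * s..15 * s} ==> square_x s t = t - 14 * s & square_y s t = -s"
 using assms by (simp_all add: square_x_def square_y_def ramp_def)

lemma square_sides_cover:
 fixes s t :: real
 assumes "s > 0" "t \<in> {-s..15 * s}"
 shows "t \<in> {-s..s} | t \<in> {s..3 * s} | t \<in> {3 * s..5 * s} | t \<in> {5 * s..7 * s} \<or>
  t \<in> {7 * s..9 * s} | t \<in> {9 * s..11 * s} | t \<in> {11 * s..13 * s} | t \<in> {13 * s..15 * s}"
 using assms unfolding atLeastAtMost_iff by linarith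

lemma continuous_square_loop [continuous_intros]: "continuous_on A (square_loop c s)"
 unfolding square_loop_def square_x_def square_y_def ramp_def Complex_eq
 by (intro continuous_intros)

lemma sup_norm_square_loop:
 assumes "s > 0" "t \<in> {-s..15 * s}"
 shows "sup_norm (square_loop c s t - c) = s"
 using square_sides_cover[OF assms] square_side[OF assms(1), of t] assms(1)
 by (auto simp: square_loop_def sup_norm_def)

lemma square_loop_period:
 assumes "s > 0" "t \<in> {-s..7 * s}"
 shows "square_loop c s (t + 8 * s) = square_loop c s t"
proof -
 consider (1) "t \<in> {-s..s}" | (2) "t \<in> {s..3 * s}" | (3) "t \<in> {3 * s..5 * s}" | (4) "t \<in> {5 * s..7 * s}"
  using assms unfolding atLeastAtMost_iff by argo
 then show ?thesis
 proof cases
  case 1 then show ?thesis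
   using square_side(1,5)[OF assms(1)] by (simp add: square_loop_def)
 next
  case 2 then show ?thesis
   using square_side(2,6)[OF assms(1)] by (simp add: square_loop_def)
 next
  case 3 then show ?thesis
   using square_side(3,7)[OF assms(1)] by (simp add: square_loop_def)
 next
  case 4 then show ?thesis
   using square_side(4,8)[OF assms(1)] by (simp add: square_loop_def)
 qed
qed

text \<open>The starting time is arbitrary because later a turn of the loop begins at a prescribed
  point of the square.\<close>

lemma square_loop_surj:
 assumes s: "s > 0" and z: "sup_norm (z - c) = s" and t0: "t0 \<in> {-s..7 * s}"
 obtains t where "t \<in> {t0..t0 + 8 * s}" "square_loop c s t = z"
proof -
 define x where "x = Re (z - c)"
 define y where "y = Im (z - c)"
 have zxy: "z = c + Complex x y" by (simp add: x_def y_def complex_eq_iff)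
 have xy: "\<bar>x\<bar> <= s" "\<bar>y\<bar> <= s" "\<bar>x\<bar> = s | \<bar>y\<bar> = s"
  using z by (auto simp: sup_norm_def x_def y_def max_def split: if_splits)
 have "\<exists>t\<in>{-s..7 * s}. square_loop c s t = z"
 proof -
  consider "x = s" | "x = -s" | "y = s" | "y = -s" using xy by linarith
  then show ?thesis
  proof cases
   case 1 then show ?thesis using square_side(1)[OF s, of y] xy s
    by (intro bexI[of _ y]) (auto simp: square_loop_def zxy abs_le_iff)
  next
   case 2 then show ?thesis using square_side(3)[OF s, of "4 * s - y"] xy s
    by (intro bexI[of _ "4 * s - y"]) (auto simp: square_loop_def zxy abs_le_iff)
  next
   case 3 then show ?thesis using square_side(2)[OF s, of "2 * s - x"] xy s
    by (intro bexI[of _ "2 * s - x"]) (auto simp: square_loop_def zxy abs_le_iff)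
  next
   case 4 then show ?thesis using square_side(4)[OF s, of "6 * s + x"] xy s
    by (intro bexI[of _ "6 * s + x"]) (auto simp: square_loop_def zxy abs_le_iff)
  qed
 qed
 then obtain t where t: "t \<in> {-s..7 * s}" "square_loop c s t = z" by blast
 show thesis
 proof (cases "t0 <= t")
  case True then show ?thesis using that[of t] t t0 by auto
 next
  case False then show ?thesis using that[of "t + 8 * s"] t t0 square_loop_period[OF s t(1)] s by auto
 qed
qed

lemma square_loop_inj_base:
 assumes s: "s > 0" and t: "t \<in> {-s..<7 * s}" "t' \<in> {-s..<7 * s}" and eq: "square_loop c s t = square_loop c s t'"
 shows "t = t'"
proof -
 \<comment> \<open>\<open>p\<close> recovers the time from the coordinates. Each corner is assigned
   to the side that starts there, which matches half-open time intervals.\<close>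
 define p where "p x y = (if x = s & y < s then y else if y = s & x > -s then 2 * s - x
  else if x = -s & y > -s then 4 * s - y else 6 * s + x)" for x y
 have p: "p (square_x s u) (square_y s u) = u" if "u \<in> {-s..<7 * s}" for u
 proof -
  have "u \<in> {-s..<s} | u \<in> {s..<3 * s} | u \<in> {3 * s..<5 * s} | u \<in> {5 * s..<7 * s}"
   using that unfolding atLeastLessThan_iff by linarith
  then show ?thesis
   by (elim disjE) (use square_side[OF s, of u] s in \<open>auto simp: p_def\<close>)
 qed
 have "square_x s t = square_x s t'" "square_y s t = square_y s t'"
  using eq by (simp_all add: square_loop_def)
 then have "p (square_x s t) (square_y s t) = p (square_x s t') (square_y s t')" by (simp only:)
 then show ?thesis by (simp only: p[OF t(1)] p[OF t(2)])
qed

lemma square_loop_inj: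
 assumes s: "s > 0" and t: "t \<in> {-s..<15 * s}" "t' \<in> {-s..<15 * s}" and d: "\<bar>t - t'\<bar> < 8 * s"
  and eq: "square_loop c s t = square_loop c s t'"
 shows "t = t'"
proof -
 define r where "r u = (if u < 7 * s then u else u - 8 * s)" for u
 have r: "r u \<in> {-s..<7 * s}" "square_loop c s (r u) = square_loop c s u" if "u \<in> {-s..<15 * s}" for u
  using that square_loop_period[OF s, of "u - 8 * s" c] s by (auto simp: r_def)
 have "r t = r t'"
  using square_loop_inj_base[OF s r(1)[OF t(1)] r(1)[OF t(2)], of c] r(2)[OF t(1)] r(2)[OF t(2)] eq by simp
 then show ?thesis using d by (auto simp: r_def split: if_splits)
qed

lemma dist_square_side:
 assumes s: "s > 0" and k: "k < (8::nat)"
  and ab: "a <= b" "a \<in> {(2 * real k - 1) * s..(2 * real k + 1) * s}" "b \<in> {(2 * real k - 1) * s..(2 * real k + 1) * s}"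
 shows "dist (square_loop c s a) (square_loop c s b) = b - a"
proof -
 have "k = 0 | k = 1 | k = 2 | k = 3 | k = 4 | k = 5 | k = 6 | k = 7" using k by linarith
 then show ?thesis
 proof (elim disjE)
  assume "k = 0" then show ?thesis
   using ab square_side(1)[OF s, of a] square_side(1)[OF s, of b] by (simp add: square_loop_def dist_norm cmod_def)
 next
  assume "k = 1" then show ?thesis
   using ab square_side(2)[OF s, of a] square_side(2)[OF s, of b] by (simp add: square_loop_def dist_norm cmod_def)
 next
  assume "k = 2" then show ?thesis
   using ab square_side(3)[OF s, of a] square_side(3)[OF s, of b] by (simp add: square_loop_def dist_norm cmod_def)
 next
  assume "k = 3" then show ?thesis
   using ab square_side(4)[OF s, of a] square_side(4)[OF s, of b] by (simp add: square_loop_def dist_norm cmod_def)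
 next
  assume "k = 4" then show ?thesis
   using ab square_side(5)[OF s, of a] square_side(5)[OF s, of b] by (simp add: square_loop_def dist_norm cmod_def)
 next
  assume "k = 5" then show ?thesis
   using ab square_side(6)[OF s, of a] square_side(6)[OF s, of b] by (simp add: square_loop_def dist_norm cmod_def)
 next
  assume "k = 6" then show ?thesis
   using ab square_side(7)[OF s, of a] square_side(7)[OF s, of b] by (simp add: square_loop_def dist_norm cmod_def)
 next
  assume "k = 7" then show ?thesis
   using ab square_side(8)[OF s, of a] square_side(8)[OF s, of b] by (simp add: square_loop_def dist_norm cmod_def)
 qed
qed

text \<open>Induction over the number of sides available, splitting at the last corner. The lower
  bound for the length comes from superadditivity, and the distance bound later gives the matching
  upper bound for partitions.\<close>

lemma square_loop_length_aux:
 assumes s: "s > 0" and "n <= (8::nat)" "a <= b" "-s <= a" "b <= (2 * real n - 1) * s"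
 shows "dist (square_loop c s a) (square_loop c s b) <= b - a &
  ennreal (b - a) <= curve_length (square_loop c s) {a..b}"
 using assms(2-)
proof (induction n arbitrary: a b)
 case 0
 then have "a = b" by simp
 then show ?case by simp
next
 case (Suc n)
 let ?m = "(2 * real n - 1) * s" and ?f = "square_loop c s"
 have side: "dist (?f a) (?f b) <= b - a & ennreal (b - a) <= curve_length ?f {a..b}"
  if "a <= b" "a \<in> {(2 * real n - 1) * s..(2 * real n + 1) * s}" "b \<in> {(2 * real n - 1) * s..(2 * real n + 1) * s}" for a b
  using dist_square_side[OF s _ that, of c] dist_le_curve_length[of a b "{a..b}" ?f] Suc.prems(1) that by auto
 have b: "b <= (2 * real n + 1) * s" using Suc.prems by (simp add: algebra_simps)
 consider "b <= ?m" | "?m <= a" | "a <= ?m" "?m <= b" by linarith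
 then show ?case
 proof cases
  case 1
  then show ?thesis using Suc by auto
 next
  case 2
  then show ?thesis using side[of a b] Suc.prems b by auto
 next
  case 3
  have 1: "dist (?f a) (?f ?m) <= ?m - a & ennreal (?m - a) <= curve_length ?f {a..?m}"
   using Suc.IH[of a ?m] Suc.prems 3 by auto
  have 2: "dist (?f ?m) (?f b) <= b - ?m & ennreal (b - ?m) <= curve_length ?f {?m..b}"
   using side[of ?m b] 3 b s by (auto simp: algebra_simps)
  have "ennreal (b - a) = ennreal (?m - a) + ennreal (b - ?m)"
   using 3 by (simp add: ennreal_plus[symmetric] del: ennreal_plus)
  also have "... <= curve_length ?f {a..?m} + curve_length ?f {?m..b}"
   using 1 2 by (intro add_mono) auto
  also have "... <= curve_length ?f {a..b}" by (rule curve_length_superadd[OF 3])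
  finally show ?thesis using 1 2 dist_triangle[of "?f a" "?f b" "?f ?m"] by linarith
 qed
qed

lemma square_loop_lipschitz:
 assumes "s > 0" "a \<in> {-s..15 * s}" "b \<in> {-s..15 * s}"
 shows "dist (square_loop c s a) (square_loop c s b) <= \<bar>a - b\<bar>"
 using square_loop_length_aux[of s 8 a b c] square_loop_length_aux[of s 8 b a c] assms
 by (cases "a <= b") (auto simp: dist_commute)

lemma square_loop_length:
 assumes s: "s > 0" and ab: "a <= b" "{a..b} \<subseteq> {-s..15 * s}"
 shows "curve_length (square_loop c s) {a..b} = ennreal (b - a)"
proof (rule antisym)
 show "ennreal (b - a) <= curve_length (square_loop c s) {a..b}"
  using square_loop_length_aux[of s 8 a b c] assms by auto
 have "(\<Sum>i<n. ennreal (dist (square_loop c s (t i)) (square_loop c s (t (Suc i))))) <= ennreal (b - a)"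
  if t: "mono t" "range t \<subseteq> {a..b}" for n :: nat and t
 proof -
  have "(\<Sum>i<n. dist (square_loop c s (t i)) (square_loop c s (t (Suc i)))) <= (\<Sum>i<n. t (Suc i) - t i)"
  proof (rule sum_mono)
   fix i
   have "t i \<in> {a..b}" "t (Suc i) \<in> {a..b}" using t by blast+
   moreover have "t i <= t (Suc i)" using t by (simp add: mono_def)
   ultimately show "dist (square_loop c s (t i)) (square_loop c s (t (Suc i))) <= t (Suc i) - t i"
    using square_loop_lipschitz[OF s, of "t i" "t (Suc i)" c] ab by auto
  qed
  also have "... = t n - t 0" by (rule sum_lessThan_telescope)
  also have "... <= b - a"
  proof -
   have "t n \<in> {a..b}" "t 0 \<in> {a..b}" using t by blast+
   then show ?thesis by auto
  qed
  finally show ?thesis by (simp add: ennreal_leI)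
 qed
 then show "curve_length (square_loop c s) {a..b} <= ennreal (b - a)"
  unfolding curve_length_def by (intro SUP_least) auto
qed

section \<open>Integration over squares\<close>

lemma lborel_complex_eq:
 "(lborel :: complex measure) = distr (lborel \<Otimes>\<^sub>M lborel) borel (%(x, y). Complex x y)"
proof (rule lborel_eqI)
 have meas: "(%(x, y). Complex x y) \<in> borel_measurable (lborel \<Otimes>\<^sub>M lborel)"
  unfolding Complex_eq by measurable
 fix l u :: complex assume lu: "!!b. b \<in> Basis ==> l \<bullet> b <= u \<bullet> b"
 then have le: "Re l <= Re u" "Im l <= Im u" using lu[of 1] lu[of \<i>] by (auto simp: Basis_complex_def inner_complex_def)
 have box: "box l u = {z. Re l < Re z & Re z < Re u & Im l < Im z & Im z < Im u}"
  by (auto simp: box_def Basis_complex_def inner_complex_def)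
 have "(%(x, y). Complex x y) -` box l u Int space (lborel \<Otimes>\<^sub>M lborel) = {Re l<..<Re u} \<times> {Im l<..<Im u}"
  by (auto simp: box space_pair_measure)
 then have "emeasure (distr (lborel \<Otimes>\<^sub>M lborel) borel (%(x, y). Complex x y)) (box l u) =
   emeasure (lborel \<Otimes>\<^sub>M lborel) ({Re l<..<Re u} \<times> {Im l<..<Im u})"
  using meas by (subst emeasure_distr) auto
 also have "... = ennreal ((Re u - Re l) * (Im u - Im l))"
  using le by (subst lborel.emeasure_pair_measure_Times) (auto simp: ennreal_mult)
 also have "(Re u - Re l) * (Im u - Im l) = (\<Prod>b\<in>Basis. (u - l) \<bullet> b)"
  by (simp add: Basis_complex_def inner_complex_def complex_eq_iff)
 finally show "emeasure (distr (lborel \<Otimes>\<^sub>M lborel) borel (%(x, y). Complex x y)) (box l u) =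
   ennreal (\<Prod>b\<in>Basis. (u - l) \<bullet> b)" .
qed simp

lemma
 fixes l :: "complex => ennreal"
 assumes l: "l \<in> borel_measurable borel"
 shows nn_integral_complex: "(\<integral>\<^sup>+z. l z \<partial>lborel) = (\<integral>\<^sup>+x. \<integral>\<^sup>+y. l (Complex x y) \<partial>lborel \<partial>lborel)"
  and nn_integral_complex': "(\<integral>\<^sup>+z. l z \<partial>lborel) = (\<integral>\<^sup>+y. \<integral>\<^sup>+x. l (Complex x y) \<partial>lborel \<partial>lborel)"
  and nn_integral_complex_meas: "(%x. \<integral>\<^sup>+y. l (Complex x y) \<partial>lborel) \<in> borel_measurable borel"
  and nn_integral_complex_meas': "(%y. \<integral>\<^sup>+x. l (Complex x y) \<partial>lborel) \<in> borel_measurable borel"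
proof -
 have meas: "(%(x, y). Complex x y) \<in> borel_measurable (lborel \<Otimes>\<^sub>M lborel)"
  unfolding Complex_eq by measurable
 then have m2: "(%p. l (Complex (fst p) (snd p))) \<in> borel_measurable (lborel \<Otimes>\<^sub>M lborel)"
  using measurable_compose[OF meas l] by (simp add: split_beta)
 have "(%(y, x). Complex x y) \<in> borel_measurable (lborel \<Otimes>\<^sub>M lborel)"
  unfolding Complex_eq by measurable
 then have m3: "(%(y, x). l (Complex x y)) \<in> borel_measurable (lborel \<Otimes>\<^sub>M lborel)"
  using measurable_compose[OF _ l] by (simp add: split_beta')
 have "(\<integral>\<^sup>+z. l z \<partial>lborel) = (\<integral>\<^sup>+p. l (Complex (fst p) (snd p)) \<partial>(lborel \<Otimes>\<^sub>M lborel))"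
  using meas l by (subst lborel_complex_eq, subst nn_integral_distr) (auto simp: split_beta)
 then show "(\<integral>\<^sup>+z. l z \<partial>lborel) = (\<integral>\<^sup>+x. \<integral>\<^sup>+y. l (Complex x y) \<partial>lborel \<partial>lborel)"
  "(\<integral>\<^sup>+z. l z \<partial>lborel) = (\<integral>\<^sup>+y. \<integral>\<^sup>+x. l (Complex x y) \<partial>lborel \<partial>lborel)"
  using lborel.nn_integral_fst[OF m2] lborel_pair.nn_integral_snd[OF m2]
  by (simp_all add: split_beta)
 show "(%x. \<integral>\<^sup>+y. l (Complex x y) \<partial>lborel) \<in> borel_measurable borel"
  using lborel.borel_measurable_nn_integral_fst[OF m2] by simp
 show "(%y. \<integral>\<^sup>+x. l (Complex x y) \<partial>lborel) \<in> borel_measurable borel"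
  using lborel.borel_measurable_nn_integral[OF m3] by simp
qed


text \<open>Each side of the square lies on a coordinate line at distance \<open>s\<close> from
  \<open>c\<close>, and by Fubini's theorem the integral of \<open>l\<close> over almost every such
  line is finite. Two turns make eight sides.\<close>

lemma AE_square_loop_finite:
 fixes l :: "complex => ennreal"
 assumes l: "l \<in> borel_measurable borel" and fin: "(\<integral>\<^sup>+z. l z \<partial>lborel) < \<infinity>"
 shows "AE s in lborel. 0 < s --> (\<integral>\<^sup>+t\<in>{-s..15 * s}. l (square_loop c s t) \<partial>lborel) < \<infinity>"
proof -
 define lc where "lc z = l (c + z)" for z
 have lc: "lc \<in> borel_measurable borel" unfolding lc_def using l by measurable
 have "(\<integral>\<^sup>+z. lc z \<partial>lborel) = (\<integral>\<^sup>+z. l z \<partial>distr lborel borel ((+) c))"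
  unfolding lc_def using l by (subst nn_integral_distr) auto
 then have finc: "(\<integral>\<^sup>+z. lc z \<partial>lborel) ~= \<infinity>" using fin by (simp add: lborel_distr_plus)
 define G1 where "G1 x = (\<integral>\<^sup>+y. lc (Complex x y) \<partial>lborel)" for x
 define G2 where "G2 y = (\<integral>\<^sup>+x. lc (Complex x y) \<partial>lborel)" for y
 have m: "G1 \<in> borel_measurable borel" "G2 \<in> borel_measurable borel"
  unfolding G1_def[abs_def] G2_def[abs_def]
  by (rule nn_integral_complex_meas[OF lc], rule nn_integral_complex_meas'[OF lc])
 have i: "(\<integral>\<^sup>+x. G1 x \<partial>lborel) ~= \<infinity>" "(\<integral>\<^sup>+x. G2 x \<partial>lborel) ~= \<infinity>"
  using finc nn_integral_complex[OF lc] nn_integral_complex'[OF lc] by (simp_all add: G1_def G2_def)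
 \<comment> \<open>The left and the lower side lie on the lines at \<open>-s\<close>, so the
   exceptional sets on the negative axis have to be reflected to sets of radii.\<close>
 have refl: "(\<integral>\<^sup>+x. G (- x) \<partial>lborel) = (\<integral>\<^sup>+x. G x \<partial>lborel)" if "G \<in> borel_measurable borel" for G :: "real => ennreal"
  using nn_integral_real_affine[OF that, of "-1" 0] by simp
 have i': "(\<integral>\<^sup>+x. G1 (- x) \<partial>lborel) ~= \<infinity>" "(\<integral>\<^sup>+x. G2 (- x) \<partial>lborel) ~= \<infinity>"
  using i refl m by simp_all
 have m': "(%x. G1 (- x)) \<in> borel_measurable borel" "(%x. G2 (- x)) \<in> borel_measurable borel"
  using m by measurable
 have ae: "AE s in lborel. G1 s ~= \<infinity> & G2 s ~= \<infinity> & G1 (- s) ~= \<infinity> & G2 (- s) ~= \<infinity>"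
  using nn_integral_PInf_AE[of G1 lborel] nn_integral_PInf_AE[of G2 lborel]
   nn_integral_PInf_AE[of "%x. G1 (- x)" lborel] nn_integral_PInf_AE[of "%x. G2 (- x)" lborel] m m' i i'
  by simp
 show ?thesis
 proof (rule AE_mp[OF ae], rule AE_I2, intro impI)
  fix s :: real assume G: "G1 s ~= \<infinity> & G2 s ~= \<infinity> & G1 (- s) ~= \<infinity> & G2 (- s) ~= \<infinity>" and s: "0 < s"
  let ?I = "%A. \<integral>\<^sup>+t\<in>A. l (square_loop c s t) \<partial>lborel"
  have lcm: "(%y. lc (Complex x y)) \<in> borel_measurable borel" "(%y. lc (Complex y x)) \<in> borel_measurable borel" for x
   unfolding Complex_eq by (rule measurable_compose[OF _ lc], measurable)+
  have shift: "(\<integral>\<^sup>+t. h (a + e * t) \<partial>lborel) = (\<integral>\<^sup>+t. h t \<partial>lborel)"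
   if "h \<in> borel_measurable borel" "\<bar>e\<bar> = 1" for h :: "real => ennreal" and a e
   using nn_integral_real_affine[OF that(1), of e a] that(2) by auto
  have side: "?I A < \<infinity>"
   if eq: "!!t. t \<in> A ==> l (square_loop c s t) = h (a + e * t)"
    and h: "h \<in> borel_measurable borel" "(\<integral>\<^sup>+t. h t \<partial>lborel) ~= \<infinity>" and e: "\<bar>e\<bar> = 1"
   for A and h :: "real => ennreal" and a e :: real
  proof -
   have "?I A <= (\<integral>\<^sup>+t. h (a + e * t) \<partial>lborel)"
    using eq by (intro nn_integral_mono) (auto simp: indicator_def)
   also have "... < \<infinity>" using shift[OF h(1) e] h(2) by (simp add: less_top)
   finally show ?thesis .
  qed
  have eq: "l (square_loop c s t) = lc (Complex (square_x s t) (square_y s t))" for t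
   by (simp add: lc_def square_loop_def)
  note sd = square_side[OF s]
  have fins: "?I {-s..s} < \<infinity>" "?I {s..3 * s} < \<infinity>" "?I {3 * s..5 * s} < \<infinity>" "?I {5 * s..7 * s} < \<infinity>"
   "?I {7 * s..9 * s} < \<infinity>" "?I {9 * s..11 * s} < \<infinity>" "?I {11 * s..13 * s} < \<infinity>" "?I {13 * s..15 * s} < \<infinity>"
   subgoal by (rule side[of _ "%y. lc (Complex s y)" 0 1]) (use sd(1) lcm G in \<open>simp_all add: eq G1_def G2_def\<close>)
   subgoal by (rule side[of _ "%y. lc (Complex y s)" "2 * s" "-1"]) (use sd(2) lcm G in \<open>simp_all add: eq G1_def G2_def\<close>)
   subgoal by (rule side[of _ "%y. lc (Complex (-s) y)" "4 * s" "-1"]) (use sd(3) lcm G in \<open>simp_all add: eq G1_def G2_def\<close>)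
   subgoal by (rule side[of _ "%y. lc (Complex y (-s))" "-(6 * s)" 1]) (use sd(4) lcm G in \<open>simp_all add: eq G1_def G2_def\<close>)
   subgoal by (rule side[of _ "%y. lc (Complex s y)" "-(8 * s)" 1]) (use sd(5) lcm G in \<open>simp_all add: eq G1_def G2_def\<close>)
   subgoal by (rule side[of _ "%y. lc (Complex y s)" "10 * s" "-1"]) (use sd(6) lcm G in \<open>simp_all add: eq G1_def G2_def\<close>)
   subgoal by (rule side[of _ "%y. lc (Complex (-s) y)" "12 * s" "-1"]) (use sd(7) lcm G in \<open>simp_all add: eq G1_def G2_def\<close>)
   subgoal by (rule side[of _ "%y. lc (Complex y (-s))" "-(14 * s)" 1]) (use sd(8) lcm G in \<open>simp_all add: eq G1_def G2_def\<close>)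
   done
  have lm: "(%t. l (square_loop c s t)) \<in> borel_measurable borel"
   by (rule measurable_compose[OF borel_measurable_continuous_onI l]) (rule continuous_square_loop)
  have split: "?I (A Un B) < \<infinity>" if "?I A < \<infinity>" "?I B < \<infinity>" "A \<in> sets borel" "B \<in> sets borel" for A B
  proof -
   have "?I (A Un B) <= (\<integral>\<^sup>+t. l (square_loop c s t) * indicator A t + l (square_loop c s t) * indicator B t \<partial>lborel)"
    by (intro nn_integral_mono) (auto simp: indicator_def)
   also have "... = ?I A + ?I B" using that lm by (intro nn_integral_add) auto
   also have "... < \<infinity>" using that by simp
   finally show ?thesis .
  qed
  have "?I ({-s..s} Un ({s..3 * s} Un ({3 * s..5 * s} Un ({5 * s..7 * s} \<union>
   ({7 * s..9 * s} Un ({9 * s..11 * s} Un ({11 * s..13 * s} Un {13 * s..15 * s}))))))) < \<infinity>"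
   by (intro split fins) auto
  also have "({-s..s} Un ({s..3 * s} Un ({3 * s..5 * s} Un ({5 * s..7 * s} \<union>
   ({7 * s..9 * s} Un ({9 * s..11 * s} Un ({11 * s..13 * s} Un {13 * s..15 * s}))))))) = {-s..15 * s}"
   using s by auto
  finally show "?I {-s..15 * s} < \<infinity>" .
 qed
qed

lemma sup_norm_ball_measurable: "{z. sup_norm (z - c) <= R} \<in> sets borel"
 by (intro borel_closed closed_Collect_le continuous_intros)

text \<open>On a bounded set square integrable functions are integrable, by
  \<open>x <= 1 + x^2\<close>; the bound \<open>R\<close> on the radii makes the set
  bounded.\<close>

lemma AE_square_loop_square_integrable:
 fixes l :: "complex => ennreal"
 assumes l: "l \<in> borel_measurable borel" and fin: "(\<integral>\<^sup>+z. (l z)^2 \<partial>lborel) < \<infinity>"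
 shows "AE s in lborel. 0 < s & s < R --> (\<integral>\<^sup>+t\<in>{-s..15 * s}. l (square_loop c s t) \<partial>lborel) < \<infinity>"
proof -
 define B where "B = {z. sup_norm (z - c) <= R}"
 define k where "k z = l z * indicator B z" for z
 have B: "B \<in> sets borel" unfolding B_def by (rule sup_norm_ball_measurable)
 have k: "k \<in> borel_measurable borel" unfolding k_def using l B by measurable
 have "B \<subseteq> cball c (2 * R)"
 proof
  fix z assume "z \<in> B"
  then show "z \<in> cball c (2 * R)"
   using norm_le_sup_norm[of "z - c"] by (simp add: B_def dist_norm norm_minus_commute)
 qed
 then have Bfin: "emeasure lborel B < \<infinity>"
  using emeasure_bounded_finite[of B] bounded_cball bounded_subset by blast
 have le: "x <= 1 + x^2" for x :: ennreal
 proof (cases x)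
  case (real r)
  have "r <= 1 + r^2" using sum_squares_ge_zero[of "r - 1" 0] real(1) by (simp add: power2_eq_square algebra_simps)
  then have "ennreal r <= ennreal (1 + r^2)" by (rule ennreal_leI)
  then show ?thesis using real by (simp add: ennreal_plus ennreal_power)
 qed (simp add: power2_eq_square ennreal_top_mult)
 have "(\<integral>\<^sup>+z. k z \<partial>lborel) <= (\<integral>\<^sup>+z. indicator B z + (l z)^2 \<partial>lborel)"
  using le by (intro nn_integral_mono) (auto simp: k_def indicator_def)
 also have "... = emeasure lborel B + (\<integral>\<^sup>+z. (l z)^2 \<partial>lborel)"
  using l B by (subst nn_integral_add) auto
 also have "... < \<infinity>" using Bfin fin by simp
 finally have "AE s in lborel. 0 < s --> (\<integral>\<^sup>+t\<in>{-s..15 * s}. k (square_loop c s t) \<partial>lborel) < \<infinity>"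
  by (rule AE_square_loop_finite[OF k])
 then show ?thesis
 proof (rule AE_mp, intro AE_I2 impI)
  fix s assume *: "0 < s --> (\<integral>\<^sup>+t\<in>{-s..15 * s}. k (square_loop c s t) \<partial>lborel) < \<infinity>" "0 < s & s < R"
  have "(\<integral>\<^sup>+t\<in>{-s..15 * s}. l (square_loop c s t) \<partial>lborel) = (\<integral>\<^sup>+t\<in>{-s..15 * s}. k (square_loop c s t) \<partial>lborel)"
   using * sup_norm_square_loop[of s _ c]
   by (intro nn_integral_cong) (auto simp: k_def B_def indicator_def)
  then show "(\<integral>\<^sup>+t\<in>{-s..15 * s}. l (square_loop c s t) \<partial>lborel) < \<infinity>" using * by simp
 qed
qed

lemma is_cpath_square_loop:
 assumes "is_interval J" "J ~= {}" "bounded J"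
 shows "is_cpath (J, square_loop c s)"
 using assms continuous_square_loop by (auto simp: is_cpath_def)

section \<open>Peripheral disks\<close>

lemma content_ball_complex: "r >= 0 ==> measure lborel (ball (z::complex) r) = unit_ball_vol 2 * r^2"
 using content_ball[of r z] by (simp add: content_ball)

lemma unit_ball_vol_2_pos: "unit_ball_vol 2 > 0"
 using unit_ball_vol_pos[of 2] by simp

lemma compact_tube:
 fixes K :: "complex set"
 assumes "compact K"
 shows "compact {z. \<exists>x\<in>K. dist x z <= d}"
proof -
 have "{z. \<exists>x\<in>K. dist x z <= d} = {x + y |x y. x \<in> K & y \<in> cball 0 d}"
 proof (intro equalityI subsetI)
  fix z assume "z \<in> {z. \<exists>x\<in>K. dist x z <= d}"
  then obtain x where "x \<in> K" "dist x z <= d" by blast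
  then have "z = x + (z - x)" "z - x \<in> cball 0 d" by (auto simp: dist_norm norm_minus_commute)
  then show "z \<in> {x + y |x y. x \<in> K & y \<in> cball 0 d}" using \<open>x \<in> K\<close> by blast
 next
  fix z assume "z \<in> {x + y |x y. x \<in> K & y \<in> cball 0 d}"
  then obtain x y where "z = x + y" "x \<in> K" "norm y <= d" by auto
  then show "z \<in> {z. \<exists>x\<in>K. dist x z <= d}" by (auto simp: dist_norm intro!: bexI[of _ x])
 qed
 also have "compact ..." by (intro compact_sums assms compact_cball)
 finally show ?thesis .
qed

locale sierpinski_carpet =
 fixes Om :: "complex set" and Q :: "nat => complex set" and v :: version
 assumes carpet: "relative_sierpinski_carpet Om Q"
begin

abbreviation "S \<equiv> carpet Om Q"
abbreviation "FQ i \<equiv> frontier (Q i)"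
abbreviation "CQ i \<equiv> closure (Q i)"
abbreviation "dQ i \<equiv> diameter (Q i)"
abbreviation "hQ A \<equiv> hits Q A"
abbreviation "cc V \<equiv> compactly_contained V Om"

lemma open_Omega: "open Om" and connected_Omega: "connected Om"
 using carpet by (auto simp: relative_sierpinski_carpet_def)

lemma jordan: "open_jordan_region (Q i)"
 using carpet by (auto simp: relative_sierpinski_carpet_def)

lemma jordan_curve:
 obtains c where "simple_path c" "pathfinish c = pathstart c" "Q i = inside (path_image c)"
  "FQ i = path_image c" "- CQ i = outside (path_image c)"
  "connected (outside (path_image c))" "\<not> bounded (outside (path_image c))"
  "frontier (outside (path_image c)) = path_image c"
proof -
 obtain c where c: "simple_path c" "pathfinish c = pathstart c" "Q i = inside (path_image c)"
  using jordan[of i] by (auto simp: open_jordan_region_def)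
 note J = Jordan_inside_outside[OF c(1,2)]
 have "CQ i = inside (path_image c) Un path_image c"
  using J closure_Un_frontier[of "Q i"] by (auto simp: c(3))
 then have "- CQ i = outside (path_image c)"
  using J by (auto simp: outside_inside)
 then show thesis using that[of c] c J by simp
qed

lemma Q_open: "open (Q i)" and Q_connected: "connected (Q i)" and Q_nonempty: "Q i ~= {}"
 and Q_bounded: "bounded (Q i)"
proof -
 obtain c where c: "simple_path c" "pathfinish c = pathstart c" "Q i = inside (path_image c)"
  using jordan[of i] by (auto simp: open_jordan_region_def)
 then show "open (Q i)" "connected (Q i)" "Q i ~= {}" "bounded (Q i)"
  using Jordan_inside_outside[OF c(1,2)] by auto
qed

lemma closure_Q_subset: "CQ i \<subseteq> Om" and compact_closure_Q: "compact (CQ i)"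
 using carpet by (auto simp: relative_sierpinski_carpet_def compactly_contained_def)

lemma closure_Q_disjoint: "i ~= j ==> CQ i Int CQ j = {}"
 using carpet by (auto simp: relative_sierpinski_carpet_def disjoint_family_on_def)

lemma Q_disjoint: "i ~= j ==> Q i Int Q j = {}"
 using closure_Q_disjoint closure_subset by blast

lemma FQ_CQ: "FQ i \<subseteq> CQ i"
 by (simp add: frontier_def)

lemma frontier_Q_Int: "FQ i Int Q i = {}"
 using Q_open[of i] by (auto simp: frontier_def interior_open)

lemma closure_Q_eq: "CQ i = Q i Un FQ i"
 using closure_Un_frontier by blast

lemma frontier_Q_nonempty: "FQ i ~= {}"
 by (metis jordan_curve path_image_nonempty)

lemma compact_frontier_Q: "compact (FQ i)"
 using Q_bounded compact_frontier_bounded by blast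

lemma FQ_S: "FQ i \<subseteq> S"
proof
 fix x assume x: "x \<in> FQ i"
 have "x \<notin> Q j" for j
 proof (cases "j = i")
  case False
  then show ?thesis using closure_Q_disjoint[OF False] x FQ_CQ closure_subset by blast
 qed (use x frontier_Q_Int in blast)
 moreover have "x \<in> Om" using x FQ_CQ closure_Q_subset by blast
 ultimately show "x \<in> S" by (simp add: carpet_def)
qed

lemma S_subset: "S \<subseteq> Om" by (auto simp: carpet_def)

lemma S_not_Q: "x \<in> S ==> x \<notin> Q i" by (auto simp: carpet_def)

lemma Omega_cases: "x \<in> Om ==> x \<in> S | (\<exists>i. x \<in> Q i)" by (auto simp: carpet_def)

lemma S_closure_Q: "x \<in> S ==> x \<in> CQ i ==> x \<in> FQ i"
 using S_not_Q closure_Q_eq by blast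

lemma frontier_unique: "x \<in> CQ i ==> x \<in> CQ j ==> i = j"
 using closure_Q_disjoint by blast

lemma S_measurable: "S \<in> sets borel" "emeasure lborel S = 0"
 using carpet Q_open open_Omega by (auto simp: carpet_def relative_sierpinski_carpet_def)

lemma ball_hits_disk:
 assumes "x \<in> Om" "r > 0"
 obtains i where "i \<in> hQ (ball x r)"
proof -
 have "\<exists>i. Q i Int ball x r ~= {}"
 proof (rule ccontr)
  assume *: "\<not> ?thesis"
  then have "ball x r Int Om \<subseteq> S" by (auto simp: carpet_def)
  then have "ball x r Int Om \<subseteq> interior S" by (intro interior_maximal open_Int open_ball open_Omega)
  moreover have "interior S = {}" using carpet by (simp add: relative_sierpinski_carpet_def)
  moreover have "x \<in> ball x r Int Om" using assms by simp
  ultimately show False by blast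
 qed
 then show thesis using that by (auto simp: hits_def)
qed

lemma diameter_Q_pos: "0 < dQ i"
proof -
 obtain x where x: "x \<in> Q i" using Q_nonempty by blast
 then obtain e where e: "e > 0" "ball x e \<subseteq> Q i" using Q_open open_contains_ball by blast
 define y where "y = x + of_real (e/2)"
 have "y \<in> Q i" using e by (intro subsetD[OF e(2)]) (auto simp: y_def dist_norm)
 then have "dist x y <= dQ i" using diameter_bounded_bound[OF Q_bounded x] by blast
 moreover have "dist x y > 0" using e by (auto simp: y_def dist_norm)
 ultimately show ?thesis by linarith
qed

lemma dist_le_diameter_Q:
 assumes "x \<in> CQ i" "y \<in> CQ i" shows "dist x y <= dQ i"
 using diameter_bounded_bound[of "CQ i" x y] assms compact_closure_Q compact_imp_bounded
  diameter_closure[OF Q_bounded] by auto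

text \<open>Fatness gives every disk near \<open>z\<close> a piece of \<open>ball z (2 * r)\<close>
  of area comparable to the square of \<open>min (dQ i) r\<close>, and these pieces are disjoint.
  That the constant is independent of \<open>z\<close> and \<open>r\<close> is what the length-area
  method rests on.\<close>

lemma sum_min_diameter:
 obtains C where "C > 0"
  "!!z r F. r > 0 ==> finite F ==> F \<subseteq> hQ (ball z r) ==>
   (\<Sum>i\<in>F. (min (dQ i) r)^2) <= C * r^2"
proof -
 obtain K1 where K1: "K1 > 0" "!!i x r. x \<in> Q i ==> 0 < r ==> r < dQ i ==>
    emeasure lborel (ball x r Int Q i) >= ennreal (K1 * r^2)"
  using carpet unfolding relative_sierpinski_carpet_def by blast
 \<comment> \<open>One factor 4 comes from halving the radius in \<open>m\<close>, which makes it
   smaller than the diameter as fatness requires, the other from the doubled ball.\<close>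
 define C where "C = 16 * unit_ball_vol 2 / K1"
 have main: "(\<Sum>i\<in>F. (min (dQ i) r)^2) <= C * r^2"
  if r: "r > 0" and F: "finite F" "F \<subseteq> hQ (ball z r)" for z r F
 proof -
  define m where "m i = min (dQ i) r / 2" for i
  have m: "m i > 0" "m i < dQ i" "m i < r" for i
   using diameter_Q_pos[of i] r by (auto simp: m_def min_def)
  have fin: "emeasure lborel (A Int ball z (2 * r)) ~= \<infinity>" for A :: "complex set"
   using emeasure_bounded_finite[of "A Int ball z (2*r)"] by (simp add: bounded_Int)
  have area: "K1 * (m i)^2 <= measure lborel (Q i Int ball z (2 * r))" if i: "i \<in> F" for i
  proof -
   obtain x where x: "x \<in> Q i" "x \<in> ball z r" using i F by (auto simp: hits_def disjoint_iff)
   have "ball x (m i) \<subseteq> ball z (2 * r)"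
   proof
    fix y assume "y \<in> ball x (m i)"
    then show "y \<in> ball z (2 * r)" using x(2) m(3)[of i] dist_triangle[of z y x] by auto
   qed
   then have "ball x (m i) Int Q i \<subseteq> Q i Int ball z (2 * r)" by blast
   then have "ennreal (K1 * (m i)^2) <= emeasure lborel (Q i Int ball z (2 * r))"
    using order_trans[OF K1(2)[OF x(1) m(1,2)] emeasure_mono] Q_open by auto
   then show ?thesis using fin[of "Q i"] K1(1) by (simp add: emeasure_eq_ennreal_measure)
  qed
  have "(\<Sum>i\<in>F. K1 * (m i)^2) <= (\<Sum>i\<in>F. measure lborel (Q i Int ball z (2 * r)))"
   by (intro sum_mono area)
  also have "... = measure lborel (\<Union>i\<in>F. Q i Int ball z (2 * r))"
  proof (intro measure_finite_Union[symmetric])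
   show "disjoint_family_on (%i. Q i Int ball z (2 * r)) F"
    unfolding disjoint_family_on_def using Q_disjoint by blast
  qed (use F(1) Q_open fin in auto)
  also have "... <= measure lborel (ball z (2 * r))"
   using Q_open emeasure_bounded_finite[of "ball z (2*r)"] by (intro measure_mono_fmeasurable) (auto simp: fmeasurable_def)
  also have "... = unit_ball_vol 2 * (2 * r)^2"
   using r by (intro content_ball_complex) auto
  finally have "K1 * (\<Sum>i\<in>F. (m i)^2) <= unit_ball_vol 2 * (2 * r)^2"
   by (simp add: sum_distrib_left)
  moreover have "(\<Sum>i\<in>F. (min (dQ i) r)^2) = 4 * (\<Sum>i\<in>F. (m i)^2)"
   by (simp add: sum_distrib_left m_def power_divide)
  ultimately show ?thesis using K1(1) by (simp add: C_def field_simps)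
 qed
 have "C > 0" using K1 unit_ball_vol_2_pos by (simp add: C_def)
 then show thesis using main by (rule that)
qed

text \<open>Each such disk contributes at least \<open>d^2\<close> to the bounded sum in
  \<open>sum_min_diameter\<close>.\<close>

lemma finite_large_disks:
 assumes V: "bounded V" and d: "d > 0"
 shows "finite {i \<in> hQ V. d <= dQ i}"
proof -
 obtain C where C: "C > 0" "!!z r F. r > 0 ==> finite F ==> F \<subseteq> hQ (ball z r) ==>
   (\<Sum>i\<in>F. (min (dQ i) r)^2) <= C * r^2"
  using sum_min_diameter by blast
 obtain r0 where r0: "r0 > 0" "V \<subseteq> ball 0 r0" using V bounded_subset_ballD by blast
 define r where "r = max r0 d"
 have r: "r > 0" "V \<subseteq> ball 0 r" "d <= r" using r0 by (auto simp: r_def)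
 show ?thesis
 proof (rule ccontr)
  assume inf: "\<not> ?thesis"
  obtain n :: nat where n: "C * r^2 / d^2 < n" using reals_Archimedean2 by blast
  obtain F where F: "finite F" "card F = n" "F \<subseteq> {i \<in> hQ V. d <= dQ i}"
   using infinite_arbitrarily_large[OF inf] by blast
  have "real n * d^2 = (\<Sum>i\<in>F. d^2)" using F by simp
  also have "... <= (\<Sum>i\<in>F. (min (dQ i) r)^2)"
   using F r d by (intro sum_mono power_mono) auto
  also have "... <= C * r^2"
   using F r by (intro C(2)) (auto simp: hits_def)
  finally show False using n d by (simp add: field_simps)
 qed
qed

lemma summable_diameter:
 assumes V: "bounded V"
 shows "(%i. (dQ i)^2) summable_on hQ V"
proof -
 obtain C where C: "C > 0" "!!z r F. r > 0 ==> finite F ==> F \<subseteq> hQ (ball z r) ==>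
   (\<Sum>i\<in>F. (min (dQ i) r)^2) <= C * r^2"
  using sum_min_diameter by blast
 obtain r where r: "r > 0" "V \<subseteq> ball 0 r" using V bounded_subset_ballD by blast
 define L where "L = {i \<in> hQ V. r <= dQ i}"
 have "(%i. (min (dQ i) r)^2) summable_on (hQ V - L)"
  using r by (intro infsum_bounded_finite_sums(1)[of _ _ "C * r^2"] C(2)) (auto simp: hits_def)
 then have "(%i. (dQ i)^2) summable_on (hQ V - L)"
  by (rule summable_on_cong[THEN iffD1, rotated]) (auto simp: L_def min_def)
 moreover have "finite L" unfolding L_def by (rule finite_large_disks[OF V r(1)])
 ultimately have "(%i. (dQ i)^2) summable_on ((hQ V - L) Un L)"
  by (intro summable_on_Un_disjoint) auto
 moreover have "(hQ V - L) Un L = hQ V" by (auto simp: L_def)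
 ultimately show ?thesis by simp
qed

text \<open>Disks meeting \<open>V\<close> may stick out of it. The small ones stay in a compact
  tube around the closure of \<open>V\<close>; the large ones are finitely many, and their closures
  are added to the tube.\<close>

lemma hull_compact:
 assumes "cc V"
 obtains K where "compact K" "K \<subseteq> Om" "closure V \<subseteq> K" "!!i. i \<in> hQ V ==> CQ i \<subseteq> K"
proof -
 have V: "compact (closure V)" "closure V \<subseteq> Om" using assms by (auto simp: compactly_contained_def)
 obtain d where d: "d > 0" "(\<Union>x\<in>closure V. cball x d) \<subseteq> Om"
  using compact_subset_open_imp_cball_epsilon_subset[OF V(1) open_Omega V(2)] by blast
 define N where "N = {z. \<exists>x\<in>closure V. dist x z <= d}"
 have N: "compact N" unfolding N_def by (intro compact_tube V)
 have Nd: "z \<in> N \<longleftrightarrow> (\<exists>x\<in>closure V. dist x z <= d)" for z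
  by (simp add: N_def)
 have bV: "bounded V" using V(1) bounded_closure_image compact_imp_bounded bounded_subset closure_subset by blast
 define F where "F = {i \<in> hQ V. d <= dQ i}"
 have F: "finite F" unfolding F_def by (rule finite_large_disks[OF bV d(1)])
 show thesis
 proof
  show "compact (N Un (\<Union>i\<in>F. CQ i))"
   by (intro compact_Un compact_UN N F compact_closure_Q)
  show "N Un (\<Union>i\<in>F. CQ i) \<subseteq> Om" using d(2) Nd closure_Q_subset by (force simp: mem_cball)
  show "closure V \<subseteq> N Un (\<Union>i\<in>F. CQ i)" using Nd d(1) by (metis Un_iff dist_self less_imp_le subsetI)
  fix i assume i: "i \<in> hQ V"
  show "CQ i \<subseteq> N Un (\<Union>i\<in>F. CQ i)"
  proof (cases "i \<in> F")
   case False
   then have "dQ i < d" using i by (auto simp: F_def)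
   obtain x where x: "x \<in> Q i" "x \<in> V" using i by (auto simp: hits_def)
   have "y \<in> N" if "y \<in> CQ i" for y
    using dist_le_diameter_Q[of x i y] x that \<open>dQ i < d\<close> closure_subset Nd by (meson less_imp_le order_trans subsetD)
   then show ?thesis by blast
  qed blast
 qed
qed

lemma open_neighbourhood:
 assumes "compact K" "K \<subseteq> Om"
 obtains W where "open W" "cc W" "K \<subseteq> W"
proof -
 obtain d where d: "d > 0" "(\<Union>x\<in>K. cball x d) \<subseteq> Om"
  using compact_subset_open_imp_cball_epsilon_subset[OF assms(1) open_Omega assms(2)] by blast
 define N where "N = {z. \<exists>x\<in>K. dist x z <= d}"
 have N: "compact N" unfolding N_def by (intro compact_tube assms)
 have Nd: "z \<in> N \<longleftrightarrow> (\<exists>x\<in>K. dist x z <= d)" for z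
  by (simp add: N_def)
 define W where "W = (\<Union>x\<in>K. ball x d)"
 have "closure W \<subseteq> N"
 proof (rule closure_minimal)
  show "W \<subseteq> N" unfolding W_def N_def by (force intro: less_imp_le)
 qed (rule compact_imp_closed[OF N])
 moreover have "N \<subseteq> Om" using d(2) Nd by force
 moreover have "compact (closure W)" if "closure W \<subseteq> N"
  using compact_Int_closed[OF N closed_closure[of W]] that by (simp add: Int_absorb1)
 ultimately have "cc W"
  by (auto simp: compactly_contained_def)
 moreover have "open W" "K \<subseteq> W" using d(1) by (auto simp: W_def)
 ultimately show thesis using that by blast
qed

lemma compactly_contained_bounded: "cc V ==> bounded V"
 unfolding compactly_contained_def by (meson bounded_subset closure_subset compact_imp_bounded)

lemma hits_mono: "A \<subseteq> B ==> hQ A \<subseteq> hQ B"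
 by (auto simp: hits_def)

text \<open>The Sobolev conditions are stated for balls; finitely many balls cover the closure of
  \<open>V\<close>.\<close>

lemma summable_on_hits_cover:
 fixes h :: "nat => real"
 assumes V: "cc V" and nn: "!!i. 0 <= h i"
  and ball: "!!x r. 0 < r ==> cc (ball x r) ==> h summable_on hQ (ball x r)"
 shows "h summable_on hQ V"
proof -
 have Vc: "compact (closure V)" "closure V \<subseteq> Om" using V by (auto simp: compactly_contained_def)
 obtain d where d: "d > 0" "(\<Union>x\<in>closure V. cball x d) \<subseteq> Om"
  using compact_subset_open_imp_cball_epsilon_subset[OF Vc(1) open_Omega Vc(2)] by blast
 obtain X where X: "finite X" "X \<subseteq> closure V" "closure V \<subseteq> (\<Union>x\<in>X. ball x d)"
  using compactE_image[OF Vc(1), of "closure V" "%x. ball x d"] d(1) by (metis UN_I centre_in_ball open_ball subsetI)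
 have b: "h summable_on hQ (ball x d)" if "x \<in> X" for x
  using that X d by (intro ball) (auto simp: compactly_contained_def closure_ball)
 have "h summable_on (\<Union>x\<in>Y. hQ (ball x d))" if "finite Y" "Y \<subseteq> X" for Y
  using that
 proof (induction Y)
  case (insert x Y)
  let ?A = "hQ (ball x d)" and ?B = "\<Union>x\<in>Y. hQ (ball x d)"
  have "h summable_on (?A Un (?B - ?A))"
   using insert b summable_on_sub[of h ?B "?B - ?A"] nn
   by (intro summable_on_Un_disjoint) auto
  then show ?case by simp
 qed simp
 from this[OF X(1) order_refl] show ?thesis
  by (rule summable_on_sub) (use X closure_subset[of V] nn in \<open>auto simp: hits_def\<close>, blast)
qed

lemma hits_near_avoid:
 assumes "finite F"
 obtains r where "r > 0" "!!i. i \<in> F ==> x \<notin> CQ i ==> i \<notin> hQ (ball x r)"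
proof -
 have "closed (\<Union>i\<in>{i\<in>F. x \<notin> CQ i}. CQ i)" using assms by auto
 then have "open (- (\<Union>i\<in>{i\<in>F. x \<notin> CQ i}. CQ i))" by blast
 then obtain r where r: "r > 0" "ball x r \<subseteq> - (\<Union>i\<in>{i\<in>F. x \<notin> CQ i}. CQ i)"
  unfolding open_contains_ball by blast
 show thesis
 proof (rule that[OF r(1)])
  fix i assume "i \<in> F" "x \<notin> CQ i"
  then have "ball x r Int CQ i = {}" using r(2) by blast
  then show "i \<notin> hQ (ball x r)" using closure_subset by (auto simp: hits_def)
 qed
qed

end

section \<open>Negligible path families\<close>

context sierpinski_carpet begin

text \<open>Families on which an admissible weight need not satisfy its inequality: of vanishing
  2-modulus in the weak version, consisting of paths that meet the carpet in positive length in the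
  strong one. Both notions pass to subfamilies, countable unions and superpaths and contain the
  paths with positive length in the carpet; through these properties the two versions share one
  proof.\<close>

definition excluded :: "cpath set => bool" where
 "excluded Gm \<longleftrightarrow> (case v of Weak => mod2 Gm = 0
  | Strong => \<forall>gm\<in>Gm. hausdorff1 (img gm Int S) ~= 0)"

definition null :: "cpath set => bool" where
 "null Gm \<longleftrightarrow> carpet_modulus v Om Q Gm = 0"

lemma excluded_Weak: "v = Weak ==> excluded Gm \<longleftrightarrow> mod2 Gm = 0"
 unfolding excluded_def by simp

lemma excluded_Strong: "v = Strong ==> excluded Gm \<longleftrightarrow> (\<forall>gm\<in>Gm. hausdorff1 (img gm Int S) ~= 0)"
 unfolding excluded_def by simp

lemma excluded_subset:
 assumes "excluded Gm" "Gm' \<subseteq> Gm" shows "excluded Gm'"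
proof (cases v)
 case Weak
 show ?thesis using assms mod2_null_subset unfolding excluded_Weak[OF Weak] by blast
next
 case Strong
 show ?thesis using assms unfolding excluded_Strong[OF Strong] by blast
qed

lemma excluded_UN:
 fixes Gm :: "nat => cpath set"
 assumes "!!n. excluded (Gm n)" shows "excluded (\<Union>n. Gm n)"
proof (cases v)
 case Weak
 show ?thesis using assms unfolding excluded_Weak[OF Weak] by (rule mod2_null_UN)
next
 case Strong
 show ?thesis using assms unfolding excluded_Strong[OF Strong] by blast
qed

lemma img_subpath: "subpath_of gm' gm ==> img gm' \<subseteq> img gm"
 by (auto simp: subpath_of_def img_def)

lemma excluded_superpaths:
 assumes "excluded Gm" shows "excluded {gm. \<exists>gm'\<in>Gm. subpath_of gm' gm}"
proof (cases v)
 case Weak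
 show ?thesis using assms unfolding excluded_Weak[OF Weak] by (rule mod2_null_superpaths)
next
 case Strong
 have "hausdorff1 (img gm Int S) ~= 0" if "gm' \<in> Gm" "subpath_of gm' gm" for gm' gm
 proof
  assume "hausdorff1 (img gm Int S) = 0"
  then have "hausdorff1 (img gm' Int S) = 0"
   by (rule hausdorff1_null_subset) (use img_subpath[OF that(2)] in blast)
  then show False using assms that unfolding excluded_Strong[OF Strong] by blast
 qed
 then show ?thesis unfolding excluded_Strong[OF Strong] by blast
qed

lemma excluded_hausdorff1: "excluded {gm \<in> cpaths_in Om. hausdorff1 (img gm Int S) ~= 0}"
proof (cases v)
 case Weak
 have "mod2 {gm \<in> cpaths_in Om. hausdorff1 (img gm Int S) ~= 0} = 0"
  by (rule mod2_null_subset[OF mod2_null_hausdorff1[OF S_measurable]]) (auto simp: cpaths_in_def)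
 then show ?thesis unfolding excluded_Weak[OF Weak] .
next
 case Strong
 show ?thesis unfolding excluded_Strong[OF Strong] by blast
qed

text \<open>In the strong version this holds because the carpet has area 0. Hence in both versions
  almost all squares avoid an excluded family.\<close>

lemma excluded_mod2:
 assumes "excluded Gm" shows "mod2 {gm \<in> Gm. is_cpath gm} = 0"
proof (cases v)
 case Weak
 have "mod2 Gm = 0" using assms unfolding excluded_Weak[OF Weak] .
 then show ?thesis by (rule mod2_null_subset) blast
next
 case Strong
 show ?thesis
  using assms unfolding excluded_Strong[OF Strong]
  by (intro mod2_null_subset[OF mod2_null_hausdorff1[OF S_measurable]]) blast
qed

text \<open>In the weak version the exceptional family may be taken to consist of all violating
  paths, since subfamilies of null families are null; this brings both moduli to one form.\<close>

lemma carpet_modulus_eq: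
 "carpet_modulus v Om Q Gm = (INF rh\<in>{rh :: nat => real. (\<forall>i. 0 <= rh i) &
  excluded {gm\<in>Gm. \<not> 1 <= path_sum Q (%i. ereal (rh i)) gm}}. \<Sum>\<^sub>\<infinity>i. ereal ((rh i)^2))"
proof (cases v)
 case Weak
 have "(\<exists>Gm0\<subseteq>Gm. mod2 Gm0 = 0 & (\<forall>gm\<in>Gm - Gm0. 1 <= path_sum Q (%i. ereal (rh i)) gm)) \<longleftrightarrow>
   mod2 {gm\<in>Gm. \<not> 1 <= path_sum Q (%i. ereal (rh i)) gm} = 0" for rh :: "nat => real"
 proof
  assume "\<exists>Gm0\<subseteq>Gm. mod2 Gm0 = 0 & (\<forall>gm\<in>Gm - Gm0. 1 <= path_sum Q (%i. ereal (rh i)) gm)"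
  then obtain Gm0 where Gm0: "mod2 Gm0 = 0" "\<forall>gm\<in>Gm - Gm0. 1 <= path_sum Q (%i. ereal (rh i)) gm" by blast
  show "mod2 {gm\<in>Gm. \<not> 1 <= path_sum Q (%i. ereal (rh i)) gm} = 0"
   by (rule mod2_null_subset[OF Gm0(1)]) (use Gm0(2) in blast)
 qed (intro exI[of _ "{gm\<in>Gm. \<not> 1 <= path_sum Q (%i. ereal (rh i)) gm}"], auto)
 then show ?thesis unfolding excluded_Weak[OF Weak] using Weak by (simp add: weak_modulus_def)
next
 case Strong
 have "(\<forall>gm\<in>Gm. hausdorff1 (img gm Int S) = 0 --> 1 <= path_sum Q (%i. ereal (rh i)) gm) \<longleftrightarrow>
   excluded {gm\<in>Gm. \<not> 1 <= path_sum Q (%i. ereal (rh i)) gm}" for rh :: "nat => real"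
  unfolding excluded_Strong[OF Strong] by blast
 then show ?thesis using Strong by (simp add: strong_modulus_def)
qed

lemma path_sum_ereal_ge_iff:
 assumes "!!i. 0 <= rh i"
 shows "1 <= path_sum Q (%i. ereal (rh i)) gm \<longleftrightarrow>
  (rh summable_on hQ (img gm) --> 1 <= infsum rh (hQ (img gm)))"
 unfolding path_sum_def using assms
 by (cases "rh summable_on hQ (img gm)")
  (simp_all add: infsum_ereal_summable infsum_ereal_top one_ereal_def)

text \<open>The discrete counterpart of Fuglede's criterion: a single square summable weight whose
  sum diverges along the paths of the family, up to an excluded part.\<close>

lemma null_iff:
 "null Gm \<longleftrightarrow> (\<exists>rh::nat => real. (\<forall>i. 0 <= rh i) & (%i. (rh i)^2) summable_on UNIV &
  excluded {gm\<in>Gm. rh summable_on hQ (img gm)})" (is "_ \<longleftrightarrow> ?R")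
proof
 assume "null Gm"
 then have 0: "carpet_modulus v Om Q Gm = 0" by (simp add: null_def)
 let ?c = "%n. real (Suc n)"
 let ?E = "%rh. {gm\<in>Gm. \<not> 1 <= path_sum Q (%i. ereal (rh i)) gm}"
 have "\<exists>rh::nat => real. (\<forall>i. 0 <= rh i) & excluded (?E rh) & (%i. (rh i)^2) summable_on UNIV &
   (\<Sum>\<^sub>\<infinity>i. (rh i)^2) <= (1/2)^n / (?c n)^2" for n
 proof -
  have "carpet_modulus v Om Q Gm < ereal ((1/2)^n / (?c n)^2)" using 0 by simp
  then obtain rh :: "nat => real" where rh: "\<forall>i. 0 <= rh i" "excluded (?E rh)"
    "(\<Sum>\<^sub>\<infinity>i. ereal ((rh i)^2)) < ereal ((1/2)^n / (?c n)^2)"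
   unfolding carpet_modulus_eq INF_less_iff by blast
  then have sm: "(%i. (rh i)^2) summable_on UNIV"
   using infsum_ereal_less_top_iff[of UNIV "%i. (rh i)^2"] less_trans[OF rh(3), of \<infinity>] by simp
  then have "ereal (\<Sum>\<^sub>\<infinity>i. (rh i)^2) < ereal ((1/2)^n / (?c n)^2)"
   using rh(3) infsum_ereal_summable[OF sm] by simp
  then show ?thesis using rh sm by (intro exI[of _ rh]) auto
 qed
 then have "\<exists>rh::nat => nat => real. \<forall>n. (\<forall>i. 0 <= rh n i) & excluded (?E (rh n)) & (%i. (rh n i)^2) summable_on UNIV &
   (\<Sum>\<^sub>\<infinity>i. (rh n i)^2) <= (1/2)^n / (?c n)^2"
  by (intro choice allI)
 then obtain rh :: "nat => nat => real" where rh': "\<forall>n. (\<forall>i. 0 <= rh n i) & excluded (?E (rh n)) & (%i. (rh n i)^2) summable_on UNIV &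
   (\<Sum>\<^sub>\<infinity>i. (rh n i)^2) <= (1/2)^n / (?c n)^2" ..
 have rh: "!!n i. 0 <= rh n i" "!!n. excluded (?E (rh n))"
   "!!n. (%i. (rh n i)^2) summable_on UNIV" "!!n. (\<Sum>\<^sub>\<infinity>i. (rh n i)^2) <= (1/2)^n / (?c n)^2"
  using rh' by simp_all
 define t where "t n i = (?c n * rh n i)^2" for n i
 have tF: "(\<Sum>i\<in>F. t n i) <= (1/2)^n" if "finite F" for n and F :: "nat set"
 proof -
  have "(\<Sum>i\<in>F. (rh n i)^2) <= (1/2)^n / (?c n)^2"
   using sum_le_infsum[OF rh(3) that subset_UNIV] rh(4)[of n] by (meson order_trans zero_le_power2)
  then show ?thesis by (simp add: t_def power_mult_distrib sum_distrib_left[symmetric] field_simps del: of_nat_Suc)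
 qed
 have t0: "t n i >= 0" for n i by (simp add: t_def)
 have ts: "summable (%n. t n i)" for i
  using tF[of "{i}"] t0 by (intro summable_comparison_test[OF _ summable_geometric[of "1/2::real"]]) auto
 \<comment> \<open>This dominates \<open>(n + 1) * rh n\<close> for every \<open>n\<close>, so a
   path with a finite \<open>r\<close>-sum has an \<open>rh n\<close>-sum below 1 for some
   \<open>n\<close>.\<close>
 define r where "r i = sqrt (\<Sum>n. t n i)" for i
 have r2: "(r i)^2 = (\<Sum>n. t n i)" for i
  using suminf_nonneg[OF ts] t0 by (simp add: r_def)
 have r_ge: "?c n * rh n i <= r i" for n i
 proof -
  have "t n i <= (\<Sum>n. t n i)" using sum_le_suminf[OF ts, of "{n}"] t0 by simp
  then show ?thesis unfolding r_def by (intro real_le_rsqrt) (simp add: t_def)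
 qed
 have "(%i. (r i)^2) summable_on UNIV"
 proof (rule infsum_bounded_finite_sums(1))
  fix F :: "nat set" assume F: "finite F"
  have "(\<Sum>i\<in>F. (r i)^2) = (\<Sum>n. \<Sum>i\<in>F. t n i)"
   unfolding r2 by (rule suminf_sum[symmetric]) (rule ts)
  also have "... <= (\<Sum>n. (1/2)^n)"
   using tF[OF F] ts by (intro suminf_le summable_sum) (auto simp: summable_geometric)
  finally show "(\<Sum>i\<in>F. (r i)^2) <= (\<Sum>n. (1/2::real)^n)" .
 qed simp
 moreover have "excluded {gm\<in>Gm. r summable_on hQ (img gm)}"
 proof (rule excluded_subset[OF excluded_UN[of "%n. ?E (rh n)", OF rh(2)]], rule subsetI)
  fix gm assume gm: "gm \<in> {gm\<in>Gm. r summable_on hQ (img gm)}"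
  let ?H = "hQ (img gm)"
  obtain n :: nat where n: "infsum r ?H < n" using reals_Archimedean2 by blast
  have le: "rh n i <= r i / ?c n" for i using r_ge[of n i] by (simp add: field_simps)
  have rs: "(%i. r i / ?c n) summable_on ?H"
   using gm summable_on_cmult_left[of r ?H "1 / ?c n"] by (simp add: divide_inverse)
  have s: "rh n summable_on ?H" by (rule summable_on_le[OF rs]) (use rh(1) le in auto)
  have "infsum (rh n) ?H <= (infsum (%i. r i / ?c n) (?H))"
   by (rule infsum_mono[OF s rs]) (use le in auto)
  also have "... = infsum r ?H / ?c n"
   using infsum_cmult_left'[of r "1 / ?c n" ?H] by (simp add: divide_inverse)
  also have "... < 1" using n by simp
  finally have "\<not> 1 <= path_sum Q (%i. ereal (rh n i)) gm"
   using path_sum_ereal_ge_iff[of "rh n" gm] rh(1) s by simp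
  then show "gm \<in> (\<Union>n. ?E (rh n))" using gm by blast
 qed
 moreover have "0 <= r i" for i using suminf_nonneg[OF ts] t0 by (simp add: r_def)
 ultimately show ?R by blast
next
 assume ?R
 then obtain rh :: "nat => real" where rh: "!!i. 0 <= rh i" "(%i. (rh i)^2) summable_on UNIV"
   "excluded {gm\<in>Gm. rh summable_on hQ (img gm)}" by blast
 define A where "A = (\<Sum>\<^sub>\<infinity>i. (rh i)^2)"
 have A: "A >= 0" unfolding A_def by (intro infsum_nonneg) simp
 have "carpet_modulus v Om Q Gm <= 0"
 proof (rule ereal_le_epsilon2)
   fix e :: real assume e: "e > 0"
   define d where "d = sqrt (e / (A + 1))"
   have d: "d > 0" using e A by (simp add: d_def)
   have dsm: "(%i. (d * rh i)^2) summable_on UNIV"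
    using rh(2) by (simp add: power_mult_distrib summable_on_cmult_right)
   have "carpet_modulus v Om Q Gm <= (\<Sum>\<^sub>\<infinity>i. ereal ((d * rh i)^2))"
    unfolding carpet_modulus_eq
   proof (rule INF_lower, intro CollectI conjI allI)
    show "0 <= d * rh i" for i using d rh(1) by simp
    show "excluded {gm \<in> Gm. \<not> 1 <= path_sum Q (%i. ereal (d * rh i)) gm}"
    proof (rule excluded_subset[OF rh(3)], rule subsetI)
    fix gm assume gm: "gm \<in> {gm \<in> Gm. \<not> 1 <= path_sum Q (%i. ereal (d * rh i)) gm}"
    then have "(%i. d * rh i) summable_on hQ (img gm)"
    using path_sum_ereal_ge_iff[of "%i. d * rh i" gm] d rh(1) by auto
    then show "gm \<in> {gm \<in> Gm. rh summable_on hQ (img gm)}"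
    using gm d summable_on_cmult_right'[of d rh] by auto
    qed
   qed
   also have "... = ereal (d^2 * A)"
    using infsum_ereal_summable[OF dsm] by (simp add: power_mult_distrib infsum_cmult_right' A_def)
   also have "d^2 * A <= e" using e A by (simp add: d_def field_simps)
   finally show "carpet_modulus v Om Q Gm <= 0 + ereal e" by simp
 qed
 moreover have "0 <= carpet_modulus v Om Q Gm"
  unfolding carpet_modulus_eq by (intro INF_greatest infsum_nonneg) simp
 ultimately show "null Gm" by (simp add: null_def)
qed

lemma null_subset:
 assumes "null Gm" "Gm' \<subseteq> Gm" shows "null Gm'"
proof -
 obtain rh :: "nat => real" where rh: "\<forall>i. 0 <= rh i" "(%i. (rh i)^2) summable_on UNIV"
   "excluded {gm\<in>Gm. rh summable_on hQ (img gm)}" using assms(1) unfolding null_iff by blast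
 have "excluded {gm\<in>Gm'. rh summable_on hQ (img gm)}"
  by (rule excluded_subset[OF rh(3)]) (use assms(2) in blast)
 then show ?thesis unfolding null_iff using rh(1,2) by blast
qed

lemma null_excluded:
 assumes "excluded Gm" shows "null Gm"
 unfolding null_iff using assms by (intro exI[of _ "%_. 0"]) auto

lemma null_UN:
 fixes Gm :: "nat => cpath set"
 assumes "!!n. null (Gm n)"
 shows "null (\<Union>n. Gm n)"
proof -
 have "\<exists>rh::nat => nat => real. \<forall>n. (\<forall>i. 0 <= rh n i) & (%i. (rh n i)^2) summable_on UNIV &
   excluded {gm\<in>Gm n. rh n summable_on hQ (img gm)}"
  using assms unfolding null_iff by (intro choice allI)
 then obtain rh :: "nat => nat => real" where rh': "\<forall>n. (\<forall>i. 0 <= rh n i) & (%i. (rh n i)^2) summable_on UNIV &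
   excluded {gm\<in>Gm n. rh n summable_on hQ (img gm)}" ..
 have rh: "!!n i. 0 <= rh n i" "!!n. (%i. (rh n i)^2) summable_on UNIV"
   "!!n. excluded {gm\<in>Gm n. rh n summable_on hQ (img gm)}"
  using rh' by simp_all
 define A where "A n = (\<Sum>\<^sub>\<infinity>i. (rh n i)^2)" for n
 have A: "A n >= 0" for n unfolding A_def by (intro infsum_nonneg) simp
 \<comment> \<open>The factors \<open>w n\<close> make the total of all square sums finite without
   changing which path sums diverge.\<close>
 define w where "w n = (1/2)^n / (A n + 1)" for n
 have w: "w n > 0" for n using A[of n] by (simp add: w_def)
 define t where "t n i = w n * (rh n i)^2" for n i
 have t0: "t n i >= 0" for n i using w[of n] by (simp add: t_def)
 have tF: "(\<Sum>i\<in>F. t n i) <= (1/2)^n" if "finite F" for n and F :: "nat set"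
 proof -
  have "(\<Sum>i\<in>F. (rh n i)^2) <= A n"
   unfolding A_def using sum_le_infsum[OF rh(2) that subset_UNIV] by simp
  then have "(\<Sum>i\<in>F. t n i) <= w n * A n"
   using w[of n] by (simp add: t_def sum_distrib_left[symmetric])
  also have "w n * A n = (1/2)^n * (A n / (A n + 1))" by (simp add: w_def)
  also have "... <= (1/2)^n * 1" using A[of n] by (intro mult_left_mono) (auto simp: divide_le_eq_1)
  finally show ?thesis by simp
 qed
 have ts: "summable (%n. t n i)" for i
  using tF[of "{i}"] t0 by (intro summable_comparison_test[OF _ summable_geometric[of "1/2::real"]]) auto
 define r where "r i = sqrt (\<Sum>n. t n i)" for i
 have r2: "(r i)^2 = (\<Sum>n. t n i)" for i
  using suminf_nonneg[OF ts] t0 by (simp add: r_def)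
 have r0: "0 <= r i" for i using suminf_nonneg[OF ts] t0 by (simp add: r_def)
 have r_ge: "sqrt (w n) * rh n i <= r i" for n i
 proof -
  have "t n i <= (\<Sum>n. t n i)" using sum_le_suminf[OF ts, of "{n}"] t0 by simp
  then show ?thesis unfolding r_def using w[of n] by (intro real_le_rsqrt) (simp add: t_def power_mult_distrib)
 qed
 have "(%i. (r i)^2) summable_on UNIV"
 proof (rule infsum_bounded_finite_sums(1))
  fix F :: "nat set" assume F: "finite F"
  have "(\<Sum>i\<in>F. (r i)^2) = (\<Sum>n. \<Sum>i\<in>F. t n i)"
   unfolding r2 by (rule suminf_sum[symmetric]) (rule ts)
  also have "... <= (\<Sum>n. (1/2)^n)"
   using tF[OF F] ts by (intro suminf_le summable_sum) (auto simp: summable_geometric)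
  finally show "(\<Sum>i\<in>F. (r i)^2) <= (\<Sum>n. (1/2::real)^n)" .
 qed simp
 moreover have "excluded {gm\<in>\<Union>n. Gm n. r summable_on hQ (img gm)}"
 proof (rule excluded_subset[OF excluded_UN[of "%n. {gm\<in>Gm n. rh n summable_on hQ (img gm)}", OF rh(3)]], rule subsetI)
  fix gm assume "gm \<in> {gm\<in>\<Union>n. Gm n. r summable_on hQ (img gm)}"
  then obtain n where n: "gm \<in> Gm n" "r summable_on hQ (img gm)" by blast
  have "(%i. sqrt (w n) * rh n i) summable_on hQ (img gm)"
   by (rule summable_on_le[OF n(2)]) (use r_ge rh(1) w[of n] in auto)
  then have "rh n summable_on hQ (img gm)"
   using w[of n] summable_on_cmult_right'[of "sqrt (w n)" "rh n"] by simp
  then show "gm \<in> (\<Union>n. {gm\<in>Gm n. rh n summable_on hQ (img gm)})" using n by blast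
 qed
 ultimately show ?thesis unfolding null_iff using r0 by blast
qed

lemma null_Un:
 assumes "null A" "null B" shows "null (A Un B)"
proof -
 have "null (\<Union>n::nat. if n = 0 then A else B)" using assms by (intro null_UN) simp
 then show ?thesis
  by (rule null_subset) (auto intro: UN_I[of "0::nat"] UN_I[of "1::nat"])
qed

lemma null_superpaths:
 assumes "null Gm" shows "null {gm. \<exists>gm'\<in>Gm. subpath_of gm' gm}"
proof -
 obtain rh :: "nat => real" where rh: "!!i. 0 <= rh i" "(%i. (rh i)^2) summable_on UNIV"
   "excluded {gm\<in>Gm. rh summable_on hQ (img gm)}" using assms unfolding null_iff by blast
 have "excluded {gm \<in> {gm. \<exists>gm'\<in>Gm. subpath_of gm' gm}. rh summable_on hQ (img gm)}"
 proof (rule excluded_subset[OF excluded_superpaths[OF rh(3)]], rule subsetI)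
  fix gm assume "gm \<in> {gm \<in> {gm. \<exists>gm'\<in>Gm. subpath_of gm' gm}. rh summable_on hQ (img gm)}"
  then obtain gm' where *: "gm' \<in> Gm" "subpath_of gm' gm" "rh summable_on hQ (img gm)" by blast
  have "rh summable_on hQ (img gm')"
   by (rule summable_on_sub[OF *(3)]) (use hits_mono[OF img_subpath[OF *(2)]] rh(1) in auto)
  then show "gm \<in> {gm. \<exists>gm'\<in>{gm\<in>Gm. rh summable_on hQ (img gm)}. subpath_of gm' gm}" using * by blast
 qed
 then show ?thesis unfolding null_iff using rh by blast
qed

lemma null_hausdorff1: "null {gm \<in> cpaths_in Om. hausdorff1 (img gm Int S) ~= 0}"
 by (rule null_excluded[OF excluded_hausdorff1])

lemma excluded_empty: "excluded {}"
proof (cases v)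
 case Weak
 show ?thesis unfolding excluded_Weak[OF Weak] mod2_eq_0_iff by (intro bexI[of _ "%_. 0"]) auto
next
 case Strong
 show ?thesis unfolding excluded_Strong[OF Strong] by blast
qed

text \<open>The weight, cut off to the disks meeting \<open>V\<close>, is its own witness in
  \<open>null_iff\<close>.\<close>

lemma null_not_summable:
 fixes rh :: "nat => real"
 assumes "!!i. 0 <= rh i" "(%i. (rh i)^2) summable_on hQ V"
 shows "null {gm. img gm \<subseteq> V & \<not> rh summable_on hQ (img gm)}"
 unfolding null_iff
proof (intro exI[of _ "%i. if i \<in> hQ V then rh i else 0"] conjI allI)
 have "(%i. (if i \<in> hQ V then rh i else 0)^2) summable_on UNIV \<longleftrightarrow> (%i. (rh i)^2) summable_on hQ V"
  by (rule summable_on_cong_neutral) auto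
 then show "(%i. (if i \<in> hQ V then rh i else 0)^2) summable_on UNIV" using assms(2) by simp
 have "rh summable_on hQ (img gm)"
  if "img gm \<subseteq> V" "(%i. if i \<in> hQ V then rh i else 0) summable_on hQ (img gm)" for gm
  by (rule summable_on_cong[THEN iffD1, OF _ that(2)]) (use hits_mono[OF that(1)] in auto)
 then have "{gm \<in> {gm. img gm \<subseteq> V & \<not> rh summable_on hQ (img gm)}.
   (%i. if i \<in> hQ V then rh i else 0) summable_on hQ (img gm)} = {}" by blast
 moreover note excluded_empty
 ultimately show "excluded {gm \<in> {gm. img gm \<subseteq> V & \<not> rh summable_on hQ (img gm)}.
   (%i. if i \<in> hQ V then rh i else 0) summable_on hQ (img gm)}" by (simp only:)
qed (use assms in auto)

subsection \<open>Generic squares\<close>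

definition square :: "complex => real => complex set" where
 "square c s = {z. sup_norm (z - c) = s}"

text \<open>The shadow of a disk under \<open>sup_norm (z - c)\<close>. Up to the restriction to
  radii below \<open>R\<close> it is an interval, as the image of a connected set, and since that
  map is 1-Lipschitz it is no longer than the diameter of the disk.\<close>

definition hit_radii :: "complex => real => nat => real set" where
 "hit_radii c R i = {s. 0 < s & s < R & i \<in> hQ (square c s)}"

lemma hit_radii_measurable: "hit_radii c R i \<in> sets borel"
proof -
 have "hit_radii c R i = {0<..<R} Int (%z. sup_norm (z - c)) ` Q i"
  by (auto simp: hit_radii_def hits_def square_def)
 moreover have "is_interval ((%z. sup_norm (z - c)) ` Q i)"
  unfolding is_interval_connected_1
  by (intro connected_continuous_image continuous_intros Q_connected)
 ultimately show ?thesis using real_interval_borel_measurable by auto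
qed

lemma hit_radii_measure:
 assumes "R > 0"
 shows "emeasure lborel (hit_radii c R i) <= ennreal (min (dQ i) R)"
proof (cases "hit_radii c R i = {}")
 case False
 then obtain s0 z0 where "s0 \<in> hit_radii c R i" "z0 \<in> Q i" "sup_norm (z0 - c) = s0"
  by (auto simp: hit_radii_def hits_def square_def)
 define D where "D = dQ i"
 have osc: "\<bar>s - t\<bar> <= D" if st: "s \<in> hit_radii c R i" "t \<in> hit_radii c R i" for s t
 proof -
  obtain z w where zw: "z \<in> Q i" "sup_norm (z - c) = s" "w \<in> Q i" "sup_norm (w - c) = t"
   using st by (auto simp: hit_radii_def hits_def square_def)
  then show ?thesis
   using sup_norm_diff_le[of z c w] diameter_bounded_bound[OF Q_bounded zw(1) zw(3)] by (simp add: D_def)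
 qed
 define a where "a = Inf (hit_radii c R i)"
 have bdd: "bdd_below (hit_radii c R i)" by (rule bdd_belowI[of _ 0]) (auto simp: hit_radii_def)
 have a0: "0 <= a" unfolding a_def using False by (intro cInf_greatest) (auto simp: hit_radii_def)
 have "hit_radii c R i \<subseteq> {a..a + min D R}"
 proof
  fix s assume s: "s \<in> hit_radii c R i"
  have "a <= s" unfolding a_def using bdd s by (rule cInf_lower[rotated])
  moreover have "s - D <= a" unfolding a_def
   using False osc[OF s] by (intro cInf_greatest) (auto simp: abs_le_iff algebra_simps)
  moreover have "s < R" using s by (simp add: hit_radii_def)
  ultimately show "s \<in> {a..a + min D R}" using a0 by (auto simp: min_def)
 qed
 then have "emeasure lborel (hit_radii c R i) <= emeasure lborel {a..a + min D R}"
  by (intro emeasure_mono) auto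
 also have "... = ennreal (min D R)" using diameter_Q_pos[of i] assms by (simp add: D_def)
 finally show ?thesis by (simp add: D_def)
qed simp

lemma hit_radii_nonempty: "hit_radii c R i ~= {} ==> i \<in> hQ (ball c (2 * R))"
proof -
 assume "hit_radii c R i ~= {}"
 then obtain s z where "s < R" "z \<in> Q i" "sup_norm (z - c) = s"
  by (auto simp: hit_radii_def hits_def square_def)
 then have "z \<in> Q i Int ball c (2 * R)"
  using norm_le_sup_norm[of "z - c"] by (simp add: dist_norm norm_minus_commute)
 then show ?thesis by (auto simp: hits_def)
qed

text \<open>After interchanging sum and integral, a disk contributes \<open>h i\<close> times the
  measure of its radii, which is at most \<open>min (dQ i) R\<close>. The set \<open>I\<close>
  allows a disk through the centre to be left out.\<close>

lemma square_sum_integral: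
 fixes h :: "nat => real"
 assumes R: "R > 0" and h: "!!i. 0 <= h i" and I: "!!i. i \<in> I ==> i \<in> hQ (ball c (2 * R)) | h i = 0"
  and bound: "!!F. finite F ==> F \<subseteq> I Int hQ (ball c (2 * R)) ==> (\<Sum>i\<in>F. h i * min (dQ i) R) <= B"
 shows "(\<integral>\<^sup>+s. (\<Sum>i. ennreal (if i \<in> I then h i else 0) * indicator (hit_radii c R i) s) \<partial>lborel) <= ennreal B"
proof -
 let ?h = "%i. if i \<in> I Int hQ (ball c (2 * R)) then h i else 0"
 have "(\<integral>\<^sup>+s. (\<Sum>i. ennreal (if i \<in> I then h i else 0) * indicator (hit_radii c R i) s) \<partial>lborel) =
   (\<Sum>i. ennreal (if i \<in> I then h i else 0) * emeasure lborel (hit_radii c R i))"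
  using hit_radii_measurable by (subst nn_integral_suminf) (auto simp: nn_integral_cmult_indicator)
 also have "... <= (\<Sum>i. ennreal (?h i * min (dQ i) R))"
 proof (intro suminf_le allI)
  fix i
  show "ennreal (if i \<in> I then h i else 0) * emeasure lborel (hit_radii c R i) <= ennreal (?h i * min (dQ i) R)"
  proof (cases "i \<in> I Int hQ (ball c (2 * R))")
   case True
   then show ?thesis
    using hit_radii_measure[OF R, of c i] h[of i] by (simp add: ennreal_mult' mult_left_mono)
  next
   case False
   then show ?thesis using I[of i] by auto
  qed
 qed auto
 also have "... <= ennreal B"
 proof (rule suminf_le_const)
  fix n
  have "(\<Sum>i<n. ?h i * min (dQ i) R) =
    (\<Sum>i\<in>{..<n} Int (I Int hQ (ball c (2 * R))). h i * min (dQ i) R)"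
   by (rule sum.mono_neutral_cong_right) auto
  also have "... <= B" by (rule bound) auto
  finally have "(\<Sum>i<n. ?h i * min (dQ i) R) <= B" .
  moreover have "(\<Sum>i<n. ennreal (?h i * min (dQ i) R)) = ennreal (\<Sum>i<n. ?h i * min (dQ i) R)"
   using h R less_imp_le[OF diameter_Q_pos] by (intro sum_ennreal) (auto simp: min_def)
  ultimately show "(\<Sum>i<n. ennreal (?h i * min (dQ i) R)) <= ennreal B"
   by (simp add: ennreal_leI)
 qed auto
 finally show ?thesis .
qed

lemma square_sum_summable:
 fixes h :: "nat => real"
 assumes s: "0 < s" "s < R" and h: "!!i. 0 <= h i"
  and fin: "(\<Sum>i. ennreal (if i \<in> I then h i else 0) * indicator (hit_radii c R i) s) <= ennreal B" "B >= 0"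
 shows "h summable_on (I Int hQ (square c s))" "infsum h (I Int hQ (square c s)) <= B"
proof -
 have "sum h F <= B" if F: "finite F" "F \<subseteq> I Int hQ (square c s)" for F
 proof -
  have "ennreal (sum h F) = (\<Sum>i\<in>F. ennreal (if i \<in> I then h i else 0) * indicator (hit_radii c R i) s)"
  proof (subst sum_ennreal[symmetric])
   show "(\<Sum>i\<in>F. ennreal (h i)) = (\<Sum>i\<in>F. ennreal (if i \<in> I then h i else 0) * indicator (hit_radii c R i) s)"
    using F s by (intro sum.cong) (auto simp: hit_radii_def)
  qed (use h in auto)
  also have "... <= (\<Sum>i. ennreal (if i \<in> I then h i else 0) * indicator (hit_radii c R i) s)"
   by (intro sum_le_suminf F) auto
  also have "... <= ennreal B" by fact
  finally show ?thesis using fin(2) by (simp add: ennreal_le_iff)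
 qed
 then show "h summable_on (I Int hQ (square c s))" "infsum h (I Int hQ (square c s)) <= B"
  using infsum_bounded_finite_sums[of "I Int hQ (square c s)" h B] h by blast+
qed

lemma square_loop_in_square:
 assumes "s > 0" "J \<subseteq> {-s..15 * s}" shows "img (J, square_loop c s) \<subseteq> square c s"
 using assms sup_norm_square_loop[of s _ c] by (auto simp: img_def square_def)

text \<open>Bounding \<open>h i * min (dQ i) R\<close> by a sum of two squares makes the integral
  over the radii finite, so the sum over the disks met is finite for almost every radius.\<close>

lemma AE_square_summable:
 fixes h :: "nat => real"
 assumes h: "!!i. 0 <= h i" "(%i. (h i)^2) summable_on hQ (ball c (2 * R))" and R: "R > 0"
 shows "AE s in lborel. 0 < s & s < R --> h summable_on hQ (square c s)"
proof -
 let ?H = "hQ (ball c (2 * R))"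
 obtain C where C: "C > 0" "!!z r F. r > 0 ==> finite F ==> F \<subseteq> hQ (ball z r) ==>
   (\<Sum>i\<in>F. (min (dQ i) r)^2) <= C * r^2"
  using sum_min_diameter by blast
 define B where "B = infsum (%i. (h i)^2) ?H + C * (2 * R)^2"
 define f where "f s = (\<Sum>i. ennreal (if i \<in> ?H then h i else 0) * indicator (hit_radii c R i) s)" for s
 have "(\<integral>\<^sup>+s. f s \<partial>lborel) <= ennreal B"
  unfolding f_def
 proof (rule square_sum_integral[OF R h(1)])
  fix F assume F: "finite F" "F \<subseteq> ?H Int ?H"
  have "h i * min (dQ i) R <= (h i)^2 + (min (dQ i) (2 * R))^2" for i
  proof -
   have "h i * min (dQ i) R <= h i * min (dQ i) (2 * R)"
    using h(1) R by (intro mult_left_mono) auto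
   also have "... <= (h i)^2 + (min (dQ i) (2 * R))^2"
   proof -
    have "0 <= h i * min (dQ i) (2 * R)"
    using h(1)[of i] R diameter_Q_pos[of i] by (intro mult_nonneg_nonneg) auto
    then show ?thesis using sum_squares_bound[of "h i" "min (dQ i) (2 * R)"] by linarith
   qed
   finally show ?thesis .
  qed
  then have "(\<Sum>i\<in>F. h i * min (dQ i) R) <= (\<Sum>i\<in>F. (h i)^2) + (\<Sum>i\<in>F. (min (dQ i) (2 * R))^2)"
   unfolding sum.distrib[symmetric] by (intro sum_mono)
  also have "... <= B"
   unfolding B_def using F R h C(2)[of "2 * R" F c] by (intro add_mono sum_le_infsum) auto
  finally show "(\<Sum>i\<in>F. h i * min (dQ i) R) <= B" .
 qed auto
 then have "(\<integral>\<^sup>+s. f s \<partial>lborel) ~= \<infinity>" using le_less_trans[OF _ ennreal_less_top] by force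
 moreover have "f \<in> borel_measurable lborel"
  unfolding f_def using hit_radii_measurable by measurable
 ultimately have "AE s in lborel. f s ~= \<infinity>" by (intro nn_integral_PInf_AE)
 then show ?thesis
 proof (rule AE_mp, intro AE_I2 impI)
  fix s assume "f s ~= \<infinity>" and s: "0 < s & s < R"
  then obtain b where b: "f s = ennreal b" "b >= 0" by (cases "f s") auto
  have "hQ (square c s) \<subseteq> ?H"
  proof
   fix i assume "i \<in> hQ (square c s)"
   then have "s \<in> hit_radii c R i" using s by (simp add: hit_radii_def)
   then show "i \<in> ?H" using hit_radii_nonempty by blast
  qed
  then show "h summable_on hQ (square c s)"
   using square_sum_summable(1)[of s R h ?H c b] s h(1) b by (simp add: f_def Int_absorb1)
 qed
qed

text \<open>The weight that witnesses that \<open>Gm\<close> is null is summable along almost every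
  square, so only the excluded part of \<open>Gm\<close> could occur there; and that part is avoided
  because a square integrable function is integrable along almost every square. All arcs
  \<open>J\<close> of the loop are treated at the same radius.\<close>

lemma AE_square_not_null:
 assumes "null Gm" and R: "R > 0"
 shows "AE s in lborel. 0 < s & s < R -->
  (\<forall>J. is_interval J & J ~= {} & J \<subseteq> {-s..15 * s} --> (J, square_loop c s) \<notin> Gm)"
proof -
 obtain rh :: "nat => real" where rh: "!!i. 0 <= rh i" "(%i. (rh i)^2) summable_on UNIV"
   "excluded {gm\<in>Gm. rh summable_on hQ (img gm)}" using assms unfolding null_iff by blast
 let ?E = "{gm\<in>Gm. rh summable_on hQ (img gm)}"
 obtain l where l: "l \<in> borel_measurable borel" "(\<integral>\<^sup>+z. (l z)^2 \<partial>lborel) < \<infinity>"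
  "!!gm. gm \<in> ?E ==> is_cpath gm ==> path_integral l gm = \<infinity>"
  using excluded_mod2[OF rh(3)] unfolding mod2_eq_0_iff by blast
 have 1: "AE s in lborel. 0 < s & s < R --> (\<integral>\<^sup>+t\<in>{-s..15 * s}. l (square_loop c s t) \<partial>lborel) < \<infinity>"
  by (rule AE_square_loop_square_integrable[OF l(1,2)])
 have 2: "AE s in lborel. 0 < s & s < R --> rh summable_on hQ (square c s)"
  by (rule AE_square_summable[OF rh(1) _ R]) (rule summable_on_sub[OF rh(2)], auto)
 show ?thesis
  using 1 2
 proof eventually_elim
  case (elim s)
  show ?case
  proof (intro impI allI notI)
   fix J assume s: "0 < s & s < R" and J: "is_interval J & J ~= {} & J \<subseteq> {-s..15 * s}"
    and G: "(J, square_loop c s) \<in> Gm"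
   have "rh summable_on hQ (img (J, square_loop c s))"
    by (rule summable_on_sub[of _ "hQ (square c s)"])
    (use elim(2) s J rh(1) hits_mono[OF square_loop_in_square[of s J c]] in auto)
   then have inE: "(J, square_loop c s) \<in> ?E" using G by simp
   have "is_cpath (J, square_loop c s)"
    using J bounded_subset[OF bounded_closed_interval, of J "-s" "15 * s"]
    by (intro is_cpath_square_loop) auto
   then have "path_integral l (J, square_loop c s) = \<infinity>" using l(3) inE by blast
   moreover have "path_integral l (J, square_loop c s) <= (\<integral>\<^sup>+t\<in>{-s..15 * s}. l (square_loop c s t) \<partial>lborel)"
    using s J by (intro path_integral_unit_speed square_loop_length
    measurable_compose[OF borel_measurable_continuous_onI l(1)] continuous_square_loop) auto
   ultimately show False using elim(1) s by (simp add: top_unique)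
  qed
 qed
qed

text \<open>The length--area argument of Courant and Lebesgue.\<close>

lemma exists_good_square:
 fixes h :: "nat => real"
 assumes R0: "R0 > 0" and h: "!!i. 0 <= h i" "(%i. (h i)^2) summable_on hQ (ball c (2 * R0))"
  and ae: "AE s in lborel. 0 < s & s < R0 --> P s" and d: "d > 0"
 obtains s where "0 < s" "s < R0" "P s" "h summable_on hQ (square c s)"
  "infsum h ({i. c \<notin> CQ i} Int hQ (square c s)) <= d"
proof -
 obtain C where C: "C > 0" "!!z r F. r > 0 ==> finite F ==> F \<subseteq> hQ (ball z r) ==>
   (\<Sum>i\<in>F. (min (dQ i) r)^2) <= C * r^2"
  using sum_min_diameter by blast
 \<comment> \<open>A disk whose closure contains the centre is met by all small squares and cannot
   be made to contribute little; it is left out of the estimate.\<close>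
 define N where "N = {i. c \<notin> CQ i}"
 \<comment> \<open>With \<open>e = 4 * C * R / d\<close> in Young's inequality below, both summands
   become \<open>d * R / 4\<close>. Any bound on the integral of \<open>f\<close> that is a fixed
   fraction of \<open>d * R\<close> would give a radius with \<open>f s <= d\<close>;
   \<open>3/4\<close> leaves some slack.\<close>
 define A where "A = d^2 / (16 * C)"
 have A: "A > 0" using d C by (simp add: A_def)
 \<comment> \<open>Off a finite set \<open>F\<close> the square sum is small, and a small enough
   ball no longer meets the disks of \<open>F\<close> that do not touch the centre.\<close>
 obtain F where F: "finite F" "F \<subseteq> hQ (ball c (2 * R0))"
  "!!B. B \<subseteq> hQ (ball c (2 * R0)) - F ==> infsum (%i. (h i)^2) B < A"
  by (rule infsum_tail_small[OF h(2) zero_le_power2 A]) (rule that)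
 obtain r1 where r1: "r1 > 0" "!!i. i \<in> F ==> c \<notin> CQ i ==> i \<notin> hQ (ball c r1)"
  using hits_near_avoid[OF F(1)] by blast
 define R where "R = min R0 (r1 / 2)"
 have R: "R > 0" "R <= R0" "2 * R <= r1" using R0 r1 by (auto simp: R_def)
 have sub: "hQ (ball c (2 * R)) \<subseteq> hQ (ball c (2 * R0))" using R by (intro hits_mono) auto
 have small: "(\<Sum>i\<in>G. (h i)^2) <= A" if G: "finite G" "G \<subseteq> N Int hQ (ball c (2 * R))" for G
 proof -
  have "hQ (ball c (2 * R)) \<subseteq> hQ (ball c r1)" using R by (intro hits_mono) auto
  then have "i \<in> hQ (ball c (2 * R0)) - F" if "i \<in> G" for i
   using that G sub r1(2)[of i] unfolding N_def by blast
  then have "G \<subseteq> hQ (ball c (2 * R0)) - F" by blast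
  from F(3)[OF this] G show ?thesis by simp
 qed
 define f where "f s = (\<Sum>i. ennreal (if i \<in> N Int hQ (ball c (2 * R)) then h i else 0) * indicator (hit_radii c R i) s)" for s
 have int: "(\<integral>\<^sup>+s. f s \<partial>lborel) <= ennreal (3/4 * d * R)"
  unfolding f_def
 proof (rule square_sum_integral[OF R(1) h(1)])
  fix G assume G: "finite G" "G \<subseteq> N Int hQ (ball c (2 * R)) Int hQ (ball c (2 * R))"
  define e where "e = 4 * C * R / d"
  have e: "e > 0" using C R d by (simp add: e_def)
  have "h i * min (dQ i) R <= e * (h i)^2 + (min (dQ i) (2 * R))^2 / (4 * e) " for i
  proof -
   let ?m = "min (dQ i) (2 * R)"
   have "0 <= (2 * e * h i - ?m)^2 / (4 * e)" using e by simp
   also have "... = e * (h i)^2 + ?m^2 / (4 * e) - h i * ?m"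
    using e by (simp add: power2_eq_square field_simps)
   finally have "h i * ?m <= e * (h i)^2 + ?m^2 / (4 * e)" by simp
   moreover have "h i * min (dQ i) R <= h i * ?m" using h(1) R by (intro mult_left_mono) auto
   ultimately show ?thesis by simp
  qed
  then have "(\<Sum>i\<in>G. h i * min (dQ i) R) <= (\<Sum>i\<in>G. e * (h i)^2 + (min (dQ i) (2 * R))^2 / (4 * e))"
   by (intro sum_mono)
  also have "... = e * (\<Sum>i\<in>G. (h i)^2) + (\<Sum>i\<in>G. (min (dQ i) (2 * R))^2) / (4 * e)"
   by (simp add: sum.distrib sum_distrib_left sum_divide_distrib)
  also have "... <= e * A + C * (2 * R)^2 / (4 * e)"
   using e G small[of G] C(2)[of "2 * R" G c] R by (intro add_mono mult_left_mono divide_right_mono) auto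
  also have "... <= 3/4 * d * R"
   using C d R by (simp add: e_def A_def field_simps power2_eq_square)
  finally show "(\<Sum>i\<in>G. h i * min (dQ i) R) <= 3/4 * d * R" .
 qed auto
 have fm: "f \<in> borel_measurable lborel"
  unfolding f_def using hit_radii_measurable by measurable
 have ae2: "AE s in lborel. 0 < s & s < R0 --> h summable_on hQ (square c s)"
  by (rule AE_square_summable[OF h R0])
 \<comment> \<open>Otherwise \<open>f\<close> would exceed \<open>d\<close> at almost every radius,
   and its integral would be at least \<open>d * R\<close>.\<close>
 have "\<exists>s. 0 < s & s < R & P s & h summable_on hQ (square c s) & f s <= ennreal d"
 proof (rule ccontr)
  assume no: "\<not> ?thesis"
  have "AE s in lborel. ennreal d * indicator {0<..<R} s <= f s"
   using ae ae2
  proof eventually_elim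
   case (elim s)
   then show ?case using no R by (auto simp: indicator_def not_le less_imp_le)
  qed
  then have "(\<integral>\<^sup>+s. ennreal d * indicator {0<..<R} s \<partial>lborel) <= (\<integral>\<^sup>+s. f s \<partial>lborel)"
   by (rule nn_integral_mono_AE)
  moreover have "(\<integral>\<^sup>+s. ennreal d * indicator {0<..<R} s \<partial>lborel) = ennreal (d * R)"
   using R d by (simp add: nn_integral_cmult_indicator ennreal_mult)
  ultimately have "ennreal (d * R) <= ennreal (3/4 * d * R)" using int by simp
  then have "d * R <= 3/4 * d * R" using d R by (simp add: ennreal_le_iff)
  then show False using d R by simp
 qed
 then obtain s where s: "0 < s" "s < R" "P s" "h summable_on hQ (square c s)" "f s <= ennreal d" by blast
 have "hQ (square c s) \<subseteq> hQ (ball c (2 * R))"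
 proof
  fix i assume "i \<in> hQ (square c s)"
  then have "s \<in> hit_radii c R i" using s by (simp add: hit_radii_def)
  then show "i \<in> hQ (ball c (2 * R))" using hit_radii_nonempty by blast
 qed
 then have "N Int hQ (ball c (2 * R)) Int hQ (square c s) = N Int hQ (square c s)" by blast
 then have "infsum h (N Int hQ (square c s)) <= d"
  using square_sum_summable(2)[OF s(1,2) h(1), where I = "N Int hQ (ball c (2 * R))" and c = c and B = d] s(5) d
  by (simp add: f_def)
 then show thesis using that[of s] s R by (simp add: N_def)
qed

end

section \<open>Functions along generic paths\<close>

text \<open>Orthogonal projection to a line is 1-Lipschitz, so the shadow of a set fits into an
  interval as long as its diameter.\<close>

lemma bounded_image_Re:
 fixes X :: "complex set"
 assumes "bounded X" "norm w = 1"
 shows "\<exists>a. (%z. Re (w * (z - z0))) ` X \<subseteq> {a..a + diameter X}"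
proof (cases "X = {}")
 case False
 define h where "h z = Re (w * (z - z0))" for z
 have lip: "h x - h y <= diameter X" if "x \<in> X" "y \<in> X" for x y
 proof -
  have "h x - h y = Re (w * (x - y))" by (simp add: h_def algebra_simps)
  also have "... <= norm (w * (x - y))" by (rule complex_Re_le_cmod)
  also have "... = dist x y" using assms(2) by (simp add: norm_mult dist_norm)
  also have "... <= diameter X" using diameter_bounded_bound[OF assms(1) that] .
  finally show ?thesis .
 qed
 obtain x0 where x0: "x0 \<in> X" using False by blast
 have bdd: "bdd_below (h ` X)"
  using lip[OF x0] by (intro bdd_belowI2[of _ "h x0 - diameter X"]) (simp add: algebra_simps)
 define a where "a = Inf (h ` X)"
 have "h x \<in> {a..a + diameter X}" if x: "x \<in> X" for x
 proof -
  have "a <= h x" unfolding a_def using bdd x by (intro cInf_lower) auto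
  moreover have "h x - diameter X <= a" unfolding a_def
   using False lip[OF x] by (intro cInf_greatest) (auto simp: algebra_simps)
  ultimately show ?thesis by simp
 qed
 then show ?thesis unfolding h_def[symmetric] by blast
qed simp

context sierpinski_carpet begin

text \<open>Project to the line through the endpoints. The projection of the arc covers the segment
  between them and is itself covered by the shadows of the disks met and of a cover of the part in
  the carpet, whose total width is as small as desired.\<close>

lemma dist_le_sum_diameter:
 fixes f :: "real => complex"
 assumes ab: "a <= b" and f: "continuous_on {a..b} f" "f ` {a..b} \<subseteq> Om"
  and H: "hausdorff1 (f ` {a..b} Int S) = 0"
  and sm: "(%i. dQ i) summable_on hQ (f ` {a..b})"
 shows "dist (f a) (f b) <= (infsum (%i. dQ i) (hQ (f ` {a..b})))"
proof (cases "f a = f b")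
 case True
 then show ?thesis using less_imp_le[OF diameter_Q_pos] by (auto intro!: infsum_nonneg)
next
 case False
 let ?H = "hQ (f ` {a..b})"
 define d where "d = dist (f a) (f b)"
 have d: "d > 0" using False by (simp add: d_def)
 \<comment> \<open>Multiplication by \<open>w\<close> rotates the direction from \<open>f a\<close>
   to \<open>f b\<close> to the positive real axis.\<close>
 define w where "w = cnj (f b - f a) / of_real d"
 have w: "norm w = 1"
  using d unfolding w_def norm_divide complex_mod_cnj by (simp add: d_def dist_norm norm_minus_commute)
 define h where "h z = Re (w * (z - f a))" for z
 have h0: "h (f a) = 0" by (simp add: h_def)
 have hd: "h (f b) = d"
 proof -
  have "w * (f b - f a) = of_real ((norm (f b - f a))^2) / of_real d"
   unfolding w_def by (simp add: complex_norm_square mult.commute del: of_real_power)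
  also have "... = of_real d" using d by (simp add: d_def dist_norm norm_minus_commute power2_eq_square)
  finally show ?thesis by (simp add: h_def)
 qed
 have "continuous_on {a..b} (%t. h (f t))" unfolding h_def by (intro continuous_intros f)
 then have "connected ((%t. h (f t)) ` {a..b})" by (intro connected_continuous_image) auto
 then have cover: "{0..d} \<subseteq> (%t. h (f t)) ` {a..b}"
  using ab h0 hd by (intro connected_contains_Icc) (auto intro: image_eqI[of _ _ a] image_eqI[of _ _ b])
 have "\<forall>i. \<exists>r. h ` Q i \<subseteq> {r..r + dQ i}"
  unfolding h_def using bounded_image_Re[OF Q_bounded w] by blast
 then obtain r where r: "!!i. h ` Q i \<subseteq> {r i..r i + dQ i}" by metis
 define VQ where "VQ i = (if i \<in> ?H then {r i..r i + dQ i} else {})" for i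
 let ?s = "\<Sum>\<^sub>\<infinity>i\<in>?H. dQ i"
 have s0: "0 <= ?s" using less_imp_le[OF diameter_Q_pos] by (auto intro!: infsum_nonneg)
 have VQ: "emeasure lborel (\<Union>i. VQ i) <= ennreal ?s"
 proof -
  have "emeasure lborel (\<Union>i. VQ i) <= (\<Sum>i. emeasure lborel (VQ i))"
   by (rule emeasure_subadditive_countably) (auto simp: VQ_def)
  also have "... <= ennreal ?s"
  proof (rule suminf_le_const)
   fix n
   have "(\<Sum>i<n. emeasure lborel (VQ i)) = (\<Sum>i<n. ennreal (if i \<in> ?H then dQ i else 0))"
    using less_imp_le[OF diameter_Q_pos] by (intro sum.cong) (auto simp: VQ_def)
   also have "... = ennreal (\<Sum>i<n. if i \<in> ?H then dQ i else 0)"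
    using less_imp_le[OF diameter_Q_pos] by (intro sum_ennreal) auto
   also have "(\<Sum>i<n. if i \<in> ?H then dQ i else 0) = (\<Sum>i\<in>{..<n} Int ?H. dQ i)"
    by (simp add: sum.inter_restrict)
   also have "... <= ?s"
    using less_imp_le[OF diameter_Q_pos] by (intro sum_le_infsum sm) auto
   finally show "(\<Sum>i<n. emeasure lborel (VQ i)) <= ennreal ?s" by (simp add: ennreal_leI)
  qed auto
  finally show ?thesis .
 qed
 have "ennreal d <= ennreal ?s + 0"
 proof (rule ennreal_le_epsilon)
  fix e :: real assume "e > 0"
  obtain U :: "nat => complex set" where U: "f ` {a..b} Int S \<subseteq> (\<Union>k. U k)" "\<forall>k. bounded (U k)"
   "(\<Sum>k. ennreal (diameter (U k))) <= ennreal e"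
   using H[unfolded hausdorff1_eq_0_iff, rule_format, OF \<open>e > 0\<close>] by (elim exE conjE)
  have "\<forall>k. \<exists>r. h ` U k \<subseteq> {r..r + diameter (U k)}"
   unfolding h_def using bounded_image_Re[OF _ w] U(2) by blast
  then obtain q where q: "!!k. h ` U k \<subseteq> {q k..q k + diameter (U k)}" by metis
  define VU where "VU k = {q k..q k + diameter (U k)}" for k
  have VU: "emeasure lborel (\<Union>k. VU k) <= ennreal e"
  proof -
   have "emeasure lborel (\<Union>k. VU k) <= (\<Sum>k. emeasure lborel (VU k))"
    by (rule emeasure_subadditive_countably) (auto simp: VU_def)
   also have "... = (\<Sum>k. ennreal (diameter (U k)))"
   proof (intro suminf_cong)
    fix k
    have "0 <= diameter (U k)" using U(2) diameter_ge_0 by blast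
    then show "emeasure lborel (VU k) = ennreal (diameter (U k))" by (simp add: VU_def)
   qed
   finally show ?thesis using U(3) by simp
  qed
  have "{0..d} \<subseteq> (\<Union>i. VQ i) Un (\<Union>k. VU k)"
  proof
   fix y assume "y \<in> {0..d}"
   then obtain t where t: "t \<in> {a..b}" "y = h (f t)" using cover by auto
   have ft: "f t \<in> f ` {a..b}" using t by blast
   then consider "f t \<in> S" | i where "f t \<in> Q i" using f(2) Omega_cases by blast
   then show "y \<in> (\<Union>i. VQ i) Un (\<Union>k. VU k)"
   proof cases
    case 1
    then obtain k where "f t \<in> U k" using U(1) ft by blast
    then have "y \<in> VU k" using q[of k] t by (auto simp: VU_def)
    then show ?thesis by blast
   next
    case 2
    then have "i \<in> ?H" using ft by (auto simp: hits_def)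
    moreover have "y \<in> {r i..r i + dQ i}" using r[of i] 2 t by blast
    ultimately have "y \<in> VQ i" by (simp add: VQ_def)
    then show ?thesis by blast
   qed
  qed
  then have "emeasure lborel {0..d} <= emeasure lborel ((\<Union>i. VQ i) Un (\<Union>k. VU k))"
   by (intro emeasure_mono) (auto simp: VQ_def VU_def)
  also have "... <= emeasure lborel (\<Union>i. VQ i) + emeasure lborel (\<Union>k. VU k)"
   by (intro emeasure_subadditive) (auto simp: VQ_def VU_def)
  also have "... <= ennreal ?s + ennreal e" by (intro add_mono VQ VU)
  finally show "ennreal d <= ennreal ?s + 0 + ennreal e" using d by simp
 qed
 then show ?thesis using s0 by (simp add: d_def ennreal_le_iff)
qed

section \<open>Suprema, infima and oscillations of real-valued functions on disk boundaries\<close>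

definition Mx :: "(complex => real) => nat => real" where
 "Mx u i = Sup (u ` FQ i)"

definition Mn :: "(complex => real) => nat => real" where
 "Mn u i = Inf (u ` FQ i)"

definition osr :: "(complex => real) => nat => real" where
 "osr u i = Mx u i - Mn u i"

definition locally_bounded :: "(complex => real) => bool" where
 "locally_bounded u \<longleftrightarrow> (\<forall>i. bounded (u ` FQ i))"

lemma
 assumes "locally_bounded u" "p \<in> FQ i"
 shows le_Mx: "u p <= Mx u i" and Mn_le: "Mn u i <= u p"
 using assms unfolding Mx_def Mn_def locally_bounded_def
 by (auto intro!: cSup_upper cInf_lower bounded_imp_bdd_above bounded_imp_bdd_below)

lemma Mx_least: "(!!p. p \<in> FQ i ==> u p <= B) ==> Mx u i <= B"
 unfolding Mx_def using frontier_Q_nonempty by (intro cSup_least) auto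

lemma Mn_greatest: "(!!p. p \<in> FQ i ==> B <= u p) ==> B <= Mn u i"
 unfolding Mn_def using frontier_Q_nonempty by (intro cInf_greatest) auto

lemma osr_least: "(!!p q. p \<in> FQ i ==> q \<in> FQ i ==> u p - u q <= B) ==> osr u i <= B"
proof -
 assume *: "!!p q. p \<in> FQ i ==> q \<in> FQ i ==> u p - u q <= B"
 have "Mx u i <= Mn u i + B"
 proof (rule Mx_least)
  fix p assume p: "p \<in> FQ i"
  have "u p - B <= Mn u i" by (rule Mn_greatest) (use *[OF p] in \<open>simp add: algebra_simps\<close>)
  then show "u p <= Mn u i + B" by simp
 qed
 then show ?thesis by (simp add: osr_def)
qed

lemma Mn_le_Mx: "locally_bounded u ==> Mn u i <= Mx u i"
 using frontier_Q_nonempty[of i] le_Mx Mn_le by (meson ex_in_conv order_trans)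

lemma osr_nonneg: "locally_bounded u ==> 0 <= osr u i"
 using Mn_le_Mx by (simp add: osr_def)

lemma abs_diff_le_osr:
 assumes "locally_bounded u" "p \<in> FQ i" "q \<in> FQ i"
 shows "\<bar>u p - u q\<bar> <= osr u i"
 using le_Mx[OF assms(1,2)] le_Mx[OF assms(1,3)] Mn_le[OF assms(1,2)] Mn_le[OF assms(1,3)]
 by (simp add: osr_def)

lemma abs_Mx_diff_le_osr:
 assumes "locally_bounded u" "p \<in> FQ i"
 shows "\<bar>Mx u i - u p\<bar> <= osr u i"
 using le_Mx[OF assms] Mn_le[OF assms] by (simp add: osr_def)

text \<open>All that is used of a path outside the exceptional family, on a compact parameter
  interval. The inequality is demanded for every subarc with endpoints in the carpet, so that it
  passes to subarcs. Summability of \<open>rh\<close> is included because a real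
  \<open>infsum\<close> carries no information without it; that of the diameters serves
  \<open>dist_le_sum_diameter\<close>.\<close>

definition good_on :: "(complex => real) => (nat => real) => (real => complex) => real => real => bool" where
 "good_on u rh f a b \<longleftrightarrow> a <= b & continuous_on {a..b} f & f ` {a..b} \<subseteq> Om &
  hausdorff1 (f ` {a..b} Int S) = 0 & rh summable_on hQ (f ` {a..b}) &
  (%i. dQ i) summable_on hQ (f ` {a..b}) &
  (\<forall>s t. a <= s --> s <= t --> t <= b --> f s \<in> S --> f t \<in> S -->
    \<bar>u (f s) - u (f t)\<bar> <= infsum rh (hQ (f ` {s..t})))"

lemma hits_Icc_mono: "a <= s ==> t <= b ==> hQ (f ` {s..t}) \<subseteq> hQ (f ` {a..b})"
 for a b s t :: real
 by (intro hits_mono image_mono) auto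

lemma good_on_sub:
 assumes "good_on u rh f a b" "a <= s" "s <= t" "t <= b" "!!i. 0 <= rh i"
 shows "good_on u rh f s t"
proof -
 have sub: "{s..t} \<subseteq> {a..b}" using assms(2,4) by auto
 have H: "hQ (f ` {s..t}) \<subseteq> hQ (f ` {a..b})" using assms(2,4) by (rule hits_Icc_mono)
 have "continuous_on {s..t} f" using assms(1) sub continuous_on_subset unfolding good_on_def by blast
 moreover have "hausdorff1 (f ` {s..t} Int S) = 0"
  by (rule hausdorff1_null_subset[of "f ` {a..b} Int S"]) (use assms(1) sub in \<open>auto simp: good_on_def\<close>)
 moreover have "rh summable_on hQ (f ` {s..t})"
  by (rule summable_on_sub[OF _ H]) (use assms in \<open>auto simp: good_on_def\<close>)
 moreover have "(%i. dQ i) summable_on hQ (f ` {s..t})"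
  by (rule summable_on_sub[OF _ H]) (use assms less_imp_le[OF diameter_Q_pos] in \<open>auto simp: good_on_def\<close>)
 moreover have "f ` {s..t} \<subseteq> Om" using assms(1) sub unfolding good_on_def by blast
 moreover have "\<bar>u (f s') - u (f t')\<bar> <= infsum rh (hQ (f ` {s'..t'}))"
  if "s <= s'" "s' <= t'" "t' <= t" "f s' \<in> S" "f t' \<in> S" for s' t'
 proof -
  have "a <= s'" "t' <= b" using that assms by auto
  then show ?thesis using assms(1) that unfolding good_on_def by blast
 qed
 ultimately show ?thesis unfolding good_on_def using assms(3) by blast
qed

text \<open>After its last visit to a disk a path no longer meets it, yet at that moment it is still
  on the boundary. Cutting there removes the disk from the sum at the price of one jump between
  boundary points.\<close>

lemma last_exit:
 fixes f :: "real => complex"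
 assumes f: "continuous_on {s..t} f" and st: "s <= ta" "ta <= t" "f ta \<in> Q i" "f t \<notin> Q i"
 obtains s' where "ta <= s'" "s' <= t" "f s' \<in> FQ i" "i \<notin> hQ (f ` {s'..t})"
proof -
 define A where "A = {x \<in> {s..t}. f x \<in> Q i}"
 define s' where "s' = Sup A"
 have bdd: "bdd_above A" by (rule bdd_aboveI[of _ t]) (auto simp: A_def)
 have tA: "ta \<in> A" using st by (simp add: A_def)
 have s': "ta <= s'" "s' <= t"
  unfolding s'_def using tA bdd by (auto intro!: cSup_upper cSup_least) (auto simp: A_def)
 have after: "x \<notin> A" if "s' < x" for x using cSup_upper[OF _ bdd, of x] that by (auto simp: s'_def)
 have op: "\<exists>e>0. \<forall>x\<in>{s..t}. dist x y < e --> f x \<in> Q i" if y: "y \<in> {s..t}" "f y \<in> Q i" for y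
 proof -
  obtain e where e: "e > 0" "ball (f y) e \<subseteq> Q i" using Q_open[of i] y(2) open_contains_ball by blast
  obtain e' where "e' > 0" "\<forall>x\<in>{s..t}. dist x y < e' --> dist (f x) (f y) < e"
   using f e(1) y(1) unfolding continuous_on_iff by meson
  then show ?thesis using e(2) by (intro exI[of _ e']) (auto simp: dist_commute subset_iff)
 qed
 have notQ: "f s' \<notin> Q i"
 proof
  assume in_Q: "f s' \<in> Q i"
  then have "s' ~= t" using st(4) by auto
  then have "s' < t" using s' by simp
  obtain e where e: "e > 0" "\<forall>x\<in>{s..t}. dist x s' < e --> f x \<in> Q i" using op[of s'] s' st in_Q by auto
  define x where "x = min t (s' + e/2)"
  have x: "s' < x" "x <= t" "dist x s' < e" using \<open>s' < t\<close> e(1) by (auto simp: x_def dist_real_def min_def)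
  then have "x \<in> A" using e(2) s' st by (auto simp: A_def)
  then show False using after x by blast
 qed
 have "f s' \<in> CQ i"
  unfolding closure_approachable
 proof (intro allI impI)
  fix e :: real assume "e > 0"
  have "s' \<in> {s..t}" using s' st by auto
  then obtain d where d: "d > 0" "\<forall>x\<in>{s..t}. dist x s' < d --> dist (f x) (f s') < e"
   using f \<open>e > 0\<close> unfolding continuous_on_iff by blast
  have "s' - d < Sup A" using d by (simp add: s'_def)
  then obtain x where x: "x \<in> A" "s' - d < x" using less_cSupE[of "s' - d" A] tA by blast
  then have "x <= s'" using cSup_upper[OF _ bdd] by (simp add: s'_def)
  then have "dist (f x) (f s') < e" using d x by (auto simp: A_def dist_real_def)
  then show "\<exists>y\<in>Q i. dist y (f s') < e" using x by (auto simp: A_def)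
 qed
 then have fr: "f s' \<in> FQ i" using notQ closure_Q_eq by blast
 have "f x \<notin> Q i" if "x \<in> {s'..t}" for x
  using after[of x] notQ that s' st by (cases "x = s'") (auto simp: A_def)
 then have "i \<notin> hQ (f ` {s'..t})" by (auto simp: hits_def)
 then show thesis using that s' fr by blast
qed

lemma first_entry:
 fixes f :: "real => complex"
 assumes f: "continuous_on {s..t} f" and st: "s <= ta" "ta <= t" "f ta \<in> Q i" "f s \<notin> Q i"
 obtains s' where "s <= s'" "s' <= ta" "f s' \<in> FQ i" "i \<notin> hQ (f ` {s..s'})"
proof -
 \<comment> \<open>Time reversal turns the first entry into a last exit.\<close>
 have "continuous_on {-t..-s} (%x. f (- x))"
  by (intro continuous_on_compose2[OF f] continuous_intros) auto
 then obtain s' where s': "-ta <= s'" "s' <= -s" "f (- s') \<in> FQ i" "i \<notin> hQ ((%x. f (- x)) ` {s'..-s})"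
  using last_exit[of "-t" "-s" "%x. f (- x)" "-ta" i] st by auto
 have "(%x. f (- x)) ` {s'..-s} = f ` {s..-s'}"
 proof (intro equalityI subsetI)
  fix z assume "z \<in> f ` {s..-s'}"
  then obtain y where "y \<in> {s..-s'}" "z = f (- (- y))" by auto
  then show "z \<in> (%x. f (- x)) ` {s'..-s}" by (intro image_eqI[of _ _ "- y"]) auto
 qed auto
 then show thesis using that[of "-s'"] s' by auto
qed

text \<open>Extends a function from the carpet to \<open>Om\<close> by the discrete value of each
  disk, so that path estimates also apply to arcs that start or end inside a disk.\<close>

definition pval :: "(complex => real) => complex => real" where
 "pval u z = (if z \<in> S then u z else Mx u (THE i. z \<in> Q i))"

lemma pval_S: "z \<in> S ==> pval u z = u z" by (simp add: pval_def)

lemma pval_Q: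
 assumes "z \<in> Q i" shows "pval u z = Mx u i"
proof -
 have "(THE i. z \<in> Q i) = i" using assms Q_disjoint by (intro the_equality) blast+
 then show ?thesis using assms S_not_Q by (auto simp: pval_def)
qed

lemma infsum_insert_le:
 fixes h :: "nat => real"
 assumes "h summable_on B" "A \<subseteq> B" "i \<in> B" "i \<notin> A" "!!i. 0 <= h i"
 shows "h i + infsum h A <= infsum h B"
proof -
 have "h summable_on A" using assms summable_on_sub by blast
 then have "infsum h (insert i A) = h i + infsum h A" using assms(4) by (rule infsum_insert)
 moreover have "infsum h (insert i A) <= infsum h B"
  using assms by (intro infsum_sub_mono) auto
 ultimately show ?thesis by simp
qed

text \<open>An endpoint inside a disk is first moved to the boundary, at the last exit or the first
  entry. This costs the oscillation of that disk, but the remaining arc no longer meets it, so the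
  disk is counted only once in the sum.\<close>

lemma pval_diff_le:
 assumes u: "locally_bounded u" and g: "good_on u (osr u) f a b"
 shows "\<bar>pval u (f a) - pval u (f b)\<bar> <= infsum (osr u) (hQ (f ` {a..b}))"
proof -
 let ?H = "%s t. hQ (f ` {s..t})"
 have c: "continuous_on {a..b} f" and ab: "a <= b" and Om: "f ` {a..b} \<subseteq> Om"
  and sm: "osr u summable_on ?H a b"
  using g by (auto simp: good_on_def)
 have nn: "0 <= osr u i" for i by (rule osr_nonneg[OF u])
 have cs: "continuous_on {s..t} f" if "a <= s" "t <= b" for s t
  by (rule continuous_on_subset[OF c]) (use that in auto)
 have sms: "osr u summable_on ?H s t" if "a <= s" "t <= b" for s t
  by (rule summable_on_sub[OF sm hits_Icc_mono[OF that]]) (rule nn)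
 have SS: "\<bar>u (f s) - u (f t)\<bar> <= infsum (osr u) (?H s t)" if "a <= s" "s <= t" "t <= b" "f s \<in> S" "f t \<in> S" for s t
  using g that unfolding good_on_def by blast
 have SQ: "\<bar>u (f s) - pval u (f b)\<bar> <= infsum (osr u) (?H s b)" if s: "a <= s" "s <= b" "f s \<in> S" for s
 proof (cases "f b \<in> S")
  case True then show ?thesis using SS[of s b] s by (simp add: pval_S)
 next
  case False
  then obtain j where j: "f b \<in> Q j" using Om ab Omega_cases by force
  obtain t' where t': "s <= t'" "t' <= b" "f t' \<in> FQ j" "j \<notin> ?H s t'"
   using first_entry[OF cs[OF s(1) order_refl] s(2) order_refl j] S_not_Q[OF s(3)] by blast
  have "\<bar>u (f s) - u (f t')\<bar> <= infsum (osr u) (?H s t')"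
   using SS[of s t'] s t' FQ_S by blast
  moreover have "\<bar>u (f t') - Mx u j\<bar> <= osr u j" using abs_Mx_diff_le_osr[OF u t'(3)] by (simp add: abs_minus_commute)
  moreover have "osr u j + infsum (osr u) (?H s t') <= infsum (osr u) (?H s b)"
  proof (rule infsum_insert_le[OF sms[OF s(1) order_refl] hits_Icc_mono _ t'(4) nn])
   show "j \<in> ?H s b" using j s by (auto simp: hits_def)
  qed (use t' in auto)
  ultimately show ?thesis unfolding pval_Q[OF j] by linarith
 qed
 show ?thesis
 proof (cases "f a \<in> S")
  case True then show ?thesis using SQ[of a] ab by (simp add: pval_S)
 next
  case False
  then obtain i where i: "f a \<in> Q i" using Om ab Omega_cases by force
  show ?thesis
  proof (cases "f b \<in> Q i")
   case True
   then show ?thesis using pval_Q[OF i] pval_Q[OF True] nn by (simp add: infsum_nonneg)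
  next
   case False
   obtain s' where s': "a <= s'" "s' <= b" "f s' \<in> FQ i" "i \<notin> ?H s' b"
    using last_exit[OF c order_refl ab i False] by blast
   have "\<bar>u (f s') - pval u (f b)\<bar> <= infsum (osr u) (?H s' b)"
    using SQ[of s'] s' FQ_S by blast
   moreover have "\<bar>Mx u i - u (f s')\<bar> <= osr u i" using abs_Mx_diff_le_osr[OF u s'(3)] .
   moreover have "osr u i + infsum (osr u) (?H s' b) <= infsum (osr u) (?H a b)"
   proof (rule infsum_insert_le[OF sm hits_Icc_mono _ s'(4) nn])
    show "i \<in> ?H a b" using i ab by (auto simp: hits_def)
   qed (use s' in auto)
   ultimately show ?thesis unfolding pval_Q[OF i] by linarith
  qed
 qed
qed


subsection \<open>The oscillation is the smallest upper gradient\<close>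

text \<open>Pieces of the path that avoid the disks of \<open>F\<close>, linked by jumps between two
  boundary points of one disk. Successive pieces are in no prescribed order in time, which leaves
  room for the shortcuts below.\<close>

definition is_chain :: "(real => complex) => real => real => nat set => nat => (nat => real) => (nat => real) => (nat => nat) => bool" where
 "is_chain f a b F n X Y j \<longleftrightarrow> X 0 = a & Y n = b &
  (\<forall>k\<le>n. a <= X k & X k <= Y k & Y k <= b & f (X k) \<in> S & f (Y k) \<in> S &
    hQ (f ` {X k..Y k}) Int F = {}) &
  (\<forall>k<n. j k \<in> hQ (f ` {a..b}) & f (Y k) \<in> frontier (Q (j k)) & f (X (Suc k)) \<in> frontier (Q (j k)))"

lemma is_chain_append:
 assumes c1: "is_chain f a s F n1 X1 Y1 j1" and c2: "is_chain f t b F n2 X2 Y2 j2"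
  and i: "i \<in> hQ (f ` {a..b})" "f s \<in> FQ i" "f t \<in> FQ i"
  and le: "a <= s" "s <= t" "t <= b"
 shows "is_chain f a b F (Suc (n1 + n2))
  (%k. if k <= n1 then X1 k else X2 (k - Suc n1)) (%k. if k <= n1 then Y1 k else Y2 (k - Suc n1))
  (%k. if k < n1 then j1 k else if k = n1 then i else j2 (k - Suc n1))"
 unfolding is_chain_def
proof (intro conjI allI impI)
 note C1 = c1[unfolded is_chain_def] and C2 = c2[unfolded is_chain_def]
 show "(if 0 <= n1 then X1 0 else X2 (0 - Suc n1)) = a" using C1 by simp
 show "(if Suc (n1 + n2) <= n1 then Y1 (Suc (n1 + n2)) else Y2 (Suc (n1 + n2) - Suc n1)) = b" using C2 by simp
 have H: "hQ (f ` {a..s}) \<subseteq> hQ (f ` {a..b})" "hQ (f ` {t..b}) \<subseteq> hQ (f ` {a..b})"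
  using hits_Icc_mono[of a a s b f] hits_Icc_mono[of a t b b f] le by auto
 {
  fix k assume k: "k <= Suc (n1 + n2)"
  let ?X = "if k <= n1 then X1 k else X2 (k - Suc n1)" and ?Y = "if k <= n1 then Y1 k else Y2 (k - Suc n1)"
  have "a <= ?X & ?X <= ?Y & ?Y <= b & f ?X \<in> S & f ?Y \<in> S & hQ (f ` {?X..?Y}) Int F = {}"
  proof (cases "k <= n1")
   case True
   then show ?thesis using C1 le by (auto intro: order_trans)
  next
   case False
   then have "k - Suc n1 <= n2" using k by linarith
   then show ?thesis using False C2 le by (auto intro: order_trans)
  qed
  then show "a <= ?X" "?X <= ?Y" "?Y <= b" "f ?X \<in> S" "f ?Y \<in> S" "hQ (f ` {?X..?Y}) Int F = {}" by blast+
 }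
 {
  fix k assume k: "k < Suc (n1 + n2)"
  let ?Y = "if k <= n1 then Y1 k else Y2 (k - Suc n1)" and ?X = "if Suc k <= n1 then X1 (Suc k) else X2 (Suc k - Suc n1)"
  let ?j = "if k < n1 then j1 k else if k = n1 then i else j2 (k - Suc n1)"
  have "?j \<in> hQ (f ` {a..b}) & f ?Y \<in> frontier (Q ?j) & f ?X \<in> frontier (Q ?j)"
  proof -
   consider "k < n1" | "k = n1" | "n1 < k" by linarith
   then show ?thesis
   proof cases
    case 1 then show ?thesis using C1 H(1) by auto
   next
    case 2 then show ?thesis using C1 C2 i by auto
   next
    case 3
    then obtain m where m: "k = Suc n1 + m" using less_iff_Suc_add by auto
    then have "m < n2" using k by simp
    then show ?thesis using C2 H(2) m by auto
   qed
  qed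
  then show "?j \<in> hQ (f ` {a..b})" "f ?Y \<in> frontier (Q ?j)" "f ?X \<in> frontier (Q ?j)" by blast+
 }
qed

text \<open>Disk by disk: if the path meets the new disk, the stretch from the first entry to the
  last exit is replaced by one jump over it, and the induction hypothesis is applied to the two
  remaining arcs.\<close>

lemma is_chain_exists:
 assumes "finite F" "continuous_on {a..b} f" "a <= b" "f a \<in> S" "f b \<in> S"
 shows "\<exists>n X Y j. is_chain f a b F n X Y j"
 using assms
proof (induction F arbitrary: a b)
 case empty
 then show ?case
  by (intro exI[of _ 0] exI[of _ "%_. a"] exI[of _ "%_. b"] exI) (auto simp: is_chain_def)
next
 case (insert i F)
 show ?case
 proof (cases "i \<in> hQ (f ` {a..b})")
  case False
  obtain n X Y j where "is_chain f a b F n X Y j" using insert by meson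
  moreover have "i \<notin> hQ (f ` {X k..Y k})" if "k <= n" for k
   using False hits_Icc_mono[of a "X k" "Y k" b f] that calculation unfolding is_chain_def by blast
  ultimately have "is_chain f a b (insert i F) n X Y j" unfolding is_chain_def by auto
  then show ?thesis by blast
 next
  case True
  then obtain ta where ta: "a <= ta" "ta <= b" "f ta \<in> Q i" by (auto simp: hits_def)
  obtain s where s: "a <= s" "s <= ta" "f s \<in> FQ i" "i \<notin> hQ (f ` {a..s})"
   using first_entry[OF insert.prems(1) ta] S_not_Q[OF insert.prems(3)] by blast
  obtain t where t: "ta <= t" "t <= b" "f t \<in> FQ i" "i \<notin> hQ (f ` {t..b})"
   using last_exit[OF insert.prems(1) ta] S_not_Q[OF insert.prems(4)] by blast
  have cont: "continuous_on {a..s} f" "continuous_on {t..b} f"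
   using s t ta by (auto intro!: continuous_on_subset[OF insert.prems(1)])
  have fS: "f s \<in> S" "f t \<in> S" using s(3) t(3) FQ_S by blast+
  obtain n1 X1 Y1 j1 where c1: "is_chain f a s F n1 X1 Y1 j1"
   using insert.IH[OF cont(1) s(1) insert.prems(3) fS(1)] by blast
  obtain n2 X2 Y2 j2 where c2: "is_chain f t b F n2 X2 Y2 j2"
   using insert.IH[OF cont(2) t(2) fS(2) insert.prems(4)] by blast
  have "is_chain f a s (insert i F) n1 X1 Y1 j1"
  proof -
   have "i \<notin> hQ (f ` {X1 k..Y1 k})" if "k <= n1" for k
    using s(4) hits_Icc_mono[of a "X1 k" "Y1 k" s f] that c1 unfolding is_chain_def by blast
   then show ?thesis using c1 unfolding is_chain_def by auto
  qed
  moreover have "is_chain f t b (insert i F) n2 X2 Y2 j2"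
  proof -
   have "i \<notin> hQ (f ` {X2 k..Y2 k})" if "k <= n2" for k
    using t(4) hits_Icc_mono[of t "X2 k" "Y2 k" b f] that c2 unfolding is_chain_def by blast
   then show ?thesis using c2 unfolding is_chain_def by auto
  qed
  ultimately show ?thesis
   using is_chain_append[of f a s "insert i F" n1 X1 Y1 j1 t b n2 X2 Y2 j2 i] True s t ta by fastforce
 qed
qed

lemma sum_disjoint_infsum_le:
 fixes h :: "nat => real" and H :: "nat => nat set"
 assumes sm: "h summable_on B" and nn: "!!i. 0 <= h i" and K: "finite K"
  and H: "!!k. k \<in> K ==> H k \<subseteq> B" "!!k l. k \<in> K ==> l \<in> K ==> k ~= l ==> H k Int H l = {}"
 shows "(\<Sum>k\<in>K. infsum h (H k)) <= infsum h B"
proof -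
 have sub: "h summable_on A" if "A \<subseteq> B" for A using sm that nn summable_on_sub by blast
 have "(\<Sum>k\<in>K. infsum h (H k)) = infsum h (\<Union>k\<in>K. H k)"
  using K H
 proof (induction K)
  case (insert x K)
  have "infsum h (H x Un (\<Union>k\<in>K. H k)) = infsum h (H x) + infsum h (\<Union>k\<in>K. H k)"
  proof (rule infsum_Un_disjoint)
   show "h summable_on H x" using insert by (intro sub) auto
   show "h summable_on (\<Union>k\<in>K. H k)" using insert by (intro sub) auto
   show "H x Int (\<Union>k\<in>K. H k) = {}" using insert by fastforce
  qed
  then show ?case using insert by simp
 qed simp
 also have "... <= infsum h B" using H(1) nn by (intro infsum_sub_mono[OF sm]) auto
 finally show ?thesis .
qed

text \<open>In a chain with the least number of pieces the jumps use distinct disks, and a disk is hit by at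
 most two pieces, which are then adjacent; otherwise one could take a shortcut.\<close>

lemma osr_upper_gradient:
 assumes u: "locally_bounded u" and g: "good_on u rh f a b" and rn: "!!i. 0 <= rh i"
  and S: "f a \<in> S" "f b \<in> S" and sm: "osr u summable_on hQ (f ` {a..b})"
 shows "\<bar>u (f a) - u (f b)\<bar> <= infsum (osr u) (hQ (f ` {a..b}))"
proof (rule field_le_epsilon)
 let ?H = "hQ (f ` {a..b})"
 fix e :: real assume "e > 0"
 have c: "continuous_on {a..b} f" and ab: "a <= b" and rs: "rh summable_on ?H"
  using g by (auto simp: good_on_def)
 have nn: "0 <= osr u i" for i by (rule osr_nonneg[OF u])
 \<comment> \<open>Pieces that avoid \<open>F\<close> cost little in terms of \<open>rh\<close>,
   while jumps are paid for by oscillations. This is how \<open>rh\<close> disappears from the final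
   bound.\<close>
 obtain F where F: "finite F" "F \<subseteq> ?H" "!!B. B \<subseteq> ?H - F ==> infsum rh B < e / 2"
  by (rule infsum_tail_small[OF rs rn, of "e/2"]) (use \<open>e > 0\<close> that in auto)
 define N where "N = (LEAST n. \<exists>X Y j. is_chain f a b F n X Y j)"
 have "\<exists>X Y j. is_chain f a b F N X Y j"
  unfolding N_def by (rule LeastI_ex) (rule is_chain_exists[OF F(1) c ab S])
 then obtain X Y j where ch: "is_chain f a b F N X Y j" by blast
 have least: "N <= n" if "is_chain f a b F n X' Y' j'" for n X' Y' j'
  unfolding N_def by (rule Least_le) (use that in blast)
 note C = ch[unfolded is_chain_def]
 have pc: "a <= X k" "X k <= Y k" "Y k <= b" "f (X k) \<in> S" "f (Y k) \<in> S" "hQ (f ` {X k..Y k}) Int F = {}"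
  if "k <= N" for k using C that by blast+
 have jp: "j k \<in> ?H" "f (Y k) \<in> frontier (Q (j k))" "f (X (Suc k)) \<in> frontier (Q (j k))" if "k < N" for k
  using C that by blast+
 \<comment> \<open>Two jumps over the same disk could be merged into one by dropping everything
   between them.\<close>
 have dist: "j k ~= j l" if kl: "k < l" "l < N" for k l
 proof
  assume eq: "j k = j l"
  define d where "d = l - k"
  have d: "d > 0" "l = k + d" using kl by (auto simp: d_def)
  have "is_chain f a b F (N - d) (%m. if m <= k then X m else X (m + d))
   (%m. if m <= k then Y m else Y (m + d)) (%m. if m < k then j m else j (m + d))"
   unfolding is_chain_def
  proof (intro conjI allI impI)
   show "(if 0 <= k then X 0 else X (0 + d)) = a" using C by simp
   show "(if N - d <= k then Y (N - d) else Y (N - d + d)) = b" using C kl d by auto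
   fix m assume m: "m <= N - d"
   define m' where "m' = (if m <= k then m else m + d)"
   have m': "m' <= N" "(if m <= k then X m else X (m + d)) = X m'" "(if m <= k then Y m else Y (m + d)) = Y m'"
    using m kl d by (auto simp: m'_def)
   show "a <= (if m <= k then X m else X (m + d))"
    "(if m <= k then X m else X (m + d)) <= (if m <= k then Y m else Y (m + d))"
    "(if m <= k then Y m else Y (m + d)) <= b"
    "f (if m <= k then X m else X (m + d)) \<in> S" "f (if m <= k then Y m else Y (m + d)) \<in> S"
    "hQ (f ` {(if m <= k then X m else X (m + d))..(if m <= k then Y m else Y (m + d))}) Int F = {}"
    unfolding m'(2,3) using pc[OF m'(1)] by blast+
  next
   fix m assume m: "m < N - d"
   have mN: "m + d < N" using m by simp
   have m1: "m < k ==> m < N" using kl by simp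
   show "(if m < k then j m else j (m + d)) \<in> ?H" using jp(1)[OF mN] jp(1) m1 by auto
   show "f (if m <= k then Y m else Y (m + d)) \<in> frontier (Q (if m < k then j m else j (m + d)))"
    using jp(2)[OF mN] jp(2)[of m] m1 jp(2)[of k] eq d kl by (cases "m = k") auto
   show "f (if Suc m <= k then X (Suc m) else X (Suc m + d)) \<in> frontier (Q (if m < k then j m else j (m + d)))"
    using jp(3)[OF mN] jp(3)[of m] m1 by auto
  qed
  then have "N <= N - d" by (rule least)
  then show False using d kl by simp
 qed
 \<comment> \<open>If two non-adjacent pieces met the same disk, a single jump from its first entry
   in piece \<open>k\<close> to its last exit in piece \<open>l\<close> would replace at least two
   jumps. For adjacent pieces nothing would be gained, which is why these may share a disk.\<close>
 have sep: "hQ (f ` {X k..Y k}) Int hQ (f ` {X l..Y l}) = {}" if kl: "Suc k < l" "l <= N" for k l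
 proof (rule ccontr)
  assume "\<not> ?thesis"
  then obtain i ta sg where i: "X k <= ta" "ta <= Y k" "f ta \<in> Q i" "X l <= sg" "sg <= Y l" "f sg \<in> Q i"
   by (auto simp: hits_def)
  have kN: "k <= N" using kl by simp
  have cc: "continuous_on {X k..Y k} f" "continuous_on {X l..Y l} f"
   using pc[OF kN] pc[OF kl(2)] by (auto intro!: continuous_on_subset[OF c])
  obtain s where s: "X k <= s" "s <= ta" "f s \<in> FQ i"
   using first_entry[OF cc(1) i(1-3)] S_not_Q[OF pc(4)[OF kN]] by blast
  obtain t where t: "sg <= t" "t <= Y l" "f t \<in> FQ i"
   using last_exit[OF cc(2) i(4-6)] S_not_Q[OF pc(5)[OF kl(2)]] by blast
  have iH: "i \<in> ?H" using i pc[OF kN] by (auto simp: hits_def)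
  have fS: "f s \<in> S" "f t \<in> S" using s(3) t(3) FQ_S by blast+
  have st: "s <= Y k" "X l <= t" using s t i by auto
  define d where "d = l - Suc k"
  have d: "d > 0" "l = Suc k + d" using kl by (auto simp: d_def)
  let ?X = "%m. if m <= k then X m else if m = Suc k then t else X (m + d)"
  let ?Y = "%m. if m < k then Y m else if m = k then s else Y (m + d)"
  let ?j = "%m. if m < k then j m else if m = k then i else j (m + d)"
  have piece: "a <= ?X m & ?X m <= ?Y m & ?Y m <= b & f (?X m) \<in> S & f (?Y m) \<in> S &
    hQ (f ` {?X m..?Y m}) Int F = {}" if m: "m <= N - d" for m
  proof -
   consider "m < k" | "m = k" | "m = Suc k" | "m > Suc k" by linarith
   then show ?thesis
   proof cases
    case 1
    then have "m <= N" using kl by simp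
    then show ?thesis using 1 pc[of m] by simp
   next
    case 2
    have "hQ (f ` {X k..s}) \<subseteq> hQ (f ` {X k..Y k})" using st by (intro hits_Icc_mono) auto
    then show ?thesis using 2 pc[OF kN] s st fS by auto
   next
    case 3
    have "hQ (f ` {t..Y l}) \<subseteq> hQ (f ` {X l..Y l})" using st by (intro hits_Icc_mono) auto
    then show ?thesis using 3 pc[OF kl(2)] t st fS d by auto
   next
    case 4
    then have "m + d <= N" using m by simp
    then show ?thesis using 4 pc[of "m + d"] by simp
   qed
  qed
  have jump: "?j m \<in> ?H & f (?Y m) \<in> frontier (Q (?j m)) & f (?X (Suc m)) \<in> frontier (Q (?j m))" if m: "m < N - d" for m
  proof -
   consider "m < k" | "m = k" | "m > k" by linarith
   then show ?thesis
   proof cases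
    case 1
    then have "m < N" using kl by simp
    then show ?thesis using 1 jp[of m] by simp
   next
    case 2 then show ?thesis using iH s t by simp
   next
    case 3
    then have "m + d < N" using m by simp
    then show ?thesis using 3 jp[of "m + d"] by simp
   qed
  qed
  have "is_chain f a b F (N - d) ?X ?Y ?j"
   unfolding is_chain_def
  proof (intro conjI)
   show "?X 0 = a" using C by simp
   show "?Y (N - d) = b" using C kl d by auto
  qed (use piece jump in blast)+
  then have "N <= N - d" by (rule least)
  then show False using d kl by simp
 qed
 define P where "P k = infsum rh (hQ (f ` {X k..Y k}))" for k
 have HF: "hQ (f ` {X k..Y k}) \<subseteq> ?H - F" if "k <= N" for k
  using pc[OF that] hits_Icc_mono[of a "X k" "Y k" b f] by blast
 have rF: "rh summable_on (?H - F)" by (rule summable_on_sub[OF rs]) (use rn in auto)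
 have half: "(\<Sum>k\<in>K. P k) <= e / 2" if K: "K \<subseteq> {..N}" "!!k l. k \<in> K ==> l \<in> K ==> k < l ==> Suc k < l" for K
 proof -
  have "(\<Sum>k\<in>K. P k) <= infsum rh (?H - F)"
   unfolding P_def
  proof (rule sum_disjoint_infsum_le[OF rF rn])
   show "finite K" using K(1) finite_subset by blast
   show "hQ (f ` {X k..Y k}) \<subseteq> ?H - F" if "k \<in> K" for k using that K(1) by (intro HF) auto
   show "hQ (f ` {X k..Y k}) Int hQ (f ` {X l..Y l}) = {}" if kl: "k \<in> K" "l \<in> K" "k ~= l" for k l
   proof (cases "k < l")
    case True
    then show ?thesis using sep[of k l] K kl by auto
   next
    case False
    then have "l < k" using kl by simp
    then show ?thesis using sep[of l k] K kl by auto
   qed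
  qed
  also have "... <= e / 2" using F(3)[OF order_refl] by simp
  finally show ?thesis .
 qed
 \<comment> \<open>Pieces of even index are pairwise non-adjacent and so meet disjoint sets of
   disks; likewise for odd indices. Each class costs at most \<open>e / 2\<close>.\<close>
 have "(\<Sum>k\<le>N. P k) = (\<Sum>k\<in>{k\<in>{..N}. even k}. P k) + (\<Sum>k\<in>{k\<in>{..N}. odd k}. P k)"
  by (subst sum.union_disjoint[symmetric]) (auto intro!: sum.cong)
 also have "... <= e / 2 + e / 2"
 proof (intro add_mono half)
  show "Suc k < l" if "k \<in> {k\<in>{..N}. even k}" "l \<in> {k\<in>{..N}. even k}" "k < l" for k l
   using that by (metis (mono_tags, lifting) Suc_lessI even_Suc mem_Collect_eq)
  show "Suc k < l" if "k \<in> {k\<in>{..N}. odd k}" "l \<in> {k\<in>{..N}. odd k}" "k < l" for k l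
   using that by (metis (mono_tags, lifting) Suc_lessI even_Suc mem_Collect_eq)
 qed auto
 finally have sumP: "(\<Sum>k\<le>N. P k) <= e" by simp
 have "inj_on j {..<N}" using dist unfolding inj_on_def by (metis lessThan_iff linorder_neqE_nat)
 then have "(\<Sum>k<N. osr u (j k)) = sum (osr u) (j ` {..<N})" by (simp add: sum.reindex)
 also have "... <= infsum (osr u) ?H" using jp(1) nn by (intro sum_le_infsum sm) auto
 finally have sumJ: "(\<Sum>k<N. osr u (j k)) <= infsum (osr u) ?H" .
 have tele: "\<bar>u (f (X 0)) - u (f (Y m))\<bar> <= (\<Sum>k\<le>m. P k) + (\<Sum>k<m. osr u (j k))" if "m <= N" for m
  using that
 proof (induction m)
  case 0
  have "\<bar>u (f (X 0)) - u (f (Y 0))\<bar> <= P 0"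
   using g pc[of 0] unfolding good_on_def P_def by blast
  then show ?case by simp
 next
  case (Suc m)
  have "\<bar>u (f (X (Suc m))) - u (f (Y (Suc m)))\<bar> <= P (Suc m)"
   using g pc[of "Suc m"] Suc.prems unfolding good_on_def P_def by blast
  moreover have "\<bar>u (f (Y m)) - u (f (X (Suc m)))\<bar> <= osr u (j m)"
   using Suc.prems by (intro abs_diff_le_osr[OF u] jp) auto
  ultimately show ?case using Suc by simp
 qed
 show "\<bar>u (f a) - u (f b)\<bar> <= infsum (osr u) ?H + e"
  using tele[OF order_refl] sumP sumJ C by simp
qed

end

section \<open>Cutting the exterior of a Jordan curve\<close>

text \<open>The loop is rotated to start at \<open>p\<close>: the parameters near both ends give an
  arc \<open>J1\<close> around \<open>p\<close>, the remaining ones the arc \<open>J2\<close>. These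
  arcs provide the connected intersections that Janiszewski's theorem asks for.\<close>

lemma jordan_curve_split:
 fixes c :: "real => complex"
 assumes c: "simple_path c" "pathfinish c = pathstart c" and p: "p \<in> path_image c" and e: "e > 0"
 obtains J1 J2 d where "compact J1" "connected J1" "compact J2" "connected J2" "J1 Un J2 = path_image c"
  "J1 \<subseteq> ball p e" "d > 0" "ball p d Int J2 = {}"
proof -
 obtain t where t: "t \<in> {0..1}" "c t = p" using p by (auto simp: path_image_def)
 define g where "g = shiftpath t c"
 have g: "simple_path g" "path_image g = path_image c" "pathstart g = p" "pathfinish g = p"
  using c t simple_path_shiftpath[OF c, of t] path_image_shiftpath[OF t(1) c(2)]
   pathstart_shiftpath[of t c] pathfinish_shiftpath[of t c] by (auto simp: g_def)
 have cg: "continuous_on {0..1} g" using g(1) by (simp add: simple_path_def path_def)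
 have g01: "g 0 = p" "g 1 = p" using g by (simp_all add: pathstart_def pathfinish_def)
 obtain h0 where h0: "h0 > 0" "!!s. s \<in> {0..1} ==> dist s 0 < h0 ==> dist (g s) (g 0) < e"
  using cg e unfolding continuous_on_iff by (metis atLeastAtMost_iff order_refl zero_le_one)
 obtain h1 where h1: "h1 > 0" "!!s. s \<in> {0..1} ==> dist s 1 < h1 ==> dist (g s) (g 1) < e"
  using cg e unfolding continuous_on_iff by (metis atLeastAtMost_iff order_refl zero_le_one)
 define h where "h = min (1/3) (min h0 h1 / 2)"
 have h: "0 < h" "h <= 1/3" "h < h0" "h < h1" using h0(1) h1(1) by (auto simp: h_def)
 define J1 where "J1 = g ` {0..h} Un g ` {1-h..1}"
 define J2 where "J2 = g ` {h..1-h}"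
 have ci: "compact (g ` {a..b})" "connected (g ` {a..b})" if "0 <= a" "b <= 1" for a b
  using that by (auto intro!: compact_continuous_image connected_continuous_image continuous_on_subset[OF cg])
 have "J1 \<subseteq> ball p e"
  using h0(2) h1(2) h g01 by (auto simp: J1_def dist_real_def dist_commute)
 moreover have "connected J1"
 proof -
  have "p \<in> g ` {0..h} Int g ` {1-h..1}"
   using h g01 image_eqI[of p g 0 "{0..h}"] image_eqI[of p g 1 "{1-h..1}"] by simp
  then show ?thesis unfolding J1_def using h by (intro connected_Un ci) auto
 qed
 moreover have "J1 Un J2 = path_image c"
 proof -
  have "{0..h} Un {1-h..1} Un {h..1-h} = {0..1}" using h by auto
  then have "J1 Un J2 = path_image g"
   unfolding J1_def J2_def path_image_def by (simp only: image_Un[symmetric])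
  then show ?thesis using g(2) by simp
 qed
 moreover have "p \<notin> J2"
 proof
  assume "p \<in> J2"
  then obtain s where s: "s \<in> {h..1-h}" "g s = g 0" using g01 by (auto simp: J2_def)
  have "\<forall>x\<in>{0..1}. \<forall>y\<in>{0..1}. g x = g y --> x = y | x = 0 & y = 1 | x = 1 & y = 0"
   using g(1) by (simp add: simple_path_def loop_free_def)
  from this[rule_format, of s 0] show False using s h by auto
 qed
 moreover have "compact J2" "compact J1" using ci h by (auto simp: J1_def J2_def)
 moreover have "connected J2" unfolding J2_def using h by (intro ci) auto
 moreover obtain d where d: "d > 0" "ball p d \<subseteq> - J2"
  using \<open>p \<notin> J2\<close> \<open>compact J2\<close> by (meson ComplI compact_imp_closed open_Compl open_contains_ball)
 moreover have "ball p d Int J2 = {}" using d(2) by blast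
 ultimately show thesis by (intro that)
qed

lemma connected_subset_outside:
 fixes C J :: "complex set"
 assumes "connected C" "C Int J = {}" "C Int outside J ~= {}" "closed J"
 shows "C \<subseteq> outside J"
proof -
 have "C \<subseteq> inside J Un outside J" using assms(2) inside_Un_outside[of J] by blast
 moreover have "open (inside J)" "open (outside J)" using assms(4) by (auto intro: open_inside open_outside)
 moreover have "inside J Int outside J = {}" by (rule inside_Int_outside)
 ultimately have "inside J Int C = {} | outside J Int C = {}"
  using connectedD[OF assms(1), of "inside J" "outside J"] by blast
 then show ?thesis using assms(3) \<open>C \<subseteq> inside J Un outside J\<close> by blast
qed

text \<open>\<open>K\<close> is the closed Jordan domain bounded by \<open>J\<close>, written as the
  complement of the exterior, in which all separation arguments take place.\<close>

locale jordan_curve =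
 fixes c :: "real => complex" and J K :: "complex set"
 assumes c: "simple_path c" "pathfinish c = pathstart c"
 defines "J \<equiv> path_image c" and "K \<equiv> - outside J"
begin

lemma J_facts: "compact J" "closed J" "connected (outside J)" "open (outside J)" "\<not> bounded (outside J)"
 "frontier (outside J) = J" "J \<subseteq> K" "connected K" "closed K" "compact K"
proof -
 note F = Jordan_inside_outside[OF c, folded J_def]
 show "compact J" "closed J" unfolding J_def using c by (auto intro: compact_simple_path_image compact_imp_closed)
 show "connected (outside J)" "open (outside J)" "\<not> bounded (outside J)" "frontier (outside J) = J"
  using F by auto
 show "J \<subseteq> K" unfolding K_def using outside_no_overlap by blast
 have K: "K = inside J Un J" unfolding K_def using inside_Un_outside[of J] inside_Int_outside[of J]
   inside_no_overlap[of J] outside_no_overlap[of J] by blast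
 then have K': "K = closure (inside J)" using F closure_Un_frontier[of "inside J"] by auto
 then show "connected K" using F connected_imp_connected_closure by auto
 show "closed K" using K' by simp
 show "compact K" using K' F compact_closure by auto
qed

text \<open>Janiszewski's theorem for \<open>J\<close> and the union of the sphere with the far arc
  \<open>J2\<close>: they meet exactly in the connected set \<open>J2\<close>, and neither separates
  the two points. A connected set avoiding both then stays in the ball and in the exterior.\<close>

lemma exterior_locally_connected:
 assumes p: "p \<in> J" and e: "e > 0"
 obtains d where "d > 0" "d <= e"
  "!!y y'. y \<in> ball p d - K ==> y' \<in> ball p d - K ==> connected_component (ball p e - K) y y'"
proof -
 obtain J1 J2 d where J: "compact J1" "connected J1" "compact J2" "connected J2" "J1 Un J2 = J"
  "J1 \<subseteq> ball p e" "d > 0" "ball p d Int J2 = {}"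
  using jordan_curve_split[OF c p[unfolded J_def] e] unfolding J_def by metis
 define r where "r = min d e"
 have r: "r > 0" "r <= e" "r <= d" using J e by (auto simp: r_def)
 have "connected_component (ball p e - K) y y'" if y: "y \<in> ball p r - K" "y' \<in> ball p r - K" for y y'
 proof -
  let ?T = "sphere p e Un J2"
  have out: "y \<in> outside J" "y' \<in> outside J" using y by (auto simp: K_def)
  have "connected_component (- (J Un ?T)) y y'"
  proof (rule Janiszewski)
   show "compact J" by (rule J_facts)
   show "closed ?T" using J by (intro closed_Un) (auto intro: compact_imp_closed)
   have "J Int ?T = J2" using J by (auto simp: subset_iff)
   then show "connected (J Int ?T)" using J by simp
   show "connected_component (- J) y y'"
    unfolding connected_component_def using J_facts(3) out outside_no_overlap[of J]
    by (intro exI[of _ "outside J"]) blast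
   show "connected_component (- ?T) y y'"
    unfolding connected_component_def using y r J(8)
    by (intro exI[of _ "ball p r"]) (auto simp: disjoint_iff)
  qed
  then obtain C where C: "connected C" "C \<subseteq> - (J Un ?T)" "y \<in> C" "y' \<in> C"
   unfolding connected_component_def by blast
  have "C \<subseteq> outside J"
   using C out J_facts(2) by (intro connected_subset_outside) auto
  moreover have "C \<subseteq> ball p e"
  proof (rule ccontr)
   assume "\<not> ?thesis"
   then have "C Int frontier (ball p e) ~= {}"
    using C y r by (intro connected_Int_frontier) auto
   then show False using C e by auto
  qed
  ultimately show ?thesis unfolding connected_component_def using C by (auto simp: K_def)
 qed
 then show thesis using that r by blast
qed

lemma outside_point_near:
 assumes "p \<in> J" "e > 0" obtains y where "y \<in> ball p e - K"
proof -
 have "p \<in> closure (outside J)" using assms J_facts(6) by (auto simp: frontier_def)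
 then obtain y where "y \<in> outside J" "dist y p < e" using assms(2) closure_approachable by blast
 then show thesis using that[of y] by (auto simp: K_def dist_commute)
qed

text \<open>A loop around \<open>x\<close> contains an arc which, together with the Jordan domain, cuts off a small
 region containing all exterior points near \<open>x\<close>: by Janiszewski's theorem some single arc separates.\<close>

lemma separating_arc:
 fixes f :: "real => complex"
 assumes x: "y0 \<notin> K" "z0 \<notin> K" and f: "t0 < t1" "continuous_on {t0..t1} f" "inj_on f {t0<..<t1}"
   "f t0 \<in> K" "f t1 \<in> K"
  and sep: "\<not> connected_component (- (f ` {t0..t1})) y0 z0"
 obtains a b where "t0 <= a" "a < b" "b <= t1" "f ` {a<..<b} Int K = {}" "f a \<in> K" "f b \<in> K"
  "\<not> connected_component (- (K Un f ` {a..b})) y0 z0"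
proof -
 \<comment> \<open>A compact curve from \<open>y0\<close> to \<open>z0\<close> in the exterior. By
   compactness the times at which the loop meets it fall into finitely many arcs, which reduces the
   argument to a finite union.\<close>
 obtain P where P: "compact P" "connected P" "P Int K = {}" "y0 \<in> P" "z0 \<in> P"
 proof -
  have "path_connected (outside J)" using J_facts by (simp add: connected_open_path_connected)
  then obtain g where "path g" "path_image g \<subseteq> outside J" "pathstart g = y0" "pathfinish g = z0"
   using x bspec[OF bspec[OF iffD1[OF path_connected_def], of "outside J" y0], of z0]
   unfolding K_def by blast
  then show thesis using that[of "path_image g"] by (auto simp: K_def compact_path_image connected_path_image)
 qed
 \<comment> \<open>The components of \<open>U\<close> are the maximal open arcs of the loop outside
   \<open>K\<close>; their endpoints are mapped into \<open>K\<close>.\<close>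
 define U where "U = {t \<in> {t0<..<t1}. f t \<notin> K}"
 have "open U"
 proof -
  have "open ({t0<..<t1} Int f -` (- K))"
   using J_facts(9) f(2) by (intro continuous_open_preimage continuous_on_subset[OF f(2)]) (auto simp: open_Compl)
  then show ?thesis by (simp add: U_def Int_def)
 qed
 have comp: "\<exists>a b. I = {a<..<b} & t0 <= a & a < b & b <= t1 & f a \<in> K & f b \<in> K" if I: "I \<in> components U" for I
 proof -
  have IU: "I \<subseteq> U" "I ~= {}" "connected I" "open I"
   using I \<open>open U\<close> in_components_subset in_components_nonempty in_components_connected open_components by auto
  have I01: "I \<subseteq> {t0..t1}" using IU(1) unfolding U_def by auto
  have bd: "bdd_below I" "bdd_above I"
   using bdd_below_mono[OF bdd_below_Icc I01] bdd_above_mono[OF bdd_above_Icc I01] by auto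
  define a where "a = Inf I"
  define b where "b = Sup I"
  have notin: "a \<notin> I" "b \<notin> I"
  proof -
   show "a \<notin> I"
   proof
    assume "a \<in> I"
    then obtain e where "e > 0" "ball a e \<subseteq> I" using IU(4) open_contains_ball by blast
    then have "a - e/2 \<in> I" by (auto simp: dist_real_def subset_iff)
    then show False using cInf_lower[OF _ bd(1)] \<open>e > 0\<close> by (force simp: a_def)
   qed
   show "b \<notin> I"
   proof
    assume "b \<in> I"
    then obtain e where "e > 0" "ball b e \<subseteq> I" using IU(4) open_contains_ball by blast
    then have "b + e/2 \<in> I" by (auto simp: dist_real_def subset_iff)
    then show False using cSup_upper[OF _ bd(2)] \<open>e > 0\<close> by (force simp: b_def)
   qed
  qed
  have I_eq: "I = {a<..<b}"
  proof
   show "I \<subseteq> {a<..<b}"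
   proof
    fix t assume "t \<in> I"
    then have "a <= t" "t <= b" "a ~= t" "t ~= b"
    using cInf_lower[OF _ bd(1)] cSup_upper[OF _ bd(2)] notin by (auto simp: a_def b_def)
    then show "t \<in> {a<..<b}" by auto
   qed
   show "{a<..<b} \<subseteq> I"
   proof
    fix t assume "t \<in> {a<..<b}"
    then obtain u w where "u \<in> I" "u < t" "w \<in> I" "t < w"
    using cInf_lessD[OF IU(2), of t] less_cSupD[OF IU(2), of t] by (auto simp: a_def b_def)
    then show "t \<in> I" using connected_contains_Icc[OF IU(3), of u w] by auto
   qed
  qed
  have ab: "a < b" using I_eq IU(2) by auto
  have lim: "t0 <= a" "b <= t1"
  proof -
   show "t0 <= a" unfolding a_def using IU(2) by (rule cInf_greatest) (use I01 in auto)
   show "b <= t1" unfolding b_def using IU(2) by (rule cSup_least) (use I01 in auto)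
  qed
  have ext: "I = V" if "V \<subseteq> U" "connected V" "I \<subseteq> V" for V
   using I[unfolded in_components_maximal] that IU(2) by (metis subset_empty)
  have "f a \<in> K"
  proof (rule ccontr)
   assume "f a \<notin> K"
   then have "a \<in> U" using lim f(4) ab by (cases "a = t0") (auto simp: U_def)
   have "{a..<b} = I"
    by (rule ext[symmetric]) (use IU(1) I_eq \<open>a \<in> U\<close> in \<open>auto simp: less_le\<close>)
   then show False using notin ab by auto
  qed
  moreover have "f b \<in> K"
  proof (rule ccontr)
   assume "f b \<notin> K"
   then have "b \<in> U" using lim f(5) ab by (cases "b = t1") (auto simp: U_def)
   have "{a<..b} = I"
    by (rule ext[symmetric]) (use IU(1) I_eq \<open>b \<in> U\<close> in \<open>auto simp: less_le\<close>)
   then show False using notin ab by auto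
  qed
  ultimately show ?thesis using I_eq ab lim by blast
 qed
 define T' where "T' = {t \<in> {t0..t1}. f t \<in> P}"
 have "compact T'"
 proof -
  have "closedin (top_of_set {t0..t1}) ({t0..t1} Int f -` P)"
   using f(2) P(1) by (intro continuous_closedin_preimage compact_imp_closed)
  then have "compact ({t0..t1} Int f -` P)" using closedin_compact compact_Icc by blast
  then show ?thesis by (simp add: T'_def Int_def)
 qed
 moreover have "T' \<subseteq> \<Union>(components U)"
 proof -
  have "t \<in> U" if "t \<in> T'" for t
  proof -
   have "f t \<notin> K" using that P(3) by (auto simp: T'_def)
   then have "t ~= t0" "t ~= t1" using f by auto
   then show ?thesis using that \<open>f t \<notin> K\<close> by (auto simp: T'_def U_def)
  qed
  then show ?thesis by (simp add: Union_components subset_iff)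
 qed
 ultimately obtain F where F: "F \<subseteq> components U" "finite F" "T' \<subseteq> \<Union>F"
  using compactE[of T' "components U"] open_components[OF \<open>open U\<close>] by metis
 have "\<exists>I\<in>F. \<not> connected_component (- (K Un f ` I)) y0 z0"
 proof (rule ccontr)
  assume "\<not> ?thesis"
  then have cc: "connected_component (- (K Un f ` I)) y0 z0" if "I \<in> F" for I using that by blast
  \<comment> \<open>If no single arc separates, start from \<open>K\<close> and the rest of the
    loop, which do not separate because \<open>P\<close> avoids them, and add the arcs of
    \<open>F\<close> one at a time. By injectivity of the loop each new set meets the previous union
    exactly in \<open>K\<close>, which is connected, so Janiszewski's theorem applies at every
    step.\<close>
  define R where "R = {t0..t1} - \<Union>F"
  have "open (\<Union>F)" using F open_components[OF \<open>open U\<close>] by blast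
  then have "compact R" unfolding R_def by (intro compact_diff compact_Icc)
  then have cR: "compact (f ` R)"
   by (intro compact_continuous_image continuous_on_subset[OF f(2)]) (auto simp: R_def)
  have "connected_component (- (K Un f ` R)) y0 z0"
  proof -
   have "P Int f ` R = {}" using F(3) by (auto simp: R_def T'_def)
   then show ?thesis unfolding connected_component_def using P by (intro exI[of _ P]) auto
  qed
  have KI: "compact (K Un f ` I)" "f ` I Int K = {}" if "I \<in> components U" for I
  proof -
   obtain a b where ab: "I = {a<..<b}" "t0 <= a" "a < b" "b <= t1" "f a \<in> K" "f b \<in> K"
    using comp[OF \<open>I \<in> components U\<close>] by blast
   have "{a..b} = insert a (insert b I)" using ab by auto
   then have "K Un f ` I = K Un f ` {a..b}" using ab(5,6) by (simp add: insert_absorb)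
   moreover have "compact (f ` {a..b})"
    by (rule compact_continuous_image[OF continuous_on_subset[OF f(2)] compact_Icc]) (use ab(2,4) in auto)
   ultimately show "compact (K Un f ` I)" using J_facts(10) by (metis compact_Un)
   show "f ` I Int K = {}" using in_components_subset[OF \<open>I \<in> components U\<close>] by (auto simp: U_def)
  qed
  have ind: "connected_component (- ((K Un f ` R) Un (\<Union>I\<in>G. K Un f ` I))) y0 z0" if "finite G" "G \<subseteq> F" for G
   using that
  proof (induction G)
   case empty
   then show ?case using \<open>connected_component (- (K Un f ` R)) y0 z0\<close> by simp
  next
   case (insert I G)
   let ?T = "(K Un f ` R) Un (\<Union>I\<in>G. K Un f ` I)"
   have IF: "I \<in> F" "I \<in> components U" using insert F by auto
   have "connected_component (- ((K Un f ` I) Un ?T)) y0 z0"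
   proof (rule Janiszewski)
    show "compact (K Un f ` I)" by (rule KI(1)[OF IF(2)])
    show "closed ?T"
    proof (intro compact_imp_closed compact_Un[OF compact_Un[OF J_facts(10) cR]] compact_UN)
    show "finite G" using insert by simp
    show "compact (K Un f ` I')" if "I' \<in> G" for I' using that insert.prems F(1) by (intro KI(1)) auto
    qed
    have "f s \<notin> ?T" if "s \<in> I" for s
    proof
    assume "f s \<in> ?T"
    moreover have sU: "s \<in> U" using that in_components_subset[OF IF(2)] by blast
    moreover have "f s \<notin> K" using sU by (simp add: U_def)
    ultimately have "f s \<in> f ` R | (\<exists>I'\<in>G. f s \<in> f ` I')" by blast
    then obtain t where t: "t \<in> R | (\<exists>I'\<in>G. t \<in> I')" "f s = f t" by blast
    have t01: "t \<in> {t0..t1}" using t(1) in_components_subset F(1) insert.prems by (fastforce simp: R_def U_def)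
    moreover have "t ~= t0" "t ~= t1" using t(2) f(4,5) \<open>f s \<notin> K\<close> by auto
    ultimately have "t = s" using f(3) t(2) sU by (auto simp: U_def inj_on_def)
    then show False
    proof (cases "t \<in> R")
    case True then show False using \<open>t = s\<close> that IF(1) by (auto simp: R_def)
    next
    case False
    then obtain I' where I': "I' \<in> G" "t \<in> I'" using t(1) by blast
    then have "I' \<in> components U" "I' ~= I" using F(1) insert by auto
    then have "I' Int I = {}" using pairwise_disjoint_components[of U] IF(2) by (auto simp: pairwise_def)
    then show False using I' \<open>t = s\<close> that by blast
    qed
    qed
    then have "(K Un f ` I) Int ?T = K" by blast
    then show "connected ((K Un f ` I) Int ?T)" using J_facts(8) by simp
    show "connected_component (- (K Un f ` I)) y0 z0" by (rule cc[OF IF(1)])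
    show "connected_component (- ?T) y0 z0" using insert by auto
   qed
   then show ?case by (simp add: Un_ac)
  qed
  have "f ` {t0..t1} \<subseteq> (K Un f ` R) Un (\<Union>I\<in>F. K Un f ` I)" by (auto simp: R_def)
  then show False
   using ind[OF F(2) order_refl] sep connected_component_mono[of "- ((K Un f ` R) Un (\<Union>I\<in>F. K Un f ` I))" "- f ` {t0..t1}" y0]
   by (meson Compl_anti_mono connected_component_of_subset)
 qed
 then obtain I where I: "I \<in> F" "\<not> connected_component (- (K Un f ` I)) y0 z0" by blast
 then obtain a b where ab: "I = {a<..<b}" "t0 <= a" "a < b" "b <= t1" "f a \<in> K" "f b \<in> K"
  using comp[of I] F(1) by blast
 have "{a..b} = insert a (insert b I)" using ab by auto
 then have "K Un f ` I = K Un f ` {a..b}" using ab by auto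
 moreover have "f ` {a<..<b} Int K = {}" using ab(1) in_components_subset[of I U] I F(1) by (auto simp: U_def)
 ultimately show thesis using that[of a b] ab I(2) by simp
qed

text \<open>\<open>W\<close> is the component, off \<open>K\<close> and the separating arc, that
  holds the exterior points near \<open>x\<close>. The list of its properties is what the maximum
  principle needs: a small region bounded by \<open>K\<close> and the arc, which near a boundary
  point in \<open>K\<close> off the arc contains all of the exterior, and whose closure reaches the
  open arc.\<close>

lemma exterior_arc_region:
 assumes x: "x \<in> J" and e: "e > 0"
 obtains d where "d > 0"
  "!!(f :: real => complex) t0 t1 r. [|t0 < t1; continuous_on {t0..t1} f; inj_on f {t0<..<t1}; f t0 \<in> K; f t1 \<in> K;
   f ` {t0..t1} \<subseteq> ball x d; r > 0; ball x r Int f ` {t0..t1} = {};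
   !!y z. y \<in> ball x r ==> z \<notin> ball x e ==> \<not> connected_component (- (f ` {t0..t1})) y z|] ==>
   \<exists>a b W. t0 <= a & a < b & b <= t1 & f ` {a<..<b} Int K = {} & f a \<in> K & f b \<in> K &
    open W & connected W & W \<subseteq> ball x e & (\<exists>rh>0. ball x rh - K \<subseteq> W) &
    W Int (K Un f ` {a..b}) = {} & frontier W \<subseteq> K Un f ` {a..b} &
    (\<forall>p\<in>(K Int closure W) - f ` {a..b}. \<exists>rh>0. ball p rh - K \<subseteq> W) &
    (\<exists>t\<in>{a<..<b}. f t \<in> closure W)"
proof -
 obtain J1 J2 d1 where J: "compact J1" "connected J1" "compact J2" "connected J2" "J1 Un J2 = J"
  "J1 \<subseteq> ball x e" "d1 > 0" "ball x d1 Int J2 = {}"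
  using jordan_curve_split[OF c x[unfolded J_def] e] unfolding J_def by metis
 \<comment> \<open>Within \<open>ball x d\<close> the curve \<open>J\<close> is seen only through
   \<open>J1\<close>, and \<open>J1\<close> stays inside \<open>ball x e\<close>.\<close>
 define d where "d = min d1 e"
 have d: "d > 0" "d <= d1" "d <= e" using J e by (auto simp: d_def)
 show thesis
 proof (rule that[OF d(1)])
  fix f :: "real => complex" and t0 t1 r
  assume f: "t0 < t1" "continuous_on {t0..t1} f" "inj_on f {t0<..<t1}" "f t0 \<in> K" "f t1 \<in> K"
   and fd: "f ` {t0..t1} \<subseteq> ball x d" and r: "r > (0::real)" "ball x r Int f ` {t0..t1} = {}"
   and sep: "!!y z. y \<in> ball x r ==> z \<notin> ball x e ==> \<not> connected_component (- (f ` {t0..t1})) y z"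
  obtain rh where rh: "rh > 0" "rh <= r"
   "!!y y'. y \<in> ball x rh - K ==> y' \<in> ball x rh - K ==> connected_component (ball x r - K) y y'"
   using exterior_locally_connected[OF x r(1)] by blast
  obtain y0 where y0: "y0 \<in> ball x rh - K" using outside_point_near[OF x rh(1)] by blast
  obtain z0 where z0: "z0 \<in> outside J" "z0 \<notin> ball x e"
   using J_facts(5) bounded_subset[OF bounded_ball] by blast
  have z0K: "z0 \<notin> K" using z0 by (simp add: K_def)
  have sep0: "\<not> connected_component (- (f ` {t0..t1})) y0 z0" using sep y0 rh z0 by auto
  obtain a b where ab: "t0 <= a" "a < b" "b <= t1" "f ` {a<..<b} Int K = {}" "f a \<in> K" "f b \<in> K"
   "\<not> connected_component (- (K Un f ` {a..b})) y0 z0"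
   using separating_arc[of y0 z0 t0 t1 f] y0 z0K f sep0 by blast
  define A where "A = f ` {a..b}"
  have "{a..b} \<subseteq> {t0..t1}" using ab(1-3) by auto
  then have cA: "compact A" unfolding A_def
   by (intro compact_continuous_image continuous_on_subset[OF f(2)] compact_Icc)
  have Asub: "A \<subseteq> f ` {t0..t1}" using ab by (auto simp: A_def)
  define W where "W = connected_component_set (- (K Un A)) y0"
  have KAo: "open (- (K Un A))"
   using J_facts(9) compact_imp_closed[OF cA] by (intro open_Compl closed_Un)
  have A_in: "f t \<notin> K" if "t \<in> {a<..<b}" for t using ab(4) that by blast
  have ball_in: "ball x r - K \<subseteq> - (K Un A)" using r(2) Asub by blast
  have "y0 \<in> ball x r - K" using y0 rh(2) by auto
  then have y0KA: "y0 \<in> - (K Un A)" using ball_in by blast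
  have Wo: "open W" "connected W" "y0 \<in> W" "W \<subseteq> - (K Un A)"
   unfolding W_def using KAo y0KA connected_component_subset
   by (auto intro: open_connected_component)
  have W_max: "T \<subseteq> W" if T: "connected T" "T \<subseteq> - (K Un A)" "T Int W ~= {}" for T
  proof -
   obtain w where w: "w \<in> T" "connected_component (- (K Un A)) y0 w" using T(3) by (auto simp: W_def)
   have "connected_component_set (- (K Un A)) w = W"
    unfolding W_def using w(2) connected_component_eq by fastforce
   then show ?thesis using connected_component_maximal[OF w(1) T(1,2)] by simp
  qed
  have W_local: "ball p s' - K \<subseteq> W" if p: "ball p e' Int A = {}" and s': "s' <= e'"
   and cc: "!!y y'. y \<in> ball p s' - K ==> y' \<in> ball p s' - K ==> connected_component (ball p e' - K) y y'"
   and w: "w \<in> ball p s'" "w \<in> W" for p s' e' w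
  proof
   fix y assume y: "y \<in> ball p s' - K"
   have "w \<in> ball p s' - K" using w Wo(4) by auto
   then obtain T where T: "connected T" "T \<subseteq> ball p e' - K" "w \<in> T" "y \<in> T"
    using cc[of w y] y unfolding connected_component_def by blast
   have "T \<subseteq> W" using T p w by (intro W_max) auto
   then show "y \<in> W" using T by blast
  qed
  have z0W: "z0 \<notin> W" using ab(7) by (simp add: W_def A_def)
  \<comment> \<open>A point of \<open>W\<close> outside the ball could be joined to
    \<open>z0\<close>: the ball contains \<open>J1\<close> and the arc, so these do not separate the
    two points; neither does \<open>J\<close>, and \<open>J\<close> meets their union exactly in the
    connected set \<open>J1\<close>. Then \<open>z0\<close> would lie in \<open>W\<close>.\<close>
  have W1: "W \<subseteq> ball x e"
  proof
   fix p assume pW: "p \<in> W"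
   show "p \<in> ball x e"
   proof (rule ccontr)
    assume pe: "p \<notin> ball x e"
    have pout: "p \<in> outside J" using pW Wo(4) by (auto simp: K_def)
    have "A \<subseteq> ball x d1" using Asub fd d by (meson order_trans subset_ball)
    then have AJ: "A Int J \<subseteq> J1" using J(5,8) by blast
    have Ae: "A \<subseteq> ball x e" using Asub fd d by (meson order_trans subset_ball)
    have "connected_component (- (J Un (J1 Un A))) p z0"
    proof (rule Janiszewski)
    show "compact J" by (rule J_facts)
    show "closed (J1 Un A)" using J(1) cA by (intro closed_Un compact_imp_closed)
    have "J Int (J1 Un A) = J1" using AJ J(5) by blast
    then show "connected (J Int (J1 Un A))" using J(2) by simp
    show "connected_component (- J) p z0"
    unfolding connected_component_def using J_facts(3) pout z0(1) outside_no_overlap[of J]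
    by (intro exI[of _ "outside J"]) blast
    have "connected (- ball x e)"
    by (rule connected_complement_bounded_convex) auto
    then show "connected_component (- (J1 Un A)) p z0"
    unfolding connected_component_def using pe z0(2) J(6) Ae
    by (intro exI[of _ "- ball x e"]) blast
    qed
    then obtain T where T: "connected T" "T \<subseteq> - (J Un (J1 Un A))" "p \<in> T" "z0 \<in> T"
    unfolding connected_component_def by blast
    have "T \<subseteq> outside J" using T pout J_facts(2) by (intro connected_subset_outside) auto
    then have "T \<subseteq> - (K Un A)" using T(2) by (auto simp: K_def)
    then have "T \<subseteq> W" using T pW by (intro W_max) auto
    then show False using T(4) z0W by blast
   qed
  qed
  have W2: "ball x rh - K \<subseteq> W"
  proof (rule W_local)
   show "ball x r Int A = {}" using r(2) Asub by blast
   show "y0 \<in> ball x rh" using y0 by simp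
  qed (use rh Wo in auto)
  have fr: "frontier W \<subseteq> K Un A"
  proof
   fix z assume z: "z \<in> frontier W"
   show "z \<in> K Un A"
   proof (rule ccontr)
    assume "z \<notin> K Un A"
    then obtain s where s: "s > 0" "ball z s \<subseteq> - (K Un A)" using KAo open_contains_ball by blast
    have "z \<in> closure W" using z by (simp add: frontier_def)
    then obtain w where "w \<in> W" "dist w z < s" using s(1) closure_approachable by blast
    then have "ball z s \<subseteq> W" using s by (intro W_max) (auto simp: dist_commute disjoint_iff)
    then have "z \<in> interior W" using s(1) by (meson centre_in_ball interior_maximal open_ball subsetD)
    then show False using z by (simp add: frontier_def)
   qed
  qed
  \<comment> \<open>Such a point lies on \<open>J\<close>, because the inside of the curve is an
    open set disjoint from \<open>W\<close>. Local connectedness of the exterior then puts all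
    nearby exterior points into the component \<open>W\<close>.\<close>
  have W3: "\<exists>rh>0. ball p rh - K \<subseteq> W" if p: "p \<in> (K Int closure W) - A" for p
  proof -
   have "p \<in> J"
   proof (rule ccontr)
    assume "p \<notin> J"
    then have "p \<in> inside J" using p inside_Un_outside[of J] unfolding K_def by blast
    moreover have "open (inside J)" using J_facts(2) by (rule open_inside)
    moreover have "inside J Int W = {}" using Wo(4) inside_Int_outside[of J] unfolding K_def by blast
    ultimately show False using p open_Int_closure_eq_empty[of "inside J" W] by auto
   qed
   obtain e' where e': "e' > 0" "ball p e' \<subseteq> - A"
    using p cA by (meson ComplI DiffD2 compact_imp_closed open_Compl open_contains_ball)
   obtain s' where s': "s' > 0" "s' <= e'"
    "!!y y'. y \<in> ball p s' - K ==> y' \<in> ball p s' - K ==> connected_component (ball p e' - K) y y'"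
    using exterior_locally_connected[OF \<open>p \<in> J\<close> e'(1)] by blast
   obtain w where "w \<in> W" "dist w p < s'" using p s'(1) closure_approachable by blast
   then have "ball p s' - K \<subseteq> W"
    using e' s' by (intro W_local[of p e' s' w]) (auto simp: dist_commute)
   then show ?thesis using s' by blast
  qed
  \<comment> \<open>Otherwise the boundary of \<open>W\<close> lies in \<open>K\<close>, so that
    \<open>W\<close> contains the whole exterior, including \<open>z0\<close>.\<close>
  have W4: "\<exists>t\<in>{a<..<b}. f t \<in> closure W"
  proof (rule ccontr)
   assume no: "\<not> ?thesis"
   have sub: "frontier W \<subseteq> K"
   proof
    fix z assume z: "z \<in> frontier W"
    show "z \<in> K"
    proof (rule ccontr)
    assume "z \<notin> K"
    then obtain t where "t \<in> {a..b}" "z = f t" using fr z by (auto simp: A_def)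
    moreover have "t ~= a" "t ~= b" using \<open>z \<notin> K\<close> \<open>z = f t\<close> ab by auto
    ultimately show False using no z by (auto simp: frontier_def)
    qed
   qed
   have "outside J \<subseteq> W"
   proof (rule ccontr)
    assume "\<not> ?thesis"
    then have "outside J Int frontier W ~= {}"
    using J_facts(3) y0 Wo(3) by (intro connected_Int_frontier) (auto simp: K_def)
    then show False using sub by (auto simp: K_def)
   qed
   then show False using z0 z0W by blast
  qed
  show "\<exists>a b W. t0 <= a & a < b & b <= t1 & f ` {a<..<b} Int K = {} & f a \<in> K & f b \<in> K &
    open W & connected W & W \<subseteq> ball x e & (\<exists>rh>0. ball x rh - K \<subseteq> W) &
    W Int (K Un f ` {a..b}) = {} & frontier W \<subseteq> K Un f ` {a..b} &
    (\<forall>p\<in>(K Int closure W) - f ` {a..b}. \<exists>rh>0. ball p rh - K \<subseteq> W) &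
    (\<exists>t\<in>{a<..<b}. f t \<in> closure W)"
  proof (rule exI[of _ a], rule exI[of _ b], rule exI[of _ W], intro conjI)
   show "\<exists>rh>0. ball x rh - K \<subseteq> W" using W2 rh(1) by (intro exI[of _ rh] conjI)
   show "W Int (K Un f ` {a..b}) = {}" using Wo(4) unfolding A_def by blast
   show "frontier W \<subseteq> K Un f ` {a..b}" using fr unfolding A_def .
   show "\<forall>p\<in>(K Int closure W) - f ` {a..b}. \<exists>rh>0. ball p rh - K \<subseteq> W"
    by (intro ballI W3[unfolded A_def])
  qed (fact ab Wo W1 W4)+
 qed
qed

end

section \<open>Real-valued Sobolev functions\<close>

context sierpinski_carpet begin

definition loc_l2 :: "(nat => real) => bool" where
 "loc_l2 rh \<longleftrightarrow> (\<forall>V. cc V --> (%i. (rh i)^2) summable_on hQ V)"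

lemma loc_l2_le:
 assumes "loc_l2 a" "!!i. \<bar>b i\<bar> <= \<bar>a i\<bar>" shows "loc_l2 b"
 unfolding loc_l2_def
proof (intro allI impI)
 fix V assume "cc V"
 then have "(%i. (a i)^2) summable_on hQ V" using assms(1) by (simp add: loc_l2_def)
 then show "(%i. (b i)^2) summable_on hQ V"
  by (rule summable_on_le) (use assms(2) abs_le_square_iff in auto)
qed

lemma loc_l2_add: "loc_l2 a ==> loc_l2 b ==> loc_l2 (%i. a i + b i)"
 unfolding loc_l2_def using summable_on_square_add by blast

lemma loc_l2_cmult: "loc_l2 a ==> loc_l2 (%i. c * a i)"
 unfolding loc_l2_def by (simp add: power_mult_distrib summable_on_cmult_right)

lemma loc_l2_diameter: "loc_l2 (%i. dQ i)"
 unfolding loc_l2_def using summable_diameter compactly_contained_bounded by blast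

lemma diameter_bound:
 assumes "bounded V"
 obtains D where "D > 0" "!!i. i \<in> hQ V ==> dQ i <= D"
proof -
 define A where "A = (infsum (%i. (dQ i)^2) (hQ V))"
 have "A >= 0" unfolding A_def by (intro infsum_nonneg) simp
 have "dQ i <= sqrt (A + 1)" if "i \<in> hQ V" for i
 proof (rule real_le_rsqrt)
  show "(dQ i)^2 <= A + 1"
   using elem_le_infsum[OF summable_diameter[OF assms] that] by (simp add: A_def)
 qed
 then show thesis using that[of "sqrt (A + 1)"] \<open>A >= 0\<close> by simp
qed

lemma loc_l2_mult_diameter:
 assumes "loc_l2 a" shows "loc_l2 (%i. a i * dQ i)"
 unfolding loc_l2_def
proof (intro allI impI)
 fix V assume V: "cc V"
 obtain D where D: "D > 0" "!!i. i \<in> hQ V ==> dQ i <= D"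
  using diameter_bound[OF compactly_contained_bounded[OF V]] by blast
 have "(%i. D^2 * (a i)^2) summable_on hQ V"
  using assms V by (intro summable_on_cmult_right) (simp add: loc_l2_def)
 then show "(%i. (a i * dQ i)^2) summable_on hQ V"
 proof (rule summable_on_le)
  fix i assume "i \<in> hQ V"
  then have "(dQ i)^2 <= D^2" using D less_imp_le[OF diameter_Q_pos] by (intro power_mono) auto
  then show "(a i * dQ i)^2 <= D^2 * (a i)^2"
   by (simp add: power_mult_distrib mult.commute[of "D^2"] mult_left_mono)
 qed simp
qed

text \<open>The exceptional family is tested on the whole path, while the conclusion covers each of
  its compact parameter intervals; so nothing has to be checked again for subarcs.\<close>

definition ae_good :: "(complex => real) => (nat => real) => cpath set => bool" where
 "ae_good u rh Gm \<longleftrightarrow> null Gm & (\<forall>J f a b. (J, f) \<in> cpaths_in Om - Gm --> a <= b --> {a..b} \<subseteq> J --> good_on u rh f a b)"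

lemma ae_goodD: "ae_good u rh Gm ==> (J, f) \<in> cpaths_in Om - Gm ==> a <= b ==> {a..b} \<subseteq> J ==> good_on u rh f a b"
 unfolding ae_good_def by blast

lemma ae_good_null: "ae_good u rh Gm ==> null Gm"
 by (simp add: ae_good_def)

text \<open>The usual exhaustion of \<open>Om\<close> by compact sets. Being countable, it reduces
  local square summability to countably many null families.\<close>

definition exhaustion :: "nat => complex set" where
 "exhaustion k = {z. norm z <= k & (\<forall>w. w \<notin> Om --> 1 / (real k + 1) <= dist z w)}"

lemma exhaustion_cc: "cc (exhaustion k)"
proof -
 have "exhaustion k = cball 0 k Int (\<Inter>w\<in>-Om. {z. 1 / (real k + 1) <= dist z w})"
  by (auto simp: exhaustion_def)
 moreover have "closed (\<Inter>w\<in>-Om. {z. 1 / (real k + 1) <= dist z w})"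
  by (intro closed_INT ballI closed_Collect_le continuous_intros)
 ultimately have "compact (exhaustion k)" by (simp add: compact_Int_closed)
 moreover have "exhaustion k \<subseteq> Om"
 proof
  fix z assume z: "z \<in> exhaustion k"
  show "z \<in> Om"
  proof (rule ccontr)
   assume "z \<notin> Om"
   then have "1 / (real k + 1) <= dist z z" using z unfolding exhaustion_def by blast
   then show False by simp
  qed
 qed
 ultimately show ?thesis by (simp add: compactly_contained_def compact_imp_closed closure_closed)
qed

lemma exhaustion_covers:
 assumes "compact K" "K \<subseteq> Om" obtains k where "K \<subseteq> exhaustion k"
proof -
 obtain e where e: "e > 0" "(\<Union>x\<in>K. cball x e) \<subseteq> Om"
  using compact_subset_open_imp_cball_epsilon_subset[OF assms(1) open_Omega assms(2)] by blast
 obtain B where B: "!!z. z \<in> K ==> norm z <= B" using assms(1) compact_imp_bounded bounded_iff by metis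
 obtain k :: nat where k: "max B (1 / e) < k" using reals_Archimedean2 by blast
 have "K \<subseteq> exhaustion k"
 proof
  fix z assume z: "z \<in> K"
  have "1 / (real k + 1) <= dist z w" if "w \<notin> Om" for w
  proof -
   have "w \<notin> cball z e" using e(2) z that by blast
   moreover have "1 / (real k + 1) <= e" using k e(1) by (simp add: field_simps)
   ultimately show ?thesis by simp
  qed
  moreover have "norm z <= k" using B[OF z] k by simp
  ultimately show "z \<in> exhaustion k" by (simp add: exhaustion_def)
 qed
 then show thesis using that by blast
qed

lemma closed_subpath:
 assumes "(J, f) \<in> cpaths_in Om" "a <= b" "{a..b} \<subseteq> J"
 shows "({a..b}, f) \<in> cpaths_in Om" "subpath_of ({a..b}, f) (J, f)" "continuous_on {a..b} f" "f ` {a..b} \<subseteq> Om"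
proof -
 obtain h where h: "continuous_on (closure J) h" "\<forall>t\<in>J. h t = f t"
  using assms(1) by (auto simp: cpaths_in_def is_cpath_def)
 have "continuous_on {a..b} h"
  using assms(3) closure_subset[of J] by (intro continuous_on_subset[OF h(1)]) auto
 then have c: "continuous_on {a..b} f"
  by (rule continuous_on_eq) (use h(2) assms(3) in auto)
 then show "continuous_on {a..b} f" .
 show im: "f ` {a..b} \<subseteq> Om" using assms by (auto simp: cpaths_in_def img_def)
 then show "({a..b}, f) \<in> cpaths_in Om"
  using assms(2) c by (auto simp: cpaths_in_def is_cpath_def img_def intro!: exI[of _ f])
 show "subpath_of ({a..b}, f) (J, f)"
  using assms by (auto simp: subpath_of_def)
qed

text \<open>To the given family one adds the paths along which a sum diverges and those meeting the
  carpet in positive length, and then passes to all superpaths. A path outside the result has only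
  good compact subarcs, and the hypothesis on endpoints applies to each of them.\<close>

lemma ae_good_exists:
 assumes rn: "!!i. 0 <= rh i" and l2: "loc_l2 rh" and G: "null Gm"
  and up: "!!f a b. [|a <= b; ({a..b}, f) \<in> cpaths_in Om - Gm; f a \<in> S; f b \<in> S; rh summable_on hQ (f ` {a..b})|]
   ==> \<bar>u (f a) - u (f b)\<bar> <= infsum rh (hQ (f ` {a..b}))"
 obtains Gm' where "ae_good u rh Gm'"
proof -
 define B where "B k = {gm. img gm \<subseteq> exhaustion k & \<not> rh summable_on hQ (img gm)}" for k
 define D where "D k = {gm. img gm \<subseteq> exhaustion k & \<not> (%i. dQ i) summable_on hQ (img gm)}" for k
 define H where "H = {gm \<in> cpaths_in Om. hausdorff1 (img gm Int S) ~= 0}"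
 define Gm0 where "Gm0 = Gm Un (H Un ((\<Union>k. B k) Un (\<Union>k. D k)))"
 define Gm' where "Gm' = {gm. \<exists>gm'\<in>Gm0. subpath_of gm' gm}"
 have nB: "null (\<Union>k. B k)" unfolding B_def
  using l2 exhaustion_cc by (intro null_UN null_not_summable rn) (auto simp: loc_l2_def)
 have nD: "null (\<Union>k. D k)" unfolding D_def
  using loc_l2_diameter exhaustion_cc less_imp_le[OF diameter_Q_pos]
  by (intro null_UN null_not_summable) (auto simp: loc_l2_def)
 have "null H" unfolding H_def by (rule null_hausdorff1)
 then have "null Gm0" unfolding Gm0_def using nB nD G by (intro null_Un)
 then have n: "null Gm'" unfolding Gm'_def by (rule null_superpaths)
 have "good_on u rh f a b" if Jf: "(J, f) \<in> cpaths_in Om - Gm'" and ab: "a <= b" "{a..b} \<subseteq> J" for J f a b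
 proof -
  have sub: "({s..t}, f) \<in> cpaths_in Om - Gm0" if st: "a <= s" "s <= t" "t <= b" for s t
  proof -
   have "{s..t} \<subseteq> J" using ab(2) st by auto
   then have "({s..t}, f) \<in> cpaths_in Om" "subpath_of ({s..t}, f) (J, f)"
    using closed_subpath[of J f s t] Jf st by auto
   then show ?thesis using Jf unfolding Gm'_def by blast
  qed
  have abG: "({a..b}, f) \<in> cpaths_in Om - Gm0" using sub[of a b] ab by simp
  have c: "continuous_on {a..b} f" "f ` {a..b} \<subseteq> Om" using closed_subpath[of J f a b] Jf ab by auto
  have "compact (f ` {a..b})" by (intro compact_continuous_image c compact_Icc)
  then obtain k where k: "f ` {a..b} \<subseteq> exhaustion k" using exhaustion_covers c(2) by blast
  have imf: "img ({s..t}, f) = f ` {s..t}" for s t by (simp add: img_def)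
  have sm: "rh summable_on hQ (f ` {a..b})" "(%i. dQ i) summable_on hQ (f ` {a..b})"
   using abG k unfolding Gm0_def B_def D_def imf[symmetric] by blast+
  have h: "hausdorff1 (f ` {a..b} Int S) = 0"
   using abG unfolding Gm0_def H_def imf[symmetric] by blast
  have "\<bar>u (f s) - u (f t)\<bar> <= infsum rh (hQ (f ` {s..t}))"
   if "a <= s" "s <= t" "t <= b" "f s \<in> S" "f t \<in> S" for s t
  proof (rule up)
   show "({s..t}, f) \<in> cpaths_in Om - Gm" using sub[of s t] that by (auto simp: Gm0_def)
   show "rh summable_on hQ (f ` {s..t})"
    by (rule summable_on_sub[OF sm(1) hits_Icc_mono]) (use that rn in auto)
  qed (use that in auto)
  then show ?thesis unfolding good_on_def using ab c sm h by blast
 qed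
 then show thesis using that[of Gm'] n unfolding ae_good_def by blast
qed

definition wloc :: "(complex => real) => bool" where
 "wloc u \<longleftrightarrow> locally_bounded u & loc_l2 (osr u) & loc_l2 (%i. Mx u i * dQ i) &
  (\<exists>Gm. ae_good u (osr u) Gm)"

lemma wlocD:
 assumes "wloc u"
 shows "locally_bounded u" "loc_l2 (osr u)" "loc_l2 (%i. Mx u i * dQ i)"
 using assms by (auto simp: wloc_def)

text \<open>By \<open>osr_upper_gradient\<close> any upper gradient that is summable along almost
  all paths will do; the oscillations are then one as well. This is how test functions and limits
  enter the Sobolev class.\<close>

lemma wlocI:
 assumes u: "locally_bounded u" "loc_l2 (osr u)" "loc_l2 (%i. Mx u i * dQ i)"
  and g: "ae_good u rh Gm" "!!i. 0 <= rh i"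
 shows "wloc u"
proof -
 obtain Gm' where "ae_good u (osr u) Gm'"
 proof (rule ae_good_exists[OF osr_nonneg[OF u(1)] u(2) ae_good_null[OF g(1)]])
  fix f a b assume *: "a <= b" "({a..b}, f) \<in> cpaths_in Om - Gm" "f a \<in> S" "f b \<in> S" "osr u summable_on hQ (f ` {a..b})"
  show "\<bar>u (f a) - u (f b)\<bar> <= infsum (osr u) (hQ (f ` {a..b}))"
   by (rule osr_upper_gradient[OF u(1) ae_goodD[OF g(1) *(2,1)] g(2) *(3-5)]) simp
 qed (rule that)
 then show ?thesis using u unfolding wloc_def by blast
qed

section \<open>Translation between extended real-valued and real-valued functions\<close>

lemma
 assumes "locally_bounded r" "!!p. p \<in> FQ i ==> g p = ereal (r p)"
 shows sup_on_ereal: "sup_on Q g i = ereal (Mx r i)"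
  and inf_on_ereal: "inf_on Q g i = ereal (Mn r i)"
  and osc_ereal: "osc Q g i = ereal (osr r i)"
proof -
 show s: "sup_on Q g i = ereal (Mx r i)"
  unfolding sup_on_def
 proof (rule antisym)
  show "(SUP x\<in>FQ i. g x) <= ereal (Mx r i)"
   using assms le_Mx[OF assms(1)] by (intro SUP_least) auto
  show "ereal (Mx r i) <= (SUP x\<in>FQ i. g x)"
  proof (rule le_SUP_iff[THEN iffD2], intro allI impI)
   fix y assume y: "y < ereal (Mx r i)"
   show "\<exists>p\<in>FQ i. y < g p"
   proof (rule ccontr)
    assume no: "\<not> ?thesis"
    obtain p0 where p0: "p0 \<in> FQ i" using frontier_Q_nonempty by blast
    have "ereal (r p) <= y" if "p \<in> FQ i" for p using no assms(2)[OF that] that by (auto simp: not_less)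
    then obtain c where c: "y = ereal c" using y p0 by (cases y) auto
    have "Mx r i <= c" using \<open>!!p. p \<in> FQ i ==> ereal (r p) <= y\<close> c by (intro Mx_least) auto
    then show False using y c by simp
   qed
  qed
 qed
 show n: "inf_on Q g i = ereal (Mn r i)"
  unfolding inf_on_def
 proof (rule antisym)
  show "ereal (Mn r i) <= (INF x\<in>FQ i. g x)"
   using assms Mn_le[OF assms(1)] by (intro INF_greatest) auto
  show "(INF x\<in>FQ i. g x) <= ereal (Mn r i)"
  proof (rule INF_le_iff[THEN iffD2], intro allI impI)
   fix y assume y: "ereal (Mn r i) < y"
   show "\<exists>p\<in>FQ i. g p < y"
   proof (rule ccontr)
    assume no: "\<not> ?thesis"
    obtain p0 where p0: "p0 \<in> FQ i" using frontier_Q_nonempty by blast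
    have "y <= ereal (r p)" if "p \<in> FQ i" for p using no assms(2)[OF that] that by (auto simp: not_less)
    then obtain c where c: "y = ereal c" using y p0 by (cases y) auto
    have "c <= Mn r i" using \<open>!!p. p \<in> FQ i ==> y <= ereal (r p)\<close> c by (intro Mn_greatest) auto
    then show False using y c by simp
   qed
  qed
 qed
 show "osc Q g i = ereal (osr r i)" unfolding osc_def s n by (simp add: osr_def)
qed

lemma finite_on_frontier:
 assumes "\<bar>sup_on Q g i\<bar> ~= \<infinity>" "\<bar>inf_on Q g i\<bar> ~= \<infinity>" "p \<in> FQ i"
 shows "g p = ereal (real_of_ereal (g p))" "real_of_ereal (inf_on Q g i) <= real_of_ereal (g p)"
  "real_of_ereal (g p) <= real_of_ereal (sup_on Q g i)"
proof -
 have le: "inf_on Q g i <= g p" "g p <= sup_on Q g i"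
  unfolding inf_on_def sup_on_def using assms(3) by (auto intro: INF_lower SUP_upper)
 then have fin: "\<bar>g p\<bar> ~= \<infinity>" using assms(1,2) by (cases "g p") auto
 then show "g p = ereal (real_of_ereal (g p))" by (simp add: ereal_real)
 show "real_of_ereal (inf_on Q g i) <= real_of_ereal (g p)" "real_of_ereal (g p) <= real_of_ereal (sup_on Q g i)"
 proof -
  obtain x y w where "inf_on Q g i = ereal x" "g p = ereal y" "sup_on Q g i = ereal w"
   using assms(1,2) fin by (metis ereal_real)
  then show "real_of_ereal (inf_on Q g i) <= real_of_ereal (g p)" "real_of_ereal (g p) <= real_of_ereal (sup_on Q g i)"
   using le by simp_all
 qed
qed

text \<open>\<open>real_of_ereal\<close> turns infinite values into 0, but infinite values occur
  neither on disk boundaries nor at carpet points of paths outside the exceptional family; so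
  suprema, oscillations and path inequalities are unchanged.\<close>

lemma sobolev_loc_real:
 assumes g: "sobolev_loc v Om Q g"
 defines "r \<equiv> %z. real_of_ereal (g z)"
 shows "wloc r" "!!i p. p \<in> FQ i ==> g p = ereal (r p)"
  "!!i. sup_on Q g i = ereal (Mx r i)" "!!i. osc Q g i = ereal (osr r i)"
proof -
 have fin: "\<bar>sup_on Q g i\<bar> ~= \<infinity>" "\<bar>inf_on Q g i\<bar> ~= \<infinity>" for i using g by (auto simp: sobolev_loc_def)
 show eq: "g p = ereal (r p)" if "p \<in> FQ i" for i p
  unfolding r_def using finite_on_frontier[OF fin that] by simp
 have lb: "locally_bounded r"
  unfolding locally_bounded_def
 proof
  fix i
  have "r ` FQ i \<subseteq> {real_of_ereal (inf_on Q g i)..real_of_ereal (sup_on Q g i)}"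
   unfolding r_def using finite_on_frontier[OF fin] by auto
  then show "bounded (r ` FQ i)" using bounded_subset bounded_closed_interval by blast
 qed
 show sup: "sup_on Q g i = ereal (Mx r i)" for i using sup_on_ereal[OF lb eq] .
 show osc: "osc Q g i = ereal (osr r i)" for i using osc_ereal[OF lb eq] .
 have "loc_l2 (osr r)"
  unfolding loc_l2_def
 proof (intro allI impI)
  fix V assume V: "cc V"
  show "(%i. (osr r i)^2) summable_on hQ V"
  proof (rule summable_on_hits_cover[OF V])
   fix x s assume "0 < s" "cc (ball x s)"
   then have "(infsum (%i. (osc Q g i)^2) (hQ (ball x s))) < \<infinity>" using g by (auto simp: sobolev_loc_def)
   then show "(%i. (osr r i)^2) summable_on hQ (ball x s)"
    using infsum_ereal_less_top_iff[of "hQ (ball x s)" "%i. (osr r i)^2"] by (simp add: osc)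
  qed simp
 qed
 moreover have "loc_l2 (%i. Mx r i * dQ i)"
  unfolding loc_l2_def
 proof (intro allI impI)
  fix V assume V: "cc V"
  show "(%i. (Mx r i * dQ i)^2) summable_on hQ V"
  proof (rule summable_on_hits_cover[OF V])
   fix x s assume "0 < s" "cc (ball x s)"
   then have "(infsum (%i. (sup_on Q g i)^2 * ereal ((dQ i)^2)) (hQ (ball x s))) < \<infinity>"
    using g by (auto simp: sobolev_loc_def)
   then show "(%i. (Mx r i * dQ i)^2) summable_on hQ (ball x s)"
    using infsum_ereal_less_top_iff[of "hQ (ball x s)" "%i. (Mx r i * dQ i)^2"]
    by (simp add: sup power_mult_distrib)
  qed simp
 qed
 moreover obtain Gm0 where Gm0: "null Gm0" "\<forall>gm\<in>cpaths_in Om - Gm0. \<forall>x\<in>img gm Int S. \<forall>y\<in>img gm Int S.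
    \<bar>g x\<bar> ~= \<infinity> & \<bar>g y\<bar> ~= \<infinity> & \<bar>g x - g y\<bar> <= path_sum Q (osc Q g) gm"
  using g unfolding sobolev_loc_def upper_gradient_def null_def by blast
 obtain Gm' where "ae_good r (osr r) Gm'"
 proof (rule ae_good_exists[OF osr_nonneg[OF lb] \<open>loc_l2 (osr r)\<close> Gm0(1)])
  fix f a b assume *: "a <= b" "({a..b}, f) \<in> cpaths_in Om - Gm0" "f a \<in> S" "f b \<in> S" "osr r summable_on hQ (f ` {a..b})"
  have m: "f a \<in> img ({a..b}, f) Int S" "f b \<in> img ({a..b}, f) Int S" using * by (auto simp: img_def)
  have gg: "\<bar>g (f a)\<bar> ~= \<infinity>" "\<bar>g (f b)\<bar> ~= \<infinity>" "\<bar>g (f a) - g (f b)\<bar> <= path_sum Q (osc Q g) ({a..b}, f)"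
   using Gm0(2)[rule_format, OF *(2) m] by simp_all
  have "path_sum Q (osc Q g) ({a..b}, f) = ereal (infsum (osr r) (hQ (f ` {a..b})))"
   unfolding path_sum_def osc img_def using infsum_ereal_summable[OF *(5)] osr_nonneg[OF lb] by simp
  moreover have "g (f a) = ereal (r (f a))" "g (f b) = ereal (r (f b))" using gg by (auto simp: r_def ereal_real)
  ultimately show "\<bar>r (f a) - r (f b)\<bar> <= infsum (osr r) (hQ (f ` {a..b}))" using gg(3) by simp
 qed (rule that)
 ultimately show "wloc r" using lb unfolding wloc_def by blast
qed

lemma wloc_sobolev_loc:
 assumes u: "wloc u"
 shows "sobolev_loc v Om Q (%z. ereal (u z))"
proof -
 note W = wlocD[OF u]
 have eqs: "sup_on Q (%z. ereal (u z)) i = ereal (Mx u i)" "inf_on Q (%z. ereal (u z)) i = ereal (Mn u i)"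
  "osc Q (%z. ereal (u z)) i = ereal (osr u i)" for i
  using sup_on_ereal[OF W(1)] inf_on_ereal[OF W(1)] osc_ereal[OF W(1)] by auto
 have eqf: "osc Q (%z. ereal (u z)) = (%i. ereal (osr u i))" using eqs by auto
 have nn: "0 <= osr u i" for i by (rule osr_nonneg[OF W(1)])
 obtain Gm where Gm: "ae_good u (osr u) Gm" using u by (auto simp: wloc_def)
 have ug: "\<bar>u x - u y\<bar> <= path_sum Q (%i. ereal (osr u i)) gm"
  if gm: "gm \<in> cpaths_in Om - Gm" "x \<in> img gm Int S" "y \<in> img gm Int S" for gm x y
 proof -
  obtain J f where Jf: "gm = (J, f)" by (cases gm)
  have int: "is_interval J" using gm(1) by (auto simp: cpaths_in_def is_cpath_def Jf)
  have *: "ereal \<bar>u (f s) - u (f t)\<bar> <= path_sum Q (%i. ereal (osr u i)) gm"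
   if st: "s \<in> J" "t \<in> J" "s <= t" "f s \<in> S" "f t \<in> S" for s t
  proof (cases "osr u summable_on hQ (img gm)")
   case True
   have sub: "{s..t} \<subseteq> J" using int st unfolding is_interval_1 by (meson atLeastAtMost_iff subsetI)
   then have "good_on u (osr u) f s t" using ae_goodD[OF Gm, of J f s t] gm(1) st Jf by blast
   then have "\<bar>u (f s) - u (f t)\<bar> <= infsum (osr u) (hQ (f ` {s..t}))"
    using st unfolding good_on_def by blast
   also have "... <= infsum (osr u) (hQ (img gm))"
    using sub nn by (intro infsum_sub_mono[OF True hits_mono]) (auto simp: Jf img_def)
   finally show ?thesis unfolding path_sum_def using infsum_ereal_summable[OF True] nn by simp
  next
   case False
   then show ?thesis unfolding path_sum_def using infsum_ereal_top[OF nn False] by simp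
  qed
  obtain s t where st: "s \<in> J" "t \<in> J" "x = f s" "y = f t" using gm by (auto simp: Jf img_def)
  show ?thesis
  proof (cases "s <= t")
   case True then show ?thesis using *[of s t] st gm by simp
  next
   case False
   then have "ereal \<bar>u (f t) - u (f s)\<bar> <= path_sum Q (%i. ereal (osr u i)) gm" using *[of t s] st gm by simp
   then show ?thesis using st by (simp add: abs_minus_commute)
  qed
 qed
 have up: "upper_gradient v Om Q (osc Q (%z. ereal (u z))) (%z. ereal (u z))"
  unfolding upper_gradient_def
 proof (intro conjI exI[of _ "Gm Int cpaths_in Om"] ballI)
  have "null (Gm Int cpaths_in Om)" by (rule null_subset[OF ae_good_null[OF Gm]]) blast
  then show "carpet_modulus v Om Q (Gm Int cpaths_in Om) = 0" by (simp add: null_def)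
  fix gm x y assume "gm \<in> cpaths_in Om - Gm Int cpaths_in Om" "x \<in> img gm Int S" "y \<in> img gm Int S"
  then have "ereal \<bar>u x - u y\<bar> <= path_sum Q (%i. ereal (osr u i)) gm" using ug[of gm x y] by blast
  then show "\<bar>ereal (u x) - ereal (u y)\<bar> <= path_sum Q (osc Q (%z. ereal (u z))) gm"
   unfolding eqf by simp
 qed (use nn in \<open>auto simp: eqs\<close>)
 have "(infsum (%i. (sup_on Q (%z. ereal (u z)) i)^2 * ereal ((dQ i)^2)) (hQ (ball x r))) < \<infinity>"
  "(infsum (%i. (osc Q (%z. ereal (u z)) i)^2) (hQ (ball x r))) < \<infinity>"
  if "cc (ball x r)" for x r
  using W(2,3) that infsum_ereal_less_top_iff[of "hQ (ball x r)" "%i. (Mx u i * dQ i)^2"]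
   infsum_ereal_less_top_iff[of "hQ (ball x r)" "%i. (osr u i)^2"]
  by (auto simp: eqs loc_l2_def power_mult_distrib)
 then show ?thesis unfolding sobolev_loc_def using up eqs by simp
qed

definition wsob :: "(complex => real) => bool" where
 "wsob ze \<longleftrightarrow> wloc ze & (%i. (osr ze i)^2) summable_on UNIV & (%i. (Mx ze i * dQ i)^2) summable_on UNIV"

lemma wsob_sobolev:
 assumes "wsob ze" shows "sobolev v Om Q (%z. ereal (ze z))"
proof -
 have w: "wloc ze" using assms by (simp add: wsob_def)
 note W = wlocD[OF w]
 have eqs: "sup_on Q (%z. ereal (ze z)) i = ereal (Mx ze i)"
  "osc Q (%z. ereal (ze z)) i = ereal (osr ze i)" for i
  using sup_on_ereal[OF W(1)] osc_ereal[OF W(1)] by auto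
 show ?thesis
  unfolding sobolev_def
  using assms wloc_sobolev_loc[OF w] infsum_ereal_less_top_iff[of UNIV "%i. (Mx ze i * dQ i)^2"]
   infsum_ereal_less_top_iff[of UNIV "%i. (osr ze i)^2"]
  by (auto simp: eqs wsob_def power_mult_distrib)
qed

lemma osr_zero: "(!!p. p \<in> FQ i ==> ze p = 0) ==> osr ze i = 0 & Mx ze i = 0 & Mn ze i = 0"
proof -
 assume *: "!!p. p \<in> FQ i ==> ze p = 0"
 then have "ze ` FQ i = {0}" using frontier_Q_nonempty[of i] by force
 then show ?thesis by (simp add: osr_def Mx_def Mn_def)
qed

text \<open>Vanishing on the disks off \<open>V\<close> turns the local sums into the global ones
  demanded of a test function.\<close>

lemma wsobI:
 assumes ze: "locally_bounded ze" and V: "cc V"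
  and zero: "!!i p. i \<notin> hQ V ==> p \<in> FQ i ==> ze p = 0"
  and sm: "(%i. (osr ze i)^2) summable_on hQ V" "(%i. (Mx ze i * dQ i)^2) summable_on hQ V"
  and g: "ae_good ze rh Gm" "!!i. 0 <= rh i"
 shows "wsob ze"
proof -
 have z: "osr ze i = 0" "Mx ze i = 0" if "i \<notin> hQ V" for i
  using osr_zero[of i ze] zero[OF that] by auto
 have U: "(%i. (osr ze i)^2) summable_on UNIV"
  by (rule summable_on_cong_neutral[THEN iffD1, OF _ _ _ sm(1)]) (use z in auto)
 have U2: "(%i. (Mx ze i * dQ i)^2) summable_on UNIV"
  by (rule summable_on_cong_neutral[THEN iffD1, OF _ _ _ sm(2)]) (use z in auto)
 have "loc_l2 (osr ze)" "loc_l2 (%i. Mx ze i * dQ i)"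
  unfolding loc_l2_def using summable_on_sub[OF U] summable_on_sub[OF U2] by auto
 then have "wloc ze" using ze g by (intro wlocI)
 then show ?thesis using U U2 by (simp add: wsob_def)
qed

text \<open>Suprema and infima are exchanged; the infima satisfy the same summability since they
  differ from the suprema by the oscillations, and diameters are locally bounded.\<close>

lemma wloc_uminus:
 assumes "wloc u" shows "wloc (%z. - u z)" "osr (%z. - u z) = osr u" "Mx (%z. - u z) = (%i. - Mn u i)"
proof -
 note W = wlocD[OF assms]
 have lb: "locally_bounded (%z. - u z)"
  unfolding locally_bounded_def
 proof
  fix i
  have "bounded (uminus ` u ` FQ i)" using W(1) by (intro bounded_uminus[THEN iffD2]) (simp add: locally_bounded_def)
  then show "bounded ((%z. - u z) ` FQ i)" by (simp add: image_image)
 qed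
 have neg: "Mx (%z. - u z) i = - Mn u i" "Mn (%z. - u z) i = - Mx u i" for i
 proof -
  show "Mx (%z. - u z) i = - Mn u i"
  proof (rule antisym)
   show "Mx (%z. - u z) i <= - Mn u i" using Mn_le[OF W(1)] by (intro Mx_least) auto
   have "- Mx (%z. - u z) i <= Mn u i" using le_Mx[OF lb] by (intro Mn_greatest) force
   then show "- Mn u i <= Mx (%z. - u z) i" by simp
  qed
  show "Mn (%z. - u z) i = - Mx u i"
  proof (rule antisym)
   show "- Mx u i <= Mn (%z. - u z) i" using le_Mx[OF W(1)] by (intro Mn_greatest) auto
   have "Mx u i <= - Mn (%z. - u z) i" using Mn_le[OF lb] by (intro Mx_least) force
   then show "Mn (%z. - u z) i <= - Mx u i" by simp
  qed
 qed
 show os: "osr (%z. - u z) = osr u" by (auto simp: osr_def neg)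
 show mx: "Mx (%z. - u z) = (%i. - Mn u i)" by (auto simp: neg)
 have "loc_l2 (%i. \<bar>Mx u i * dQ i\<bar> + osr u i * dQ i)"
  by (intro loc_l2_add loc_l2_mult_diameter W(2) loc_l2_le[OF W(3)]) simp
 then have l2: "loc_l2 (%i. Mx (%z. - u z) i * dQ i)"
 proof (rule loc_l2_le)
  fix i
  have "\<bar>Mn u i\<bar> <= \<bar>Mx u i\<bar> + osr u i" using osr_nonneg[OF W(1), of i] by (simp add: osr_def)
  then have "\<bar>Mn u i\<bar> * dQ i <= (\<bar>Mx u i\<bar> + osr u i) * dQ i"
   using less_imp_le[OF diameter_Q_pos] by (rule mult_right_mono)
  then show "\<bar>Mx (%z. - u z) i * dQ i\<bar> <= \<bar>\<bar>Mx u i * dQ i\<bar> + osr u i * dQ i\<bar>"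
   using less_imp_le[OF diameter_Q_pos[of i]] osr_nonneg[OF W(1), of i]
   by (simp add: neg abs_mult algebra_simps)
 qed
 obtain Gm where "ae_good u (osr u) Gm" using assms by (auto simp: wloc_def)
 moreover have "good_on (%z. - u z) rh f a b \<longleftrightarrow> good_on u rh f a b" for rh f a b
  by (simp add: good_on_def abs_minus_commute)
 ultimately have "ae_good (%z. - u z) (osr u) Gm" by (simp add: ae_good_def)
 then show "wloc (%z. - u z)" using lb l2 W(2) unfolding wloc_def os by blast
qed

end

section \<open>The maximum principle\<close>

context sierpinski_carpet begin

definition energy :: "complex set => (complex => real) => real" where
 "energy V u = (infsum (%i. (osr u i)^2) (hQ V))"

text \<open>The minimality alone, for real-valued functions and test functions. Normalization enters
  separately, where continuity is proved.\<close>

definition har :: "(complex => real) => bool" where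
 "har u \<longleftrightarrow> wloc u & (\<forall>V ze. open V --> cc V --> wsob ze --> (\<forall>x\<in>S - V. ze x = 0) -->
  energy V u <= energy V (%x. u x + ze x))"

lemma frontier_hits_open:
 assumes "open V" "p \<in> CQ i" "p \<in> V" shows "i \<in> hQ V"
 using assms open_Int_closure_eq_empty[of V "Q i"] by (auto simp: hits_def)

lemma bounded_add:
 assumes "locally_bounded u" "locally_bounded ze" shows "locally_bounded (%x. u x + ze x)"
 unfolding locally_bounded_def
proof
 fix i
 obtain B C where "\<forall>p\<in>FQ i. \<bar>u p\<bar> <= B" "\<forall>p\<in>FQ i. \<bar>ze p\<bar> <= C"
  using assms unfolding locally_bounded_def bounded_iff by (metis imageI real_norm_def)
 then have "\<forall>p\<in>FQ i. \<bar>u p + ze p\<bar> <= B + C" by (meson abs_triangle_ineq add_mono order_trans)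
 then show "bounded ((%x. u x + ze x) ` FQ i)" by (auto simp: bounded_iff)
qed

lemma osr_add_le:
 assumes "locally_bounded u" "locally_bounded ze" shows "osr (%x. u x + ze x) i <= osr u i + osr ze i"
proof (rule osr_least)
 fix p q assume "p \<in> FQ i" "q \<in> FQ i"
 then show "u p + ze p - (u q + ze q) <= osr u i + osr ze i"
  using abs_diff_le_osr[OF assms(1), of p i q] abs_diff_le_osr[OF assms(2), of p i q] by linarith
qed

lemma osr_add_summable:
 assumes "locally_bounded u" "locally_bounded ze" "loc_l2 (osr u)" "loc_l2 (osr ze)"
 shows "loc_l2 (osr (%x. u x + ze x))"
proof (rule loc_l2_le[OF loc_l2_add[OF assms(3,4)]])
 fix i
 show "\<bar>osr (%x. u x + ze x) i\<bar> <= \<bar>osr u i + osr ze i\<bar>"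
  using osr_add_le[OF assms(1,2), of i] osr_nonneg[OF bounded_add[OF assms(1,2)], of i] by simp
qed

lemma dirichlet_energy_eq:
 assumes r: "locally_bounded r" "loc_l2 (osr r)" and V: "cc V"
  and g: "!!i p. p \<in> FQ i ==> g p = ereal (r p)"
 shows "dirichlet_energy Q V g = ereal (energy V r)"
proof -
 have "osc Q g i = ereal (osr r i)" for i using osc_ereal[OF r(1) g] .
 then show ?thesis
  unfolding dirichlet_energy_def energy_def
  using infsum_ereal_summable[of "%i. (osr r i)^2" "hQ V"] r(2) V by (simp add: loc_l2_def)
qed

lemma carpet_harmonic_har:
 assumes "carpet_harmonic v Om Q (%z. ereal (u z))" shows "har u"
proof -
 have w: "wloc u" using sobolev_loc_real(1)[of "%z. ereal (u z)"] assms by (simp add: carpet_harmonic_def)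
 note W = wlocD[OF w]
 have "energy V u <= energy V (%x. u x + ze x)"
  if V: "open V" "cc V" and z: "wsob ze" "\<forall>x\<in>S - V. ze x = 0" for V ze
 proof -
  have zw: "wloc ze" using z by (simp add: wsob_def)
  note Z = wlocD[OF zw]
  have "dirichlet_energy Q V (%z. ereal (u z)) <= dirichlet_energy Q V (%x. ereal (u x) + ereal (ze x))"
   using assms V z wsob_sobolev[OF z(1)] unfolding carpet_harmonic_def by force
  moreover have "dirichlet_energy Q V (%z. ereal (u z)) = ereal (energy V u)"
   by (rule dirichlet_energy_eq[OF W(1,2) V(2)]) simp
  moreover have "dirichlet_energy Q V (%x. ereal (u x) + ereal (ze x)) = ereal (energy V (%x. u x + ze x))"
   by (rule dirichlet_energy_eq[OF bounded_add[OF W(1) Z(1)] osr_add_summable[OF W(1) Z(1) W(2) Z(2)] V(2)]) simp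
  ultimately show ?thesis by simp
 qed
 then show ?thesis using w by (auto simp: har_def)
qed

lemma har_uminus:
 assumes "har u" shows "har (%z. - u z)"
proof -
 have w: "wloc u" using assms by (simp add: har_def)
 have "energy V (%z. - u z) <= energy V (%x. - u x + ze x)"
  if V: "open V" "cc V" and z: "wsob ze" "\<forall>x\<in>S - V. ze x = 0" for V ze
 proof -
  have zw: "wloc ze" using z by (simp add: wsob_def)
  note Z = wlocD[OF zw] and mz = wloc_uminus[OF zw]
  note MZ = wlocD[OF mz(1)]
  obtain Gm where Gm: "ae_good (%z. - ze z) (osr (%z. - ze z)) Gm" using mz(1) by (auto simp: wloc_def)
  have "wsob (%z. - ze z)"
  proof (rule wsobI[OF MZ(1) V(2) _ _ _ Gm osr_nonneg[OF MZ(1)]])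
   fix i p assume "i \<notin> hQ V" "p \<in> FQ i"
   then have "p \<in> S - V" using FQ_S FQ_CQ frontier_hits_open[OF V(1)] by blast
   then show "- ze p = 0" using z by simp
  qed (use MZ V in \<open>auto simp: loc_l2_def\<close>)
  moreover have "\<forall>x\<in>S - V. - ze x = 0" using z(2) by simp
  ultimately have "energy V u <= energy V (%x. u x + - ze x)"
   using assms[unfolded har_def, THEN conjunct2, rule_format, OF V] by blast
  moreover have "energy V (%x. - u x) = energy V u" by (simp add: energy_def wloc_uminus(2)[OF w])
  moreover have "energy V (%x. - u x + ze x) = energy V (%x. u x + - ze x)"
  proof -
   have "osr (%x. - u x + ze x) i = osr (%x. u x + - ze x) i" for i
   proof (rule antisym)
    have lb: "locally_bounded (%x. u x + - ze x)" "locally_bounded (%x. - u x + ze x)"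
    using bounded_add[OF wlocD(1)[OF w] MZ(1)] bounded_add[OF wlocD(1)[OF wloc_uminus(1)[OF w]] Z(1)] by auto
    show "osr (%x. - u x + ze x) i <= osr (%x. u x + - ze x) i"
    using abs_diff_le_osr[OF lb(1), of _ i] by (intro osr_least) (smt (verit))
    show "osr (%x. u x + - ze x) i <= osr (%x. - u x + ze x) i"
    using abs_diff_le_osr[OF lb(2), of _ i] by (intro osr_least) (smt (verit))
   qed
   then show ?thesis by (simp add: energy_def)
  qed
  ultimately show ?thesis by simp
 qed
 then show ?thesis using wloc_uminus(1)[OF w] unfolding har_def by blast
qed

lemma infsum_less:
 fixes f g :: "nat => real"
 assumes "f summable_on A" "g summable_on A" "!!i. i \<in> A ==> f i <= g i" "k \<in> A" "f k < g k"
 shows "infsum f A < infsum g A"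
proof -
 have m: "(%i. (- 1) * f i) summable_on A" by (rule summable_on_cmult_right[OF assms(1)])
 have d: "(%i. g i + (- 1) * f i) summable_on A" by (rule summable_on_add[OF assms(2) m])
 have "g k + (- 1) * f k <= infsum (%i. g i + (- 1) * f i) A"
  by (rule elem_le_infsum[OF d assms(4)]) (use assms(3) in simp)
 also have "... = infsum g A + (- 1) * infsum f A"
  by (simp only: infsum_add[OF assms(2) m] infsum_cmult_right[OF assms(1)])
 finally show ?thesis using assms(5) by simp
qed

lemma AE_ex_interval:
 assumes "AE s in lborel. al < s & s < be --> P s" "al < (be::real)"
 obtains s where "al < s" "s < be" "P s"
proof -
 have "\<exists>s. al < s & s < be & P s"
 proof (rule ccontr)
  assume no: "\<not> ?thesis"
  have "AE s in lborel. s \<notin> {al<..<be}"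
   using assms(1) by eventually_elim (use no in auto)
  then have "emeasure lborel {al<..<be} = 0"
   by (subst (asm) AE_iff_measurable[of "{al<..<be}"]) auto
  then show False using assms(2) by simp
 qed
 then show thesis using that by blast
qed

section \<open>Generic squares as good arcs of a Sobolev function\<close>

lemma square_loop_cpath:
 assumes "s > 0" "square c s \<subseteq> Om"
 shows "({-s..15 * s}, square_loop c s) \<in> cpaths_in Om"
proof -
 have "is_cpath ({-s..15 * s}, square_loop c s)"
  using assms(1) by (intro is_cpath_square_loop) (auto simp: is_interval_cc)
 then show ?thesis
  using assms square_loop_in_square[of s "{-s..15 * s}" c] by (auto simp: cpaths_in_def)
qed

lemma square_subset_cball: "square c s \<subseteq> cball c (2 * s)"
 using norm_le_sup_norm by (auto simp: square_def dist_norm norm_minus_commute)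

lemma AE_square_good:
 assumes g: "ae_good u rh Gm" and R: "R > 0" and sub: "ball c (2 * R) \<subseteq> Om"
 shows "AE s in lborel. 0 < s & s < R --> (\<forall>a b. - s <= a --> a <= b --> b <= 15 * s --> good_on u rh (square_loop c s) a b)"
 using AE_square_not_null[OF ae_good_null[OF g] R, of c]
proof eventually_elim
 case (elim s)
 show ?case
 proof (intro impI allI)
  fix a b assume s: "0 < s & s < R" and ab: "- s <= a" "a <= b" "b <= 15 * s"
  have "square c s \<subseteq> Om"
   using square_subset_cball[of c s] sub s by (auto simp: subset_iff)
  then have "({-s..15 * s}, square_loop c s) \<in> cpaths_in Om" using s by (intro square_loop_cpath) auto
  moreover have "({-s..15 * s}, square_loop c s) \<notin> Gm"
   using elim s by (auto simp: is_interval_cc)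
  ultimately show "good_on u rh (square_loop c s) a b"
   using ae_goodD[OF g, of "{-s..15 * s}" "square_loop c s" a b] ab by auto
 qed
qed

lemma square_loop_image:
 assumes "s > 0" "t0 \<in> {-s..7 * s}"
 shows "square_loop c s ` {t0..t0 + 8 * s} = square c s"
proof
 show "square_loop c s ` {t0..t0 + 8 * s} \<subseteq> square c s"
  using assms square_loop_in_square[of s "{t0..t0 + 8 * s}" c] by (auto simp: img_def)
 show "square c s \<subseteq> square_loop c s ` {t0..t0 + 8 * s}"
 proof
  fix z assume "z \<in> square c s"
  then have "sup_norm (z - c) = s" by (simp add: square_def)
  then obtain t where "t \<in> {t0..t0 + 8 * s}" "square_loop c s t = z"
   by (rule square_loop_surj[OF assms(1) _ assms(2)])
  then show "z \<in> square_loop c s ` {t0..t0 + 8 * s}" by blast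
 qed
qed

lemma connected_square: "s > 0 ==> connected (square c s)"
 using square_loop_image[of s "-s" c] connected_continuous_image[OF continuous_square_loop[of "{-s..-s + 8 * s}" c s]]
 by simp

lemma connected_meets_square:
 assumes "connected X" "p \<in> X" "q \<in> X" "sup_norm (p - c) <= s" "s <= sup_norm (q - c)"
 shows "X Int square c s ~= {}"
proof -
 have "connected ((%z. sup_norm (z - c)) ` X)"
  by (intro connected_continuous_image assms continuous_intros)
 then have "s \<in> (%z. sup_norm (z - c)) ` X"
  using connected_contains_Icc[of "(%z. sup_norm (z - c)) ` X" "sup_norm (p - c)" "sup_norm (q - c)"] assms by auto
 then show ?thesis by (auto simp: square_def)
qed

lemma sup_norm_scale: "sup_norm (of_real t * z) = \<bar>t\<bar> * sup_norm z"
 by (simp add: sup_norm_def abs_mult max_mult_distrib_left)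

lemma square_pval_diff:
 assumes u: "locally_bounded u" and s: "s > 0"
  and g: "!!a b. - s <= a ==> a <= b ==> b <= 15 * s ==> good_on u (osr u) (square_loop c s) a b"
  and pq: "p \<in> square c s" "q \<in> square c s"
 shows "\<bar>pval u p - pval u q\<bar> <= infsum (osr u) (hQ (square c s))"
proof -
 have im: "square_loop c s ` {-s..-s + 8 * s} = square c s" using s by (intro square_loop_image) auto
 have nn: "0 <= osr u i" for i by (rule osr_nonneg[OF u])
 have "good_on u (osr u) (square_loop c s) (-s) (-s + 8 * s)" using s by (intro g) auto
 then have sm: "osr u summable_on hQ (square c s)" unfolding good_on_def im by blast
 have *: "\<bar>pval u (square_loop c s a) - pval u (square_loop c s b)\<bar> <= infsum (osr u) (hQ (square c s))"
  if ab: "- s <= a" "a <= b" "b <= -s + 8 * s" for a b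
 proof -
  have "\<bar>pval u (square_loop c s a) - pval u (square_loop c s b)\<bar> <= infsum (osr u) (hQ (square_loop c s ` {a..b}))"
   by (rule pval_diff_le[OF u g]) (use ab s in auto)
  also have "... <= infsum (osr u) (hQ (square c s))"
   by (rule infsum_sub_mono[OF sm hits_Icc_mono[OF ab(1,3), of "square_loop c s", unfolded im] nn order.refl nn])
  finally show ?thesis .
 qed
 obtain a b where ab: "a \<in> {-s..-s + 8 * s}" "p = square_loop c s a" "b \<in> {-s..-s + 8 * s}" "q = square_loop c s b"
  using pq unfolding im[symmetric] by blast
 show ?thesis
 proof (cases "a <= b")
  case True
  show ?thesis unfolding ab(2,4) by (rule *[OF _ True]) (use ab(1,3) in auto)
 next
  case False
  then have ba: "b <= a" by simp
  show ?thesis unfolding ab(2,4) by (subst abs_minus_commute, rule *[OF _ ba]) (use ab(1,3) in auto)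
 qed
qed

text \<open>Two squares centred in the two disks, each passing through the other disk, have to cross.\<close>

lemma locally_constant_of_osr_zero:
 assumes u: "wloc u" and r: "r > 0" "ball z (6 * r) \<subseteq> Om"
  and z: "!!i. i \<in> hQ (ball z (6 * r)) ==> osr u i = 0"
  and k: "k1 \<in> hQ (ball z r)" "k2 \<in> hQ (ball z r)"
 shows "Mx u k1 = Mx u k2"
proof (cases "k1 = k2")
 case False
 note U = wlocD(1)[OF u]
 obtain Gm where Gm: "ae_good u (osr u) Gm" using u by (auto simp: wloc_def)
 obtain o1 o2 where o: "o1 \<in> Q k1" "o1 \<in> ball z r" "o2 \<in> Q k2" "o2 \<in> ball z r"
  using k by (auto simp: hits_def)
 define d where "d = sup_norm (o2 - o1)"
 have "o1 ~= o2" using o Q_disjoint[OF False] by blast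
 then have d: "d > 0" using sup_norm_nonneg[of "o2 - o1"] sup_norm_eq_0[of "o2 - o1"] by (simp add: d_def)
 have "d <= dist o2 o1" using sup_norm_le_norm[of "o2 - o1"] by (simp add: d_def dist_norm)
 also have "... < 2 * r" using o(2,4) dist_triangle[of o2 o1 z] by (auto simp: dist_commute)
 finally have d2: "d < 2 * r" .
 \<comment> \<open>At a generic radius just below \<open>d\<close>, the square around one point
   still passes through the disk of the other, because that disk contains a ball around its point.
   Along the square nothing oscillates, so \<open>pval u\<close> is constant on it.\<close>
 have circ: "\<exists>s. d / 2 < s & s < d & j \<in> hQ (square p s) &
   (\<forall>p'\<in>square p s. \<forall>q'\<in>square p s. pval u p' = pval u q')"
  if pq: "p \<in> ball z r" "q \<in> Q j" "sup_norm (q - p) = d" for p q j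
 proof -
  obtain et where et: "et > 0" "ball q et \<subseteq> Q j" using Q_open pq(2) open_contains_ball by blast
  have sub: "ball p (2 * (2 * r)) \<subseteq> ball z (6 * r)"
  proof
   fix y assume "y \<in> ball p (2 * (2 * r))"
   then show "y \<in> ball z (6 * r)" using pq(1) r dist_triangle[of z y p] by auto
  qed
  have "AE s in lborel. 0 < s & s < 2 * r --> (\<forall>a b. - s <= a --> a <= b --> b <= 15 * s --> good_on u (osr u) (square_loop p s) a b)"
   using sub r by (intro AE_square_good[OF Gm]) auto
  then have "AE s in lborel. max (d/2) (d - et/2) < s & s < d -->
    (\<forall>a b. - s <= a --> a <= b --> b <= 15 * s --> good_on u (osr u) (square_loop p s) a b)"
   by eventually_elim (use d d2 in auto)
  moreover have "max (d/2) (d - et/2) < d" using d et by simp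
  ultimately obtain s where s: "max (d/2) (d - et/2) < s" "s < d"
    "\<forall>a b. - s <= a --> a <= b --> b <= 15 * s --> good_on u (osr u) (square_loop p s) a b"
   by (rule AE_ex_interval)
  have s0: "s > 0" using s(1) d by simp
  define y where "y = p + of_real (s / d) * (q - p)"
  have "sup_norm (y - p) = s" using s0 d pq(3) by (simp add: y_def sup_norm_scale del: of_real_divide)
  moreover have "y \<in> ball q et"
  proof -
   have "q - y = of_real (1 - s / d) * (q - p)" by (simp add: y_def algebra_simps)
   then have "sup_norm (q - y) = (1 - s / d) * d" using s d pq(3) by (simp only: sup_norm_scale) simp
   also have "... = d - s" using d by (simp add: field_simps)
   finally have "norm (q - y) <= 2 * (d - s)" using norm_le_sup_norm[of "q - y"] by simp
   then show ?thesis using s(1) by (simp add: dist_norm)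
  qed
  ultimately have "j \<in> hQ (square p s)" using et(2) by (auto simp: hits_def square_def)
  moreover have "pval u p' = pval u q'" if "p' \<in> square p s" "q' \<in> square p s" for p' q'
  proof -
   have "square p s \<subseteq> ball p (2 * (2 * r))" using square_subset_cball[of p s] s d2 by (auto simp: subset_iff)
   then have "square p s \<subseteq> ball z (6 * r)" using sub by blast
   then have "hQ (square p s) \<subseteq> hQ (ball z (6 * r))" by (rule hits_mono)
   then have "infsum (osr u) (hQ (square p s)) = 0" using z by (intro infsum_0) blast
   then show ?thesis using square_pval_diff[OF U s0 _ that] s(3) by simp
  qed
  moreover have "d / 2 < s" using s(1) by simp
  ultimately show ?thesis using s(2) by blast
 qed
 obtain s where s: "d / 2 < s" "s < d" "k2 \<in> hQ (square o1 s)"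
   "\<forall>p'\<in>square o1 s. \<forall>q'\<in>square o1 s. pval u p' = pval u q'"
  using circ[OF o(2,3) d_def[symmetric]] by blast
 obtain s' where s': "d / 2 < s'" "s' < d" "k1 \<in> hQ (square o2 s')"
   "\<forall>p'\<in>square o2 s'. \<forall>q'\<in>square o2 s'. pval u p' = pval u q'"
  using circ[OF o(4,1)] sup_norm_commute[of o1 o2] unfolding d_def by blast
 \<comment> \<open>The two points of the first square on the line through \<open>o1\<close> and
   \<open>o2\<close> have sup-norm distances \<open>d - s\<close> and \<open>d + s\<close> from
   \<open>o2\<close>. As both radii lie between \<open>d / 2\<close> and \<open>d\<close>, these
   distances are on different sides of \<open>s'\<close>.\<close>
 have "square o1 s Int square o2 s' ~= {}"
 proof (rule connected_meets_square)
  show "connected (square o1 s)" using s d by (intro connected_square) auto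
  show "o1 + of_real (s / d) * (o2 - o1) \<in> square o1 s" "o1 - of_real (s / d) * (o2 - o1) \<in> square o1 s"
   using s d sup_norm_scale[of "s / d" "o2 - o1"] sup_norm_scale[of "- (s / d)" "o2 - o1"]
   by (auto simp: square_def d_def[symmetric] sup_norm_minus)
  have "o1 + of_real (s / d) * (o2 - o1) - o2 = of_real (s / d - 1) * (o2 - o1)" by (simp add: algebra_simps)
  then show "sup_norm (o1 + of_real (s / d) * (o2 - o1) - o2) <= s'"
   using s(1,2) s'(1) d mult_left_mono[of d "s' + s" d]
   by (simp only: sup_norm_scale d_def[symmetric]) (simp add: abs_if field_simps)
  have "o1 - of_real (s / d) * (o2 - o1) - o2 = of_real (- (s / d) - 1) * (o2 - o1)" by (simp add: algebra_simps)
  then show "s' <= sup_norm (o1 - of_real (s / d) * (o2 - o1) - o2)"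
   using s(1,2) s'(2) d mult_left_mono[of s' "d + s" d]
   by (simp only: sup_norm_scale d_def[symmetric]) (simp add: abs_if field_simps)
 qed
 then obtain y where y: "y \<in> square o1 s" "y \<in> square o2 s'" by blast
 obtain y1 y2 where y12: "y1 \<in> square o2 s'" "y1 \<in> Q k1" "y2 \<in> square o1 s" "y2 \<in> Q k2"
  using s(3) s'(3) by (auto simp: hits_def)
 have "Mx u k1 = pval u y1" using pval_Q[OF y12(2)] by simp
 also have "... = pval u y" using s'(4) y y12 by blast
 also have "... = pval u y2" using s(4) y y12 by blast
 also have "... = Mx u k2" using pval_Q[OF y12(4)] by simp
 finally show ?thesis .
qed simp


lemma closure_complement_disk:
 assumes "z \<in> FQ i" "e > 0"
 obtains y where "y \<in> ball z e" "y \<notin> CQ i"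
proof -
 obtain c where c: "FQ i = path_image c" "- CQ i = outside (path_image c)"
  "frontier (outside (path_image c)) = path_image c" by (rule jordan_curve)
 then have "z \<in> closure (- CQ i)" using assms(1) by (metis frontier_def Diff_iff)
 then obtain y where "y \<in> - CQ i" "dist y z < e" using closure_approachable assms(2) by blast
 then show thesis using that[of y] by (auto simp: dist_commute)
qed

text \<open>Truncating \<open>u\<close> at the level \<open>M'\<close> inside the region gives an admissible competitor. Its oscillation
 is at most that of \<open>u\<close> on each disk, so by minimality they agree; hence the truncated part has no
 oscillation on the disks other than the one cut by the boundary of the region.\<close>

lemma max_principle:
 assumes u: "har u" and E: "!!i j. i \<in> E ==> j \<in> E ==> i = j" and K: "K = (\<Union>i\<in>E. CQ i)"
  and W: "open W" "connected W" "cc W"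
  and good: "good_on u (osr u) f a b" and A: "A = f ` {a..b}"
  and WKA: "W Int (K Un A) = {}" "frontier W \<subseteq> K Un A"
  and AE: "!!i. i \<in> E ==> A Int Q i = {} & A Int FQ i ~= {}"
  and near: "!!p. p \<in> (K Int closure W) - A ==> \<exists>rh>0. ball p rh - K \<subseteq> W"
  and t: "t \<in> {a<..<b}" "f t \<in> closure W" "f t \<notin> K" "!!e. e > 0 ==> \<exists>t'. \<bar>t' - t\<bar> < e & f t' ~= f t"
  and M: "!!p. p \<in> A Int S ==> u p <= M'" "!!j. j \<in> hQ A ==> Mx u j <= M'"
  and k: "k \<in> hQ W"
 shows "Mx u k <= M'"
proof -
 have uw: "wloc u" using u by (simp add: har_def)
 note U = wlocD[OF uw]
 have nn: "0 <= osr u i" for i by (rule osr_nonneg[OF U(1)])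
 have Wc: "compact (closure W)" "closure W \<subseteq> Om" using W(3) by (auto simp: compactly_contained_def)
 \<comment> \<open>\<open>E\<close> has at most one element: none when the region is a full square,
   otherwise the disk carrying the centre. Working with a set treats both cases at once.\<close>
 have fE: "finite E"
 proof (cases "E = {}")
  case False
  then obtain i where "i \<in> E" by blast
  then have "E = {i}" using E by blast
  then show ?thesis by simp
 qed simp
 have KQ: "CQ j Int K = {}" if "j \<notin> E" for j
 proof -
  have "CQ j Int CQ i = {}" if "i \<in> E" for i
   using closure_Q_disjoint[of j i] that \<open>j \<notin> E\<close> by auto
  then show ?thesis unfolding K by blast
 qed
 have pM: "pval u z <= M'" if zA: "z \<in> A" "z \<in> Om" for z
 proof (cases "z \<in> S")
  case True then show ?thesis using M(1) zA by (simp add: pval_S)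
 next
  case False
  then obtain j where j: "z \<in> Q j" using Omega_cases zA(2) by blast
  then have "j \<in> hQ A" using zA by (auto simp: hits_def)
  then show ?thesis using M(2) pval_Q[OF j] by simp
 qed
 \<comment> \<open>The excess of \<open>u\<close> over \<open>M'\<close> inside the region;
   subtracting it is the truncation.\<close>
 define w where "w z = (if z \<in> closure W then max (u z - M') 0 else 0)" for z
 have w0: "w z >= 0" for z by (simp add: w_def)
 have wA: "w p = 0" if "p \<in> A Int S" for p using M(1)[OF that] by (simp add: w_def)
 \<comment> \<open>A disk meeting the arc has values at most \<open>M'\<close>, hence no excess; any
   other disk off \<open>E\<close> lies inside or outside \<open>W\<close>, as it cannot cross the
   boundary of \<open>W\<close>.\<close>
 have dicho: "(Q j \<subseteq> W & (\<forall>p\<in>FQ j. w p = max (u p - M') 0)) | (\<forall>p\<in>FQ j. w p = 0)" if j: "j \<notin> E" for j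
 proof (cases "j \<in> hQ A")
  case True
  then have "w p = 0" if "p \<in> FQ j" for p
   using M(2)[OF True] le_Mx[OF U(1) that] by (simp add: w_def)
  then show ?thesis by blast
 next
  case False
  have "Q j Int frontier W = {}"
   using WKA(2) KQ[OF j] False closure_subset[of "Q j"] by (auto simp: hits_def)
  then have or: "Q j Int W = {} | Q j \<subseteq> W"
   using connected_Int_frontier[OF Q_connected, of j W] by blast
  show ?thesis
  proof (cases "Q j Int W = {}")
   case False
   then have "Q j \<subseteq> W" using or by blast
   then have "CQ j \<subseteq> closure W" by (rule closure_mono)
   then have "w p = max (u p - M') 0" if "p \<in> FQ j" for p
    using that FQ_CQ by (auto simp: w_def)
   then show ?thesis using \<open>Q j \<subseteq> W\<close> by blast
  next
   case True
   have "w p = 0" if p: "p \<in> FQ j" for p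
   proof (cases "p \<in> closure W")
    case True
    have "p \<notin> W"
    using frontier_hits_open[OF W(1), of p j] p FQ_CQ \<open>Q j Int W = {}\<close> by (auto simp: hits_def)
    then have "p \<in> frontier W" using True W(1) by (simp add: frontier_def interior_open)
    then have "p \<in> A" using WKA(2) KQ[OF j] p FQ_CQ by blast
    then show ?thesis using wA FQ_S p by blast
   qed (simp add: w_def)
   then show ?thesis by blast
  qed
 qed
 define ze where "ze z = - w z" for z
 have zb: "\<bar>ze p\<bar> <= \<bar>Mx u i\<bar> + \<bar>M'\<bar>" if "p \<in> FQ i" for i p
  using le_Mx[OF U(1) that] by (auto simp: ze_def w_def max_def)
 have lbz: "locally_bounded ze"
  unfolding locally_bounded_def bounded_iff using zb by (metis imageE real_norm_def)
 have oz: "osr ze j <= osr u j" if j: "j \<notin> E" for j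
  using dicho[OF j]
 proof
  assume *: "Q j \<subseteq> W & (\<forall>p\<in>FQ j. w p = max (u p - M') 0)"
  show ?thesis
  proof (rule osr_least)
   fix p q assume "p \<in> FQ j" "q \<in> FQ j"
   then show "ze p - ze q <= osr u j"
    using * abs_diff_le_osr[OF U(1), of p j q] nn[of j] by (auto simp: ze_def max_def)
  qed
 next
  assume "\<forall>p\<in>FQ j. w p = 0"
  then have "osr ze j = 0" using osr_zero[of j ze] by (simp add: ze_def)
  then show ?thesis using nn by simp
 qed
 \<comment> \<open>A path may leave the region through the disk of \<open>E\<close>, where the
   excess need not vanish; the second term pays for the difference between the value of that disk
   and \<open>M'\<close>.\<close>
 define rh where "rh i = osr u i + (if i \<in> E then \<bar>Mx u i - M'\<bar> else 0)" for i
 have rn: "0 <= rh i" for i using nn by (simp add: rh_def)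
 have ru: "osr u i <= rh i" for i by (simp add: rh_def)
 have fin_sum: "(%i. if i \<in> E then h i else 0) summable_on B" for h :: "nat => real" and B
  by (rule finite_nonzero_values_imp_summable_on, rule finite_subset[OF _ fE]) auto
 have gw: "good_on ze rh g a' b'" if g: "good_on u (osr u) g a' b'" for g a' b'
 proof -
  let ?H = "%s t. hQ (g ` {s..t})"
  have G: "a' <= b'" "continuous_on {a'..b'} g" "g ` {a'..b'} \<subseteq> Om" "osr u summable_on ?H a' b'"
   using g by (auto simp: good_on_def)
  have rs: "rh summable_on ?H a' b'"
   unfolding rh_def using G(4) fin_sum by (intro summable_on_add)
  have main: "\<bar>ze (g s) - ze (g t)\<bar> <= infsum rh (?H s t)"
   if st: "a' <= s" "s <= t" "t <= b'" "g s \<in> S" "g t \<in> S" for s t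
  proof -
   have gst: "good_on u (osr u) g s t" by (rule good_on_sub[OF g st(1-3) nn])
   have rst: "rh summable_on ?H s t"
    by (rule summable_on_sub[OF rs hits_Icc_mono]) (use st rn in auto)
   have le0: "infsum (osr u) (?H s' t') <= infsum rh (?H s t)" if "s <= s'" "t' <= t" for s' t'
    by (rule infsum_sub_mono[OF rst hits_Icc_mono[OF that]]) (use ru rn nn in auto)
   have nonneg: "0 <= infsum rh (?H s t)" by (intro infsum_nonneg rn)
   have pv: "\<bar>pval u (g x) - pval u (g ta)\<bar> <= infsum (osr u) (?H s t)" if "x = s | x = t" "s <= ta" "ta <= t" for x ta
   proof -
    have "\<bar>pval u (g s) - pval u (g ta)\<bar> <= infsum (osr u) (?H s ta)"
    by (rule pval_diff_le[OF U(1) good_on_sub[OF gst order.refl that(2,3) nn]])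
    moreover have "\<bar>pval u (g ta) - pval u (g t)\<bar> <= infsum (osr u) (?H ta t)"
    by (rule pval_diff_le[OF U(1) good_on_sub[OF gst that(2,3) order.refl nn]])
    moreover have sms: "osr u summable_on ?H s t" using gst unfolding good_on_def by blast
    have "infsum (osr u) (?H s ta) <= infsum (osr u) (?H s t)"
    by (rule infsum_sub_mono[OF sms hits_Icc_mono[OF order.refl that(3)] nn order.refl nn])
    moreover have "infsum (osr u) (?H ta t) <= infsum (osr u) (?H s t)"
    by (rule infsum_sub_mono[OF sms hits_Icc_mono[OF that(2) order.refl] nn order.refl nn])
    ultimately show ?thesis using that(1) by (auto simp: abs_minus_commute)
   qed
   \<comment> \<open>Between a point in the closure of \<open>W\<close> and one outside, the path
     must meet the arc or the open disk of \<open>E\<close>: otherwise its part in the closure of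
     \<open>W\<close> would be both relatively open and relatively closed.\<close>
   have cross: "w (g x) <= infsum rh (?H s t)"
    if x: "x = s | x = t" and y: "y = s | y = t" and ins: "g x \<in> closure W" "g y \<notin> closure W" for x y
   proof -
    have xS: "g x \<in> S" using x st by blast
    let ?X = "g ` {s..t}"
    have "?X Int A ~= {} | (\<exists>i\<in>E. ?X Int Q i ~= {})"
    proof (rule ccontr)
    assume no: "\<not> ?thesis"
    have XW: "\<exists>e>0. ?X Int ball y e \<subseteq> closure W" if y: "y \<in> ?X Int closure W" for y
    proof (cases "y \<in> W")
    case True
    then obtain e where "e > 0" "ball y e \<subseteq> W" using W(1) open_contains_ball by blast
    then show ?thesis using closure_subset[of W] by (intro exI[of _ e]) auto
    next
    case False
    then have "y \<in> frontier W" using y W(1) by (simp add: frontier_def interior_open)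
    moreover have "y \<notin> A" using y no by blast
    ultimately have yK: "y \<in> (K Int closure W) - A" using WKA(2) y by blast
    then obtain e where e: "e > 0" "ball y e - K \<subseteq> W" using near by blast
    have "z \<in> closure W" if z: "z \<in> ?X" "z \<in> ball y e" for z
    proof (cases "z \<in> K")
    case False then show ?thesis using e(2) z closure_subset by blast
    next
    case True
    then obtain i where i: "i \<in> E" "z \<in> CQ i" using K by blast
    have "z \<notin> Q i" using no i z by blast
    then have zf: "z \<in> FQ i" using i closure_Q_eq by blast
    have Ki: "K = CQ i" using K E i by blast
    show ?thesis
    unfolding closure_approachable
    proof (intro allI impI)
    fix e' :: real assume "e' > 0"
    obtain e1 where e1: "e1 > 0" "ball z e1 \<subseteq> ball y e" using z(2) open_contains_ball open_ball by blast
    obtain y' where "y' \<in> ball z (min e' e1)" "y' \<notin> CQ i"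
    using closure_complement_disk[OF zf, of "min e' e1"] \<open>e' > 0\<close> e1(1) by auto
    then show "\<exists>y\<in>W. dist y z < e'"
    using e(2) e1(2) Ki by (intro bexI[of _ y']) (auto simp: dist_commute subset_iff)
    qed
    qed
    then show ?thesis using e(1) by (intro exI[of _ e]) blast
    qed
    have conX: "connected ?X"
    using st by (intro connected_continuous_image continuous_on_subset[OF G(2)]) auto
    have "openin (top_of_set ?X) (?X Int closure W)"
    unfolding openin_contains_ball using XW by (auto simp: Int_commute)
    moreover have "closedin (top_of_set ?X) (?X Int closure W)" by (simp add: closedin_closed_Int)
    ultimately have "?X Int closure W = {} | ?X Int closure W = ?X"
    using conX connected_clopen by blast
    moreover have "g x \<in> ?X" "g y \<in> ?X" using x y st by auto
    ultimately show False using ins by blast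
    qed
    then have "u (g x) - M' <= infsum rh (?H s t)"
    proof
    assume "?X Int A ~= {}"
    then obtain ta where ta: "s <= ta" "ta <= t" "g ta \<in> A" by auto
    have "\<bar>pval u (g x) - pval u (g ta)\<bar> <= infsum rh (?H s t)"
    using pv[OF x ta(1,2)] le0[of s t] by simp
    moreover have "g ta \<in> Om" by (rule subsetD[OF G(3)]) (use ta st in auto)
    then have "pval u (g ta) <= M'" by (rule pM[OF ta(3)])
    ultimately show ?thesis using xS by (simp add: pval_S)
    next
    assume "\<exists>i\<in>E. ?X Int Q i ~= {}"
    then obtain i ta where i: "i \<in> E" "s <= ta" "ta <= t" "g ta \<in> Q i" by auto
    have "\<bar>u (g x) - Mx u i\<bar> <= infsum (osr u) (?H s t)"
    using pv[OF x i(2,3)] xS pval_Q[OF i(4)] by (simp add: pval_S)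
    moreover have "infsum (osr u) (?H s t) + \<bar>Mx u i - M'\<bar> <= infsum rh (?H s t)"
    proof -
    have "i \<in> ?H s t" using i by (auto simp: hits_def)
    then have "\<bar>Mx u i - M'\<bar> <= infsum (%i. if i \<in> E then \<bar>Mx u i - M'\<bar> else 0) (?H s t)"
    using elem_le_infsum[OF fin_sum[of "%i. \<bar>Mx u i - M'\<bar>"], of i "?H s t"] i(1) by simp
    moreover have "infsum rh (?H s t) = infsum (osr u) (?H s t) + infsum (%i. if i \<in> E then \<bar>Mx u i - M'\<bar> else 0) (?H s t)"
    unfolding rh_def using gst fin_sum by (intro infsum_add) (auto simp: good_on_def)
    ultimately show ?thesis by simp
    qed
    ultimately show ?thesis by linarith
    qed
    then show ?thesis using nonneg by (simp add: w_def)
   qed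
   have ust: "\<bar>u (g s) - u (g t)\<bar> <= infsum rh (?H s t)"
   proof -
    have "\<bar>u (g s) - u (g t)\<bar> <= infsum (osr u) (?H s t)" using g st unfolding good_on_def by blast
    then show ?thesis using le0[of s t] by simp
   qed
   consider "g s \<in> closure W" "g t \<in> closure W" | "g s \<notin> closure W" "g t \<notin> closure W"
    | "g s \<in> closure W" "g t \<notin> closure W" | "g s \<notin> closure W" "g t \<in> closure W" by blast
   then show ?thesis
   proof cases
    case 1 then show ?thesis using ust by (auto simp: ze_def w_def max_def abs_if split: if_splits)
   next
    case 2 then show ?thesis using nonneg by (simp add: ze_def w_def)
   next
    case 3
    then have "w (g t) = 0" by (simp add: w_def)
    then show ?thesis using cross[of s t] 3 w0[of "g s"] by (simp add: ze_def)
   next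
    case 4
    then have "w (g s) = 0" by (simp add: w_def)
    then show ?thesis using cross[of t s] 4 w0[of "g t"] by (simp add: ze_def)
   qed
  qed
  then show ?thesis using g rs unfolding good_on_def by blast
 qed
 obtain Gm where Gm: "ae_good u (osr u) Gm" using uw by (auto simp: wloc_def)
 then have Gmz: "ae_good ze rh Gm" using gw unfolding ae_good_def by blast
 obtain V where V: "open V" "cc V" "closure W \<subseteq> V" using open_neighbourhood[OF Wc] by blast
 have zV: "ze p = 0" if "i \<notin> hQ V" "p \<in> FQ i" for i p
  using that frontier_hits_open[OF V(1), of p i] V(3) FQ_CQ by (auto simp: ze_def w_def)
 have sz: "wsob ze"
 proof (rule wsobI[OF lbz V(2) zV _ _ Gmz rn])
  have "(%i. (osr u i + (if i \<in> E then osr ze i else 0))^2) summable_on hQ V"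
  proof (rule summable_on_square_add)
   show "(%i. (osr u i)^2) summable_on hQ V" using U(2) V(2) by (simp add: loc_l2_def)
   have "(%i. (if i \<in> E then osr ze i else 0)^2) = (%i. if i \<in> E then (osr ze i)^2 else 0)" by auto
   then show "(%i. (if i \<in> E then osr ze i else 0)^2) summable_on hQ V" using fin_sum by simp
  qed
  then show "(%i. (osr ze i)^2) summable_on hQ V"
  proof (rule summable_on_le)
   fix i
   show "(osr ze i)^2 <= (osr u i + (if i \<in> E then osr ze i else 0))^2"
    using oz[of i] nn[of i] osr_nonneg[OF lbz, of i] by (intro power_mono) auto
  qed simp
  have "(%i. (\<bar>Mx u i * dQ i\<bar> + \<bar>M'\<bar> * dQ i)^2) summable_on hQ V"
   using loc_l2_add[OF loc_l2_le[OF U(3), of "%i. \<bar>Mx u i * dQ i\<bar>"] loc_l2_cmult[OF loc_l2_diameter, of "\<bar>M'\<bar>"]] V(2)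
   by (simp add: loc_l2_def)
  then show "(%i. (Mx ze i * dQ i)^2) summable_on hQ V"
  proof (rule summable_on_le)
   fix i
   obtain p where p: "p \<in> FQ i" using frontier_Q_nonempty by blast
   have "Mx ze i <= \<bar>Mx u i\<bar> + \<bar>M'\<bar>" using zb by (intro Mx_least) (meson abs_le_D1)
   moreover have "- (\<bar>Mx u i\<bar> + \<bar>M'\<bar>) <= Mx ze i" using zb[OF p] le_Mx[OF lbz p] by linarith
   ultimately have "\<bar>Mx ze i\<bar> <= \<bar>Mx u i\<bar> + \<bar>M'\<bar>" by simp
   then have "\<bar>Mx ze i\<bar> * dQ i <= (\<bar>Mx u i\<bar> + \<bar>M'\<bar>) * dQ i"
    using less_imp_le[OF diameter_Q_pos] by (rule mult_right_mono)
   then have "\<bar>Mx ze i * dQ i\<bar> <= \<bar>\<bar>Mx u i * dQ i\<bar> + \<bar>M'\<bar> * dQ i\<bar>"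
    using less_imp_le[OF diameter_Q_pos[of i]] by (simp add: abs_mult algebra_simps)
   then show "(Mx ze i * dQ i)^2 <= (\<bar>Mx u i * dQ i\<bar> + \<bar>M'\<bar> * dQ i)^2"
    by (simp add: abs_le_square_iff)
  qed simp
 qed
 have zS: "ze x = 0" if "x \<in> S - V" for x using that V(3) by (auto simp: ze_def w_def)
 have en: "energy V u <= energy V (%x. u x + ze x)"
  using u V sz zS unfolding har_def by blast
 have lbu: "locally_bounded (%x. u x + ze x)" by (rule bounded_add[OF U(1) lbz])
 \<comment> \<open>The arc touches the disk of \<open>E\<close>, so the infimum of \<open>u\<close>
   there is at most \<open>M'\<close>. Hence the truncation does not go below that infimum, and the
   oscillation of this disk does not grow.\<close>
 have MnM: "Mn u i <= M'" if i: "i \<in> E" for i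
 proof -
  obtain p where p: "p \<in> A" "p \<in> FQ i" using AE[OF i] by blast
  then have "u p <= M'" using M(1) FQ_S by blast
  then show ?thesis using Mn_le[OF U(1) p(2)] by simp
 qed
 have ole: "osr (%x. u x + ze x) j <= osr u j" for j
 proof (cases "j \<in> E")
  case True
  show ?thesis
  proof (rule osr_least)
   fix p q assume pq: "p \<in> FQ j" "q \<in> FQ j"
   have "u p + ze p <= Mx u j" using le_Mx[OF U(1) pq(1)] w0[of p] by (simp add: ze_def)
   moreover have "Mn u j <= u q + ze q" using Mn_le[OF U(1) pq(2)] MnM[OF True] by (auto simp: ze_def w_def max_def)
   ultimately show "u p + ze p - (u q + ze q) <= osr u j" by (simp add: osr_def)
  qed
 next
  case False
  show ?thesis
  proof (rule osr_least)
   fix p q assume pq: "p \<in> FQ j" "q \<in> FQ j"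
   then show "u p + ze p - (u q + ze q) <= osr u j"
    using dicho[OF False] abs_diff_le_osr[OF U(1) pq] nn[of j] by (auto simp: ze_def max_def)
  qed
 qed
 have eq: "osr (%x. u x + ze x) j = osr u j" if j: "j \<in> hQ V" for j
 proof (rule ccontr)
  assume "\<not> ?thesis"
  then have lt: "osr (%x. u x + ze x) j < osr u j" using ole[of j] by simp
  have su: "(%i. (osr u i)^2) summable_on hQ V" using U(2) V(2) by (simp add: loc_l2_def)
  have le: "(osr (%x. u x + ze x) i)^2 <= (osr u i)^2" for i
   using ole osr_nonneg[OF lbu] by (intro power_mono)
  have "energy V (%x. u x + ze x) < energy V u"
   unfolding energy_def
  proof (rule infsum_less[OF _ su le j])
   show "(%i. (osr (%x. u x + ze x) i)^2) summable_on hQ V" by (rule summable_on_le[OF su]) (use le in auto)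
   show "(osr (%x. u x + ze x) j)^2 < (osr u j)^2" using lt osr_nonneg[OF lbu] by (intro power_strict_mono) auto
  qed
  then show False using en by simp
 qed
 \<comment> \<open>If \<open>u\<close> exceeds \<open>M'\<close> somewhere on the boundary of a disk
   inside \<open>W\<close>, cutting off at \<open>M'\<close> strictly lowers the oscillation unless
   it is 0 already. Since minimality forces equality, the excess is constant on each disk off
   \<open>E\<close>.\<close>
 have oz0: "osr ze j = 0" if j: "j \<notin> E" for j
  using dicho[OF j]
 proof
  assume "\<forall>p\<in>FQ j. w p = 0"
  then show ?thesis using osr_zero[of j ze] by (simp add: ze_def)
 next
  assume *: "Q j \<subseteq> W & (\<forall>p\<in>FQ j. w p = max (u p - M') 0)"
  have jV: "j \<in> hQ V"
  proof -
   have "Q j \<subseteq> V" using * V(3) closure_subset[of W] by blast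
   then show ?thesis using Q_nonempty[of j] by (auto simp: hits_def)
  qed
  show ?thesis
  proof (cases "Mx u j <= M'")
   case True
   then have "ze p = 0" if "p \<in> FQ j" for p using * that le_Mx[OF U(1) that] by (simp add: ze_def)
   then show ?thesis using osr_zero[of j ze] by simp
  next
   case False
   have "osr (%x. u x + ze x) j <= max (M' - Mn u j) 0"
   proof (rule osr_least)
    fix p q assume "p \<in> FQ j" "q \<in> FQ j"
    then show "u p + ze p - (u q + ze q) <= max (M' - Mn u j) 0"
    using * Mn_le[OF U(1), of q j] by (auto simp: ze_def max_def)
   qed
   then have "osr u j <= max (M' - Mn u j) 0" using eq[OF jV] by simp
   then have "osr u j <= 0" using False by (auto simp: osr_def max_def split: if_splits)
   then show ?thesis using oz[OF j] osr_nonneg[OF lbz, of j] by simp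
  qed
 qed
 have wz: "wloc ze" using sz by (simp add: wsob_def)
 \<comment> \<open>\<open>W\<close> together with one point of the open arc is still connected and
   avoids \<open>K\<close>. On this set the excess, seen through nearby disks, is locally constant,
   so it suffices that it vanishes at the point on the arc.\<close>
 define C where "C = insert (f t) W"
 have Cc: "connected C" unfolding C_def
  by (rule connected_intermediate_closure[OF W(2)]) (use t(2) closure_subset in auto)
 have CK: "C Int K = {}" using t(3) WKA(1) by (auto simp: C_def)
 have CO: "C \<subseteq> Om" using Wc(2) t(2) closure_subset by (auto simp: C_def)
 have Kc: "closed K" unfolding K using fE by auto
 have loc: "\<exists>r>0. \<forall>k1\<in>hQ (ball z r). \<forall>k2\<in>hQ (ball z r). Mx ze k1 = Mx ze k2" if z: "z \<in> C" for z
 proof -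
  have "open (Om - K)" using open_Omega Kc by blast
  then obtain e where e: "e > 0" "ball z e \<subseteq> Om - K" using z CK CO open_contains_ball by (metis DiffI IntI empty_iff subsetD)
  have "osr ze i = 0" if "i \<in> hQ (ball z (6 * (e/6)))" for i
  proof (rule oz0)
   show "i \<notin> E"
   proof
    assume "i \<in> E"
    then have "Q i \<subseteq> K" using K closure_subset by blast
    then show False using that e(2) by (auto simp: hits_def)
   qed
  qed
  note o0 = this
  have e6: "e / 6 > 0" "ball z (6 * (e/6)) \<subseteq> Om" using e by auto
  have "Mx ze k1 = Mx ze k2" if "k1 \<in> hQ (ball z (e/6))" "k2 \<in> hQ (ball z (e/6))" for k1 k2
   by (rule locally_constant_of_osr_zero[OF wz e6 o0 that])
  then show ?thesis using e6(1) by blast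
 qed
 define T where "T = {z \<in> C. \<exists>r>0. \<forall>k\<in>hQ (ball z r). Mx ze k = 0}"
 have openT: "\<exists>r>0. ball z r Int C \<subseteq> (if z \<in> T then T else - T)" if z: "z \<in> C" for z
 proof -
  obtain r where r: "r > 0" "\<forall>k1\<in>hQ (ball z r). \<forall>k2\<in>hQ (ball z r). Mx ze k1 = Mx ze k2" using loc[OF z] by blast
  have shrink: "\<exists>r'>0. ball y r' \<subseteq> ball z r" if "y \<in> ball z r" for y
   using that open_contains_ball open_ball by blast
  show ?thesis
  proof (cases "z \<in> T")
   case True
   then obtain r1 where r1: "r1 > 0" "\<forall>k\<in>hQ (ball z r1). Mx ze k = 0" by (auto simp: T_def)
   obtain k1 where k1: "k1 \<in> hQ (ball z (min r r1))" using ball_hits_disk[of z "min r r1"] z CO r r1 by auto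
   have "Mx ze k1 = 0" "k1 \<in> hQ (ball z r)"
    using k1 r1(2) hits_mono[OF subset_ball[of "min r r1" r z]] hits_mono[OF subset_ball[of "min r r1" r1 z]] by auto
   then have all: "Mx ze k = 0" if "k \<in> hQ (ball z r)" for k
    using r(2)[rule_format, OF that, of k1] by simp
   have "y \<in> T" if y: "y \<in> ball z r Int C" for y
   proof -
    obtain r' where "r' > 0" "ball y r' \<subseteq> ball z r" using shrink y by blast
    then have "\<forall>k\<in>hQ (ball y r'). Mx ze k = 0" using all hits_mono[of "ball y r'" "ball z r"] by blast
    then show ?thesis using y \<open>r' > 0\<close> unfolding T_def by blast
   qed
   then show ?thesis using True r(1) by auto
  next
   case False
   have "y \<notin> T" if y: "y \<in> ball z r Int C" for y
   proof
    assume "y \<in> T"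
    then obtain r2 where r2: "r2 > 0" "\<forall>k\<in>hQ (ball y r2). Mx ze k = 0" by (auto simp: T_def)
    obtain r' where r': "r' > 0" "ball y r' \<subseteq> ball z r" using shrink y by blast
    obtain k1 where k1: "k1 \<in> hQ (ball y (min r' r2))" using ball_hits_disk[of y "min r' r2"] y CO r' r2 by auto
    have "Mx ze k1 = 0" using k1 r2(2) hits_mono[OF subset_ball[of "min r' r2" r2 y]] by auto
    moreover have "k1 \<in> hQ (ball z r)"
    using k1 hits_mono[OF order.trans[OF subset_ball[of "min r' r2" r' y] r'(2)]] by auto
    ultimately have "Mx ze k = 0" if "k \<in> hQ (ball z r)" for k
    using r(2)[rule_format, OF that, of k1] by simp
    then show False using False z r(1) by (auto simp: T_def)
   qed
   then show ?thesis using False r(1) by auto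
  qed
 qed
 have "openin (top_of_set C) T"
  unfolding openin_contains_ball
 proof (intro conjI ballI)
  fix z assume "z \<in> T"
  then have "z \<in> C" by (simp add: T_def)
  then show "\<exists>e>0. ball z e Int C \<subseteq> T" using openT[of z] \<open>z \<in> T\<close> by auto
 qed (auto simp: T_def)
 moreover have "openin (top_of_set C) (C - T)"
  unfolding openin_contains_ball
 proof (intro conjI ballI)
  fix z assume z: "z \<in> C - T"
  then obtain e where "e > 0" "ball z e Int C \<subseteq> - T" using openT[of z] by auto
  then show "\<exists>e>0. ball z e Int C \<subseteq> C - T" by blast
 qed auto
 then have "closedin (top_of_set C) T"
  unfolding closedin_def by (auto simp: T_def)
 ultimately have TC: "T = {} | T = C" using Cc connected_clopen by blast
 \<comment> \<open>Near \<open>t\<close> the arc is not constant, so by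
   \<open>dist_le_sum_diameter\<close> it meets a disk there, and the values of that disk are at
   most \<open>M'\<close>.\<close>
 have tT: "f t \<in> T"
 proof -
  have ftC: "f t \<in> C" by (simp add: C_def)
  obtain r where r: "r > 0" "\<forall>k1\<in>hQ (ball (f t) r). \<forall>k2\<in>hQ (ball (f t) r). Mx ze k1 = Mx ze k2" using loc[OF ftC] by blast
  have cf: "continuous_on {a..b} f" using good by (simp add: good_on_def)
  obtain d where d: "d > 0" "\<forall>x\<in>{a..b}. dist x t < d --> dist (f x) (f t) < r"
  proof -
   have "t \<in> {a..b}" using t(1) by auto
   then show ?thesis using cf r(1) that unfolding continuous_on_iff by blast
  qed
  obtain t' where t': "\<bar>t' - t\<bar> < min d (min (t - a) (b - t))" "f t' ~= f t"
   using t(4)[of "min d (min (t - a) (b - t))"] d(1) t(1) by auto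
  define s1 where "s1 = min t t'"
  define s2 where "s2 = max t t'"
  have s12: "a <= s1" "s1 <= s2" "s2 <= b" "f s1 ~= f s2" "!!x. x \<in> {s1..s2} ==> dist x t < d"
   using t' t(1) by (auto simp: s1_def s2_def min_def max_def dist_real_def abs_if split: if_splits)
  have gs: "good_on u (osr u) f s1 s2" by (rule good_on_sub[OF good s12(1-3) nn])
  have "hQ (f ` {s1..s2}) ~= {}"
  proof
   assume "hQ (f ` {s1..s2}) = {}"
   then have "dist (f s1) (f s2) <= 0"
    using dist_le_sum_diameter[of s1 s2 f] gs by (simp add: good_on_def)
   then show False using s12 by simp
  qed
  then obtain j where j: "j \<in> hQ (f ` {s1..s2})" by blast
  have "hQ (f ` {s1..s2}) \<subseteq> hQ A" unfolding A using s12 by (intro hits_Icc_mono) auto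
  then have "Mx u j <= M'" using M(2) j by blast
  then have "ze p = 0" if "p \<in> FQ j" for p using le_Mx[OF U(1) that] by (simp add: ze_def w_def)
  then have "Mx ze j = 0" using osr_zero[of j ze] by simp
  moreover have sb: "f ` {s1..s2} \<subseteq> ball (f t) r"
  proof
   fix y assume "y \<in> f ` {s1..s2}"
   then obtain x where x: "x \<in> {s1..s2}" "y = f x" by (rule imageE) (rule that)
   then have "x \<in> {a..b}" using s12(1,3) by auto
   then have "dist (f x) (f t) < r" using d(2) s12(5)[OF x(1)] by blast
   then show "y \<in> ball (f t) r" unfolding x(2) by (simp add: dist_commute)
  qed
  have "j \<in> hQ (ball (f t) r)" using j hits_mono[OF sb] by (rule rev_subsetD)
  ultimately have "Mx ze k = 0" if "k \<in> hQ (ball (f t) r)" for k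
   using r(2)[rule_format, OF that, of j] by simp
  then show ?thesis using r(1) ftC unfolding T_def by blast
 qed
 then have TeqC: "T = C" using TC by auto
 obtain z where z: "z \<in> Q k" "z \<in> W" using k by (auto simp: hits_def)
 then have "z \<in> T" unfolding TeqC by (simp add: C_def)
 then obtain r where "r > 0" "\<forall>k\<in>hQ (ball z r). Mx ze k = 0" unfolding T_def by blast
 moreover have "k \<in> hQ (ball z r)" if "r > 0" for r using z that by (auto simp: hits_def)
 ultimately have Mz: "Mx ze k = 0" by simp
 have kE: "k \<notin> E" using z WKA(1) K closure_subset by blast
 have zero: "ze p = 0" if "p \<in> FQ k" for p
  using le_Mx[OF lbz that] Mn_le[OF lbz that] oz0[OF kE] Mz by (simp add: osr_def)
 show ?thesis
  using dicho[OF kE]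
 proof
  assume *: "Q k \<subseteq> W & (\<forall>p\<in>FQ k. w p = max (u p - M') 0)"
  show ?thesis
  proof (rule Mx_least)
   fix p assume "p \<in> FQ k"
   then show "u p <= M'" using zero[of p] * by (auto simp: ze_def max_def split: if_splits)
  qed
 next
  assume *: "\<forall>p\<in>FQ k. w p = 0"
  show ?thesis
  proof (cases "k \<in> hQ A")
   case False
   have "Q k Int frontier W = {}"
    using WKA(2) KQ[OF kE] False closure_subset[of "Q k"] by (auto simp: hits_def)
   then have "Q k \<subseteq> W" using connected_Int_frontier[OF Q_connected, of k W] z by blast
   then have "CQ k \<subseteq> closure W" by (rule closure_mono)
   show ?thesis
   proof (rule Mx_least)
    fix p assume "p \<in> FQ k"
    then show "u p <= M'" using * \<open>CQ k \<subseteq> closure W\<close> FQ_CQ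
    by (fastforce simp: w_def max_def split: if_splits)
   qed
  qed (rule M(2))
 qed
qed


section \<open>Oscillation of harmonic functions near a point\<close>

lemma sup_norm_ball_connected: "connected {z. sup_norm (z - c) < s}"
proof (cases "s > 0")
 case True
 have "closed_segment c y \<subseteq> {z. sup_norm (z - c) < s}" if "sup_norm (y - c) < s" for y
 proof
  fix z assume "z \<in> closed_segment c y"
  then obtain l where l: "0 <= l" "l <= 1" "z = (1 - l) *\<^sub>R c + l *\<^sub>R y" by (auto simp: closed_segment_def)
  have "z - c = of_real l * (y - c)" using l(3) by (simp add: scaleR_conv_of_real algebra_simps)
  then have "sup_norm (z - c) = l * sup_norm (y - c)" using l(1) by (simp add: sup_norm_scale)
  also have "... <= 1 * sup_norm (y - c)" using l(2) sup_norm_nonneg by (rule mult_right_mono)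
  finally show "z \<in> {z. sup_norm (z - c) < s}" using that by simp
 qed
 then have "starlike {z. sup_norm (z - c) < s}"
  unfolding starlike_def using True by (intro bexI[of _ c]) (auto simp: sup_norm_0)
 then show ?thesis by (rule starlike_imp_connected)
next
 case False
 then have "{z. sup_norm (z - c) < s} = {}" using sup_norm_nonneg by (auto simp: not_less intro: order_trans)
 then show ?thesis by simp
qed

lemma sup_norm_sphere_closure:
 assumes "s > 0" "sup_norm (y - c) = s" shows "y \<in> closure {z. sup_norm (z - c) < s}"
 unfolding closure_approachable
proof (intro allI impI)
 fix e :: real assume e: "e > 0"
 define l where "l = min (1/2) (e / (2 * (norm (y - c) + 1)))"
 have l: "l > 0" "l < 1" using e by (auto simp: l_def add_nonneg_pos)
 define z where "z = c + of_real (1 - l) * (y - c)"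
 have "sup_norm (z - c) = (1 - l) * s" using l assms(2) sup_norm_scale[of "1 - l" "y - c"] by (simp add: z_def)
 then have "sup_norm (z - c) < s" using l assms(1) by simp
 moreover have "y - z = of_real l * (y - c)" by (simp add: z_def algebra_simps)
 then have "dist z y = l * norm (y - c)" using l by (simp add: dist_norm norm_minus_commute norm_mult)
 moreover have "l * norm (y - c) < e"
 proof -
  have "l * norm (y - c) <= e / (2 * (norm (y - c) + 1)) * norm (y - c)" by (intro mult_right_mono) (auto simp: l_def)
  also have "... = e * (norm (y - c) / (2 * (norm (y - c) + 1)))" by simp
  also have "... < e * 1" using e by (intro mult_strict_left_mono) (auto simp: divide_less_eq add_nonneg_pos)
  finally show ?thesis by simp
 qed
 ultimately show "\<exists>z\<in>{z. sup_norm (z - c) < s}. dist z y < e" by auto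
qed

lemma square_loop_not_constant_near:
 assumes s: "s > 0" and t: "-s <= t" "t < 15 * s" and e: "e > 0"
 shows "\<exists>t'. \<bar>t' - t\<bar> < e & square_loop c s t' ~= square_loop c s t"
proof -
 define t' where "t' = t + min (e/2) (min s ((15 * s - t) / 2))"
 have "t' > t" "t' - t < e" "t' - t < 8 * s" "t' < 15 * s" using s t e by (auto simp: t'_def min_def field_simps)
 then show ?thesis using square_loop_inj[of s t' t c] s t by (intro exI[of _ t']) auto
qed

text \<open>The maximum principle for \<open>u\<close> and for \<open>- u\<close>. Along the arc
  \<open>pval u\<close> stays within \<open>d\<close> of its first value; a disk on the arc has
  oscillation at most \<open>d\<close>, and passing from its supremum to its infimum accounts for
  the second \<open>d\<close>.\<close>

lemma region_oscillation:
 assumes u: "har u" and E: "!!i j. i \<in> E ==> j \<in> E ==> i = j" and K: "K = (\<Union>i\<in>E. CQ i)"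
  and W: "open W" "connected W" "cc W"
  and good: "good_on u (osr u) f a b" and A: "A = f ` {a..b}"
  and WKA: "W Int (K Un A) = {}" "frontier W \<subseteq> K Un A"
  and AE: "!!i. i \<in> E ==> A Int Q i = {} & A Int FQ i ~= {}"
  and near: "!!p. p \<in> (K Int closure W) - A ==> \<exists>rh>0. ball p rh - K \<subseteq> W"
  and t: "t \<in> {a<..<b}" "f t \<in> closure W" "f t \<notin> K" "!!e. e > 0 ==> \<exists>t'. \<bar>t' - t\<bar> < e & f t' ~= f t"
  and d: "infsum (osr u) (hQ A) <= d" and k: "k \<in> hQ W"
 shows "pval u (f a) - 2 * d <= Mn u k" "Mx u k <= pval u (f a) + 2 * d"
proof -
 have uw: "wloc u" using u by (simp add: har_def)
 note U = wlocD(1)[OF uw] and um = wloc_uminus[OF uw]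
 have nn: "0 <= osr u i" for i by (rule osr_nonneg[OF U])
 have sm: "osr u summable_on hQ A" using good by (simp add: good_on_def A)
 have pv: "\<bar>pval u (f a) - pval u y\<bar> <= d" if y: "y \<in> A" for y
 proof -
  obtain t where t: "t \<in> {a..b}" "y = f t" using y unfolding A by (rule imageE) (rule that)
  then have t': "a <= t" "t <= b" by auto
  have "\<bar>pval u (f a) - pval u (f t)\<bar> <= infsum (osr u) (hQ (f ` {a..t}))"
   by (rule pval_diff_le[OF U good_on_sub[OF good order.refl t' nn]])
  also have "... <= infsum (osr u) (hQ A)"
   unfolding A by (rule infsum_sub_mono[OF sm[unfolded A] hits_Icc_mono[OF order.refl t'(2)] nn order.refl nn])
  finally show ?thesis using d t(2) by simp
 qed
 have d0: "d >= 0" using infsum_nonneg[of "hQ A" "osr u"] nn d by simp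
 have on: "\<bar>u p - pval u (f a)\<bar> <= d" if "p \<in> A Int S" for p
  using pv[of p] that by (simp add: pval_S abs_minus_commute)
 have dk: "\<bar>Mx u j - pval u (f a)\<bar> <= d & osr u j <= d" if j: "j \<in> hQ A" for j
 proof -
  obtain y where y: "y \<in> Q j" "y \<in> A" using j by (auto simp: hits_def)
  have "osr u j <= d" using elem_le_infsum[OF sm j nn] d by simp
  then show ?thesis using pv[OF y(2)] pval_Q[OF y(1), of u] by (simp add: abs_minus_commute)
 qed
 show "Mx u k <= pval u (f a) + 2 * d"
 proof (rule max_principle[OF u E K W good A WKA AE near t _ _ k])
  fix p assume "p \<in> A Int S" then show "u p <= pval u (f a) + 2 * d" using on[of p] d0 by linarith
 next
  fix j assume "j \<in> hQ A" then show "Mx u j <= pval u (f a) + 2 * d" using dk[of j] d0 by linarith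
 qed
 have gm: "good_on (%z. - u z) (osr (%z. - u z)) f a b"
  using good unfolding um(2) good_on_def by (simp add: abs_minus_commute)
 have "Mx (%z. - u z) k <= - pval u (f a) + 2 * d"
 proof (rule max_principle[OF har_uminus[OF u] E K W gm A WKA AE near t _ _ k])
  fix p assume "p \<in> A Int S" then show "- u p <= - pval u (f a) + 2 * d" using on[of p] d0 by linarith
 next
  fix j assume "j \<in> hQ A"
  then show "Mx (%z. - u z) j <= - pval u (f a) + 2 * d" using dk[of j] d0 by (auto simp: um(3) osr_def abs_le_iff)
 qed
 then show "pval u (f a) - 2 * d <= Mn u k" by (simp add: um(3))
qed

text \<open>If \<open>x\<close> lies on no disk boundary, the region is a full open square around
  \<open>x\<close>. Otherwise it is the exterior region cut off by one arc of a square, and only the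
  disk carrying \<open>x\<close> stays uncontrolled.\<close>

lemma harmonic_disks_near:
 assumes u: "har u" and x: "x \<in> S" and d: "d > 0"
 obtains r c where "r > 0"
  "!!k. k \<in> hQ (ball x r) ==> x \<notin> CQ k ==> c - d <= Mn u k & Mx u k <= c + d"
proof -
 have uw: "wloc u" using u by (simp add: har_def)
 note U = wlocD[OF uw]
 have nn: "0 <= osr u i" for i by (rule osr_nonneg[OF U(1)])
 obtain Gm where Gm: "ae_good u (osr u) Gm" using uw by (auto simp: wloc_def)
 have "x \<in> Om" using x S_subset by blast
 then obtain e where e: "e > 0" "cball x e \<subseteq> Om" using open_Omega open_contains_cball by blast
 have cc: "cc W" if "W \<subseteq> cball x e" for W
 proof -
  have "closure W \<subseteq> cball x e" using that by (rule closure_minimal) simp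
  moreover have "bounded W" using that bounded_subset bounded_cball by blast
  then have "compact (closure W)" by (simp add: compact_closure)
  ultimately show ?thesis using e(2) by (auto simp: compactly_contained_def)
 qed
 have square: "\<exists>s>0. s < R0 & (\<forall>a b. - s <= a --> a <= b --> b <= 15 * s --> good_on u (osr u) (square_loop x s) a b) &
   osr u summable_on hQ (square x s) & infsum (osr u) ({i. x \<notin> CQ i} Int hQ (square x s)) <= d / 2"
  if R0: "0 < R0" "R0 <= e / 4" for R0
 proof -
  have "ball x (2 * R0) \<subseteq> cball x e" using R0 by auto
  then have sm: "(%i. (osr u i)^2) summable_on hQ (ball x (2 * R0))" and sub: "ball x (2 * R0) \<subseteq> Om"
   using U(2) cc e(2) by (auto simp: loc_l2_def)
  have d2: "d / 2 > 0" using d by simp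
  obtain s where "0 < s" "s < R0"
   "\<forall>a b. - s <= a --> a <= b --> b <= 15 * s --> good_on u (osr u) (square_loop x s) a b"
   "osr u summable_on hQ (square x s)"
   "infsum (osr u) ({i. x \<notin> CQ i} Int hQ (square x s)) <= d / 2"
   by (rule exists_good_square[OF R0(1) nn sm AE_square_good[OF Gm R0(1) sub] d2])
  then show ?thesis by blast
 qed
 show thesis
 proof (cases "\<exists>i. x \<in> FQ i")
  case False
  have "e / 4 > 0" using e by simp
  obtain s where s: "0 < s" "s < e / 4"
   "\<forall>a b. - s <= a --> a <= b --> b <= 15 * s --> good_on u (osr u) (square_loop x s) a b"
   "osr u summable_on hQ (square x s)"
   "infsum (osr u) ({i. x \<notin> CQ i} Int hQ (square x s)) <= d / 2"
   using square[OF \<open>e / 4 > 0\<close> order.refl] by blast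
  have all: "{i. x \<notin> CQ i} Int hQ (square x s) = hQ (square x s)"
   using S_closure_Q[OF x] False by blast
  define W where "W = {z. sup_norm (z - x) < s}"
  have We: "W \<subseteq> cball x e"
  proof
   fix z assume "z \<in> W"
   then have "norm (z - x) <= e" using norm_le_sup_norm[of "z - x"] s by (simp add: W_def)
   then show "z \<in> cball x e" by (simp add: dist_norm norm_minus_commute)
  qed
  have W: "open W" "connected W" "cc W"
   using cc[OF We] sup_norm_ball_connected[of x s] unfolding W_def
   by (auto intro!: open_Collect_less continuous_intros)
  have good: "good_on u (osr u) (square_loop x s) (-s) (-s + 8 * s)" using s(1,3) by simp
  have im: "square_loop x s ` {-s..-s + 8 * s} = square x s" using s by (intro square_loop_image) auto
  have WA: "W Int ({} Un square x s) = {}" by (auto simp: W_def square_def)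
  have "closure W \<subseteq> {z. sup_norm (z - x) <= s}"
   unfolding W_def by (rule closure_minimal) (auto intro!: closed_Collect_le continuous_intros)
  then have fr: "frontier W \<subseteq> {} Un square x s"
   using W(1) by (auto simp: frontier_def interior_open W_def square_def)
  have f0: "square_loop x s 0 \<in> closure W"
   unfolding W_def by (rule sup_norm_sphere_closure[OF s(1) sup_norm_square_loop[OF s(1)]]) (use s in auto)
  have nc: "\<exists>t'. \<bar>t' - 0\<bar> < e & square_loop x s t' ~= square_loop x s 0" if "e > 0" for e
   by (rule square_loop_not_constant_near[OF s(1) _ _ that]) (use s in auto)
  have su: "infsum (osr u) (hQ (square x s)) <= d / 2" using s(5) all by simp
  have osc: "pval u (square_loop x s (- s)) - 2 * (d / 2) <= Mn u k" "Mx u k <= pval u (square_loop x s (- s)) + 2 * (d / 2)"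
   if "k \<in> hQ W" for k
   by (rule region_oscillation[OF u _ _ W good im[symmetric] WA fr _ _ _ f0 _ nc su that, of "{}"]; use s in auto)+
  have bW: "ball x s \<subseteq> W"
  proof
   fix z assume "z \<in> ball x s"
   then show "z \<in> W" using sup_norm_le_norm[of "z - x"] by (simp add: W_def dist_norm norm_minus_commute)
  qed
  show thesis
  proof (rule that[OF s(1)])
   fix k assume "k \<in> hQ (ball x s)"
   then have "k \<in> hQ W" using hits_mono[OF bW] by (rule rev_subsetD)
   then show "pval u (square_loop x s (- s)) - d <= Mn u k & Mx u k <= pval u (square_loop x s (- s)) + d"
    using osc[of k] by simp
  qed
 next
  case True
  then obtain i0 where i0: "x \<in> FQ i0" by blast
  obtain c where c: "simple_path c" "pathfinish c = pathstart c" "Q i0 = inside (path_image c)"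
   "FQ i0 = path_image c" "- CQ i0 = outside (path_image c)"
   by (rule jordan_curve[of i0]) (rule that)
  define K where "K = CQ i0"
  have Kc: "K = - outside (path_image c)" using c(5) by (auto simp: K_def)
  show thesis
  proof (rule jordan_curve.exterior_arc_region[OF jordan_curve.intro[OF c(1,2)] i0[unfolded c(4)] e(1), folded Kc])
  fix d' :: real
  assume d': "d' > 0"
   "!!(f :: real => complex) t0 t1 r. [|t0 < t1; continuous_on {t0..t1} f; inj_on f {t0<..<t1}; f t0 \<in> K; f t1 \<in> K;
   f ` {t0..t1} \<subseteq> ball x d'; r > 0; ball x r Int f ` {t0..t1} = {};
   !!y z. y \<in> ball x r ==> z \<notin> ball x e ==> \<not> connected_component (- (f ` {t0..t1})) y z|] ==>
   \<exists>a b W. t0 <= a & a < b & b <= t1 & f ` {a<..<b} Int K = {} & f a \<in> K & f b \<in> K &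
    open W & connected W & W \<subseteq> ball x e & (\<exists>rh>0. ball x rh - K \<subseteq> W) &
    W Int (K Un f ` {a..b}) = {} & frontier W \<subseteq> K Un f ` {a..b} &
    (\<forall>p\<in>(K Int closure W) - f ` {a..b}. \<exists>rh>0. ball p rh - K \<subseteq> W) &
    (\<exists>t\<in>{a<..<b}. f t \<in> closure W)"
  obtain q where q: "q \<in> Q i0" using Q_nonempty by blast
  have xQ: "x \<notin> Q i0" using S_not_Q[OF x] .
  then have qx: "sup_norm (q - x) > 0" using q sup_norm_nonneg[of "q - x"] sup_norm_eq_0[of "q - x"] by auto
  \<comment> \<open>Below \<open>sup_norm (q - x)\<close> every square still crosses
    \<open>Q i0\<close>, so the loop can start and end inside this disk. The division of
    \<open>d'\<close> by 2 comes from comparing the two norms.\<close>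
  define R0 where "R0 = min (sup_norm (q - x)) (min (d' / 2) (e / 4))"
  have R0: "0 < R0" "R0 <= e / 4" "R0 <= d' / 2" "R0 <= sup_norm (q - x)" using qx d'(1) e(1) by (auto simp: R0_def)
  obtain s where s: "0 < s" "s < R0"
   "\<forall>a b. - s <= a --> a <= b --> b <= 15 * s --> good_on u (osr u) (square_loop x s) a b"
   "osr u summable_on hQ (square x s)"
   "infsum (osr u) ({i. x \<notin> CQ i} Int hQ (square x s)) <= d / 2"
   using square[OF R0(1,2)] by blast
  have "x \<in> CQ i0" using i0 FQ_CQ by blast
  then obtain p where p: "p \<in> Q i0" "dist p x < s" using s(1) closure_approachable by blast
  have "sup_norm (p - x) <= s" using p(2) sup_norm_le_norm[of "p - x"] by (simp add: dist_norm)
  then have "Q i0 Int square x s ~= {}"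
   using s R0 by (intro connected_meets_square[OF Q_connected p(1) q]) auto
  then obtain y where y: "y \<in> Q i0" "sup_norm (y - x) = s" by (auto simp: square_def)
  define f where "f = square_loop x s"
  have s7: "-s \<in> {-s..7 * s}" using s by simp
  obtain t0 where t0: "t0 \<in> {-s..7 * s}" "f t0 = y"
   using square_loop_surj[OF s(1) y(2) s7] unfolding f_def by auto
  have per: "f (t0 + 8 * s) = y" using square_loop_period[OF s(1) t0(1)] t0(2) by (simp add: f_def)
  have yK: "y \<in> K" using y(1) closure_subset by (auto simp: K_def)
  have im: "f ` {t0..t0 + 8 * s} = square x s" unfolding f_def by (rule square_loop_image[OF s(1) t0(1)])
  have contf: "continuous_on A f" for A unfolding f_def by (rule continuous_square_loop)
  have "\<exists>a b W. t0 <= a & a < b & b <= t0 + 8 * s & f ` {a<..<b} Int K = {} & f a \<in> K & f b \<in> K &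
    open W & connected W & W \<subseteq> ball x e & (\<exists>rh>0. ball x rh - K \<subseteq> W) &
    W Int (K Un f ` {a..b}) = {} & frontier W \<subseteq> K Un f ` {a..b} &
    (\<forall>p\<in>(K Int closure W) - f ` {a..b}. \<exists>rh>0. ball p rh - K \<subseteq> W) &
    (\<exists>t\<in>{a<..<b}. f t \<in> closure W)"
  proof (rule d'(2)[where r = s])
   show "inj_on f {t0<..<t0 + 8 * s}"
    unfolding f_def
   proof (rule inj_onI)
    fix t t' assume "t \<in> {t0<..<t0 + 8 * s}" "t' \<in> {t0<..<t0 + 8 * s}" "square_loop x s t = square_loop x s t'"
    then show "t = t'" using t0(1) by (intro square_loop_inj[OF s(1), of t t' x]) auto
   qed
   show "f ` {t0..t0 + 8 * s} \<subseteq> ball x d'"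
    unfolding im using square_subset_cball[of x s] s(2) R0(3) by (auto simp: subset_iff)
   have sb: "sup_norm (z - x) < s" if "z \<in> ball x s" for z
    using that sup_norm_le_norm[of "z - x"] by (simp add: dist_norm norm_minus_commute)
   then show "ball x s Int f ` {t0..t0 + 8 * s} = {}" unfolding im by (force simp: square_def)
   fix y z assume yz: "y \<in> ball x s" "z \<notin> ball x e"
   show "\<not> connected_component (- (f ` {t0..t0 + 8 * s})) y z"
   proof
    assume "connected_component (- (f ` {t0..t0 + 8 * s})) y z"
    then obtain T where T: "connected T" "T \<subseteq> - square x s" "y \<in> T" "z \<in> T"
    unfolding connected_component_def im by blast
    have "s <= sup_norm (z - x)"
    using yz(2) norm_le_sup_norm[of "z - x"] s(2) R0(1,2) by (simp add: dist_norm norm_minus_commute)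
    then show False using connected_meets_square[OF T(1,3,4) less_imp_le[OF sb[OF yz(1)]]] T(2) by blast
   qed
  qed (use s t0 per yK contf in auto)
  then obtain a b W where ab: "t0 <= a" "a < b" "b <= t0 + 8 * s" and fK: "f ` {a<..<b} Int K = {}" "f a \<in> K" "f b \<in> K"
   and W: "open W" "connected W" "W \<subseteq> ball x e" and near: "\<exists>rh>0. ball x rh - K \<subseteq> W"
   and WK: "W Int (K Un f ` {a..b}) = {}" "frontier W \<subseteq> K Un f ` {a..b}"
   and nb: "\<forall>p\<in>(K Int closure W) - f ` {a..b}. \<exists>rh>0. ball p rh - K \<subseteq> W"
   and tt: "\<exists>t\<in>{a<..<b}. f t \<in> closure W"
   by - (erule exE, erule exE, erule exE, (erule conjE)+, rule that)
  obtain t where t: "t \<in> {a<..<b}" "f t \<in> closure W" using tt by blast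
  have tK: "f t \<notin> K" using fK(1) t(1) by blast
  have E: "i = j" if "i \<in> {i0}" "j \<in> {i0}" for i j using that by simp
  have KE: "K = (\<Union>i\<in>{i0}. CQ i)" by (simp add: K_def)
  have Wcc: "cc W" by (rule cc) (use W(3) in auto)
  have good: "good_on u (osr u) f a b" using s(3) ab t0(1) by (simp add: f_def)
  \<comment> \<open>The open arc avoids the closed disk, so its closure avoids the open disk. The
    endpoints, which lie in \<open>K\<close>, are therefore on the boundary of the disk: this is the
    contact that the maximum principle asks for.\<close>
  have AQ: "f ` {a..b} Int Q i0 = {}"
  proof -
   have "f ` closure {a<..<b} \<subseteq> closure (f ` {a<..<b})"
    by (rule image_closure_subset[OF contf closed_closure closure_subset])
   also have "... \<subseteq> - Q i0"
    by (rule closure_minimal) (use fK(1) closure_subset Q_open in \<open>auto simp: K_def closed_Compl\<close>)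
   finally show ?thesis using ab(2) by auto
  qed
  have fa: "f a \<in> f ` {a..b}" using ab(2) by simp
  then have "f a \<in> FQ i0"
   using fK(2) AQ closure_Q_eq[of i0] unfolding K_def by blast
  then have AE: "f ` {a..b} Int Q i = {} & f ` {a..b} Int FQ i ~= {}" if "i \<in> {i0}" for i
   using that AQ fa by blast
  have nc: "\<exists>t'. \<bar>t' - t\<bar> < e & f t' ~= f t" if "e > 0" for e
   unfolding f_def by (rule square_loop_not_constant_near[OF s(1) _ _ that]) (use t ab t0 s in auto)
  \<comment> \<open>The arc does not meet \<open>i0\<close>, the sole disk touching
    \<open>x\<close>, so the estimate for the good square covers all disks on the arc.\<close>
  have "hQ (f ` {a..b}) \<subseteq> {i. x \<notin> CQ i} Int hQ (square x s)"
  proof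
   fix i assume i: "i \<in> hQ (f ` {a..b})"
   then have "i ~= i0" using AQ by (auto simp: hits_def)
   then have "x \<notin> CQ i" using frontier_unique[of x i i0] i0 FQ_CQ by blast
   moreover have "i \<in> hQ (square x s)"
    using i hits_Icc_mono[OF ab(1,3), of f] unfolding im by blast
   ultimately show "i \<in> {i. x \<notin> CQ i} Int hQ (square x s)" by simp
  qed
  note sub = this
  have "infsum (osr u) (hQ (f ` {a..b})) <= infsum (osr u) ({i. x \<notin> CQ i} Int hQ (square x s))"
   by (rule infsum_sub_mono[OF summable_on_sub[OF s(4)] sub nn order.refl nn]) (use nn in auto)
  then have su: "infsum (osr u) (hQ (f ` {a..b})) <= d / 2" using s(5) by simp
  obtain rh where rh: "rh > 0" "ball x rh - K \<subseteq> W" using near by blast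
  show thesis
  proof (rule that[OF rh(1)])
   fix k assume k: "k \<in> hQ (ball x rh)" "x \<notin> CQ k"
   then have "k ~= i0" using i0 FQ_CQ by blast
   then have "Q k Int K = {}" using closure_Q_disjoint[of k i0] closure_subset[of "Q k"] by (auto simp: K_def)
   then have kW: "k \<in> hQ W" using k(1) rh(2) by (auto simp: hits_def)
   note ro = region_oscillation[OF u E KE W(1,2) Wcc good refl WK AE bspec[OF nb] t tK nc su kW]
   show "pval u (f a) - d <= Mn u k & Mx u k <= pval u (f a) + d" using ro by simp
  qed
  qed
 qed
qed

end

section \<open>Normalized functions\<close>

text \<open>The images of the covering sets lie in intervals of twice their diameter, so the image
  has arbitrarily small measure. Applied to distance functions: almost every circle or square around
  a point misses a given set of length 0.\<close>

lemma lipschitz_image_null: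
 fixes ph :: "complex => real"
 assumes A: "hausdorff1 A = 0" and lip: "!!x y. \<bar>ph x - ph y\<bar> <= dist x y"
 shows "AE s in lborel. s \<notin> ph ` A"
proof -
 have "\<forall>n::nat. \<exists>U::nat => complex set. A \<subseteq> (\<Union>k. U k) & (\<forall>k. bounded (U k)) & (\<Sum>k. ennreal (diameter (U k))) <= ennreal (1 / real (Suc n))"
  using A unfolding hausdorff1_eq_0_iff by simp
 then obtain U :: "nat => nat => complex set" where
  U: "!!n. A \<subseteq> (\<Union>k. U n k)" "!!n k. bounded (U n k)" "!!n. (\<Sum>k. ennreal (diameter (U n k))) <= ennreal (1 / real (Suc n))"
  by metis
 define y where "y n k = (SOME z. z \<in> U n k)" for n k
 define I where "I n k = {ph (y n k) - diameter (U n k)..ph (y n k) + diameter (U n k)}" for n k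
 define N where "N = (\<Inter>n. \<Union>k. I n k)"
 have d0: "0 <= diameter (U n k)" for n k by (rule diameter_ge_0[OF U(2)])
 have meas: "(\<Union>k. I n k) \<in> sets lborel" "N \<in> sets lborel" for n unfolding N_def I_def by auto
 have "emeasure lborel N <= ennreal (2 / real (Suc n))" for n
 proof -
  have "emeasure lborel N <= emeasure lborel (\<Union>k. I n k)" using meas by (intro emeasure_mono) (auto simp: N_def)
  also have "... <= (\<Sum>k. emeasure lborel (I n k))" by (rule emeasure_subadditive_countably) (auto simp: I_def)
  also have "... = (\<Sum>k. 2 * ennreal (diameter (U n k)))"
  proof (rule suminf_cong)
   fix k
   have "emeasure lborel (I n k) = ennreal (2 * diameter (U n k))" using d0[of n k] by (simp add: I_def)
   then show "emeasure lborel (I n k) = 2 * ennreal (diameter (U n k))" using d0[of n k] by (simp add: ennreal_mult)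
  qed
  also have "... = 2 * (\<Sum>k. ennreal (diameter (U n k)))" by simp
  also have "... <= 2 * ennreal (1 / real (Suc n))" by (intro mult_left_mono U(3)) simp
  also have "... = ennreal (2 * (1 / real (Suc n)))" by (subst ennreal_mult) auto
  finally show ?thesis by simp
 qed
 note bd = this
 have "emeasure lborel N <= 0"
 proof (rule tendsto_lowerbound[OF _ _ sequentially_bot])
  have "(%n. 2 / real (Suc n)) \<longlonglongrightarrow> 0" using LIMSEQ_Suc[OF lim_const_over_n[of 2]] by simp
  then show "(%n. ennreal (2 / real (Suc n))) \<longlonglongrightarrow> 0" using tendsto_ennrealI[of _ 0] by fastforce
  show "\<forall>\<^sub>F n in sequentially. emeasure lborel N <= ennreal (2 / real (Suc n))" using bd by simp
 qed
 then have N: "N \<in> null_sets lborel" using meas by auto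
 have "ph ` A \<subseteq> N"
  unfolding N_def
 proof (intro subsetI INT_I)
  fix s n assume "s \<in> ph ` A"
  then obtain x where x: "x \<in> A" "s = ph x" by blast
  then obtain k where k: "x \<in> U n k" using U(1)[of n] by blast
  have "y n k \<in> U n k" unfolding y_def using k by (rule someI)
  then have "dist x (y n k) <= diameter (U n k)" using k U(2) by (intro diameter_bounded_bound)
  then have "s \<in> I n k" using lip[of x "y n k"] x by (auto simp: I_def abs_le_iff)
  then show "s \<in> (\<Union>k. I n k)" by blast
 qed
 then show ?thesis by (intro AE_I'[OF N]) auto
qed

lemma open_bounded_interval:
 fixes J :: "real set"
 assumes "open J" "is_interval J" "bounded J" "J ~= {}"
 obtains a b where "a < b" "J = {a<..<b}"
proof -
 have bb: "bdd_above J" "bdd_below J" using assms(3) by (auto intro: bounded_imp_bdd_above bounded_imp_bdd_below)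
 have in1: "Inf J < x & x < Sup J" if x: "x \<in> J" for x
 proof -
  obtain e where e: "e > 0" "ball x e \<subseteq> J" using assms(1) x open_contains_ball by blast
  have "x - e/2 \<in> J" "x + e/2 \<in> J" using e by (auto intro!: subsetD[OF e(2)] simp: dist_real_def)
  then have "Inf J <= x - e/2" "x + e/2 <= Sup J" using bb by (auto intro: cInf_lower cSup_upper)
  then show ?thesis using e(1) by simp
 qed
 have "x \<in> J" if x: "Inf J < x" "x < Sup J" for x
 proof -
  obtain p where p: "p \<in> J" "p < x" using cInf_lessD[OF assms(4) x(1)] by blast
  obtain q where q: "q \<in> J" "x < q" using less_cSupD[OF assms(4) x(2)] by blast
  show ?thesis using mem_is_interval_1_I[OF assms(2) p(1) q(1)] p(2) q(2) by simp
 qed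
 then have J: "J = {Inf J<..<Sup J}" using in1 by auto
 obtain x where "x \<in> J" using assms(4) by blast
 then have "Inf J < Sup J" using in1[of x] by simp
 then show thesis using J by (rule that)
qed

context sierpinski_carpet begin

text \<open>By square summability only finitely many disks in a ball around \<open>x\<close> have a
  large value, and those among them that do not touch \<open>x\<close> are left behind in a smaller
  ball.\<close>

lemma small_near:
 assumes h: "loc_l2 h" and x: "x \<in> Om" and d: "d > 0"
 obtains r where "r > 0" "!!i. i \<in> hQ (ball x r) ==> x \<notin> CQ i ==> \<bar>h i\<bar> <= d"
proof -
 obtain e where e: "e > 0" "cball x e \<subseteq> Om" using x open_Omega open_contains_cball by blast
 have "closure (ball x e) \<subseteq> cball x e" by (rule closure_minimal) auto
 then have cc: "cc (ball x e)"
  using e(2) unfolding compactly_contained_def by (auto simp: compact_closure)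
 have sm: "(%i. (h i)^2) summable_on hQ (ball x e)" using h cc by (simp add: loc_l2_def)
 have d2: "d^2 > 0" using d by simp
 obtain F where F: "finite F" "F \<subseteq> hQ (ball x e)" "!!B. B \<subseteq> hQ (ball x e) - F ==> (infsum (%i. (h i)^2) B) < d^2"
  by (rule infsum_tail_small[OF sm _ d2]) (simp, rule that)
 obtain r where r: "r > 0" "!!i. i \<in> F ==> x \<notin> CQ i ==> i \<notin> hQ (ball x r)"
  by (rule hits_near_avoid[OF F(1)]) (rule that)
 show thesis
 proof (rule that[of "min r e"])
  show "min r e > 0" using r(1) e(1) by simp
  fix i assume i: "i \<in> hQ (ball x (min r e))" "x \<notin> CQ i"
  have "i \<in> hQ (ball x r)" "i \<in> hQ (ball x e)" using i(1) by (auto simp: hits_def)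
  then have "{i} \<subseteq> hQ (ball x e) - F" using r(2)[OF _ i(2)] by blast
  then have "(infsum (%i. (h i)^2) ({i})) < d^2" by (rule F(3))
  then have "(h i)^2 < d^2" by simp
  then show "\<bar>h i\<bar> <= d" using d abs_le_square_iff[of "h i" d] by simp
 qed
qed

lemma disks_shrink:
 assumes x: "x \<in> Om" and e: "e > 0"
 obtains r where "r > 0" "!!i. i \<in> hQ (ball x r) ==> x \<notin> CQ i ==> CQ i \<subseteq> ball x e"
proof -
 have e3: "e / 3 > 0" using e by simp
 obtain r where r: "r > 0" "!!i. i \<in> hQ (ball x r) ==> x \<notin> CQ i ==> \<bar>dQ i\<bar> <= e / 3"
  by (rule small_near[OF loc_l2_diameter x e3]) (rule that)
 show thesis
 proof (rule that[of "min r (e/3)"])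
  show "min r (e/3) > 0" using r(1) e by simp
  fix i assume i: "i \<in> hQ (ball x (min r (e/3)))" "x \<notin> CQ i"
  obtain y where "y \<in> Q i Int ball x (min r (e/3))" using i(1) unfolding hits_def by blast
  then have y: "y \<in> Q i" "dist x y < min r (e/3)" by simp_all
  have "y \<in> ball x r" using y(2) by simp
  then have "i \<in> hQ (ball x r)" using y(1) by (auto simp: hits_def)
  then have d: "dQ i <= e / 3" using r(2)[OF _ i(2)] by simp
  show "CQ i \<subseteq> ball x e"
  proof
   fix z assume z: "z \<in> CQ i"
   have "y \<in> CQ i" using y(1) closure_subset by blast
   then have "dist y z <= e / 3" using dist_le_diameter_Q[OF _ z, of y] d by simp
   then show "z \<in> ball x e" using y(2) dist_triangle[of x z y] e by simp
  qed
 qed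
qed

lemma frontier_not_inner: "x \<in> FQ i ==> x \<notin> carpet_inner Om Q"
 by (auto simp: carpet_inner_def)

text \<open>This supplies good paths: by \<open>pval_diff_le\<close> the discrete values met along
  any subpath differ by no more than the sum of the oscillations. The arc is taken open because
  accessibility of boundary points is defined through open subpaths.\<close>

lemma good_path_arc:
 assumes g: "sobolev_loc v Om Q g" and r: "r = (%z. real_of_ereal (g z))"
  and good: "good_on r (osr r) f a b" and ab: "a < b" and nc: "\<not> f constant_on {a<..<b}"
 shows "({a<..<b}, f) \<in> good_paths Om Q g"
proof -
 note G = sobolev_loc_real[OF g, folded r]
 note lb = wlocD(1)[OF G(1)]
 have nn: "0 <= osr r i" for i by (rule osr_nonneg[OF lb])
 have gd: "continuous_on {a..b} f" "f ` {a..b} \<subseteq> Om" "hausdorff1 (f ` {a..b} Int S) = 0" "osr r summable_on hQ (f ` {a..b})"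
  using good by (auto simp: good_on_def)
 have sub: "f ` {a<..<b} \<subseteq> f ` {a..b}" by auto
 have cp: "({a<..<b}, f) \<in> cpaths_in Om"
  using ab gd(1,2) unfolding cpaths_in_def is_cpath_def img_def
  by (auto simp: is_interval_oo bounded_Ioo intro!: exI[of _ f])
 have h: "hausdorff1 (img ({a<..<b}, f) Int S) = 0"
  by (rule hausdorff1_null_subset[OF gd(3)]) (auto simp: img_def)
 have sum: "osr r summable_on hQ (img gm')" "path_sum Q (osc Q g) gm' = ereal (infsum (osr r) (hQ (img gm')))"
  if "subpath_of gm' ({a<..<b}, f)" for gm'
 proof -
  have "img gm' \<subseteq> f ` {a..b}" using img_subpath[OF that] sub by (simp add: img_def)
  then show s: "osr r summable_on hQ (img gm')"
   using nn by (intro summable_on_sub[OF gd(4)] hits_mono) auto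
  show "path_sum Q (osc Q g) gm' = ereal (infsum (osr r) (hQ (img gm')))"
   unfolding path_sum_def G(4) using s nn by (rule infsum_ereal_summable)
 qed
 have ineq: "\<bar>sup_on Q g i - sup_on Q g j\<bar> <= path_sum Q (osc Q g) gm'"
  if sp: "subpath_of gm' ({a<..<b}, f)" and ij: "i \<in> hQ (img gm')" "j \<in> hQ (img gm')" for gm' i j
 proof -
  have J: "is_interval (fst gm')" "fst gm' \<subseteq> {a<..<b}" "snd gm' = f" using sp by (auto simp: subpath_of_def)
  have *: "\<bar>Mx r i - Mx r j\<bar> <= infsum (osr r) (hQ (img gm'))"
   if st: "s \<in> fst gm'" "t \<in> fst gm'" "s <= t" "f s \<in> Q i" "f t \<in> Q j" for s t i j
  proof -
   have "a <= s" "t <= b" using st J(2) by (auto dest: subsetD)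
   then have gs: "good_on r (osr r) f s t" using st(3) by (intro good_on_sub[OF good _ _ _ nn])
   have "\<bar>Mx r i - Mx r j\<bar> <= infsum (osr r) (hQ (f ` {s..t}))"
    using pval_diff_le[OF lb gs] pval_Q[OF st(4)] pval_Q[OF st(5)] by simp
   also have "... <= infsum (osr r) (hQ (img gm'))"
   proof (rule infsum_sub_mono[OF sum(1)[OF sp] hits_mono nn order.refl nn])
    have "{s..t} \<subseteq> fst gm'" using mem_is_interval_1_I[OF J(1) st(1,2)] by auto
    then show "f ` {s..t} \<subseteq> img gm'" unfolding img_def J(3) by (rule image_mono)
   qed
   finally show ?thesis .
  qed
  obtain s t where st: "s \<in> fst gm'" "f s \<in> Q i" "t \<in> fst gm'" "f t \<in> Q j"
   using ij J(3) by (auto simp: hits_def img_def)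
  have "\<bar>Mx r i - Mx r j\<bar> <= infsum (osr r) (hQ (img gm'))"
  proof (cases "s <= t")
   case True
   then show ?thesis by (rule *[OF st(1,3) _ st(2,4)])
  next
   case False
   then have "t <= s" by simp
   then have "\<bar>Mx r j - Mx r i\<bar> <= infsum (osr r) (hQ (img gm'))" by (rule *[OF st(3,1) _ st(4,2)])
   then show ?thesis by (simp add: abs_minus_commute)
  qed
  then show ?thesis by (simp add: G(3) sum(2)[OF sp])
 qed
 have self: "subpath_of ({a<..<b}, f) ({a<..<b}, f)" using ab by (simp add: subpath_of_def is_interval_oo)
 show ?thesis
  unfolding good_paths_def using cp nc h ineq sum(2) sum(2)[OF self] by simp
qed

lemma good_pathD:
 assumes "gm0 \<in> good_paths Om Q g"
 shows "gm0 \<in> cpaths_in Om" "\<not> snd gm0 constant_on fst gm0" "hausdorff1 (img gm0 Int S) = 0"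
  "!!gm' i j. subpath_of gm' gm0 ==> i \<in> hQ (img gm') ==> j \<in> hQ (img gm') ==>
   \<bar>sup_on Q g i - sup_on Q g j\<bar> <= path_sum Q (osc Q g) gm'"
  "!!gm'. subpath_of gm' gm0 ==> cc (img gm') ==> path_sum Q (osc Q g) gm' < \<infinity>"
 using assms unfolding good_paths_def by blast+

lemma AE_square_good_cc:
 assumes "wloc u" "x \<in> Om"
 obtains R where "R > 0" "ball x (2 * R) \<subseteq> Om" "(%i. (osr u i)^2) summable_on hQ (ball x (2 * R))"
  "!!R'. 0 < R' ==> R' <= R ==> AE s in lborel. 0 < s & s < R' -->
   (\<forall>a b. - s <= a --> a <= b --> b <= 15 * s --> good_on u (osr u) (square_loop x s) a b)"
proof -
 obtain Gm where Gm: "ae_good u (osr u) Gm" using assms(1) by (auto simp: wloc_def)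
 obtain e where e: "e > 0" "cball x e \<subseteq> Om" using assms(2) open_Omega open_contains_cball by blast
 have sub: "ball x (2 * (e/2)) \<subseteq> Om" using e by auto
 have "closure (ball x (2 * (e/2))) \<subseteq> cball x e" by (rule closure_minimal) auto
 then have "compactly_contained (ball x (2 * (e/2))) Om"
  using e(2) unfolding compactly_contained_def by (auto simp: compact_closure)
 then have sm: "(%i. (osr u i)^2) summable_on hQ (ball x (2 * (e/2)))"
  using wlocD(2)[OF assms(1)] by (simp add: loc_l2_def)
 show thesis
 proof (rule that[OF _ sub sm])
  show "e / 2 > 0" using e by simp
  fix R' assume R': "0 < R'" "R' <= e / 2"
  have "ball x (2 * R') \<subseteq> ball x (2 * (e/2))" using R' by (intro subset_ball) simp
  then show "AE s in lborel. 0 < s & s < R' -->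
   (\<forall>a b. - s <= a --> a <= b --> b <= 15 * s --> good_on u (osr u) (square_loop x s) a b)"
   using sub by (intro AE_square_good[OF Gm R'(1)]) blast
 qed
qed

text \<open>Both the disk and its exterior are connected and contain points close to
  \<open>p\<close> as well as points farther away, so a small square crosses both.\<close>

lemma square_meets:
 assumes p: "p \<in> FQ i"
 obtains R where "R > 0" "!!s. 0 < s ==> s < R ==> Q i Int square p s ~= {}"
  "!!s. 0 < s ==> square p s - CQ i ~= {}"
proof -
 obtain q where q: "q \<in> Q i" using Q_nonempty by blast
 have "p \<notin> Q i" using p frontier_Q_Int by blast
 then have R: "sup_norm (q - p) > 0" using q sup_norm_nonneg[of "q - p"] sup_norm_eq_0[of "q - p"] by auto
 have pc: "p \<in> CQ i" using p FQ_CQ by blast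
 show thesis
 proof (rule that[OF R])
  fix s assume s: "0 < s" "s < sup_norm (q - p)"
  obtain y where y: "y \<in> Q i" "dist y p < s" using pc s(1) closure_approachable by blast
  have "sup_norm (y - p) <= s" using y(2) sup_norm_le_norm[of "y - p"] by (simp add: dist_norm)
  then show "Q i Int square p s ~= {}" using s(2) by (intro connected_meets_square[OF Q_connected y(1) q]) auto
 next
  fix s :: real assume s: "0 < s"
  obtain c where c: "- CQ i = outside (path_image c)" "connected (outside (path_image c))" "\<not> bounded (outside (path_image c))"
   by (rule jordan_curve[of i]) (rule that)
  obtain y where y: "y \<in> ball p s" "y \<notin> CQ i" by (rule closure_complement_disk[OF p s]) (rule that)
  have "\<not> (- CQ i \<subseteq> ball p (2 * s))" using c(1,3) bounded_subset[OF bounded_ball] by metis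
  then obtain z where z: "z \<in> - CQ i" "z \<notin> ball p (2 * s)" by blast
  have "sup_norm (y - p) <= s" using y(1) sup_norm_le_norm[of "y - p"] by (simp add: dist_norm norm_minus_commute)
  moreover have "s <= sup_norm (z - p)" using z(2) norm_le_sup_norm[of "z - p"] by (simp add: dist_norm norm_minus_commute)
  moreover have "connected (- CQ i)" using c(1,2) by simp
  ultimately have "(- CQ i) Int square p s ~= {}"
   using y(2) z(1) by (intro connected_meets_square[of _ y z]) auto
  then show "square p s - CQ i ~= {}" by blast
 qed
qed

text \<open>Follow a generic small square around \<open>p\<close>, starting outside the closed disk,
  up to its first entry. The boundary point reached there is accessible along the arc just run
  through, since this arc has not yet met the disk.\<close>

lemma accessible_near:
 assumes g: "sobolev_loc v Om Q g" and p: "p \<in> FQ i" and e: "e > 0"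
 obtains y where "y \<in> FQ i" "dist y p < e" "accessible Om Q g y"
proof -
 define r where "r = (%z. real_of_ereal (g z))"
 note G = sobolev_loc_real[OF g, folded r_def]
 have pO: "p \<in> Om" using p FQ_S S_subset by blast
 obtain R1 where R1: "R1 > 0" "ball p (2 * R1) \<subseteq> Om"
  "!!R'. 0 < R' ==> R' <= R1 ==> AE s in lborel. 0 < s & s < R' -->
   (\<forall>a b. - s <= a --> a <= b --> b <= 15 * s --> good_on r (osr r) (square_loop p s) a b)"
  by (rule AE_square_good_cc[OF G(1) pO]) (rule that)
 obtain R2 where R2: "R2 > 0" "!!s. 0 < s ==> s < R2 ==> Q i Int square p s ~= {}"
  "!!s. 0 < s ==> square p s - CQ i ~= {}" by (rule square_meets[OF p]) (rule that)
 define R where "R = min R1 (min R2 (e/2))"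
 have R: "0 < R" "R <= R1" "R <= R2" "R <= e / 2" using R1(1) R2(1) e by (auto simp: R_def)
 obtain s where s: "0 < s" "s < R"
  "\<forall>a b. - s <= a --> a <= b --> b <= 15 * s --> good_on r (osr r) (square_loop p s) a b"
  by (rule AE_ex_interval[OF R1(3)[OF R(1,2)] R(1)]) (rule that)
 define f where "f = square_loop p s"
 obtain w where w: "w \<in> square p s" "w \<notin> CQ i" using R2(3)[OF s(1)] by blast
 obtain q where q: "q \<in> Q i" "q \<in> square p s" using R2(2)[of s] s R(3) by auto
 have s7: "-s \<in> {-s..7 * s}" using s by simp
 have wn: "sup_norm (w - p) = s" and qn: "sup_norm (q - p) = s" using w q by (auto simp: square_def)
 obtain t0 where t0: "t0 \<in> {-s..7 * s}" "f t0 = w"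
  using square_loop_surj[OF s(1) wn s7] unfolding f_def by auto
 obtain t1 where t1: "t1 \<in> {t0..t0 + 8 * s}" "f t1 = q"
  using square_loop_surj[OF s(1) qn t0(1)] unfolding f_def by auto
 have contf: "continuous_on A f" for A unfolding f_def by (rule continuous_square_loop)
 have wQ: "f t0 \<notin> Q i" using w(2) t0(2) closure_subset by blast
 obtain t2 where t2: "t0 <= t2" "t2 <= t1" "f t2 \<in> FQ i" "i \<notin> hQ (f ` {t0..t2})"
 proof -
  have "t0 <= t1" "f t1 \<in> Q i" using t1 q(1) by auto
  then show ?thesis by (rule first_entry[OF contf[of "{t0..t1}"] _ order.refl _ wQ]) (rule that)
 qed
 have "t0 ~= t2" using t2(3) t0(2) w(2) FQ_CQ by blast
 then have lt: "t0 < t2" using t2(1) by simp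
 have "t2 ~= t1" using t2(3) t1(2) q(1) frontier_Q_Int by blast
 then have t2lt: "t2 < t0 + 8 * s" "t2 < 15 * s" using t2(2) t1(1) t0(1) by auto
 \<comment> \<open>Injectivity of the loop keeps the end point off the open arc, as
   \<open>access_paths\<close> demands, and also shows that the arc is not constant.\<close>
 have inj: "f t ~= f t'" if "t0 <= t" "t < t'" "t' <= t2" for t t'
  using square_loop_inj[OF s(1), of t t' p] that t2lt t0(1) unfolding f_def by auto
 have good: "good_on r (osr r) f t0 t2" using s(3) lt t2lt t0(1) by (simp add: f_def)
 have nc: "\<not> f constant_on {t0<..<t2}"
 proof
  assume "f constant_on {t0<..<t2}"
  then have "f (t0 + (t2 - t0)/3) = f (t0 + (t2 - t0)/2)"
   using lt unfolding constant_on_def by (auto simp: field_simps)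
  then show False using inj[of "t0 + (t2 - t0)/3" "t0 + (t2 - t0)/2"] lt by (auto simp: field_simps)
 qed
 have gp: "({t0<..<t2}, f) \<in> good_paths Om Q g" by (rule good_path_arc[OF g r_def good lt nc])
 have "f t2 \<in> closure (f ` {t0<..<t2})"
 proof -
  have "f ` closure {t0<..<t2} \<subseteq> closure (f ` {t0<..<t2})"
   by (rule image_closure_subset[OF contf closed_closure closure_subset])
  then show ?thesis using lt by auto
 qed
 moreover have "f t2 \<notin> f ` {t0<..<t2}"
 proof
  assume "f t2 \<in> f ` {t0<..<t2}"
  then obtain t where "t \<in> {t0<..<t2}" "f t = f t2" by (metis imageE)
  then show False using inj[of t t2] by simp
 qed
 moreover have "f ` {t0<..<t2} Int Q j = {}" if "f t2 \<in> FQ j" for j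
 proof -
  have "j = i" using frontier_unique[of "f t2" j i] that t2(3) FQ_CQ by blast
  moreover have "f ` {t0<..<t2} \<subseteq> f ` {t0..t2}" by auto
  ultimately show ?thesis using t2(4) unfolding hits_def by blast
 qed
 moreover have "open_subpath_of ({t0<..<t2}, f) ({t0<..<t2}, f)"
  using lt by (simp add: open_subpath_of_def subpath_of_def is_interval_oo)
 moreover have "f t2 \<notin> carpet_inner Om Q" by (rule frontier_not_inner[OF t2(3)])
 ultimately have "({t0<..<t2}, f) \<in> access_paths Om Q g (f t2)"
  unfolding access_paths_def using gp by (auto simp: img_def intro!: bexI[of _ "({t0<..<t2}, f)"])
 moreover have "f t2 \<in> S" using t2(3) FQ_S by blast
 ultimately have acc: "accessible Om Q g (f t2)" by (auto simp: accessible_def)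
 have "sup_norm (f t2 - p) = s" unfolding f_def by (rule sup_norm_square_loop[OF s(1)]) (use t2lt lt t0(1) in auto)
 then have "dist (f t2) p < e" using norm_le_sup_norm[of "f t2 - p"] s(2) R(4) by (simp add: dist_norm)
 then show thesis by (rule that[OF t2(3) _ acc])
qed

lemma access_path_not_near:
 assumes "x \<in> S" "gm \<in> access_paths Om Q g x" "i \<in> hQ (img gm)" shows "x \<notin> CQ i"
proof
 assume "x \<in> CQ i"
 then have xf: "x \<in> FQ i" using S_closure_Q assms(1) by blast
 obtain gm0 where "if x \<in> img gm0 Int carpet_inner Om Q then gm = gm0
   else open_subpath_of gm gm0 & x \<in> closure (img gm) - img gm & (\<forall>i. x \<in> FQ i --> img gm Int Q i = {})"
  using assms(2) unfolding access_paths_def by blast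
 then have "img gm Int Q i = {}" using frontier_not_inner[OF xf] xf by auto
 then show False using assms(3) by (auto simp: hits_def)
qed

lemma access_path_connected:
 assumes "gm0 \<in> cpaths_in Om" "subpath_of gm gm0" shows "connected (img gm)"
proof -
 obtain h where h: "continuous_on (closure (fst gm0)) h" "\<forall>t\<in>fst gm0. h t = snd gm0 t"
  using assms(1) by (auto simp: cpaths_in_def is_cpath_def)
 have J: "is_interval (fst gm)" "fst gm \<subseteq> fst gm0" "snd gm = snd gm0" using assms(2) by (auto simp: subpath_of_def)
 have "continuous_on (fst gm) h" by (rule continuous_on_subset[OF h(1)]) (use J(2) closure_subset in blast)
 then have "continuous_on (fst gm) (snd gm)" by (rule continuous_on_eq) (use h(2) J in auto)
 then show ?thesis unfolding img_def using J(1) is_interval_connected by (intro connected_continuous_image)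
qed

text \<open>The distances from \<open>x\<close> of points of \<open>X\<close> fill an interval,
  while those of its points in the carpet have measure 0. A distance outside this null set is
  realized inside a disk.\<close>

lemma null_path_hits:
 assumes X: "connected X" "X \<subseteq> Om" "X \<subseteq> Y" "hausdorff1 (Y Int S) = 0"
  and ab: "y \<in> X" "y' \<in> X" "dist x y < dist x y'" "dist x y' < e"
 shows "\<exists>i\<in>hQ X. i \<in> hQ (ball x e)"
proof -
 have "AE s in lborel. s \<notin> (%z. dist x z) ` (Y Int S)"
  by (rule lipschitz_image_null[OF X(4)]) (metis abs_dist_diff_le dist_commute)
 then have "AE s in lborel. dist x y < s & s < dist x y' --> s \<notin> (%z. dist x z) ` (Y Int S)" by eventually_elim simp
 then obtain s where s: "dist x y < s" "s < dist x y'" "s \<notin> (%z. dist x z) ` (Y Int S)"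
  using ab(3) by (rule AE_ex_interval) (rule that)
 have "connected ((%z. dist x z) ` X)" by (intro connected_continuous_image X(1) continuous_intros)
 then have "{dist x y..dist x y'} \<subseteq> (%z. dist x z) ` X" using ab by (intro connected_contains_Icc) auto
 then obtain z where z: "z \<in> X" "dist x z = s" using s(1,2) by (metis (no_types, lifting) atLeastAtMost_iff imageE less_imp_le subsetD)
 have "z \<notin> S" using s(3) z X(3) by blast
 then obtain i where "z \<in> Q i" using Omega_cases X(2) z(1) by blast
 then have "i \<in> hQ X" "i \<in> hQ (ball x e)" using z s(2) ab(4) by (auto simp: hits_def)
 then show ?thesis by blast
qed

text \<open>Without small disks along the path the infimum in \<open>disk_liminf\<close> would run
  over the empty set and be infinite. A generic small distance from \<open>x\<close> is attained
  inside some disk, and this disk is small because it does not touch \<open>x\<close>.\<close>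

lemma access_path_hits:
 assumes x: "x \<in> S" and a: "gm \<in> access_paths Om Q g x" and e: "e > 0"
 shows "\<exists>i\<in>hQ (img gm). Q i \<subseteq> ball x e"
proof -
 obtain gm0 where g0: "gm0 \<in> good_paths Om Q g" and ac: "if x \<in> img gm0 Int carpet_inner Om Q then gm = gm0
   else open_subpath_of gm gm0 & x \<in> closure (img gm) - img gm & (\<forall>i. x \<in> FQ i --> img gm Int Q i = {})"
  using a unfolding access_paths_def by blast
 note g = good_pathD[OF g0]
 have self: "subpath_of gm0 gm0" using g(1) by (auto simp: subpath_of_def cpaths_in_def is_cpath_def)
 have sp: "subpath_of gm gm0" using ac self by (auto simp: open_subpath_of_def split: if_splits)
 have con: "connected (img gm)" by (rule access_path_connected[OF g(1) sp])
 have sub: "img gm \<subseteq> img gm0" by (rule img_subpath[OF sp])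
 have om: "img gm \<subseteq> Om" using sub g(1) by (auto simp: cpaths_in_def)
 have xO: "x \<in> Om" using x S_subset by blast
 obtain r where r: "r > 0" "!!i. i \<in> hQ (ball x r) ==> x \<notin> CQ i ==> CQ i \<subseteq> ball x e"
  by (rule disks_shrink[OF xO e]) (rule that)
 have "\<exists>y\<in>img gm. \<exists>y'\<in>img gm. dist x y < dist x y' & dist x y' < r"
 proof (cases "x \<in> img gm")
  case True
  then have "gm = gm0" using ac by (auto split: if_splits)
  have "\<exists>y\<in>img gm. y ~= x"
  proof (rule ccontr)
   assume "\<not> ?thesis"
   then have "\<forall>t\<in>fst gm0. snd gm0 t = x" unfolding \<open>gm = gm0\<close> by (auto simp: img_def)
   then show False using g(2) unfolding constant_on_def by blast
  qed
  then obtain y where y: "y \<in> img gm" "y ~= x" by blast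
  have "connected ((%z. dist x z) ` img gm)" by (intro connected_continuous_image con continuous_intros)
  then have "{dist x x..dist x y} \<subseteq> (%z. dist x z) ` img gm" using True y by (intro connected_contains_Icc) auto
  moreover have "min (dist x y) (r/2) \<in> {dist x x..dist x y}" using r(1) by simp
  ultimately have "min (dist x y) (r/2) \<in> (%z. dist x z) ` img gm" by (rule subsetD)
  then obtain y' where y': "min (dist x y) (r/2) = dist x y'" "y' \<in> img gm" by (rule imageE)
  have "dist x x < dist x y'" "dist x y' < r" unfolding y'(1)[symmetric] using y(2) r(1) by (auto simp: min_def)
  then show ?thesis using True y'(2) by blast
 next
  case False
  have xc: "x \<in> closure (img gm)" using ac False by (auto split: if_splits)
  then obtain y' where y': "y' \<in> img gm" "dist y' x < r" using closure_approachable r(1) by blast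
  have "dist x y' > 0" using False y'(1) by auto
  then obtain y where "y \<in> img gm" "dist y x < dist x y'" using closure_approachable xc by blast
  then have "y \<in> img gm" "dist x y < dist x y'" "dist x y' < r" using y'(2) by (simp_all add: dist_commute)
  then show ?thesis using y'(1) by blast
 qed
 then obtain y y' where yy: "y \<in> img gm" "y' \<in> img gm" "dist x y < dist x y'" "dist x y' < r" by blast
 obtain i where i: "i \<in> hQ (img gm)" "i \<in> hQ (ball x r)"
  using null_path_hits[OF con om sub g(3) yy] by blast
 have "CQ i \<subseteq> ball x e" by (rule r(2)[OF i(2) access_path_not_near[OF x a i(1)]])
 then show ?thesis using i(1) closure_subset by blast
qed

lemma disk_liminf_bounds:
 assumes x: "x \<in> S" and a: "gm \<in> access_paths Om Q g x" and e: "e > 0"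
  and b: "!!i. i \<in> hQ (img gm) ==> Q i \<subseteq> ball x e ==> lo <= sup_on Q g i & sup_on Q g i <= hi"
 shows "lo <= disk_liminf Q g gm x" "disk_liminf Q g gm x <= hi"
proof -
 have "lo <= (INF i\<in>{i\<in>hQ (img gm). Q i \<subseteq> ball x e}. sup_on Q g i)" using b by (intro INF_greatest) auto
 also have "... <= disk_liminf Q g gm x" unfolding disk_liminf_def using e by (intro SUP_upper) auto
 finally show "lo <= disk_liminf Q g gm x" .
 show "disk_liminf Q g gm x <= hi"
  unfolding disk_liminf_def
 proof (rule SUP_least)
  fix e' :: real assume e': "e' \<in> {0<..}"
  then have "min e e' > 0" using e by simp
  then obtain i where i: "i \<in> hQ (img gm)" "Q i \<subseteq> ball x (min e e')" using access_path_hits[OF x a] by blast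
  have "Q i \<subseteq> ball x e" "Q i \<subseteq> ball x e'" using i(2) by auto
  then show "(INF i\<in>{i\<in>hQ (img gm). Q i \<subseteq> ball x e'}. sup_on Q g i) <= hi"
   using b[OF i(1)] i(1) by (intro INF_lower2[of i]) auto
 qed
qed

lemma access_value_bounds:
 assumes acc: "accessible Om Q g x" and e: "e > 0"
  and b: "!!i. x \<notin> CQ i ==> Q i \<subseteq> ball x e ==> lo <= sup_on Q g i & sup_on Q g i <= hi"
 shows "lo <= access_value Om Q g x" "access_value Om Q g x <= hi"
proof -
 have x: "x \<in> S" and "\<exists>gm. gm \<in> access_paths Om Q g x" using acc by (auto simp: accessible_def)
 then have s: "(SOME gm. gm \<in> access_paths Om Q g x) \<in> access_paths Om Q g x" by - (rule someI_ex)
 define gm where "gm = (SOME gm. gm \<in> access_paths Om Q g x)"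
 have a: "gm \<in> access_paths Om Q g x" using s by (simp only: gm_def)
 have bb: "lo <= sup_on Q g i & sup_on Q g i <= hi" if "i \<in> hQ (img gm)" "Q i \<subseteq> ball x e" for i
  using access_path_not_near[OF x a that(1)] that(2) by (rule b)
 note dl = disk_liminf_bounds[OF x a e, of lo hi]
 have av: "access_value Om Q g x = disk_liminf Q g gm x" by (simp only: access_value_def gm_def)
 have "lo <= disk_liminf Q g gm x" by (rule dl(1)) (erule (1) bb)
 then show "lo <= access_value Om Q g x" by (simp only: av)
 have "disk_liminf Q g gm x <= hi" by (rule dl(2)) (erule (1) bb)
 then show "access_value Om Q g x <= hi" by (simp only: av)
qed

lemma accessible_dense:
 assumes g: "sobolev_loc v Om Q g" and y: "y \<in> S" and e: "e > 0"
 shows "\<exists>z. accessible Om Q g z & dist z y < e & (\<forall>i. y \<in> FQ i --> z \<in> FQ i)"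
proof (cases "\<exists>i. y \<in> FQ i")
 case True
 then obtain i where i: "y \<in> FQ i" by blast
 obtain z where z: "z \<in> FQ i" "dist z y < e" "accessible Om Q g z" by (rule accessible_near[OF g i e]) (rule that)
 have "j = i" if "y \<in> FQ j" for j using frontier_unique[of y j i] that i FQ_CQ by blast
 then show ?thesis using z by blast
next
 case False
 have yO: "y \<in> Om" using y S_subset by blast
 have e2: "e / 2 > 0" using e by simp
 obtain r where r: "r > 0" "!!i. i \<in> hQ (ball y r) ==> y \<notin> CQ i ==> CQ i \<subseteq> ball y (e/2)"
  by (rule disks_shrink[OF yO e2]) (rule that)
 obtain k where k: "k \<in> hQ (ball y r)" by (rule ball_hits_disk[OF yO r(1)]) (rule that)
 have "y \<notin> CQ k" using False S_closure_Q[OF y] by blast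
 then have sub: "CQ k \<subseteq> ball y (e/2)" by (rule r(2)[OF k])
 obtain p where p: "p \<in> FQ k" using frontier_Q_nonempty by blast
 obtain z where z: "z \<in> FQ k" "dist z p < e / 2" "accessible Om Q g z" by (rule accessible_near[OF g p e2]) (rule that)
 have "z \<in> ball y (e/2)" using sub z(1) FQ_CQ by blast
 then have "dist z y < e" using e by (simp add: dist_commute)
 then show ?thesis using z(3) False by blast
qed

lemma Liminf_within_bounds:
 fixes F :: "complex => ereal"
 assumes r: "r > 0" and b: "!!z. z \<in> A ==> dist z y < r ==> lo <= F z & F z <= hi"
  and d: "!!e. e > 0 ==> \<exists>z\<in>A. z ~= y & dist z y < e"
 shows "lo <= Liminf (at y within A) F" "Liminf (at y within A) F <= hi"
proof -
 have ne: "at y within A ~= bot"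
  using d unfolding trivial_limit_within islimpt_approachable by blast
 have ev: "\<forall>\<^sub>F z in at y within A. lo <= F z & F z <= hi"
  unfolding eventually_at using r b by blast
 show "lo <= Liminf (at y within A) F" by (rule Liminf_bounded) (use ev in eventually_elim, simp)
 have "Liminf (at y within A) F <= Limsup (at y within A) F" by (rule Liminf_le_Limsup[OF ne])
 also have "... <= hi" by (rule Limsup_bounded) (use ev in eventually_elim, simp)
 finally show "Liminf (at y within A) F <= hi" .
qed

text \<open>Accessible values are lower limits of disk values, and the remaining values are lower
  limits of accessible ones. Accessible points are dense, also within each disk boundary, so these
  lower limits are taken over nontrivial filters and inherit both bounds.\<close>

lemma normalized_near:
 assumes g: "sobolev_loc v Om Q g" and r: "r > 0"
  and b: "!!k. k \<in> hQ (ball x r) ==> x \<notin> CQ k ==> lo <= sup_on Q g k & sup_on Q g k <= hi"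
  and y: "y \<in> S" "dist y x < r"
 shows "lo <= normalized_version Om Q g y & normalized_version Om Q g y <= hi"
proof -
 have F: "finite {i. x \<in> CQ i}"
 proof (cases "\<exists>i. x \<in> CQ i")
  case True
  then obtain i where "x \<in> CQ i" by blast
  then have "{i. x \<in> CQ i} \<subseteq> {i}" using frontier_unique[of x _ i] by blast
  then show ?thesis using finite_subset by blast
 qed simp
 have acc: "lo <= access_value Om Q g z & access_value Om Q g z <= hi"
  if z: "accessible Om Q g z" "dist z x < r" for z
 proof -
  \<comment> \<open>A disk touching \<open>x\<close> but not \<open>z\<close> is not covered by the
    hypothesis; a small enough ball around \<open>z\<close> avoids it.\<close>
  obtain r1 where r1: "r1 > 0" "!!i. i \<in> {i. x \<in> CQ i} ==> z \<notin> CQ i ==> i \<notin> hQ (ball z r1)"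
   by (rule hits_near_avoid[OF F, of z]) (rule that)
  define e where "e = min r1 (r - dist z x)"
  have e: "e > 0" using r1(1) z(2) by (simp add: e_def)
  have bb: "lo <= sup_on Q g i & sup_on Q g i <= hi" if i: "z \<notin> CQ i" "Q i \<subseteq> ball z e" for i
  proof (rule b)
   obtain q where q: "q \<in> Q i" using Q_nonempty by blast
   then have qe: "dist z q < e" using i(2) by auto
   then have "q \<in> ball x r" using dist_triangle[of x q z] by (simp add: e_def dist_commute)
   then show "i \<in> hQ (ball x r)" using q by (auto simp: hits_def)
   have "q \<in> ball z r1" using qe by (simp add: e_def)
   then have "i \<in> hQ (ball z r1)" using q by (auto simp: hits_def)
   then show "x \<notin> CQ i" using r1(2)[OF _ i(1)] by blast
  qed
  show ?thesis using access_value_bounds[OF z(1) e bb] by blast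
 qed
 show ?thesis
 proof (cases "accessible Om Q g y")
  case True then show ?thesis using acc[OF True y(2)] by (simp add: normalized_version_def)
 next
  case na: False
  have r': "r - dist y x > 0" using y(2) by simp
  have close: "dist z x < r" if "dist z y < r - dist y x" for z
   using that dist_triangle[of z x y] by simp
  show ?thesis
  proof (cases "\<exists>i. y \<in> FQ i")
   case True
   let ?A = "{z. accessible Om Q g z & (\<exists>i. y \<in> FQ i & z \<in> FQ i)}"
   have bA: "lo <= access_value Om Q g z & access_value Om Q g z <= hi" if "z \<in> ?A" "dist z y < r - dist y x" for z
    using that by (intro acc close) auto
   have dn: "\<exists>z\<in>?A. z ~= y & dist z y < e" if e: "e > 0" for e
   proof -
    obtain z where z: "accessible Om Q g z" "dist z y < e" "\<forall>i. y \<in> FQ i --> z \<in> FQ i"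
    using accessible_dense[OF g y(1) e] by blast
    then show ?thesis using na True by (intro bexI[of _ z]) auto
   qed
   have "lo <= Liminf (at y within ?A) (access_value Om Q g) & Liminf (at y within ?A) (access_value Om Q g) <= hi"
    by (intro conjI Liminf_within_bounds[OF r' bA dn])
   then show ?thesis using na True by (simp add: normalized_version_def)
  next
   case False
   let ?A = "{z. accessible Om Q g z}"
   have bA: "lo <= access_value Om Q g z & access_value Om Q g z <= hi" if "z \<in> ?A" "dist z y < r - dist y x" for z
    using that by (intro acc close) auto
   have dn: "\<exists>z\<in>?A. z ~= y & dist z y < e" if e: "e > 0" for e
   proof -
    obtain z where z: "accessible Om Q g z" "dist z y < e"
    using accessible_dense[OF g y(1) e] by blast
    then show ?thesis using na by (intro bexI[of _ z]) auto
   qed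
   have "lo <= Liminf (at y within ?A) (access_value Om Q g) & Liminf (at y within ?A) (access_value Om Q g) <= hi"
    by (intro conjI Liminf_within_bounds[OF r' bA dn])
   then show ?thesis using na False by (simp add: normalized_version_def)
  qed
 qed
qed

text \<open>By continuity the suprema over the small disks near \<open>x\<close> are close to
  \<open>u x\<close>, and \<open>normalized_near\<close> squeezes the normalized value.\<close>

lemma normalized_continuous:
 assumes u: "wloc u" and c: "continuous_on S u"
 shows "normalized v Om Q (%z. ereal (u z))"
 unfolding normalized_def
proof (intro exI[of _ "%z. ereal (u z)"] conjI ballI)
 show g: "sobolev_loc v Om Q (%z. ereal (u z))" by (rule wloc_sobolev_loc[OF u])
 fix x assume x: "x \<in> S"
 have xO: "x \<in> Om" using x S_subset by blast
 note lb = wlocD(1)[OF u]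
 have sup: "sup_on Q (%z. ereal (u z)) k = ereal (Mx u k)" for k by (rule sup_on_ereal[OF lb]) simp
 let ?N = "normalized_version Om Q (%z. ereal (u z)) x"
 have bd: "ereal (u x - d) <= ?N & ?N <= ereal (u x + d)" if d: "d > 0" for d
 proof -
  obtain e where e: "e > 0" "\<forall>y\<in>S. dist y x < e --> dist (u y) (u x) < d"
   using c x d unfolding continuous_on_iff by blast
  obtain r where r: "r > 0" "!!i. i \<in> hQ (ball x r) ==> x \<notin> CQ i ==> CQ i \<subseteq> ball x e"
   by (rule disks_shrink[OF xO e(1)]) (rule that)
  show ?thesis
  proof (rule normalized_near[OF g r(1) _ x])
   fix k assume k: "k \<in> hQ (ball x r)" "x \<notin> CQ k"
   have pt: "\<bar>u p - u x\<bar> < d" if p: "p \<in> FQ k" for p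
   proof -
    have "p \<in> ball x e" using r(2)[OF k] p FQ_CQ by blast
    moreover have "p \<in> S" using p FQ_S by blast
    ultimately show ?thesis using e(2) by (auto simp: dist_real_def dist_commute)
   qed
   obtain p where p: "p \<in> FQ k" using frontier_Q_nonempty by blast
   have "Mx u k <= u x + d"
   proof (rule Mx_least)
    fix p assume "p \<in> FQ k" then show "u p <= u x + d" using pt[of p] by simp
   qed
   moreover have "u x - d <= Mx u k" using pt[OF p] le_Mx[OF lb p] by simp
   ultimately show "ereal (u x - d) <= sup_on Q (%z. ereal (u z)) k & sup_on Q (%z. ereal (u z)) k <= ereal (u x + d)"
    by (simp add: sup)
  qed (use r(1) in simp)
 qed
 obtain m where m: "?N = ereal m" using bd[of 1] by (cases ?N) auto
 have ml: "\<bar>m - u x\<bar> <= d" if "d > 0" for d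
 proof -
  have "u x - d <= m & m <= u x + d" using bd[OF that] m by simp
  then show ?thesis by linarith
 qed
 have "\<bar>m - u x\<bar> <= 0" by (rule dense_ge) (rule ml)
 then have "m = u x" by simp
 then show "ereal (u x) = ?N" using m by simp
qed


text \<open>The tail of an access path crosses almost every small square around the accessible point, and such a
 square also meets the disk carrying that point.\<close>

lemma tail_crosses_good_square:
 assumes g: "sobolev_loc v Om Q g" and r: "r = (%z. real_of_ereal (g z))"
  and z: "z \<in> FQ j" and d: "d > 0"
  and X: "connected X" "X \<subseteq> Om" "X \<subseteq> Y" "hausdorff1 (Y Int S) = 0" "X ~= {}" "z \<in> closure X" "z \<notin> X"
 shows "\<exists>i\<in>hQ X. \<bar>Mx r i - Mx r j\<bar> <= osr r j + d"
proof -
 note G = sobolev_loc_real[OF g, folded r]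
 note lb = wlocD(1)[OF G(1)]
 have nn: "0 <= osr r i" for i by (rule osr_nonneg[OF lb])
 have zO: "z \<in> Om" using z FQ_S S_subset by blast
 obtain R1 where R1: "R1 > 0" "ball z (2 * R1) \<subseteq> Om" "(%i. (osr r i)^2) summable_on hQ (ball z (2 * R1))"
  "!!R'. 0 < R' ==> R' <= R1 ==> AE s in lborel. 0 < s & s < R' -->
   (\<forall>a b. - s <= a --> a <= b --> b <= 15 * s --> good_on r (osr r) (square_loop z s) a b)"
  by (rule AE_square_good_cc[OF G(1) zO]) (rule that)
 obtain R2 where R2: "R2 > 0" "!!s. 0 < s ==> s < R2 ==> Q j Int square z s ~= {}"
  "!!s. 0 < s ==> square z s - CQ j ~= {}" by (rule square_meets[OF z]) (rule that)
 obtain x0 where x0: "x0 \<in> X" using X(5) by blast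
 have x0p: "sup_norm (x0 - z) > 0"
  using x0 X(7) sup_norm_nonneg[of "x0 - z"] sup_norm_eq_0[of "x0 - z"] by (metis eq_iff_diff_eq_0 less_eq_real_def)
 define R where "R = min R1 (min R2 (sup_norm (x0 - z)))"
 have R: "0 < R" "R <= R1" "R <= R2" "R <= sup_norm (x0 - z)" using R1(1) R2(1) x0p by (auto simp: R_def)
 have "ball z (2 * R) \<subseteq> ball z (2 * R1)" using R(2) by (intro subset_ball) simp
 then have sm: "(%i. (osr r i)^2) summable_on hQ (ball z (2 * R))"
  by (intro summable_on_sub[OF R1(3) hits_mono]) auto
 have "AE s in lborel. s \<notin> (%x. sup_norm (x - z)) ` (Y Int S)"
  by (rule lipschitz_image_null[OF X(4)]) (rule sup_norm_diff_le)
 with R1(4)[OF R(1,2)] have ae: "AE s in lborel. 0 < s & s < R -->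
   (\<forall>a b. - s <= a --> a <= b --> b <= 15 * s --> good_on r (osr r) (square_loop z s) a b) & s \<notin> (%x. sup_norm (x - z)) ` (Y Int S)"
  by eventually_elim simp
 obtain s where s: "0 < s" "s < R" "(\<forall>a b. - s <= a --> a <= b --> b <= 15 * s --> good_on r (osr r) (square_loop z s) a b) & s \<notin> (%x. sup_norm (x - z)) ` (Y Int S)"
  "osr r summable_on hQ (square z s)" "infsum (osr r) ({i. z \<notin> CQ i} Int hQ (square z s)) <= d"
  by (rule exists_good_square[OF R(1) nn sm ae d]) (rule that)
 obtain y where y: "y \<in> X" "dist y z < s" using X(6) s(1) closure_approachable by blast
 have "sup_norm (y - z) <= s" using y(2) sup_norm_le_norm[of "y - z"] by (simp add: dist_norm)
 moreover have "s <= sup_norm (x0 - z)" using s(2) R(4) by simp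
 ultimately have "X Int square z s ~= {}" by (rule connected_meets_square[OF X(1) y(1) x0])
 then obtain x where x: "x \<in> X" "x \<in> square z s" by blast
 have "x \<notin> S"
 proof
  assume "x \<in> S"
  then have "sup_norm (x - z) \<in> (%x. sup_norm (x - z)) ` (Y Int S)" using x(1) X(3) by blast
  then show False using s(3) x(2) by (simp add: square_def)
 qed
 then obtain i where i: "x \<in> Q i" using Omega_cases X(2) x(1) by blast
 have sR: "s < R2" using s(2) R(3) by simp
 obtain q where q: "q \<in> Q j" "q \<in> square z s" using R2(2)[OF s(1) sR] by blast
 have "\<bar>pval r x - pval r q\<bar> <= infsum (osr r) (hQ (square z s))"
  by (rule square_pval_diff[OF lb s(1) _ x(2) q(2)]) (use s(3) in simp)
 also have "... <= infsum (osr r) (insert j ({i. z \<notin> CQ i} Int hQ (square z s)))"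
 proof (rule infsum_sub_mono[OF _ _ nn order.refl nn])
  show "osr r summable_on insert j ({i. z \<notin> CQ i} Int hQ (square z s))"
   unfolding summable_on_insert_iff by (rule summable_on_sub[OF s(4)]) (use nn in auto)
  have "k = j" if "z \<in> CQ k" for k using frontier_unique[OF that, of j] z FQ_CQ by blast
  then show "hQ (square z s) \<subseteq> insert j ({i. z \<notin> CQ i} Int hQ (square z s))" by blast
 qed
 also have "... = osr r j + infsum (osr r) ({i. z \<notin> CQ i} Int hQ (square z s))"
 proof (rule infsum_insert)
  show "osr r summable_on {i. z \<notin> CQ i} Int hQ (square z s)"
   by (rule summable_on_sub[OF s(4)]) (use nn in auto)
  show "j \<notin> {i. z \<notin> CQ i} Int hQ (square z s)" using z FQ_CQ by blast
 qed
 finally have "\<bar>Mx r i - Mx r j\<bar> <= osr r j + d" using s(5) pval_Q[OF i, of r] pval_Q[OF q(1), of r] by simp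
 moreover have "i \<in> hQ X" using i x(1) by (auto simp: hits_def)
 ultimately show ?thesis by blast
qed

text \<open>Towards the end \<open>e\<close> of the path the remaining sum of oscillations is below
  \<open>d\<close>, so all disks met there have nearly the same value. One of them lies on a generic
  square that also crosses the disk \<open>j\<close>, which ties this value to \<open>Mx r j\<close>
  up to the oscillation of \<open>j\<close>.\<close>

lemma access_tail_value:
 assumes g: "sobolev_loc v Om Q g" and r: "r = (%z. real_of_ereal (g z))"
  and z: "z \<in> FQ j" and d: "d > 0" and gm0: "gm0 \<in> good_paths Om Q g"
  and sp: "subpath_of ({a<..<b}, f) gm0" and ab: "a < b" and h: "continuous_on {a..b} h" "!!t. t \<in> {a<..<b} ==> h t = f t"
  and zf: "z \<notin> f ` {a<..<b}" "f ` {a<..<b} Int Q j = {}" and e: "e = a | e = b" "h e = z"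
 shows "\<exists>ta>0. \<forall>t\<in>{a<..<b}. \<bar>t - e\<bar> < ta --> (\<forall>i. f t \<in> Q i --> \<bar>Mx r i - Mx r j\<bar> <= osr r j + 2 * d)"
proof -
 note G = sobolev_loc_real[OF g, folded r]
 note lb = wlocD(1)[OF G(1)]
 have nn: "0 <= osr r i" for i by (rule osr_nonneg[OF lb])
 note gp = good_pathD[OF gm0]
 define J where "J ta = {a<..<b} Int {e - ta<..<e + ta}" for ta
 have zO: "z \<in> Om" using z FQ_S S_subset by blast
 have eab: "e \<in> {a..b}" using e(1) ab by auto
 have hc: "\<exists>ta>0. f ` J ta \<subseteq> ball z ep" if ep: "ep > 0" for ep
 proof -
  obtain ta where ta: "ta > 0" "\<forall>t\<in>{a..b}. dist t e < ta --> dist (h t) (h e) < ep"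
   using h(1) eab ep unfolding continuous_on_iff by blast
  have "f t \<in> ball z ep" if t: "t \<in> J ta" for t
  proof -
   have "dist (h t) (h e) < ep" using t ta(2) by (auto simp: J_def dist_real_def)
   then show ?thesis using h(2)[of t] t e(2) by (auto simp: J_def dist_commute)
  qed
  then show ?thesis using ta(1) by blast
 qed
 have Jsub: "subpath_of (J ta, f) gm0" if "ta > 0" for ta
 proof -
  have "J ta ~= {}"
  proof -
   have "(if e = a then a + min ta (b - a) / 2 else b - min ta (b - a) / 2) \<in> J ta"
    using e(1) ab that by (auto simp: J_def min_def field_simps)
   then show ?thesis by blast
  qed
  moreover have "is_interval (J ta)" unfolding J_def by (intro is_interval_Int is_interval_oo)
  ultimately show ?thesis using sp by (auto simp: subpath_of_def J_def)
 qed
 have img: "img (J ta, f) = f ` J ta" for ta by (simp add: img_def)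
 have zcl: "z \<in> closure (f ` J ta)" if "ta > 0" for ta
  unfolding closure_approachable
 proof (intro allI impI)
  fix ep :: real assume "ep > 0"
  then obtain ta' where ta': "ta' > 0" "f ` J ta' \<subseteq> ball z ep" using hc by blast
  have "J (min ta ta') ~= {}" using Jsub[of "min ta ta'"] that ta'(1) by (simp add: subpath_of_def)
  then obtain t where "t \<in> J (min ta ta')" by blast
  then have "t \<in> J ta" "t \<in> J ta'" by (auto simp: J_def)
  then show "\<exists>y\<in>f ` J ta. dist y z < ep" using ta'(2) by (auto simp: dist_commute intro!: bexI[of _ t])
 qed
 obtain ep0 where ep0: "ep0 > 0" "cball z ep0 \<subseteq> Om" using zO open_Omega open_contains_cball by blast
 obtain ta0 where ta0: "ta0 > 0" "f ` J ta0 \<subseteq> ball z ep0" using hc[OF ep0(1)] by blast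
 have "closure (f ` J ta0) \<subseteq> cball z ep0" using ta0(2) by (intro closure_minimal) auto
 moreover have "bounded (f ` J ta0)" using ta0(2) bounded_subset bounded_ball by blast
 ultimately have "cc (img (J ta0, f))"
  unfolding img compactly_contained_def using ep0(2) by (auto simp: compact_closure)
 then have "path_sum Q (osc Q g) (J ta0, f) < \<infinity>" by (rule gp(5)[OF Jsub[OF ta0(1)]])
 then have sm: "osr r summable_on hQ (f ` J ta0)"
  unfolding path_sum_def G(4) img using infsum_ereal_less_top_iff[of "hQ (f ` J ta0)" "osr r"] nn by simp
 obtain F where F: "finite F" "F \<subseteq> hQ (f ` J ta0)" "!!B. B \<subseteq> hQ (f ` J ta0) - F ==> infsum (osr r) B < d"
  by (rule infsum_tail_small[OF sm nn d]) (rule that)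
 obtain ep1 where ep1: "ep1 > 0" "!!i. i \<in> F ==> z \<notin> CQ i ==> i \<notin> hQ (ball z ep1)"
  by (rule hits_near_avoid[OF F(1)]) (rule that)
 obtain ta1 where ta1: "ta1 > 0" "f ` J ta1 \<subseteq> ball z ep1" using hc[OF ep1(1)] by blast
 define ta where "ta = min ta0 ta1"
 have ta: "ta > 0" "J ta \<subseteq> J ta0" "J ta \<subseteq> J ta1" using ta0(1) ta1(1) by (auto simp: ta_def J_def)
 have zQ: "z \<notin> CQ i" if i: "i \<in> hQ (f ` J ta)" for i
 proof
  assume "z \<in> CQ i"
  then have "i = j" using frontier_unique[of z i j] z FQ_CQ by blast
  moreover have "f ` J ta \<subseteq> f ` {a<..<b}" by (auto simp: J_def)
  ultimately show False using i zf(2) unfolding hits_def by blast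
 qed
 have "hQ (f ` J ta) \<subseteq> hQ (f ` J ta0) - F"
 proof
  fix i assume i: "i \<in> hQ (f ` J ta)"
  have "i \<in> hQ (f ` J ta0)" using i hits_mono[OF image_mono[OF ta(2)]] by blast
  moreover have "f ` J ta \<subseteq> ball z ep1" using ta(3) ta1(2) by blast
  then have "i \<in> hQ (ball z ep1)" using i hits_mono by blast
  ultimately show "i \<in> hQ (f ` J ta0) - F" using ep1(2)[OF _ zQ[OF i]] by blast
 qed
 then have su: "infsum (osr r) (hQ (f ` J ta)) < d" and sm': "osr r summable_on hQ (f ` J ta)"
  using F(3) summable_on_sub[OF sm _ nn] by blast+
 have near: "\<bar>Mx r i - Mx r k\<bar> <= d" if "i \<in> hQ (f ` J ta)" "k \<in> hQ (f ` J ta)" for i k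
 proof -
  have "\<bar>sup_on Q g i - sup_on Q g k\<bar> <= path_sum Q (osc Q g) (J ta, f)"
   by (rule gp(4)[OF Jsub[OF ta(1)]]) (use that in \<open>auto simp: img\<close>)
  also have "... = ereal (infsum (osr r) (hQ (f ` J ta)))"
   unfolding path_sum_def G(4) img using infsum_ereal_summable[OF sm'] nn by simp
  finally show ?thesis using su by (simp add: G(3))
 qed
 have con: "connected (f ` J ta)" using access_path_connected[OF gp(1) Jsub[OF ta(1)]] by (simp add: img)
 have sub0: "f ` J ta \<subseteq> img gm0" using img_subpath[OF Jsub[OF ta(1)]] by (simp add: img)
 have subO: "f ` J ta \<subseteq> Om" using sub0 gp(1) by (auto simp: cpaths_in_def)
 have ne: "f ` J ta ~= {}" using Jsub[OF ta(1)] by (simp add: subpath_of_def)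
 have zn: "z \<notin> f ` J ta" using zf(1) by (auto simp: J_def)
 obtain k where k: "k \<in> hQ (f ` J ta)" "\<bar>Mx r k - Mx r j\<bar> <= osr r j + d"
  using tail_crosses_good_square[OF g r z d con subO sub0 gp(3) ne zcl[OF ta(1)] zn] by blast
 have "\<bar>Mx r i - Mx r j\<bar> <= osr r j + 2 * d" if t: "t \<in> {a<..<b}" "\<bar>t - e\<bar> < ta" "f t \<in> Q i" for t i
 proof -
  have "t \<in> J ta" using t(1,2) by (auto simp: J_def)
  then have "i \<in> hQ (f ` J ta)" using t(3) by (auto simp: hits_def)
  then have "\<bar>Mx r i - Mx r k\<bar> <= d" using near k(1) by blast
  then show ?thesis using k(2) by linarith
 qed
 then show ?thesis using ta(1) by blast
qed

text \<open>As \<open>z\<close> is not on the access path, the path can approach it only at an end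
  of its parameter interval, possibly at both ends; at each such end
  \<open>access_tail_value\<close> applies.\<close>

lemma access_value_frontier:
 assumes g: "sobolev_loc v Om Q g" and r: "r = (%z. real_of_ereal (g z))"
  and z: "z \<in> FQ j" and acc: "accessible Om Q g z" and d: "d > 0"
 shows "ereal (Mx r j - osr r j - 2 * d) <= access_value Om Q g z" "access_value Om Q g z <= ereal (Mx r j + osr r j + 2 * d)"
proof -
 note G = sobolev_loc_real[OF g, folded r]
 have zS: "z \<in> S" and "\<exists>gm. gm \<in> access_paths Om Q g z" using acc by (auto simp: accessible_def)
 then have s: "(SOME gm. gm \<in> access_paths Om Q g z) \<in> access_paths Om Q g z" by - (rule someI_ex)
 define gm where "gm = (SOME gm. gm \<in> access_paths Om Q g z)"
 have a: "gm \<in> access_paths Om Q g z" using s by (simp only: gm_def)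
 have av: "access_value Om Q g z = disk_liminf Q g gm z" by (simp only: access_value_def gm_def)
 obtain gm0 where g0: "gm0 \<in> good_paths Om Q g" and ac: "if z \<in> img gm0 Int carpet_inner Om Q then gm = gm0
   else open_subpath_of gm gm0 & z \<in> closure (img gm) - img gm & (\<forall>i. z \<in> FQ i --> img gm Int Q i = {})"
  using a unfolding access_paths_def by blast
 have op: "open_subpath_of gm gm0" and zi: "z \<notin> img gm" "img gm Int Q j = {}"
  using ac frontier_not_inner[OF z] z by (auto split: if_splits)
 obtain h where h: "continuous_on (closure (fst gm0)) h" "\<forall>t\<in>fst gm0. h t = snd gm0 t" and b0: "bounded (fst gm0)"
  using good_pathD(1)[OF g0] by (auto simp: cpaths_in_def is_cpath_def)
 have sp: "subpath_of gm gm0" and oJ: "open (fst gm)" using op by (auto simp: open_subpath_of_def)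
 have J: "is_interval (fst gm)" "fst gm ~= {}" "fst gm \<subseteq> fst gm0" "snd gm = snd gm0" using sp by (auto simp: subpath_of_def)
 obtain al be where ab: "al < be" "fst gm = {al<..<be}"
  by (rule open_bounded_interval[OF oJ J(1) bounded_subset[OF b0 J(3)] J(2)]) (rule that)
 define f where "f = snd gm"
 have gm: "gm = ({al<..<be}, f)" using ab(2) by (simp add: f_def prod_eq_iff)
 have "{al..be} = closure {al<..<be}" using ab(1) by simp
 also have "... \<subseteq> closure (fst gm0)" using J(3) ab(2) by (intro closure_mono) simp
 finally have hab: "continuous_on {al..be} h" using h(1) continuous_on_subset by blast
 have hf: "h t = f t" if "t \<in> {al<..<be}" for t using h(2) J(3,4) ab(2) that by (auto simp: f_def)
 have imf: "img gm = f ` {al<..<be}" by (simp add: gm img_def)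
 note zz = zi[unfolded imf]
 have tail: "\<exists>ta>0. \<forall>t\<in>{al<..<be}. \<bar>t - e\<bar> < ta --> (\<forall>i. f t \<in> Q i --> \<bar>Mx r i - Mx r j\<bar> <= osr r j + 2 * d)"
  if "e = al | e = be" "h e = z" for e
  by (rule access_tail_value[OF g r z d g0 sp[unfolded gm] ab(1) hab hf zz that])
 have tail': "\<exists>ta>0. h e = z --> (\<forall>t\<in>{al<..<be}. \<bar>t - e\<bar> < ta --> (\<forall>i. f t \<in> Q i --> \<bar>Mx r i - Mx r j\<bar> <= osr r j + 2 * d))"
  if e: "e = al | e = be" for e
 proof (cases "h e = z")
  case True then show ?thesis using tail[OF e True] by blast
 next
  case False then show ?thesis by (intro exI[of _ 1]) simp
 qed
 obtain ta1 where ta1: "ta1 > 0" "h al = z --> (\<forall>t\<in>{al<..<be}. \<bar>t - al\<bar> < ta1 --> (\<forall>i. f t \<in> Q i --> \<bar>Mx r i - Mx r j\<bar> <= osr r j + 2 * d))"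
  using tail'[of al] by blast
 obtain ta2 where ta2: "ta2 > 0" "h be = z --> (\<forall>t\<in>{al<..<be}. \<bar>t - be\<bar> < ta2 --> (\<forall>i. f t \<in> Q i --> \<bar>Mx r i - Mx r j\<bar> <= osr r j + 2 * d))"
  using tail'[of be] by blast
 \<comment> \<open>The parameters away from the ends that tend to \<open>z\<close>. Their image
   under \<open>h\<close> is compact and misses \<open>z\<close>, so disks close to \<open>z\<close>
   are met only in the tails.\<close>
 define C where "C = {al..be} Int (if h al = z then {t. ta1 <= \<bar>t - al\<bar>} else UNIV) Int (if h be = z then {t. ta2 <= \<bar>t - be\<bar>} else UNIV)"
 have "closed {t. ta1 <= \<bar>t - al\<bar>}" "closed {t. ta2 <= \<bar>t - be\<bar>}" by (intro closed_Collect_le continuous_intros)+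
 then have "compact C" unfolding C_def by (intro compact_Int_closed compact_Icc) auto
 moreover have "C \<subseteq> {al..be}" by (auto simp: C_def)
 ultimately have "closed (h ` C)"
  using compact_continuous_image[OF continuous_on_subset[OF hab]] compact_imp_closed by blast
 moreover have "z \<notin> h ` C"
 proof
  assume "z \<in> h ` C"
  then obtain t where t: "t \<in> C" "h t = z" by blast
  have "t ~= al" using t ta1(1) by (auto simp: C_def split: if_splits)
  moreover have "t ~= be" using t ta2(1) by (auto simp: C_def split: if_splits)
  ultimately have "t \<in> {al<..<be}" using t(1) by (auto simp: C_def)
  then show False using hf t(2) zz(1) by (metis imageI)
 qed
 ultimately have "open (- (h ` C))" "z \<in> - (h ` C)" by (auto simp: open_Compl)
 then obtain ep where ep: "ep > 0" "ball z ep \<subseteq> - (h ` C)" using open_contains_ball by blast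
 have bb: "ereal (Mx r j - osr r j - 2 * d) <= sup_on Q g i & sup_on Q g i <= ereal (Mx r j + osr r j + 2 * d)"
  if i: "i \<in> hQ (img gm)" "Q i \<subseteq> ball z ep" for i
 proof -
  obtain t where t: "t \<in> {al<..<be}" "f t \<in> Q i" using i(1) unfolding imf hits_def by blast
  have "h t \<in> ball z ep" using hf[OF t(1)] t(2) i(2) by auto
  then have "t \<notin> C" using ep(2) by blast
  then have "(h al = z & \<bar>t - al\<bar> < ta1) | (h be = z & \<bar>t - be\<bar> < ta2)"
   using t(1) by (auto simp: C_def split: if_splits)
  then have "\<bar>Mx r i - Mx r j\<bar> <= osr r j + 2 * d" using ta1(2) ta2(2) t by blast
  then show ?thesis unfolding G(3) by (simp add: abs_le_iff)
 qed
 note dl = disk_liminf_bounds[OF zS a ep(1), of "ereal (Mx r j - osr r j - 2 * d)" "ereal (Mx r j + osr r j + 2 * d)"]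
 have "ereal (Mx r j - osr r j - 2 * d) <= disk_liminf Q g gm z" by (rule dl(1)) (erule (1) bb)
 then show "ereal (Mx r j - osr r j - 2 * d) <= access_value Om Q g z" by (simp only: av)
 have "disk_liminf Q g gm z <= ereal (Mx r j + osr r j + 2 * d)" by (rule dl(2)) (erule (1) bb)
 then show "access_value Om Q g z <= ereal (Mx r j + osr r j + 2 * d)" by (simp only: av)
qed

text \<open>The function \<open>g\<close> behind the normalized \<open>u\<close> is merely some
  Sobolev function. At an accessible boundary point \<open>u\<close> takes the access value of
  \<open>g\<close>; hence the disk values of the two differ by at most the sum of both oscillations,
  which is small near \<open>x\<close>. The estimate for the disk values of \<open>u\<close> thus
  carries over to those of \<open>g\<close>, and from there to all values of \<open>u\<close> near
  \<open>x\<close>.\<close>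

lemma har_normalized_continuous:
 assumes u: "har u" and n: "normalized v Om Q (%z. ereal (u z))"
 shows "continuous_on S u"
proof -
 obtain g where g: "sobolev_loc v Om Q g" and ug: "\<forall>x\<in>S. ereal (u x) = normalized_version Om Q g x"
  using n unfolding normalized_def by blast
 define r where "r = (%z. real_of_ereal (g z))"
 note G = sobolev_loc_real[OF g, folded r_def]
 have uw: "wloc u" using u by (simp add: har_def)
 note U = wlocD[OF uw]
 have cmp: "\<bar>Mx u j - Mx r j\<bar> <= osr u j + osr r j" for j
 proof -
  obtain p where p: "p \<in> FQ j" using frontier_Q_nonempty by blast
  obtain z where z: "z \<in> FQ j" "dist z p < 1" "accessible Om Q g z"
   by (rule accessible_near[OF g p zero_less_one]) (rule that)
  have zS: "z \<in> S" using z(1) FQ_S by blast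
  have uz: "ereal (u z) = access_value Om Q g z" using ug zS z(3) by (simp add: normalized_version_def)
  have "\<bar>u z - Mx r j\<bar> <= osr r j + 2 * d" if "d > 0" for d
   using access_value_frontier[OF g r_def z(1,3) that] unfolding uz[symmetric] by (simp add: abs_le_iff)
  then have "\<bar>u z - Mx r j\<bar> <= osr r j + e" if "e > 0" for e using that by (metis half_gt_zero field_sum_of_halves mult_2)
  then have "\<bar>u z - Mx r j\<bar> <= osr r j" by (rule field_le_epsilon)
  moreover have "\<bar>Mx u j - u z\<bar> <= osr u j" by (rule abs_Mx_diff_le_osr[OF U(1) z(1)])
  ultimately show ?thesis by linarith
 qed
 show ?thesis
  unfolding continuous_on_iff
 proof (intro ballI allI impI)
  fix x e assume x: "x \<in> S" and e: "(e::real) > 0"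
  have xO: "x \<in> Om" using x S_subset by blast
  \<comment> \<open>Three errors of \<open>e / 9\<close> add up to \<open>e / 3\<close> for the disk
    values of \<open>g\<close>, and comparing two points with \<open>c\<close> doubles this.\<close>
  have e9: "e / 9 > 0" using e by simp
  obtain r1 c where r1: "r1 > 0" "!!k. k \<in> hQ (ball x r1) ==> x \<notin> CQ k ==> c - e / 9 <= Mn u k & Mx u k <= c + e / 9"
   by (rule harmonic_disks_near[OF u x e9]) (rule that)
  obtain r2 where r2: "r2 > 0" "!!i. i \<in> hQ (ball x r2) ==> x \<notin> CQ i ==> \<bar>osr u i\<bar> <= e / 9"
   by (rule small_near[OF U(2) xO e9]) (rule that)
  obtain r3 where r3: "r3 > 0" "!!i. i \<in> hQ (ball x r3) ==> x \<notin> CQ i ==> \<bar>osr r i\<bar> <= e / 9"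
   by (rule small_near[OF wlocD(2)[OF G(1)] xO e9]) (rule that)
  define R where "R = min r1 (min r2 r3)"
  have R: "R > 0" "R <= r1" "R <= r2" "R <= r3" using r1(1) r2(1) r3(1) by (auto simp: R_def)
  have b: "ereal (c - e / 3) <= sup_on Q g k & sup_on Q g k <= ereal (c + e / 3)"
   if k: "k \<in> hQ (ball x R)" "x \<notin> CQ k" for k
  proof -
   have k': "k \<in> hQ (ball x r1)" "k \<in> hQ (ball x r2)" "k \<in> hQ (ball x r3)"
    by (rule subsetD[OF hits_mono[OF subset_ball[OF R(2)]] k(1)] subsetD[OF hits_mono[OF subset_ball[OF R(3)]] k(1)]
    subsetD[OF hits_mono[OF subset_ball[OF R(4)]] k(1)])+
   have "\<bar>Mx r k - c\<bar> <= e / 3"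
    using r1(2)[OF k'(1) k(2)] r2(2)[OF k'(2) k(2)] r3(2)[OF k'(3) k(2)] cmp[of k] Mn_le_Mx[OF U(1), of k] by linarith
   then have "c - e / 3 <= Mx r k & Mx r k <= c + e / 3" by linarith
   then show ?thesis unfolding G(3) ereal_less_eq(3) .
  qed
  have near: "\<bar>u y - c\<bar> <= e / 3" if y: "y \<in> S" "dist y x < R" for y
  proof -
   have "ereal (c - e / 3) <= ereal (u y) & ereal (u y) <= ereal (c + e / 3)"
    using normalized_near[OF g R(1) b y] ug y(1) by simp
   then show ?thesis unfolding ereal_less_eq(3) by linarith
  qed
  show "\<exists>d>0. \<forall>y\<in>S. dist y x < d --> dist (u y) (u x) < e"
  proof (intro exI[of _ R] conjI ballI impI)
   show "R > 0" by (rule R(1))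
   fix y assume "y \<in> S" "dist y x < R"
   then have "\<bar>u y - c\<bar> <= e / 3" by (rule near)
   moreover have "\<bar>u x - c\<bar> <= e / 3" by (rule near[OF x]) (use R(1) in simp)
   ultimately have "\<bar>u y - u x\<bar> < e" using e by linarith
   then show "dist (u y) (u x) < e" by (simp add: dist_real_def)
  qed
 qed
qed

end

section \<open>Limits of harmonic functions\<close>

context sierpinski_carpet begin

section \<open>A Caccioppoli estimate for the oscillations of two harmonic functions\<close>

lemma osr_diff_le:
 assumes "locally_bounded f" "locally_bounded g" and d: "!!p. p \<in> FQ i ==> \<bar>f p - g p\<bar> <= e"
 shows "\<bar>osr f i - osr g i\<bar> <= 2 * e"
proof -
 have *: "osr f i <= osr g i + 2 * e" if "locally_bounded g" "!!p. p \<in> FQ i ==> \<bar>f p - g p\<bar> <= e" for f g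
 proof (rule osr_least)
  fix p q assume pq: "p \<in> FQ i" "q \<in> FQ i"
  have "\<bar>g p - g q\<bar> <= osr g i" by (rule abs_diff_le_osr[OF that(1) pq])
  then show "f p - f q <= osr g i + 2 * e" using that(2)[OF pq(1)] that(2)[OF pq(2)] by linarith
 qed
 have "osr f i <= osr g i + 2 * e" by (rule *[OF assms(2) d])
 moreover have "osr g i <= osr f i + 2 * e" by (rule *[OF assms(1)]) (use d in \<open>simp add: abs_minus_commute\<close>)
 ultimately show ?thesis by linarith
qed

text \<open>Testing the minimality of \<open>w\<close> with \<open>ph (u - w)\<close> and that of \<open>u\<close> with \<open>- ph (u - w)\<close>, where
 \<open>ph = et^2/2\<close>, and adding the two inequalities leaves \<open>2 ph (1 - ph) (a - b)^2\<close> on the left. The following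
 is the resulting estimate on one disk with oscillations \<open>a\<close>, \<open>b\<close>.\<close>

lemma cutoff_term_le:
 fixes a b et om ep W :: real
 assumes "0 <= et" "et <= 1" "0 <= om" "om <= W" "0 <= a" "0 <= b" "\<bar>a - b\<bar> <= 2 * ep" "0 < ep" "ep <= 1"
 defines "ph \<equiv> et^2 / 2" and "c \<equiv> 3 * ep * (om * (et + om))"
 shows "et^2 * (a - b)^2 / 4 <= ((1 - ph) * a + ph * b + c)^2 * (-1) + a^2 + b^2 - (ph * a + (1 - ph) * b + c)^2
  + ep * (48 + 24 * (1 + W)^2) * (om^2 + b^2)"
proof -
 define o' where "o' = om * (et + om)"
 define D where "D = \<bar>a - b\<bar>"
 have D: "0 <= D" "D <= 2 * ep" "D^2 = (a - b)^2" "a <= b + D" using assms(7) by (auto simp: D_def)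
 have o0: "0 <= o'" using assms by (simp add: o'_def)
 have "o' <= om * (1 + W)" unfolding o'_def using assms by (intro mult_left_mono) auto
 then have "o'^2 <= (om * (1 + W))^2" using o0 by (intro power_mono)
 then have o2: "o'^2 <= (1 + W)^2 * om^2" by (simp add: power_mult_distrib mult.commute)
 have "et^2 <= 1" using assms(1,2) by (simp add: power_le_one)
 then have ph: "0 <= ph" "ph <= 1 / 2" by (auto simp: ph_def)
 have id: "((1 - ph) * a + ph * b + c)^2 + (ph * a + (1 - ph) * b + c)^2
   = a^2 + b^2 - 2 * ph * (1 - ph) * (a - b)^2 + 2 * c * (a + b) + 2 * c^2"
  by (simp add: power2_eq_square algebra_simps)
 have "2 * (1/2) * ph * (a - b)^2 <= 2 * (1 - ph) * ph * (a - b)^2"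
  using ph by (intro mult_right_mono) auto
 moreover have "2 * (1 - ph) * ph * (a - b)^2 = 2 * ph * (1 - ph) * (a - b)^2" by simp
 moreover have "2 * (1/2) * ph * (a - b)^2 = et^2 * (a - b)^2 / 2" by (simp add: ph_def)
 ultimately have l: "et^2 * (a - b)^2 / 2 <= 2 * ph * (1 - ph) * (a - b)^2" by linarith
 have c: "c = 3 * ep * o'" by (simp add: c_def o'_def)
 have c0: "c >= 0" using c o0 assms(8) by simp
 \<comment> \<open>By Young's inequality the mixed term with \<open>et * D\<close> costs a quarter
   of \<open>et^2 * (a - b)^2\<close>, absorbed by the half obtained from
   \<open>ph <= 1 / 2\<close>. This works because \<open>c\<close> contains the factor
   \<open>et\<close>, up to a term of second order in \<open>om\<close>.\<close>
 have "2 * c * (a + b) <= 2 * c * (2 * b + D)" using c0 D(4) by (intro mult_left_mono) auto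
 also have "... = 12 * ep * (o' * b) + 6 * (ep * om) * (et * D) + 6 * ep * om^2 * D"
  by (simp add: c o'_def power2_eq_square algebra_simps)
 also have "... <= 6 * ep * (o'^2 + b^2) + (et^2 * (a - b)^2 / 4 + 36 * ep * om^2) + 12 * ep * om^2"
 proof (intro add_mono)
  have "2 * (o' * b) <= o'^2 + b^2" using sum_squares_bound[of o' b] by simp
  then have "6 * ep * (2 * (o' * b)) <= 6 * ep * (o'^2 + b^2)" using assms(8) by (intro mult_left_mono) auto
  then show "12 * ep * (o' * b) <= 6 * ep * (o'^2 + b^2)" by simp
  have "2 * (et * D / 2) * (6 * (ep * om)) <= (et * D / 2)^2 + (6 * (ep * om))^2" by (rule sum_squares_bound)
  moreover have "(et * D / 2)^2 = et^2 * (a - b)^2 / 4" by (simp add: power_mult_distrib power_divide D(3))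
  moreover have "(6 * (ep * om))^2 = 36 * ep^2 * om^2" by (simp add: power_mult_distrib)
  moreover have "ep^2 <= ep" using assms(8,9) by (simp add: power2_eq_square mult_left_le_one_le)
  then have "36 * ep^2 * om^2 <= 36 * ep * om^2" by (intro mult_right_mono) auto
  ultimately show "6 * (ep * om) * (et * D) <= et^2 * (a - b)^2 / 4 + 36 * ep * om^2" by (simp add: mult_ac)
  have "D <= 2" using D(2) assms(9) by linarith
  then have "ep * D <= ep * 2" using assms(8) by (intro mult_left_mono) auto
  then have "6 * om^2 * (ep * D) <= 6 * om^2 * (ep * 2)" by (rule mult_left_mono) simp
  then show "6 * ep * om^2 * D <= 12 * ep * om^2" by (simp add: mult_ac)
 qed
 finally have t1: "2 * c * (a + b) <= 6 * ep * (o'^2 + b^2) + (et^2 * (a - b)^2 / 4 + 36 * ep * om^2) + 12 * ep * om^2" .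
 have "ep^2 <= ep" using assms(8,9) by (simp add: power2_eq_square mult_left_le_one_le)
 then have "18 * ep^2 * o'^2 <= 18 * ep * o'^2" by (intro mult_right_mono) auto
 then have t2: "2 * c^2 <= 18 * ep * o'^2" by (simp add: c power_mult_distrib)
 have "24 * ep * o'^2 <= 24 * ep * ((1 + W)^2 * om^2)" using o2 assms(8) by (intro mult_left_mono) auto
 then have t3: "6 * ep * (o'^2 + b^2) + 36 * ep * om^2 + 12 * ep * om^2 + 18 * ep * o'^2
   <= ep * (48 + 24 * (1 + W)^2) * om^2 + 6 * ep * b^2" by (simp add: algebra_simps)
 have "6 * ep * b^2 <= ep * (48 + 24 * (1 + W)^2) * b^2"
  using assms(8) by (intro mult_right_mono) (auto simp: mult.commute[of 6] intro!: mult_left_mono add_increasing2)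
 then show ?thesis using id l t1 t2 t3 by (simp add: algebra_simps)
qed

text \<open>In the product rule the variation of the cutoff is controlled by a distance; along a
  good arc \<open>dist_le_sum_diameter\<close> replaces it by the sum of the diameters of the disks
  met.\<close>

lemma lipschitz_good_on:
 assumes good: "good_on u (osr u) f a b" "good_on w (osr w) f a b"
  and nn: "!!i. 0 <= osr u i" "!!i. 0 <= osr w i" and e: "0 <= e" and L: "0 <= L"
  and z: "!!x y. x \<in> S ==> y \<in> S ==> \<bar>ze x - ze y\<bar> <= \<bar>u x - u y\<bar> + \<bar>w x - w y\<bar> + e * L * dist x y"
 shows "good_on ze (%i. osr u i + osr w i + e * L * dQ i) f a b"
proof -
 let ?H = "%s t. hQ (f ` {s..t})"
 have G: "a <= b" "continuous_on {a..b} f" "f ` {a..b} \<subseteq> Om" "hausdorff1 (f ` {a..b} Int S) = 0"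
  "osr u summable_on ?H a b" "osr w summable_on ?H a b" "(%i. dQ i) summable_on ?H a b"
  using good by (auto simp: good_on_def)
 have dn: "0 <= dQ i" for i using diameter_Q_pos[of i] by simp
 have sm: "(%i. osr u i + osr w i + e * L * dQ i) summable_on ?H a b"
  by (intro summable_on_add summable_on_cmult_right G(5-7))
 have "\<bar>ze (f s) - ze (f t)\<bar> <= infsum (%i. osr u i + osr w i + e * L * dQ i) (?H s t)"
  if st: "a <= s" "s <= t" "t <= b" "f s \<in> S" "f t \<in> S" for s t
 proof -
  note gu = good_on_sub[OF good(1) st(1-3) nn(1)] and gw = good_on_sub[OF good(2) st(1-3) nn(2)]
  have su: "osr u summable_on ?H s t" "osr w summable_on ?H s t" "(%i. dQ i) summable_on ?H s t"
   using gu gw by (auto simp: good_on_def)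
  have du: "\<bar>u (f s) - u (f t)\<bar> <= infsum (osr u) (?H s t)" using good(1) st unfolding good_on_def by blast
  have dw: "\<bar>w (f s) - w (f t)\<bar> <= infsum (osr w) (?H s t)" using good(2) st unfolding good_on_def by blast
  have "dist (f s) (f t) <= infsum (%i. dQ i) (?H s t)"
   by (rule dist_le_sum_diameter) (use gu in \<open>auto simp: good_on_def\<close>)
  then have dd: "e * L * dist (f s) (f t) <= e * L * infsum (%i. dQ i) (?H s t)"
   using e L by (intro mult_left_mono) auto
  have "infsum (%i. osr u i + osr w i + e * L * dQ i) (?H s t)
    = infsum (osr u) (?H s t) + infsum (osr w) (?H s t) + e * L * infsum (%i. dQ i) (?H s t)"
   using su by (simp add: infsum_add summable_on_add summable_on_cmult_right infsum_cmult_right)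
  then show ?thesis using z[OF st(4,5)] du dw dd by linarith
 qed
 then show ?thesis using G sm unfolding good_on_def by blast
qed

text \<open>The cutoff is Lipschitz and the difference is bounded by \<open>e\<close> where the
  cutoff is nonzero, so the product rule gives an upper gradient built from both oscillations and
  the diameters.\<close>

lemma cutoff_wsob:
 assumes u: "wloc u" and w: "wloc w" and V: "cc V"
  and b: "!!x. x \<in> S ==> x \<in> V ==> \<bar>u x - w x\<bar> <= e" and e: "e > 0" and L: "L >= 0"
  and bd: "!!x. 0 <= ph x & ph x <= 1" and lip: "!!x y. \<bar>ph x - ph y\<bar> <= L * dist x y"
  and z: "!!x. x \<notin> V ==> ph x = 0" and Vo: "open V"
 shows "wsob (%x. ph x * (u x - w x))"
proof -
 note U = wlocD[OF u] and Ww = wlocD[OF w]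
 define ze where "ze x = ph x * (u x - w x)" for x
 define rh where "rh i = osr u i + osr w i + e * L * dQ i" for i
 have nn: "0 <= osr u i" "0 <= osr w i" for i using osr_nonneg[OF U(1)] osr_nonneg[OF Ww(1)] by auto
 have rn: "0 <= rh i" for i using nn[of i] e L diameter_Q_pos[of i] by (simp add: rh_def)
 have diff1: "\<bar>ze x - ze y\<bar> <= \<bar>u x - u y\<bar> + \<bar>w x - w y\<bar> + e * L * dist x y" if xy: "x \<in> S" "x \<in> V" for x y
 proof -
  have "ze x - ze y = ph y * ((u x - u y) - (w x - w y)) + (ph x - ph y) * (u x - w x)"
   by (simp add: ze_def algebra_simps)
  also have "\<bar>...\<bar> <= \<bar>ph y * ((u x - u y) - (w x - w y))\<bar> + \<bar>(ph x - ph y) * (u x - w x)\<bar>" by (rule abs_triangle_ineq)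
  also have "... <= 1 * \<bar>(u x - u y) - (w x - w y)\<bar> + (L * dist x y) * e"
   unfolding abs_mult using bd[of y] lip[of x y] b[OF xy] L by (intro add_mono mult_mono) auto
  finally show ?thesis by (simp add: mult_ac)
 qed
 have diff: "\<bar>ze x - ze y\<bar> <= \<bar>u x - u y\<bar> + \<bar>w x - w y\<bar> + e * L * dist x y" if xy: "x \<in> S" "y \<in> S" for x y
 proof -
  consider "x \<in> V" | "y \<in> V" | "x \<notin> V" "y \<notin> V" by blast
  then show ?thesis
  proof cases
   case 1 then show ?thesis using diff1[OF xy(1)] by simp
  next
   case 2
   show ?thesis using diff1[OF xy(2) 2, of x] by (simp add: abs_minus_commute dist_commute)
  next
   case 3
   then show ?thesis using z e L by (simp add: ze_def)
  qed
 qed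
 have zb: "\<bar>ze x\<bar> <= e" if x: "x \<in> S" for x
 proof (cases "x \<in> V")
  case True
  have "\<bar>ph x\<bar> * \<bar>u x - w x\<bar> <= 1 * e" using bd[of x] b[OF x True] by (intro mult_mono) auto
  then show ?thesis by (simp add: ze_def abs_mult)
 qed (use z e in \<open>simp add: ze_def\<close>)
 have zf: "\<bar>ze p\<bar> <= e" if "p \<in> FQ i" for p i using zb FQ_S that by blast
 have lb: "locally_bounded ze" unfolding locally_bounded_def bounded_iff using zf by (metis imageE real_norm_def)
 obtain Gm1 Gm2 where Gm: "ae_good u (osr u) Gm1" "ae_good w (osr w) Gm2" using u w unfolding wloc_def by blast
 have g: "ae_good ze rh (Gm1 Un Gm2)"
  unfolding ae_good_def
 proof (intro conjI allI impI)
  show "null (Gm1 Un Gm2)" by (rule null_Un[OF ae_good_null[OF Gm(1)] ae_good_null[OF Gm(2)]])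
  fix J f a b assume *: "(J, f) \<in> cpaths_in Om - (Gm1 Un Gm2)" "a <= b" "{a..b} \<subseteq> J"
  have "good_on u (osr u) f a b" "good_on w (osr w) f a b"
   using ae_goodD[OF Gm(1) _ *(2,3)] ae_goodD[OF Gm(2) _ *(2,3)] *(1) by auto
  then show "good_on ze rh f a b" unfolding rh_def by (rule lipschitz_good_on) (use nn e L diff in auto)
 qed
 have os: "osr ze i <= rh i" for i
 proof (rule osr_least)
  fix p q assume pq: "p \<in> FQ i" "q \<in> FQ i"
  have "dist p q <= dQ i" using pq FQ_CQ by (intro dist_le_diameter_Q) auto
  then have "e * L * dist p q <= e * L * dQ i" using e L by (intro mult_left_mono) auto
  moreover have "p \<in> S" "q \<in> S" using pq FQ_S by auto
  ultimately show "ze p - ze q <= rh i"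
   using diff[of p q] abs_diff_le_osr[OF U(1) pq] abs_diff_le_osr[OF Ww(1) pq] unfolding rh_def by linarith
 qed
 have "loc_l2 rh" unfolding rh_def by (intro loc_l2_add loc_l2_cmult loc_l2_diameter U(2) Ww(2))
 then have "loc_l2 (osr ze)" by (rule loc_l2_le) (use os osr_nonneg[OF lb] rn in \<open>simp add: abs_of_nonneg\<close>)
 then have s1: "(%i. (osr ze i)^2) summable_on hQ V" using V by (simp add: loc_l2_def)
 have "loc_l2 (%i. Mx ze i * dQ i)"
 proof (rule loc_l2_le[OF loc_l2_cmult[OF loc_l2_diameter, of e]])
  fix i
  obtain p where p: "p \<in> FQ i" using frontier_Q_nonempty by blast
  have "Mx ze i <= e" using zf by (intro Mx_least) (meson abs_le_D1)
  moreover have "- e <= Mx ze i" using zf[OF p] le_Mx[OF lb p] by linarith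
  ultimately have "\<bar>Mx ze i\<bar> <= \<bar>e\<bar>" using e by simp
  then show "\<bar>Mx ze i * dQ i\<bar> <= \<bar>e * dQ i\<bar>" unfolding abs_mult by (rule mult_right_mono) simp
 qed
 then have s2: "(%i. (Mx ze i * dQ i)^2) summable_on hQ V" using V by (simp add: loc_l2_def)
 have "wsob ze"
 proof (rule wsobI[OF lb V _ s1 s2 g rn])
  fix i p assume "i \<notin> hQ V" "p \<in> FQ i"
  then have "p \<notin> V" using frontier_hits_open[OF Vo, of p i] FQ_CQ by blast
  then show "ze p = 0" by (simp add: ze_def z)
 qed
 then show ?thesis unfolding ze_def .
qed

lemma cutoff_osr_le:
 assumes u: "locally_bounded u" and w: "locally_bounded w"
  and b: "!!p. p \<in> FQ i ==> \<bar>u p - w p\<bar> <= e"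
  and ph: "!!p. p \<in> FQ i ==> 0 <= ph p & ph p <= 1 & \<bar>ph p - ph0\<bar> <= k"
  and o2: "!!p q. p \<in> FQ i ==> q \<in> FQ i ==> \<bar>ph p - ph q\<bar> <= k"
 shows "osr (%x. w x + ph x * (u x - w x)) i <= (1 - ph0) * osr w i + ph0 * osr u i + 3 * e * k"
proof (rule osr_least)
 fix p q assume pq: "p \<in> FQ i" "q \<in> FQ i"
 have e0: "0 <= e" using b[OF pq(1)] by simp
 have D: "\<bar>osr u i - osr w i\<bar> <= 2 * e" by (rule osr_diff_le[OF u w b])
 have k0: "0 <= k" using o2[OF pq] by simp
 have "w p + ph p * (u p - w p) - (w q + ph q * (u q - w q))
   = (1 - ph q) * (w p - w q) + ph q * (u p - u q) + (ph p - ph q) * (u p - w p)" by (simp add: algebra_simps)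
 also have "... <= (1 - ph q) * osr w i + ph q * osr u i + k * e"
 proof (intro add_mono mult_left_mono)
  show "w p - w q <= osr w i" "u p - u q <= osr u i" using abs_diff_le_osr[OF w pq] abs_diff_le_osr[OF u pq] by auto
  have "(ph p - ph q) * (u p - w p) <= \<bar>ph p - ph q\<bar> * \<bar>u p - w p\<bar>" by (simp add: abs_mult[symmetric])
  also have "... <= k * e" using o2[OF pq] b[OF pq(1)] k0 by (intro mult_mono) auto
  finally show "(ph p - ph q) * (u p - w p) <= k * e" .
 qed (use ph[OF pq(2)] in auto)
 also have "(1 - ph q) * osr w i + ph q * osr u i = (1 - ph0) * osr w i + ph0 * osr u i + (ph q - ph0) * (osr u i - osr w i)"
  by (simp add: algebra_simps)
 also have "(ph q - ph0) * (osr u i - osr w i) <= k * (2 * e)"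
 proof -
  have "(ph q - ph0) * (osr u i - osr w i) <= \<bar>ph q - ph0\<bar> * \<bar>osr u i - osr w i\<bar>" by (simp add: abs_mult[symmetric])
  also have "... <= k * (2 * e)" using ph[OF pq(2)] D k0 by (intro mult_mono) auto
  finally show ?thesis .
 qed
 finally show "w p + ph p * (u p - w p) - (w q + ph q * (u q - w q)) <= (1 - ph0) * osr w i + ph0 * osr u i + 3 * e * k"
  by (simp add: algebra_simps)
qed

text \<open>A Caccioppoli inequality. The bound is only linear in \<open>e\<close>, but with the
  energy of \<open>u\<close> on the right it is all that a Cauchy estimate asks for.\<close>

lemma harmonic_energy_estimate:
 assumes u: "har u" and w: "har w" and V: "open V" "cc V"
  and b: "!!x. x \<in> S ==> x \<in> V ==> \<bar>u x - w x\<bar> <= e"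
   "!!i p. i \<in> hQ V ==> p \<in> FQ i ==> \<bar>u p - w p\<bar> <= e"
  and e: "0 < e" "e <= 1" and L: "0 <= L"
  and et: "!!x. 0 <= et x & et x <= 1" "!!x y. \<bar>et x - et y\<bar> <= L * dist x y" "!!x. x \<notin> V ==> et x = (0::real)"
  and W: "!!i. i \<in> hQ V ==> L * dQ i <= W" and p: "!!i. p i \<in> FQ i"
 shows "(infsum (%i. (et (p i))^2 * (osr w i - osr u i)^2 / 4) (hQ V))
  <= e * (48 + 24 * (1 + W)^2) * (infsum (%i. (L * dQ i)^2 + (osr u i)^2) (hQ V))"
proof -
 have uw: "wloc u" "wloc w" using u w by (auto simp: har_def)
 note U = wlocD[OF uw(1)] and Ww = wlocD[OF uw(2)]
 define ph where "ph x = (et x)^2 / 2" for x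
 define om where "om i = L * dQ i" for i
 \<comment> \<open>As \<open>ph\<close> is half the square of \<open>et\<close>, its variation on a
   disk keeps a factor \<open>et\<close>, up to the variation \<open>om\<close> of \<open>et\<close>
   itself; \<open>cutoff_term_le\<close> relies on this factor.\<close>
 define k where "k i = om i * (et (p i) + om i)" for i
 define A where "A i = (1 - ph (p i)) * osr w i + ph (p i) * osr u i + 3 * e * k i" for i
 define B where "B i = ph (p i) * osr w i + (1 - ph (p i)) * osr u i + 3 * e * k i" for i
 have nn: "0 <= osr u i" "0 <= osr w i" for i using osr_nonneg[OF U(1)] osr_nonneg[OF Ww(1)] by auto
 have ph1: "0 <= ph x & ph x <= 1" for x
 proof -
  have "(et x)^2 <= 1" using et(1)[of x] by (simp add: power_le_one)
  then show ?thesis by (simp add: ph_def)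
 qed
 have phd: "\<bar>ph x - ph y\<bar> = \<bar>et x - et y\<bar> * ((et x + et y) / 2)" for x y
 proof -
  have "ph x - ph y = (et x - et y) * ((et x + et y) / 2)" by (simp add: ph_def power2_eq_square field_simps)
  then have "\<bar>ph x - ph y\<bar> = \<bar>et x - et y\<bar> * \<bar>(et x + et y) / 2\<bar>" by (simp only: abs_mult)
  moreover have "\<bar>(et x + et y) / 2\<bar> = (et x + et y) / 2" using et(1)[of x] et(1)[of y] by simp
  ultimately show ?thesis by (simp only:)
 qed
 have phL: "\<bar>ph x - ph y\<bar> <= L * dist x y" for x y
 proof -
  have "\<bar>et x - et y\<bar> * ((et x + et y) / 2) <= \<bar>et x - et y\<bar> * 1"
   using et(1)[of x] et(1)[of y] by (intro mult_left_mono) auto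
  then show ?thesis using phd[of x y] et(2)[of x y] by simp
 qed
 have om0: "0 <= om i" for i using L diameter_Q_pos[of i] by (simp add: om_def)
 have etom: "\<bar>et x - et y\<bar> <= om i" if "x \<in> FQ i" "y \<in> FQ i" for x y i
 proof -
  have "dist x y <= dQ i" using that FQ_CQ by (intro dist_le_diameter_Q) auto
  then have "L * dist x y <= om i" using L by (simp add: om_def mult_left_mono)
  then show ?thesis using et(2)[of x y] by simp
 qed
 have phk: "\<bar>ph x - ph y\<bar> <= k i" if xy: "x \<in> FQ i" "y \<in> FQ i" for x y i
 proof -
  have "(et x + et y) / 2 <= et (p i) + om i" using etom[OF xy(1) p] etom[OF xy(2) p] by (auto simp: abs_le_iff field_simps)
  then show ?thesis
   unfolding phd k_def using etom[OF xy] om0[of i] et(1)[of x] et(1)[of y] by (intro mult_mono) auto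
 qed
 have b': "\<bar>w x - u x\<bar> <= e" if "x \<in> S" "x \<in> V" for x using b(1)[OF that] by (simp add: abs_minus_commute)
 have zV: "ph x = 0" if "x \<notin> V" for x using et(3)[OF that] by (simp add: ph_def)
 have t1: "wsob (%x. ph x * (u x - w x))" by (rule cutoff_wsob[OF uw V(2) b(1) e(1) L ph1 phL zV V(1)])
 have t2: "wsob (%x. ph x * (w x - u x))" by (rule cutoff_wsob[OF uw(2,1) V(2) b' e(1) L ph1 phL zV V(1)])
 have e1: "energy V w <= energy V (%x. w x + ph x * (u x - w x))"
  by (rule w[unfolded har_def, THEN conjunct2, rule_format, OF V t1]) (simp add: zV)
 have e2: "energy V u <= energy V (%x. u x + ph x * (w x - u x))"
  by (rule u[unfolded har_def, THEN conjunct2, rule_format, OF V t2]) (simp add: zV)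
 have lb: "locally_bounded (%x. w x + ph x * (u x - w x))" "locally_bounded (%x. u x + ph x * (w x - u x))"
  using bounded_add[OF Ww(1)] bounded_add[OF U(1)] t1 t2 wlocD(1) unfolding wsob_def by blast+
 have oA: "osr (%x. w x + ph x * (u x - w x)) i <= A i" if "i \<in> hQ V" for i
  unfolding A_def by (rule cutoff_osr_le[OF U(1) Ww(1) b(2)[OF that]]) (use ph1 phk p in auto)
 have oB: "osr (%x. u x + ph x * (w x - u x)) i <= B i" if "i \<in> hQ V" for i
 proof -
  have "osr (%x. u x + ph x * (w x - u x)) i <= (1 - ph (p i)) * osr u i + ph (p i) * osr w i + 3 * e * k i"
   by (rule cutoff_osr_le[OF Ww(1) U(1)]) (use b(2)[OF that] ph1 phk p in \<open>auto simp: abs_minus_commute\<close>)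
  then show ?thesis by (simp add: B_def)
 qed
 have sa: "(%i. (osr w i)^2) summable_on hQ V" and sb: "(%i. (osr u i)^2) summable_on hQ V"
  using U(2) Ww(2) V(2) by (auto simp: loc_l2_def)
 have l2: "loc_l2 om" unfolding om_def by (intro loc_l2_cmult loc_l2_diameter)
 have so: "(%i. (om i)^2) summable_on hQ V" using l2 V(2) by (simp add: loc_l2_def)
 have "loc_l2 (%i. osr w i + osr u i + 3 * (1 + W) * om i)" by (intro loc_l2_add loc_l2_cmult l2 U(2) Ww(2))
 then have sm: "(%i. (osr w i + osr u i + 3 * (1 + W) * om i)^2) summable_on hQ V" using V(2) by (simp add: loc_l2_def)
 have ck: "0 <= 3 * e * k i & 3 * e * k i <= 3 * (1 + W) * om i" if i: "i \<in> hQ V" for i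
 proof -
  have k0: "0 <= k i" using om0[of i] et(1)[of "p i"] by (simp add: k_def)
  have "k i <= om i * (1 + W)" unfolding k_def using W[OF i] om0[of i] et(1)[of "p i"] by (intro mult_left_mono) (auto simp: om_def)
  moreover have "e * k i <= 1 * k i" using e k0 by (intro mult_right_mono) auto
  ultimately have "3 * (e * k i) <= 3 * (om i * (1 + W))" by linarith
  moreover have "3 * e * k i = 3 * (e * k i)" "3 * (1 + W) * om i = 3 * (om i * (1 + W))" by (simp_all add: algebra_simps)
  moreover have "0 <= 3 * (e * k i)" using k0 e(1) by simp
  ultimately show ?thesis by linarith
 qed
 have conv: "0 <= t * x + (1 - t) * y & t * x + (1 - t) * y <= x + y" if "0 <= t" "t <= 1" "0 <= x" "0 <= y" for t x y :: real
  using that mult_left_le_one_le[of x t] mult_left_le_one_le[of y "1 - t"] by auto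
 have AB: "0 <= A i & A i <= osr w i + osr u i + 3 * (1 + W) * om i"
  "0 <= B i & B i <= osr w i + osr u i + 3 * (1 + W) * om i" if "i \<in> hQ V" for i
  using conv[of "ph (p i)" "osr u i" "osr w i"] conv[of "ph (p i)" "osr w i" "osr u i"] ph1[of "p i"] nn[of i] ck[OF that]
  by (auto simp: A_def B_def)
 have sA: "(%i. (A i)^2) summable_on hQ V" and sB: "(%i. (B i)^2) summable_on hQ V"
  using AB by (auto intro!: summable_on_le[OF sm] power_mono)
 have eA: "energy V w <= infsum (%i. (A i)^2) (hQ V)"
 proof -
  have "energy V (%x. w x + ph x * (u x - w x)) <= infsum (%i. (A i)^2) (hQ V)"
   unfolding energy_def by (rule infsum_sub_mono[OF sA order.refl]) (use oA osr_nonneg[OF lb(1)] in \<open>auto intro!: power_mono\<close>)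
  then show ?thesis using e1 by simp
 qed
 have eB: "energy V u <= infsum (%i. (B i)^2) (hQ V)"
 proof -
  have "energy V (%x. u x + ph x * (w x - u x)) <= infsum (%i. (B i)^2) (hQ V)"
   unfolding energy_def by (rule infsum_sub_mono[OF sB order.refl]) (use oB osr_nonneg[OF lb(2)] in \<open>auto intro!: power_mono\<close>)
  then show ?thesis using e2 by simp
 qed
 define C where "C = e * (48 + 24 * (1 + W)^2)"
 define T where "T i = ((osr w i)^2 + (- 1) * (A i)^2) + ((osr u i)^2 + (- 1) * (B i)^2) + C * ((om i)^2 + (osr u i)^2)" for i
 have term_le: "(et (p i))^2 * (osr w i - osr u i)^2 / 4 <= T i" if i: "i \<in> hQ V" for i
 proof -
  have "\<bar>osr w i - osr u i\<bar> <= 2 * e"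
   using osr_diff_le[OF U(1) Ww(1) b(2)[OF i]] by (simp add: abs_minus_commute)
  then show ?thesis
   using cutoff_term_le[of "et (p i)" "om i" W "osr w i" "osr u i" e] et(1)[of "p i"] om0[of i] W[OF i] nn[of i] e
   by (simp add: T_def A_def B_def C_def k_def ph_def om_def[of i])
 qed
 have mA: "(%i. (- 1) * (A i)^2) summable_on hQ V" and mB: "(%i. (- 1) * (B i)^2) summable_on hQ V"
  by (rule summable_on_cmult_right[OF sA], rule summable_on_cmult_right[OF sB])
 note s1 = summable_on_add[OF sa mA] and s2 = summable_on_add[OF sb mB] and s3 = summable_on_add[OF so sb]
 have s4: "(%i. C * ((om i)^2 + (osr u i)^2)) summable_on hQ V" by (rule summable_on_cmult_right[OF s3])
 have sT: "T summable_on hQ V" unfolding T_def by (intro summable_on_add s1 s2 s4)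
 have sL: "(%i. (et (p i))^2 * (osr w i - osr u i)^2 / 4) summable_on hQ V"
  by (rule summable_on_le[OF sT]) (use term_le in auto)
 have "infsum (%i. (et (p i))^2 * (osr w i - osr u i)^2 / 4) (hQ V) <= infsum T (hQ V)"
  by (rule infsum_mono[OF sL sT term_le])
 also have "infsum T (hQ V) = (infsum (%i. (osr w i)^2) (hQ V) + (- 1) * infsum (%i. (A i)^2) (hQ V))
  + (infsum (%i. (osr u i)^2) (hQ V) + (- 1) * infsum (%i. (B i)^2) (hQ V)) + C * infsum (%i. (om i)^2 + (osr u i)^2) (hQ V)"
  unfolding T_def
  by (simp only: infsum_add[OF summable_on_add[OF s1 s2] s4] infsum_add[OF s1 s2] infsum_add[OF sa mA] infsum_add[OF sb mB]
    infsum_cmult_right[OF sA] infsum_cmult_right[OF sB] infsum_cmult_right[OF s3])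
 also have "... <= C * infsum (%i. (om i)^2 + (osr u i)^2) (hQ V)" using eA eB by (simp add: energy_def)
 finally show ?thesis by (simp add: C_def om_def)
qed

text \<open>The constant depends on \<open>V'\<close> only. The cutoff equals 1 on a compact set
  that contains all disks meeting \<open>V'\<close>, so its weight at the sample points of these
  disks is 1. The case without disks is separated because the distance to an empty set is of no
  use.\<close>

lemma osr_cauchy:
 assumes V': "cc V'"
 obtains V K C where "cc V" "compact K" "K \<subseteq> Om" "C > 0"
  "!!u w e. har u ==> har w ==> 0 < e ==> e <= 1 ==> (!!x. x \<in> S ==> x \<in> K ==> \<bar>u x - w x\<bar> <= e) ==>
   (infsum (%i. (osr w i - osr u i)^2) (hQ V')) <= e * C * (1 + energy V u)"
proof (cases "hQ V' = {}")
 case True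
 have "(infsum (%i. (osr w i - osr u i)^2) (hQ V')) <= e * 1 * (1 + energy V' u)" if "0 < e" for e u w
  using that infsum_nonneg[of "hQ V'" "%i. (osr u i)^2"] by (simp add: True energy_def)
 then show thesis using that[OF V', of "{}" 1] by simp
next
 case False
 obtain K' where K': "compact K'" "K' \<subseteq> Om" "!!i. i \<in> hQ V' ==> CQ i \<subseteq> K'"
  by (rule hull_compact[OF V']) (rule that)
 have K'ne: "K' ~= {}" using False K'(3) Q_nonempty closure_subset by blast
 obtain d where d: "d > 0" "(\<Union>x\<in>K'. cball x d) \<subseteq> Om"
  using compact_subset_open_imp_cball_epsilon_subset[OF K'(1) open_Omega K'(2)] by blast
 define V where "V = {z. infdist z K' < d}"
 define et where "et z = max 0 (1 - infdist z K' / d)" for z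
 have Vo: "open V" unfolding V_def by (intro open_Collect_less continuous_intros)
 have cl: "{z. infdist z K' <= d} \<subseteq> (\<Union>x\<in>K'. cball x d)"
 proof
  fix z assume z: "z \<in> {z. infdist z K' <= d}"
  obtain x where "x \<in> K'" "infdist z K' = dist z x" using infdist_attains_inf[OF compact_imp_closed[OF K'(1)] K'ne] by blast
  then show "z \<in> (\<Union>x\<in>K'. cball x d)" using z by (auto simp: dist_commute)
 qed
 have "{z. infdist z K' <= d} \<subseteq> {z. \<exists>x\<in>K'. dist x z <= d}"
 proof
  fix z assume "z \<in> {z. infdist z K' <= d}"
  then obtain x where "x \<in> K'" "z \<in> cball x d" using cl by blast
  then show "z \<in> {z. \<exists>x\<in>K'. dist x z <= d}" by auto
 qed
 then have bdd: "bounded {z. infdist z K' <= d}"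
  using compact_imp_bounded[OF compact_tube[OF K'(1)]] bounded_subset by blast
 have "closed {z. infdist z K' <= d}" by (intro closed_Collect_le continuous_intros)
 then have "closure V \<subseteq> {z. infdist z K' <= d}" by (intro closure_minimal) (auto simp: V_def)
 then have Vc: "cc V"
  unfolding compactly_contained_def using cl d(2) bdd bounded_subset[OF bdd, of "closure V"]
  by (auto simp: compact_eq_bounded_closed)
 obtain K where K: "compact K" "K \<subseteq> Om" "closure V \<subseteq> K" "!!i. i \<in> hQ V ==> CQ i \<subseteq> K"
  by (rule hull_compact[OF Vc]) (rule that)
 obtain D where D: "D > 0" "!!i. i \<in> hQ V ==> dQ i <= D"
  by (rule diameter_bound[OF compactly_contained_bounded[OF Vc]]) (rule that)
 define L where "L = 1 / d"
 have L: "0 <= L" using d(1) by (simp add: L_def)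
 define p where "p i = (SOME x. x \<in> FQ i)" for i
 have p: "p i \<in> FQ i" for i unfolding p_def using frontier_Q_nonempty by (simp add: some_in_eq)
 have et1: "0 <= et x & et x <= 1" for x using d(1) infdist_nonneg[of x K'] by (simp add: et_def)
 have etL: "\<bar>et x - et y\<bar> <= L * dist x y" for x y
 proof -
  have "\<bar>infdist x K' - infdist y K'\<bar> <= dist x y" by (rule infdist_triangle_abs)
  then have "\<bar>infdist x K' / d - infdist y K' / d\<bar> <= dist x y / d"
   using d(1) by (simp add: diff_divide_distrib[symmetric] divide_right_mono)
  then show ?thesis by (auto simp: et_def L_def max_def abs_if split: if_splits)
 qed
 have etV: "et x = 0" if "x \<notin> V" for x using that d(1) by (simp add: et_def V_def max_def field_simps)
 have etp: "et (p i) = 1" if "i \<in> hQ V'" for i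
 proof -
  have "p i \<in> K'" using K'(3)[OF that] p[of i] FQ_CQ by blast
  then show ?thesis by (simp add: et_def)
 qed
 have LW: "L * dQ i <= L * D" if "i \<in> hQ V" for i using D(2)[OF that] L by (rule mult_left_mono)
 have sub: "hQ V' \<subseteq> hQ V"
 proof
  fix i assume i: "i \<in> hQ V'"
  have "Q i \<subseteq> V" using K'(3)[OF i] closure_subset[of "Q i"] d(1) by (auto simp: V_def)
  then show "i \<in> hQ V" using Q_nonempty by (auto simp: hits_def)
 qed
 have l2: "loc_l2 (%i. L * dQ i)" by (intro loc_l2_cmult loc_l2_diameter)
 then have sd: "(%i. (L * dQ i)^2) summable_on hQ V" using Vc unfolding loc_l2_def by blast
 define E where "E = (infsum (%i. (L * dQ i)^2) (hQ V))"
 have E: "E >= 0" unfolding E_def by (intro infsum_nonneg) simp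
 \<comment> \<open>The factor 4 undoes the division by 4 in
   \<open>harmonic_energy_estimate\<close>.\<close>
 define C0 where "C0 = 4 * (48 + 24 * (1 + L * D)^2)"
 have C0: "C0 > 0" by (simp add: C0_def add_pos_nonneg)
 show thesis
 proof (rule that[OF Vc K(1,2), of "C0 * (1 + E)"])
  show "0 < C0 * (1 + E)" using C0 E by simp
  fix u w e assume u: "har u" and w: "har w" and e: "0 < e" "e <= 1" and uw: "!!x. x \<in> S ==> x \<in> K ==> \<bar>u x - w x\<bar> <= e"
  have wl: "wloc u" "wloc w" using u w by (auto simp: har_def)
  have lu: "loc_l2 (osr u)" "loc_l2 (osr w)" using wlocD(2)[OF wl(1)] wlocD(2)[OF wl(2)] by auto
  have su: "(%i. (osr u i)^2) summable_on hQ V" using lu(1) Vc by (simp add: loc_l2_def)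
  have "loc_l2 (%i. osr w i + (- 1) * osr u i)" by (intro loc_l2_add loc_l2_cmult lu)
  then have sdf: "(%i. (osr w i - osr u i)^2) summable_on hQ V" using Vc by (simp add: loc_l2_def)
  have b1: "\<bar>u x - w x\<bar> <= e" if "x \<in> S" "x \<in> V" for x using uw[OF that(1)] that(2) K(3) closure_subset by blast
  have b2: "\<bar>u x - w x\<bar> <= e" if "i \<in> hQ V" "x \<in> FQ i" for i x
   using uw[of x] K(4)[OF that(1)] that(2) FQ_CQ FQ_S by blast
  have est: "(infsum (%i. (et (p i))^2 * (osr w i - osr u i)^2 / 4) (hQ V))
   <= e * (48 + 24 * (1 + L * D)^2) * (infsum (%i. (L * dQ i)^2 + (osr u i)^2) (hQ V))"
   by (rule harmonic_energy_estimate[OF u w Vo Vc b1 b2 e L et1 etL etV LW p])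
  have sl: "(%i. (et (p i))^2 * (osr w i - osr u i)^2 / 4) summable_on hQ V"
  proof (rule summable_on_le[OF sdf])
   fix i
   have "(et (p i))^2 <= 1" using et1[of "p i"] by (simp add: power_le_one)
   then have "(et (p i))^2 * (osr w i - osr u i)^2 <= 1 * (osr w i - osr u i)^2" by (intro mult_right_mono) auto
   then show "(et (p i))^2 * (osr w i - osr u i)^2 / 4 <= (osr w i - osr u i)^2" using zero_le_power2[of "osr w i - osr u i"] by linarith
  qed simp
  have "(infsum (%i. (osr w i - osr u i)^2 / 4) (hQ V')) <= (infsum (%i. (et (p i))^2 * (osr w i - osr u i)^2 / 4) (hQ V))"
   by (rule infsum_sub_mono[OF sl sub]) (auto simp: etp)
  also note est
  also have "(infsum (%i. (L * dQ i)^2 + (osr u i)^2) (hQ V)) = E + energy V u"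
   unfolding E_def energy_def by (rule infsum_add[OF sd su])
  finally have "(infsum (%i. (osr w i - osr u i)^2 / 4) (hQ V')) <= e * (48 + 24 * (1 + L * D)^2) * (E + energy V u)" .
  moreover have "(infsum (%i. (osr w i - osr u i)^2 / 4) (hQ V')) = (infsum (%i. (osr w i - osr u i)^2) (hQ V')) / 4"
  proof -
   have "(%i. (osr w i - osr u i)^2) summable_on hQ V'" by (rule summable_on_sub[OF sdf sub]) simp
   then have "(infsum (%i. (1/4) * (osr w i - osr u i)^2) (hQ V')) = (1/4) * (infsum (%i. (osr w i - osr u i)^2) (hQ V'))"
    by (rule infsum_cmult_right)
   then show ?thesis by simp
  qed
  ultimately have "(infsum (%i. (osr w i - osr u i)^2) (hQ V')) <= 4 * (e * (48 + 24 * (1 + L * D)^2) * (E + energy V u))" by linarith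
  also have "... = e * C0 * (E + energy V u)" by (simp only: C0_def mult_ac)
  also have "... <= e * C0 * ((1 + E) * (1 + energy V u))"
  proof (rule mult_left_mono)
   have "0 <= energy V u" unfolding energy_def by (intro infsum_nonneg) simp
   then have "0 <= E * energy V u" using E by simp
   then show "E + energy V u <= (1 + E) * (1 + energy V u)" by (simp add: algebra_simps)
  qed (use e C0 in simp)
  finally show "(infsum (%i. (osr w i - osr u i)^2) (hQ V')) <= e * (C0 * (1 + E)) * (1 + energy V u)" by (simp add: mult_ac)
 qed
qed


section \<open>Passage to the limit in oscillations, upper gradients and energies\<close>

lemma uniform_limit_near:
 assumes lim: "locally_uniform_limit Om Q u ul" and K: "compact K" "K \<subseteq> Om" and e: "(e::real) > 0"
 obtains N where "!!n x. n >= N ==> x \<in> S ==> x \<in> K ==> \<bar>u n x - ul x\<bar> <= e"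
proof -
 have "uniform_limit (S Int K) u ul sequentially" using lim K unfolding locally_uniform_limit_def by blast
 then have "\<forall>\<^sub>F n in sequentially. \<forall>x\<in>S Int K. dist (u n x) (ul x) < e" using e by (rule uniform_limitD)
 then obtain N where N: "\<forall>n\<ge>N. \<forall>x\<in>S Int K. dist (u n x) (ul x) < e" unfolding eventually_sequentially by blast
 show thesis
 proof (rule that)
  fix n x assume "n >= N" "x \<in> S" "x \<in> K"
  then have "dist (u n x) (ul x) < e" using N by blast
  then show "\<bar>u n x - ul x\<bar> <= e" by (simp add: dist_real_def)
 qed
qed

lemma frontier_in_Omega: "FQ i \<subseteq> Om"
 using FQ_S S_subset by blast

lemma limit_locally_bounded:
 assumes lim: "locally_uniform_limit Om Q u ul" and u: "!!n. locally_bounded (u n)"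
 shows "locally_bounded ul"
 unfolding locally_bounded_def
proof
 fix i
 obtain N where N: "!!n x. n >= N ==> x \<in> S ==> x \<in> FQ i ==> \<bar>u n x - ul x\<bar> <= 1"
  by (rule uniform_limit_near[OF lim compact_frontier_Q frontier_in_Omega zero_less_one]) (rule that)
 have "bounded (u N ` FQ i)" using u by (simp add: locally_bounded_def)
 then obtain B where B: "\<forall>y\<in>u N ` FQ i. norm y <= B" unfolding bounded_iff by blast
 have "norm (ul p) <= B + 1" if p: "p \<in> FQ i" for p
 proof -
  have "\<bar>u N p - ul p\<bar> <= 1" using N[of N p] p FQ_S by auto
  moreover have "\<bar>u N p\<bar> <= B" using B p by auto
  ultimately show ?thesis by simp
 qed
 then show "bounded (ul ` FQ i)" unfolding bounded_iff by blast
qed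

lemma osr_tendsto:
 assumes lim: "locally_uniform_limit Om Q u ul" and u: "!!n. locally_bounded (u n)" and r: "locally_bounded r"
 shows "(%n. osr (%x. u n x + r x) i) \<longlonglongrightarrow> osr (%x. ul x + r x) i"
proof (rule LIMSEQ_I)
 fix e :: real assume e: "0 < e"
 then have e3: "e / 3 > 0" by simp
 obtain N where N: "!!n x. n >= N ==> x \<in> S ==> x \<in> FQ i ==> \<bar>u n x - ul x\<bar> <= e / 3"
  by (rule uniform_limit_near[OF lim compact_frontier_Q frontier_in_Omega e3]) (rule that)
 have lb: "locally_bounded (%x. u n x + r x)" "locally_bounded (%x. ul x + r x)" for n
  using bounded_add[OF u r] bounded_add[OF limit_locally_bounded[OF lim u] r] by auto
 have "norm (osr (%x. u n x + r x) i - osr (%x. ul x + r x) i) < e" if n: "n >= N" for n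
 proof -
  have "\<bar>osr (%x. u n x + r x) i - osr (%x. ul x + r x) i\<bar> <= 2 * (e / 3)"
  proof (rule osr_diff_le[OF lb])
   fix p assume "p \<in> FQ i"
   then show "\<bar>u n p + r p - (ul p + r p)\<bar> <= e / 3" using N[OF n, of p] FQ_S by auto
  qed
  then show ?thesis using e by simp
 qed
 then show "\<exists>no. \<forall>n\<ge>no. norm (osr (%x. u n x + r x) i - osr (%x. ul x + r x) i) < e" by blast
qed

lemma locally_bounded_zero: "locally_bounded (%x. 0)"
 unfolding locally_bounded_def bounded_iff by auto

text \<open>Everything is compared with one fixed member \<open>u N\<close>. Only the energy of this
  one function on the larger set enters the Cauchy estimate, so there is no regress to ever larger
  sets.\<close>

lemma harmonic_energy_bounded:
 assumes lim: "locally_uniform_limit Om Q u ul" and u: "!!n. har (u n)" and V: "cc V"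
 obtains B N where "B >= 0" "!!n. n >= N ==> energy V (u n) <= B"
proof -
 show thesis
 proof (rule osr_cauchy[OF V])
 fix V' K C
 assume V': "cc V'" "compact K" "K \<subseteq> Om" "C > 0"
  "!!u w e. har u ==> har w ==> 0 < e ==> e <= 1 ==> (!!x. x \<in> S ==> x \<in> K ==> \<bar>u x - w x\<bar> <= e) ==>
   (infsum (%i. (osr w i - osr u i)^2) (hQ V)) <= e * C * (1 + energy V' u)"
 have h: "(1 / 2 :: real) > 0" by simp
 obtain N where N: "!!n x. n >= N ==> x \<in> S ==> x \<in> K ==> \<bar>u n x - ul x\<bar> <= 1 / 2"
  by (rule uniform_limit_near[OF lim V'(2,3) h]) (rule that)
 have l2: "loc_l2 (osr (u n))" for n using u[of n] wlocD(2) by (simp add: har_def)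
 have en: "0 <= energy W w" for W w unfolding energy_def by (intro infsum_nonneg) simp
 define B where "B = 2 * energy V (u N) + 2 * (C * (1 + energy V' (u N)))"
 show thesis
 proof (rule that)
  show "B >= 0" using en V'(4) by (simp add: B_def)
  fix n assume n: "n >= N"
  have sN: "(%i. (osr (u N) i)^2) summable_on hQ V" using l2 V by (simp add: loc_l2_def)
  have "loc_l2 (%i. osr (u n) i + (- 1) * osr (u N) i)" by (intro loc_l2_add loc_l2_cmult l2)
  then have sd: "(%i. (osr (u n) i - osr (u N) i)^2) summable_on hQ V" using V by (simp add: loc_l2_def)
  have "(infsum (%i. (osr (u n) i - osr (u N) i)^2) (hQ V)) <= 1 * C * (1 + energy V' (u N))"
  proof (rule V'(5)[OF u u])
   fix x assume x: "x \<in> S" "x \<in> K"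
   show "\<bar>u N x - u n x\<bar> <= 1" using N[OF n x] N[OF order.refl x] by linarith
  qed auto
  note d = this
  have "energy V (u n) <= (infsum (%i. 2 * (osr (u N) i)^2 + 2 * (osr (u n) i - osr (u N) i)^2) (hQ V))"
   unfolding energy_def
  proof (rule infsum_sub_mono)
   show "(%i. 2 * (osr (u N) i)^2 + 2 * (osr (u n) i - osr (u N) i)^2) summable_on hQ V"
    by (intro summable_on_add summable_on_cmult_right sN sd)
   fix i show "(osr (u n) i)^2 <= 2 * (osr (u N) i)^2 + 2 * (osr (u n) i - osr (u N) i)^2"
    using square_sum_le[of "osr (u N) i" "osr (u n) i - osr (u N) i"] by simp
  qed auto
  also have "... = 2 * energy V (u N) + 2 * (infsum (%i. (osr (u n) i - osr (u N) i)^2) (hQ V))"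
   unfolding energy_def
   by (simp only: infsum_add[OF summable_on_cmult_right[OF sN] summable_on_cmult_right[OF sd]] infsum_cmult_right[OF sN] infsum_cmult_right[OF sd])
  also have "... <= B" using d by (simp add: B_def)
  finally show "energy V (u n) <= B" .
 qed
 qed
qed

lemma osr_converges:
 assumes lim: "locally_uniform_limit Om Q u ul" and u: "!!n. har (u n)" and V: "cc V" and d: "d > 0"
 obtains N where "!!n. n >= N ==> (%i. (osr (u n) i - osr ul i)^2) summable_on hQ V"
  "!!n. n >= N ==> (infsum (%i. (osr (u n) i - osr ul i)^2) (hQ V)) <= d"
proof -
 show thesis
 proof (rule osr_cauchy[OF V])
 fix V' K C
 assume V': "cc V'" "compact K" "K \<subseteq> Om" "C > 0"
  "!!u w e. har u ==> har w ==> 0 < e ==> e <= 1 ==> (!!x. x \<in> S ==> x \<in> K ==> \<bar>u x - w x\<bar> <= e) ==>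
   (infsum (%i. (osr w i - osr u i)^2) (hQ V)) <= e * C * (1 + energy V' u)"
 obtain B N1 where B: "B >= 0" "!!n. n >= N1 ==> energy V' (u n) <= B"
  by (rule harmonic_energy_bounded[OF lim u V'(1)]) (rule that)
 define e where "e = min 1 (d / (C * (1 + B)))"
 have CB: "C * (1 + B) > 0" using V'(4) B(1) by simp
 have e: "0 < e" "e <= 1" using d CB by (auto simp: e_def)
 have "e <= d / (C * (1 + B))" by (simp add: e_def)
 then have eC: "e * C * (1 + B) <= d" using CB by (simp add: pos_le_divide_eq mult_ac)
 have e2: "e / 2 > 0" using e by simp
 obtain N2 where N2: "!!n x. n >= N2 ==> x \<in> S ==> x \<in> K ==> \<bar>u n x - ul x\<bar> <= e / 2"
  by (rule uniform_limit_near[OF lim V'(2,3) e2]) (rule that)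
 define N where "N = max N1 N2"
 have uw: "wloc (u n)" for n using u by (simp add: har_def)
 have l2: "loc_l2 (osr (u n))" and lb: "locally_bounded (u n)" for n using wlocD[OF uw] by auto
 have conv: "(%n. osr (u n) i) \<longlonglongrightarrow> osr ul i" for i
  using osr_tendsto[OF lim lb locally_bounded_zero, of i] by simp
 \<comment> \<open>The limit in \<open>m\<close> is taken in finite sums, where convergence of the
   oscillation on each disk suffices; summability over \<open>hQ V\<close> follows from the uniform
   bound.\<close>
 have fin: "(\<Sum>i\<in>F. (osr (u n) i - osr ul i)^2) <= d" if n: "n >= N" and F: "finite F" "F \<subseteq> hQ V" for n F
 proof (rule LIMSEQ_le_const2)
  show "(%m. \<Sum>i\<in>F. (osr (u n) i - osr (u m) i)^2) \<longlonglongrightarrow> (\<Sum>i\<in>F. (osr (u n) i - osr ul i)^2)"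
   by (intro tendsto_intros conv)
  have "(\<Sum>i\<in>F. (osr (u n) i - osr (u m) i)^2) <= d" if m: "m >= N" for m
  proof -
   have "loc_l2 (%i. osr (u n) i + (- 1) * osr (u m) i)" by (intro loc_l2_add loc_l2_cmult l2)
   then have sd: "(%i. (osr (u n) i - osr (u m) i)^2) summable_on hQ V" using V by (simp add: loc_l2_def)
   have "(\<Sum>i\<in>F. (osr (u n) i - osr (u m) i)^2) <= (infsum (%i. (osr (u n) i - osr (u m) i)^2) (hQ V))"
    by (rule sum_le_infsum[OF sd F]) simp
   also have "... <= e * C * (1 + energy V' (u m))"
   proof (rule V'(5)[OF u u e])
    fix x assume x: "x \<in> S" "x \<in> K"
    have "n >= N2" "m >= N2" using n m by (auto simp: N_def)
    then show "\<bar>u m x - u n x\<bar> <= e" using N2[OF _ x, of n] N2[OF _ x, of m] by linarith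
   qed
   also have "... <= e * C * (1 + B)" using B(2)[of m] m e V'(4) by (intro mult_left_mono) (auto simp: N_def)
   finally show ?thesis using eC by linarith
  qed
  then show "\<exists>N. \<forall>m\<ge>N. (\<Sum>i\<in>F. (osr (u n) i - osr (u m) i)^2) <= d" by blast
 qed
 show thesis
 proof (rule that)
  fix n assume n: "n >= N"
  show "(%i. (osr (u n) i - osr ul i)^2) summable_on hQ V"
   by (rule infsum_bounded_finite_sums(1)[OF _ fin[OF n]]) auto
  show "(infsum (%i. (osr (u n) i - osr ul i)^2) (hQ V)) <= d"
   by (rule infsum_bounded_finite_sums(2)[OF _ fin[OF n]]) auto
 qed
 qed
qed

lemma limit_loc_l2:
 assumes lim: "locally_uniform_limit Om Q u ul" and u: "!!n. har (u n)"
 shows "loc_l2 (osr ul)"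
 unfolding loc_l2_def
proof (intro allI impI)
 fix V assume V: "cc V"
 obtain N where N: "!!n. n >= N ==> (%i. (osr (u n) i - osr ul i)^2) summable_on hQ V"
  by (rule osr_converges[OF lim u V zero_less_one]) (rule that)
 have "wloc (u N)" using u by (simp add: har_def)
 then have a: "(%i. (osr (u N) i)^2) summable_on hQ V" using V wlocD(2) by (simp add: loc_l2_def)
 have "(%i. (osr ul i - osr (u N) i)^2) summable_on hQ V" using N[of N] by (simp add: power2_commute)
 then have "(%i. (osr (u N) i + (osr ul i - osr (u N) i))^2) summable_on hQ V" by (rule summable_on_square_add[OF a])
 then show "(%i. (osr ul i)^2) summable_on hQ V" by simp
qed

lemma exhaustion_mono: "k <= l ==> exhaustion k \<subseteq> exhaustion l"
proof
 fix z assume kl: "k <= l" and z: "z \<in> exhaustion k"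
 have "1 / (real l + 1) <= 1 / (real k + 1)" using kl by (intro divide_left_mono) auto
 moreover have "norm z <= real l" using z kl by (auto simp: exhaustion_def)
 ultimately show "z \<in> exhaustion l" using z unfolding exhaustion_def by (auto intro: order_trans)
qed

text \<open>Along a subsequence whose oscillations converge fast, the square root of the sum of the squared errors is
 locally square summable and dominates all the errors at once.\<close>

lemma dominated_subsequence:
 assumes lim: "locally_uniform_limit Om Q u ul" and u: "!!n. har (u n)"
 obtains sg :: "nat => nat" and rh :: "nat => real" where "!!j. j <= sg j" "loc_l2 rh" "!!i. 0 <= rh i" "!!i j. osr (u (sg j)) i <= rh i"
proof -
 have uw: "wloc (u n)" for n using u by (simp add: har_def)
 have l2: "loc_l2 (osr (u n))" and lb: "locally_bounded (u n)" for n using wlocD[OF uw] by auto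
 note lbl = limit_locally_bounded[OF lim lb] and l2l = limit_loc_l2[OF lim u]
 have "\<exists>n\<ge>j. (infsum (%i. (osr (u n) i - osr ul i)^2) (hQ (exhaustion j))) <= (1/2) ^ j" for j
 proof -
  have "(1/2 :: real) ^ j > 0" by simp
  then obtain N where "!!n. n >= N ==> (infsum (%i. (osr (u n) i - osr ul i)^2) (hQ (exhaustion j))) <= (1/2) ^ j"
   by (rule osr_converges[OF lim u exhaustion_cc]) (rule that)
  then show ?thesis by (intro exI[of _ "N + j"]) simp
 qed
 then obtain sg where sg: "!!j. j <= sg j" "!!j. (infsum (%i. (osr (u (sg j)) i - osr ul i)^2) (hQ (exhaustion j))) <= (1/2) ^ j"
  by metis
 define t where "t i j = (osr (u (sg j)) i - osr ul i)^2" for i j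
 have st: "(%i. t i j) summable_on hQ V" if "cc V" for V j
 proof -
  have "loc_l2 (%i. osr (u (sg j)) i + (- 1) * osr ul i)" by (intro loc_l2_add loc_l2_cmult l2 l2l)
  then show ?thesis using that by (simp add: loc_l2_def t_def)
 qed
 have t0: "0 <= t i j" for i j by (simp add: t_def)
 have V: "\<exists>b. summable b & (\<forall>j F. finite F --> F \<subseteq> hQ V --> (\<Sum>i\<in>F. t i j) <= b j)" if V: "cc V" for V
 proof -
  obtain k where k: "closure V \<subseteq> exhaustion k"
   using exhaustion_covers[of "closure V"] V unfolding compactly_contained_def by blast
  define b where "b j = infsum (%i. t i j) (hQ V)" for j
  have "summable b"
  proof (rule summable_comparison_test)
   have "norm (b j) <= (1/2) ^ j" if j: "j >= k" for j
   proof -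
    have sub: "hQ V \<subseteq> hQ (exhaustion j)" using k exhaustion_mono[OF j] closure_subset[of V] by (intro hits_mono) blast
    have "b j <= infsum (%i. t i j) (hQ (exhaustion j))"
    unfolding b_def by (rule infsum_sub_mono[OF st[OF exhaustion_cc] sub t0 order.refl t0])
    also have "... <= (1/2) ^ j" using sg(2)[of j] by (simp add: t_def)
    finally show ?thesis using infsum_nonneg[of "hQ V" "%i. t i j"] t0 by (simp add: b_def)
   qed
   then show "\<exists>N. \<forall>n\<ge>N. norm (b n) <= (1/2) ^ n" by blast
   show "summable (%n. (1/2 :: real) ^ n)" by (rule summable_geometric) simp
  qed
  moreover have "(\<Sum>i\<in>F. t i j) <= b j" if "finite F" "F \<subseteq> hQ V" for j F
   unfolding b_def by (rule sum_le_infsum[OF st[OF V] that t0])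
  ultimately show ?thesis by blast
 qed
 \<comment> \<open>Every index occurs for a suitable \<open>V\<close>, for instance a single point
   of the disk; so the summable bound on \<open>V\<close> also gives summability in \<open>j\<close>
   on each fixed disk.\<close>
 have sj: "summable (t i)" for i
 proof -
  obtain q where q: "q \<in> Q i" using Q_nonempty by blast
  then have "q \<in> Om" using closure_subset closure_Q_subset by blast
  then have "cc {q}" by (simp add: compactly_contained_def)
  then obtain b where b: "summable b" "\<forall>j F. finite F --> F \<subseteq> hQ {q} --> (\<Sum>i\<in>F. t i j) <= b j" using V by blast
  have "{i} \<subseteq> hQ {q}" using q by (auto simp: hits_def)
  then have "(\<Sum>i\<in>{i}. t i j) <= b j" for j using b(2) by blast
  then have "norm (t i j) <= b j" for j using t0 by simp
  then have "\<exists>N. \<forall>n\<ge>N. norm (t i n) <= b n" by simp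
  then show ?thesis using b(1) by (rule summable_comparison_test)
 qed
 define ep where "ep i = sqrt (\<Sum>j. t i j)" for i
 have ep2: "(ep i)^2 = (\<Sum>j. t i j)" for i unfolding ep_def using suminf_nonneg[OF sj t0] by simp
 have ep0: "0 <= ep i" for i unfolding ep_def using suminf_nonneg[OF sj t0] by simp
 have "loc_l2 ep"
  unfolding loc_l2_def
 proof (intro allI impI)
  fix V assume "cc V"
  then obtain b where b: "summable b" "\<forall>j F. finite F --> F \<subseteq> hQ V --> (\<Sum>i\<in>F. t i j) <= b j" using V by blast
  show "(%i. (ep i)^2) summable_on hQ V"
  proof (rule infsum_bounded_finite_sums(1))
   fix F assume F: "finite F" "F \<subseteq> hQ V"
   have "(\<Sum>i\<in>F. (ep i)^2) = (\<Sum>j. \<Sum>i\<in>F. t i j)" unfolding ep2 by (rule suminf_sum[symmetric]) (rule sj)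
   also have "... <= suminf b"
    by (rule suminf_le[OF _ summable_sum[OF sj] b(1)]) (use b(2) F in blast)
   finally show "(\<Sum>i\<in>F. (ep i)^2) <= suminf b" .
  qed simp
 qed
 then have l2r: "loc_l2 (%i. osr ul i + ep i)" by (rule loc_l2_add[OF l2l])
 have dom: "osr (u (sg j)) i <= osr ul i + ep i" for i j
 proof -
  have "t i j <= (\<Sum>j. t i j)" using sum_le_suminf[OF sj, of "{j}" i] t0 by simp
  then have "(osr (u (sg j)) i - osr ul i)^2 <= (ep i)^2" unfolding ep2 t_def .
  then have "osr (u (sg j)) i - osr ul i <= ep i" using ep0 by (rule power2_le_imp_le)
  then show ?thesis by simp
 qed
 have nn: "0 <= osr ul i + ep i" for i using ep0[of i] osr_nonneg[OF lbl, of i] by simp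
 show thesis by (rule that[OF sg(1) l2r nn dom])
qed

text \<open>The common majorant \<open>rh\<close> is an upper gradient for all members of the
  subsequence, and its path inequality survives convergence at the two end points.
  \<open>wlocI\<close> then returns from \<open>rh\<close> to the oscillations of the limit.\<close>

lemma limit_wloc:
 assumes lim: "locally_uniform_limit Om Q u ul" and u: "!!n. har (u n)"
 shows "wloc ul"
proof -
 have uw: "wloc (u n)" for n using u by (simp add: har_def)
 note W = wlocD[OF uw]
 note lbl = limit_locally_bounded[OF lim W(1)] and l2l = limit_loc_l2[OF lim u]
 obtain sg :: "nat => nat" and rh :: "nat => real" where rh: "!!j. j <= sg j" "loc_l2 rh" "!!i. 0 <= rh i" "!!i j. osr (u (sg j)) i <= rh i"
  by (rule dominated_subsequence[OF lim u]) (rule that)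
 have "\<forall>n. \<exists>Gm. ae_good (u n) (osr (u n)) Gm" using uw by (simp add: wloc_def)
 then obtain Gm where Gm: "!!n. ae_good (u n) (osr (u n)) (Gm n)" by metis
 have nG: "null (\<Union>n. Gm n)" by (rule null_UN[OF ae_good_null[OF Gm]])
 obtain Gm' where g: "ae_good ul rh Gm'"
 proof (rule ae_good_exists[OF rh(3,2) nG])
  fix f a b assume f: "a <= b" "({a..b}, f) \<in> cpaths_in Om - (\<Union>n. Gm n)" "f a \<in> S" "f b \<in> S" "rh summable_on hQ (f ` {a..b})"
  have le: "\<bar>u (sg j) (f a) - u (sg j) (f b)\<bar> <= infsum rh (hQ (f ` {a..b}))" for j
  proof -
   have "good_on (u (sg j)) (osr (u (sg j))) f a b" by (rule ae_goodD[OF Gm _ f(1) order.refl]) (use f(2) in blast)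
   then have "\<bar>u (sg j) (f a) - u (sg j) (f b)\<bar> <= infsum (osr (u (sg j))) (hQ (f ` {a..b}))"
    using f(1,3,4) unfolding good_on_def by blast
   also have "... <= infsum rh (hQ (f ` {a..b}))"
    by (rule infsum_sub_mono[OF f(5) order.refl osr_nonneg[OF W(1)] rh(4,3)])
   finally show ?thesis .
  qed
  show "\<bar>ul (f a) - ul (f b)\<bar> <= infsum rh (hQ (f ` {a..b}))"
  proof (rule field_le_epsilon)
   fix e :: real assume "0 < e"
   then have e2: "e / 2 > 0" by simp
   have K: "compact {f a, f b}" "{f a, f b} \<subseteq> Om" using f(3,4) S_subset by auto
   obtain N where N: "!!n x. n >= N ==> x \<in> S ==> x \<in> {f a, f b} ==> \<bar>u n x - ul x\<bar> <= e / 2"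
    by (rule uniform_limit_near[OF lim K e2]) (rule that)
   have "\<bar>u (sg N) (f a) - ul (f a)\<bar> <= e / 2" "\<bar>u (sg N) (f b) - ul (f b)\<bar> <= e / 2"
    by (rule N[OF rh(1)]; use f(3,4) in simp)+
   then show "\<bar>ul (f a) - ul (f b)\<bar> <= infsum rh (hQ (f ` {a..b})) + e" using le[of N] by linarith
  qed
 qed (rule that)
 have "loc_l2 (%i. Mx ul i * dQ i)"
  unfolding loc_l2_def
 proof (intro allI impI)
  fix V assume V: "cc V"
  obtain K where K: "compact K" "K \<subseteq> Om" "!!i. i \<in> hQ V ==> CQ i \<subseteq> K"
   by (rule hull_compact[OF V]) (rule that)
  obtain N where N: "!!n x. n >= N ==> x \<in> S ==> x \<in> K ==> \<bar>u n x - ul x\<bar> <= 1"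
   by (rule uniform_limit_near[OF lim K(1,2) zero_less_one]) (rule that)
  have "loc_l2 (%i. \<bar>Mx (u N) i * dQ i\<bar> + 1 * dQ i)"
   by (intro loc_l2_add loc_l2_cmult loc_l2_diameter loc_l2_le[OF W(3)[of N]]) simp
  then have "(%i. (\<bar>Mx (u N) i * dQ i\<bar> + 1 * dQ i)^2) summable_on hQ V" using V unfolding loc_l2_def by blast
  then show "(%i. (Mx ul i * dQ i)^2) summable_on hQ V"
  proof (rule summable_on_le)
   fix i assume i: "i \<in> hQ V"
   have pt: "\<bar>u N p - ul p\<bar> <= 1" if "p \<in> FQ i" for p
    using N[of N p] K(3)[OF i] that FQ_S FQ_CQ by blast
   have "Mx ul i <= Mx (u N) i + 1"
   proof (rule Mx_least)
    fix p assume "p \<in> FQ i" then show "ul p <= Mx (u N) i + 1" using pt[of p] le_Mx[OF W(1), of p i N] by linarith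
   qed
   moreover have "Mx (u N) i <= Mx ul i + 1"
   proof (rule Mx_least)
    fix p assume "p \<in> FQ i" then show "u N p <= Mx ul i + 1" using pt[of p] le_Mx[OF lbl, of p i] by linarith
   qed
   ultimately have "\<bar>Mx ul i\<bar> <= \<bar>Mx (u N) i\<bar> + 1" by linarith
   then have "\<bar>Mx ul i\<bar> * dQ i <= (\<bar>Mx (u N) i\<bar> + 1) * dQ i"
    using less_imp_le[OF diameter_Q_pos] by (rule mult_right_mono)
   then have "\<bar>Mx ul i * dQ i\<bar> <= \<bar>\<bar>Mx (u N) i * dQ i\<bar> + 1 * dQ i\<bar>"
    using less_imp_le[OF diameter_Q_pos[of i]] by (simp add: abs_mult algebra_simps)
   then show "(Mx ul i * dQ i)^2 <= (\<bar>Mx (u N) i * dQ i\<bar> + 1 * dQ i)^2"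
    by (simp only: abs_le_square_iff)
  qed simp
 qed
 then show ?thesis by (rule wlocI[OF lbl l2l _ g rh(3)])
qed

lemma limit_continuous:
 assumes lim: "locally_uniform_limit Om Q u ul" and c: "!!n. continuous_on S (u n)"
 shows "continuous_on S ul"
 unfolding continuous_on_iff
proof (intro ballI allI impI)
 fix x e assume x: "x \<in> S" and e: "(e::real) > 0"
 have "x \<in> Om" using x S_subset by blast
 then obtain r where r: "r > 0" "cball x r \<subseteq> Om" using open_Omega open_contains_cball by blast
 have e4: "e / 4 > 0" using e by simp
 obtain N where N: "!!n y. n >= N ==> y \<in> S ==> y \<in> cball x r ==> \<bar>u n y - ul y\<bar> <= e / 4"
  by (rule uniform_limit_near[OF lim compact_cball r(2) e4]) (rule that)
 obtain d where d: "d > 0" "\<forall>y\<in>S. dist y x < d --> dist (u N y) (u N x) < e / 4"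
  using c[of N] x e4 unfolding continuous_on_iff by blast
 show "\<exists>d>0. \<forall>y\<in>S. dist y x < d --> dist (ul y) (ul x) < e"
 proof (intro exI[of _ "min d r"] conjI ballI impI)
  show "min d r > 0" using d(1) r(1) by simp
  fix y assume y: "y \<in> S" "dist y x < min d r"
  have "\<bar>u N y - u N x\<bar> < e / 4" using d(2) y by (simp add: dist_real_def)
  moreover have "\<bar>u N y - ul y\<bar> <= e / 4" by (rule N) (use y in \<open>auto simp: dist_commute\<close>)
  moreover have "\<bar>u N x - ul x\<bar> <= e / 4" by (rule N) (use x r(1) in auto)
  ultimately show "dist (ul y) (ul x) < e" unfolding dist_real_def using e by linarith
 qed
qed

text \<open>Finitely many disks carry almost all of the energy of the competitors, uniformly in \<open>n\<close>, because the
 oscillations of \<open>u n\<close> converge in the square mean.\<close>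

lemma limit_energy_le:
 assumes lim: "locally_uniform_limit Om Q u ul" and u: "!!n. har (u n)" and r: "wloc r" and V: "cc V"
  and le: "!!n. energy V (u n) <= energy V (%x. u n x + r x)"
 shows "energy V ul <= energy V (%x. ul x + r x)"
proof -
 have uw: "wloc (u n)" for n using u by (simp add: har_def)
 note W = wlocD[OF uw] and ulw = limit_wloc[OF lim u] and Rr = wlocD[OF r]
 note UL = wlocD[OF ulw]
 have lb: "locally_bounded (%x. u n x + r x)" "locally_bounded (%x. ul x + r x)" for n
  using bounded_add[OF W(1) Rr(1)] bounded_add[OF UL(1) Rr(1)] by auto
 have conv: "(%n. osr (u n) i) \<longlonglongrightarrow> osr ul i" for i
  using osr_tendsto[OF lim W(1) locally_bounded_zero, of i] by simp
 have convr: "(%n. osr (%x. u n x + r x) i) \<longlonglongrightarrow> osr (%x. ul x + r x) i" for i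
  by (rule osr_tendsto[OF lim W(1) Rr(1)])
 have sr: "(%i. (osr (%x. u n x + r x) i)^2) summable_on hQ V" for n
  using osr_add_summable[OF W(1) Rr(1) W(2) Rr(2)] V by (simp add: loc_l2_def)
 have srl: "(%i. (osr (%x. ul x + r x) i)^2) summable_on hQ V"
  using osr_add_summable[OF UL(1) Rr(1) UL(2) Rr(2)] V by (simp add: loc_l2_def)
 have su: "(%i. (osr (u n) i)^2) summable_on hQ V" for n using W(2) V by (simp add: loc_l2_def)
 \<comment> \<open>The part of the bound for the competitors that does not depend on
   \<open>n\<close>; the rest is the difference between \<open>osr (u n)\<close> and
   \<open>osr ul\<close>, small in square mean by \<open>osr_converges\<close>.\<close>
 define q where "q i = 2 * (osr ul i + osr r i)^2" for i
 have "loc_l2 (%i. osr ul i + osr r i)" by (intro loc_l2_add UL(2) Rr(2))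
 then have "(%i. (osr ul i + osr r i)^2) summable_on hQ V" using V by (simp add: loc_l2_def)
 then have sq: "q summable_on hQ V" unfolding q_def by (rule summable_on_cmult_right)
 have q0: "0 <= q i" for i by (simp add: q_def)
 have "(\<Sum>i\<in>G. (osr ul i)^2) <= energy V (%x. ul x + r x)" if G: "finite G" "G \<subseteq> hQ V" for G
 proof (rule field_le_epsilon)
  \<comment> \<open>The budget: the tail off \<open>F\<close> costs
    \<open>2 * (d / 8) + d / 4\<close>, and the finite sums over \<open>F\<close> and over
    \<open>G\<close> cost \<open>d / 4\<close> each.\<close>
  fix d :: real assume "0 < d"
  then have d4: "d / 4 > 0" and d8: "d / 8 > 0" by auto
  obtain F where F: "finite F" "F \<subseteq> hQ V" "!!B. B \<subseteq> hQ V - F ==> infsum q B < d / 4"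
   by (rule infsum_tail_small[OF sq q0 d4]) (rule that)
  obtain N where N: "!!n. n >= N ==> (%i. (osr (u n) i - osr ul i)^2) summable_on hQ V"
   "!!n. n >= N ==> (infsum (%i. (osr (u n) i - osr ul i)^2) (hQ V)) <= d / 8"
   by (rule osr_converges[OF lim u V d8]) (rule that)
  have "(%n. \<Sum>i\<in>F. (osr (%x. u n x + r x) i)^2) \<longlonglongrightarrow> (\<Sum>i\<in>F. (osr (%x. ul x + r x) i)^2)"
   by (intro tendsto_intros convr)
  then have ev2: "\<forall>\<^sub>F n in sequentially. (\<Sum>i\<in>F. (osr (%x. u n x + r x) i)^2) < (\<Sum>i\<in>F. (osr (%x. ul x + r x) i)^2) + d / 4"
   by (rule order_tendstoD(2)) (use d4 in simp)
  have "(%n. \<Sum>i\<in>G. (osr (u n) i)^2) \<longlonglongrightarrow> (\<Sum>i\<in>G. (osr ul i)^2)" by (intro tendsto_intros conv)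
  then have ev3: "\<forall>\<^sub>F n in sequentially. (\<Sum>i\<in>G. (osr ul i)^2) - d / 4 < (\<Sum>i\<in>G. (osr (u n) i)^2)"
   by (rule order_tendstoD(1)) (use d4 in simp)
  have "\<forall>\<^sub>F n in sequentially. n >= N" by (rule eventually_ge_at_top)
  with ev2 ev3 have "\<forall>\<^sub>F n in sequentially. (\<Sum>i\<in>F. (osr (%x. u n x + r x) i)^2) < (\<Sum>i\<in>F. (osr (%x. ul x + r x) i)^2) + d / 4 &
    (\<Sum>i\<in>G. (osr ul i)^2) - d / 4 < (\<Sum>i\<in>G. (osr (u n) i)^2) & n >= N"
   by eventually_elim simp
  then obtain n where n: "(\<Sum>i\<in>F. (osr (%x. u n x + r x) i)^2) < (\<Sum>i\<in>F. (osr (%x. ul x + r x) i)^2) + d / 4"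
    "(\<Sum>i\<in>G. (osr ul i)^2) - d / 4 < (\<Sum>i\<in>G. (osr (u n) i)^2)" "n >= N"
   using eventually_happens'[OF sequentially_bot] by blast
  let ?T = "hQ V - F"
  note sd = N(1)[OF n(3)]
  have sdT: "(%i. (osr (u n) i - osr ul i)^2) summable_on ?T" and sqT: "q summable_on ?T"
   by (rule summable_on_sub[OF sd], simp, simp) (rule summable_on_sub[OF sq], simp, rule q0)
  note s2T = summable_on_cmult_right[OF sdT, of 2]
  have tail: "infsum (%i. (osr (%x. u n x + r x) i)^2) ?T <= infsum (%i. 2 * (osr (u n) i - osr ul i)^2 + q i) ?T"
  proof (rule infsum_sub_mono[OF summable_on_add[OF s2T sqT] order.refl])
   fix i
   have "osr (%x. u n x + r x) i <= \<bar>osr (u n) i - osr ul i\<bar> + (osr ul i + osr r i)"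
    using osr_add_le[OF W(1) Rr(1), of n i] by linarith
   then have "(osr (%x. u n x + r x) i)^2 <= (\<bar>osr (u n) i - osr ul i\<bar> + (osr ul i + osr r i))^2"
    using osr_nonneg[OF lb(1)] by (intro power_mono)
   also have "... <= 2 * (osr (u n) i - osr ul i)^2 + q i"
    using square_sum_le[of "\<bar>osr (u n) i - osr ul i\<bar>" "osr ul i + osr r i"] by (simp add: q_def)
   finally show "(osr (%x. u n x + r x) i)^2 <= 2 * (osr (u n) i - osr ul i)^2 + q i" .
  qed (use q0 in auto)
  also have "... = 2 * infsum (%i. (osr (u n) i - osr ul i)^2) ?T + infsum q ?T"
   by (simp only: infsum_add[OF s2T sqT] infsum_cmult_right[OF sdT])
  finally have tl': "infsum (%i. (osr (%x. u n x + r x) i)^2) ?T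
   <= 2 * infsum (%i. (osr (u n) i - osr ul i)^2) ?T + infsum q ?T" .
  have mT: "infsum (%i. (osr (u n) i - osr ul i)^2) ?T <= infsum (%i. (osr (u n) i - osr ul i)^2) (hQ V)"
   by (rule infsum_sub_mono[OF sd]) auto
  have "infsum q ?T < d / 4" by (rule F(3)) simp
  then have tl: "infsum (%i. (osr (%x. u n x + r x) i)^2) ?T <= 2 * (d / 8) + d / 4"
   using tl' mT N(2)[OF n(3)] by linarith
  have "energy V (%x. u n x + r x) = infsum (%i. (osr (%x. u n x + r x) i)^2) (F Un ?T)"
   unfolding energy_def using F(2) by (simp add: Un_absorb1)
  also have "... = (\<Sum>i\<in>F. (osr (%x. u n x + r x) i)^2) + infsum (%i. (osr (%x. u n x + r x) i)^2) ?T"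
   using infsum_Un_disjoint[of "%i. (osr (%x. u n x + r x) i)^2" F ?T] F(1) summable_on_sub[OF sr[of n], of ?T]
   by (simp add: summable_on_finite)
  finally have e1: "energy V (%x. u n x + r x) <= (\<Sum>i\<in>F. (osr (%x. ul x + r x) i)^2) + 3 * (d / 4)" using n(1) tl by linarith
  have e2: "(\<Sum>i\<in>F. (osr (%x. ul x + r x) i)^2) <= energy V (%x. ul x + r x)"
   unfolding energy_def by (rule sum_le_infsum[OF srl F(1,2)]) simp
  have e3: "(\<Sum>i\<in>G. (osr (u n) i)^2) <= energy V (u n)"
   unfolding energy_def by (rule sum_le_infsum[OF su G]) simp
  show "(\<Sum>i\<in>G. (osr ul i)^2) <= energy V (%x. ul x + r x) + d"
   using e1 e2 e3 n(2) le[of n] by linarith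
 qed
 note fin = this
 show ?thesis unfolding energy_def[of V ul] by (rule infsum_bounded_finite_sums(2)[OF _ fin]) auto
qed

text \<open>A test function with extended real values is replaced by its real part; energies see
  only the boundaries of disks, where the two agree.\<close>

lemma carpet_harmonic_limit:
 assumes u: "!!n. carpet_harmonic v Om Q (%z. ereal (u n z))" and lim: "locally_uniform_limit Om Q u ul"
 shows "carpet_harmonic v Om Q (%z. ereal (ul z))"
proof -
 have h: "har (u n)" for n by (rule carpet_harmonic_har[OF u])
 have uw: "wloc (u n)" for n using h by (simp add: har_def)
 note W = wlocD[OF uw] and ulw = limit_wloc[OF lim h]
 note UL = wlocD[OF ulw]
 have "continuous_on S (u n)" for n
  by (rule har_normalized_continuous[OF h]) (use u in \<open>simp add: carpet_harmonic_def\<close>)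
 then have "continuous_on S ul" by (rule limit_continuous[OF lim])
 then have n: "normalized v Om Q (%z. ereal (ul z))" by (rule normalized_continuous[OF ulw])
 have "dirichlet_energy Q V (%z. ereal (ul z)) <= dirichlet_energy Q V (%x. ereal (ul x) + ze x)"
  if V: "open V" "cc V" and z: "sobolev v Om Q ze" "\<forall>x\<in>S - V. ze x = 0" for V ze
 proof -
  have zl: "sobolev_loc v Om Q ze" using z(1) by (simp add: sobolev_def)
  define r where "r = (%z. real_of_ereal (ze z))"
  note R = sobolev_loc_real[OF zl, folded r_def]
  note Rr = wlocD[OF R(1)]
  have zr: "ze p = ereal (r p)" if "p \<in> FQ i" for i p using R(2)[OF that] by (simp only: r_def)
  have eq: "dirichlet_energy Q V (%x. ereal (w x) + ze x) = ereal (energy V (%x. w x + r x))"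
   "dirichlet_energy Q V (%x. ereal (w x)) = ereal (energy V w)" if w: "wloc w" for w
  proof -
   note Ww = wlocD[OF w]
   show "dirichlet_energy Q V (%x. ereal (w x) + ze x) = ereal (energy V (%x. w x + r x))"
   proof (rule dirichlet_energy_eq[OF bounded_add[OF Ww(1) Rr(1)] osr_add_summable[OF Ww(1) Rr(1) Ww(2) Rr(2)] V(2)])
    fix i p assume "p \<in> FQ i"
    then show "ereal (w p) + ze p = ereal (w p + r p)" by (simp only: zr plus_ereal.simps)
   qed
   show "dirichlet_energy Q V (%x. ereal (w x)) = ereal (energy V w)"
    by (rule dirichlet_energy_eq[OF Ww(1,2) V(2)]) simp
  qed
  have "energy V (u n) <= energy V (%x. u n x + r x)" for n
  proof -
   have "dirichlet_energy Q V (%z. ereal (u n z)) <= dirichlet_energy Q V (%x. ereal (u n x) + ze x)"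
    using u[of n] V z unfolding carpet_harmonic_def by blast
   then show ?thesis unfolding eq[OF uw] by simp
  qed
  then have "energy V ul <= energy V (%x. ul x + r x)" by (rule limit_energy_le[OF lim h R(1) V(2)])
  then show ?thesis unfolding eq[OF ulw] by simp
 qed
 then show ?thesis unfolding carpet_harmonic_def using wloc_sobolev_loc[OF ulw] n by blast
qed

end

theorem theorem2p85:
  fixes \<Omega> :: "complex set" and Q :: "nat \<Rightarrow> complex set" and v :: version
    and u :: "nat \<Rightarrow> complex \<Rightarrow> real" and u_lim :: "complex \<Rightarrow> real"
  assumes "relative_sierpinski_carpet \<Omega> Q"
    and "\<And>n. carpet_harmonic v \<Omega> Q (\<lambda>z. ereal (u n z))"
    and "locally_uniform_limit \<Omega> Q u u_lim"
  shows "carpet_harmonic v \<Omega> Q (\<lambda>z. ereal (u_lim z))"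
proof -
  interpret sierpinski_carpet \<Omega> Q v by unfold_locales (rule assms(1))
  show ?thesis by (rule carpet_harmonic_limit[OF assms(2,3)])
qed

end
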